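(* Let $\mathfrak{g}=\mathfrak{osp}(2a|2b)$ or $\mathfrak{g}=\mathfrak{osp}(2a+1|2b)$, where $a,b\in\mathbb{Z}_{\ge 0}\cup\{\infty\}$, at least one of $a,b$ equals $\infty$, and $\mathfrak{g}_{\bar 1}\neq 0$. Let $M$ be a simple bounded weight $\mathfrak{g}$-module of spinor-oscillator type. Then the following statements hold. (a) $M_{\bar 0}$ and $M_{\bar 1}$ are simple $\mathfrak{g}_{\bar 0}$-modules. (b) There exist twin spinor $\mathfrak{o}(2a)$-modules (if $\mathfrak{g}=\mathfrak{osp}(2a|2b)$), respectively $\mathfrak{o}(2a+1)$-modules (if $\mathfrak{g}=\mathfrak{osp}(2a+1|2b)$), $S$ and $S'$, and twin simple $\mathfrak{sp}(2b)$-modules $T$ and $T'$ of oscillator type, such that $$M_{\bar 0}\simeq S\otimes T,\qquad M_{\bar 1}\simeq \Pi(S'\otimes T').\qquad ( * )$$ The modules $S,S',T,T'$ are unique up to isomorphism and determine $M$ up to isomorphism. (c) Any pair $(S,T)$, where $S$ is a spinor $\mathfrak{o}(2a)$-module (respectively, $\mathfrak{o}(2a+1)$-module) and $T$ is a simple $\mathfrak{sp}(2b)$-module of oscillator type, determines a simple bounded weight $\mathfrak{g}$-module $M$ of spinor-oscillator type for which $( * )$ holds.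
   Context: The ground field is $\mathbb{C}$; modules over Lie superalgebras are $\mathbb{Z}_2$-graded, homomorphisms preserve the grading, $\bar u$ denotes the parity of $u$, and $\Pi$ is the parity change functor. Modules over Lie algebras such as $S,S',T,T'$ are purely even. $Cl(a|b)$ is the associative superalgebra with generators $\xi_i,\eta_i$, $i\in\{1,\dots,a\}\cup\{-1,\dots,-b\}$ (all positive, resp. negative, integers if $a=\infty$, resp. $b=\infty$), where $\xi_i,\eta_i$ are even for $i>0$ and odd for $i<0$, and relations $\{\xi_i,\xi_j\}=\{\eta_i,\eta_j\}=0$, $\{\eta_i,\xi_j\}=\delta_{ij}$, with $\{u,v\}:=uv+(-1)^{\bar u\bar v}vu$. It is $\mathbb{Z}$-graded by $\deg\xi_i=1$, $\deg\eta_i=-1$; $Cl(a|b)_{ev}$ is the subsuperalgebra of elements of even degree. A weight module over $Cl(a|b)$ or $Cl(a|b)_{ev}$ is a module which is a direct sum of simultaneous eigenspaces for all $u_i=\xi_i\eta_i$. Let $U_{2a|2b}\subset Cl(a|b)$ be the span of all $\xi_i,\eta_i$, with its even symmetric bilinear form $\{\cdot,\cdot\}$. The span of all $uv-(-1)^{\bar u\bar v}vu$ ($u,v\in U_{2a|2b}$ homogeneous) is a Lie subsuperalgebra of $Cl(a|b)$ under the supercommutator, canonically identified with the orthosymplectic Lie superalgebra $\mathfrak{osp}(2a|2b)$ of this form; the sum of this span and $U_{2a|2b}$ is a Lie superalgebra identified with $\mathfrak{osp}(2a+1|2b)$. These inclusions induce homomorphisms $\Psi_{a|b}:U(\mathfrak{osp}(2a|2b))\to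 Cl(a|b)$ (with image $Cl(a|b)_{ev}$) and $\Theta_{a|b}:U(\mathfrak{osp}(2a+1|2b))\to Cl(a|b)$ (surjective). Set $J_{\mathfrak{g}}:=\ker\Psi_{a|b}$, respectively $J_{\mathfrak{g}}:=\ker\Theta_{a|b}$. The Cartan subalgebra $\mathfrak{h}$ of $\mathfrak{g}$ is spanned by $\xi_i\eta_i-\frac12$ ($i>0$) and $\xi_i\eta_i+\frac12$ ($i<0$). We have $\mathfrak{g}_{\bar 0}=\mathfrak{o}(2a)\oplus\mathfrak{sp}(2b)$, respectively $\mathfrak{o}(2a+1)\oplus\mathfrak{sp}(2b)$. A weight $\mathfrak{g}$-module is a $\mathfrak{g}$-module semisimple over $\mathfrak{h}$; it is bounded if the dimensions of its weight spaces are uniformly bounded by some $(p|q)$, $p,q\in\mathbb{Z}_{\ge0}$. A simple weight $\mathfrak{g}$-module is of spinor-oscillator type if it is annihilated by $J_{\mathfrak{g}}$; equivalently, it is the pullback via $\Theta_{a|b}$ of a weight $Cl(a|b)$-module if $\mathfrak{g}=\mathfrak{osp}(2a+1|2b)$, or via $\Psi_{a|b}$ of a weight $Cl(a|b)_{ev}$-module if $\mathfrak{g}=\mathfrak{osp}(2a|2b)$. Spinor and oscillator modules. Spinor $\mathfrak{o}(2a)$-modules are the pullbacks via $\Psi_{a|0}$ of simple weight $Cl(a|0)_{ev}$-modules, and spinor $\mathfrak{o}(2a+1)$-modules are the pullbacks via $\Theta_{a|0}$ of simple weight $Cl(a|0)$-modules (for $a=\infty$ these are the simple direct limits of spinor modules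 of finite-dimensional orthogonal Lie algebras). Simple weight $\mathfrak{sp}(2b)$-modules of oscillator type are the pullbacks via $\Psi_{0|b}$ of simple weight $Cl(0|b)_{ev}$-modules (for $b=\infty$ these are the simple direct limits of simple multiplicity free infinite-dimensional weight $\mathfrak{sp}(2n)$-modules, $n\to\infty$). Twins. If $T$ is a simple weight $\mathfrak{sp}(2b)$-module of oscillator type, it is the pullback of a unique simple weight $Cl(0|b)_{ev}$-module $\tilde T$; $\tilde T$ generates a unique simple weight $Cl(0|b)$-module, which as a $Cl(0|b)_{ev}$-module has the form $\tilde T\oplus\tilde T'$; the twin of $T$ is the pullback $T'$ of $\tilde T'$ to $\mathfrak{sp}(2b)$. Two spinor $\mathfrak{o}(2a)$-modules are twins if they are the pullbacks of the two simple $Cl(a|0)_{ev}$-constituents of a simple weight $Cl(a|0)$-module. Two spinor $\mathfrak{o}(2a+1)$-modules are twins if they are isomorphic. In (c), the modules $S',T'$ in $( * )$ are the twins of $S$ and $T$. *)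

theory Defs
  imports
    Complex_Main
    "HOL-Library.Extended_Nat"
    "HOL-Library.Z2"
    "HOL-Algebra.Algebra"
    "HOL-Algebra.Algebraic_Closure_Type"
begin

abbreviation CC :: "complex ring" where
  "CC \<equiv> ring_of_type_algebra"


section \<open>Superspaces\<close>

text \<open>
  \<open>part V 0\<close> and \<open>part V 1\<close> are the even and the odd part. The fields \<open>mult\<close> and \<open>one\<close> of the
  record \<open>module\<close> are used only when the superspace is, or lies in, an associative superalgebra.
\<close>

record 'v superspace = "(complex, 'v) module" +
  part :: "bit \<Rightarrow> 'v set"

definition superspace :: "('v, 'z) superspace_scheme \<Rightarrow> bool" where
  "superspace V \<longleftrightarrow>
     module CC V \<and> (\<forall>p. submodule (part V p) CC V) \<and>
     part V 0 \<inter> part V 1 = {\<zero>\<^bsub>V\<^esub>} \<and>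
     (\<forall>v\<in>carrier V. \<exists>x\<in>part V 0. \<exists>y\<in>part V 1. v = x \<oplus>\<^bsub>V\<^esub> y)"

definition purely_even :: "('v, 'z) superspace_scheme \<Rightarrow> bool" where
  "purely_even V \<longleftrightarrow> part V 1 = {\<zero>\<^bsub>V\<^esub>}"

definition lin_span :: "(complex, 'v, 'z) module_scheme \<Rightarrow> 'v set \<Rightarrow> 'v set" where
  "lin_span V S = \<Inter> {W. submodule W CC V \<and> S \<subseteq> W}"

definition dim_le :: "(complex, 'v, 'z) module_scheme \<Rightarrow> 'v set \<Rightarrow> nat \<Rightarrow> bool" where
  "dim_le V W n \<longleftrightarrow>
     (\<exists>B \<subseteq> carrier V. finite B \<and> card B \<le> n \<and> W \<subseteq> lin_span V B)"

definition subsp :: "('v, 'z) superspace_scheme \<Rightarrow> 'v set \<Rightarrow> ('v, 'z) superspace_scheme" where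
  "subsp V W = V\<lparr>carrier := W, part := (\<lambda>p. W \<inter> part V p)\<rparr>"

definition quot :: "('v, 'z) superspace_scheme \<Rightarrow> 'v set \<Rightarrow> 'v set superspace" where
  "quot V W =
     \<lparr>carrier = a_rcosets\<^bsub>V\<^esub> W,
      monoid.mult = rcoset_mult V W,
      monoid.one = W +>\<^bsub>V\<^esub> \<one>\<^bsub>V\<^esub>,
      ring.zero = W,
      ring.add = set_add V,
      module.smult = (\<lambda>c Z. \<Union>x\<in>Z. W +>\<^bsub>V\<^esub> (c \<odot>\<^bsub>V\<^esub> x)),
      part = (\<lambda>p. (\<lambda>x. W +>\<^bsub>V\<^esub> x) ` part V p)\<rparr>"

definition sign :: "bit \<Rightarrow> bit \<Rightarrow> complex" where
  "sign p q = (if p = 1 \<and> q = 1 then - 1 else 1)"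

text \<open>
  For \<open>u\<close> of parity \<open>p\<close> and \<open>v\<close> of parity \<open>q\<close> in an associative superalgebra: \<open>anti\<close> is
  \<open>{u, v} = uv + (-1)^(pq) vu\<close> and \<open>scomm\<close> is the supercommutator \<open>uv - (-1)^(pq) vu\<close>.
\<close>

definition anti :: "(complex, 'v, 'z) module_scheme \<Rightarrow> bit \<Rightarrow> bit \<Rightarrow> 'v \<Rightarrow> 'v \<Rightarrow> 'v" where
  "anti A p q u v = (u \<otimes>\<^bsub>A\<^esub> v) \<oplus>\<^bsub>A\<^esub> (sign p q \<odot>\<^bsub>A\<^esub> (v \<otimes>\<^bsub>A\<^esub> u))"

definition scomm :: "(complex, 'v, 'z) module_scheme \<Rightarrow> bit \<Rightarrow> bit \<Rightarrow> 'v \<Rightarrow> 'v \<Rightarrow> 'v" where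
  "scomm A p q u v = (u \<otimes>\<^bsub>A\<^esub> v) \<oplus>\<^bsub>A\<^esub> ((- sign p q) \<odot>\<^bsub>A\<^esub> (v \<otimes>\<^bsub>A\<^esub> u))"


section \<open>Free spaces and free associative superalgebras\<close>

definition single :: "'i \<Rightarrow> 'i \<Rightarrow> complex" where
  "single i = (\<lambda>j. if j = i then 1 else 0)"

definition free_space :: "'i set \<Rightarrow> ('i \<Rightarrow> bit) \<Rightarrow> ('i \<Rightarrow> complex) superspace" where
  "free_space G par =
     \<lparr>carrier = {f. finite {i. f i \<noteq> 0} \<and> {i. f i \<noteq> 0} \<subseteq> G},
      monoid.mult = undefined,
      monoid.one = undefined,
      ring.zero = (\<lambda>_. 0),
      ring.add = (\<lambda>f g i. f i + g i),
      module.smult = (\<lambda>c f i. c * f i),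
      part = (\<lambda>p. {f. finite {i. f i \<noteq> 0} \<and> {i. f i \<noteq> 0} \<subseteq> {i\<in>G. par i = p}})\<rparr>"

definition free_alg :: "'x set \<Rightarrow> ('x \<Rightarrow> bit) \<Rightarrow> ('x list \<Rightarrow> complex) superspace" where
  "free_alg G par =
     (free_space (lists G) (\<lambda>w. \<Sum>x\<leftarrow>w. par x))
       \<lparr>monoid.mult := (\<lambda>f g w. \<Sum>k\<le>length w. f (take k w) * g (drop k w)),
        monoid.one := single []\<rparr>"


section \<open>The Clifford-Weyl superalgebra \<open>Cl(a|b)\<close>\<close>

datatype gen = Xi (idx: int) | Eta (idx: int)

type_synonym cl = "(gen list \<Rightarrow> complex) set"

definition gen_par :: "gen \<Rightarrow> bit" where
  "gen_par g = (if idx g < 0 then 1 else 0)"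

fun gen_deg :: "gen \<Rightarrow> int" where
  "gen_deg (Xi i) = 1"
| "gen_deg (Eta i) = - 1"

definition Idx :: "enat \<Rightarrow> enat \<Rightarrow> int set" where
  "Idx a b = {i. 0 < i \<and> enat (nat i) \<le> a} \<union> {i. i < 0 \<and> enat (nat (- i)) \<le> b}"

definition cl_free :: "enat \<Rightarrow> enat \<Rightarrow> (gen list \<Rightarrow> complex) superspace" where
  "cl_free a b = free_alg {g. idx g \<in> Idx a b} gen_par"

definition gen_anti :: "enat \<Rightarrow> enat \<Rightarrow> gen \<Rightarrow> gen \<Rightarrow> gen list \<Rightarrow> complex" where
  "gen_anti a b g h = anti (cl_free a b) (gen_par g) (gen_par h) (single [g]) (single [h])"

definition cl_rels :: "enat \<Rightarrow> enat \<Rightarrow> (gen list \<Rightarrow> complex) set" where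
  "cl_rels a b =
     {gen_anti a b (Xi i) (Xi j) | i j. i \<in> Idx a b \<and> j \<in> Idx a b} \<union>
     {gen_anti a b (Eta i) (Eta j) | i j. i \<in> Idx a b \<and> j \<in> Idx a b} \<union>
     {gen_anti a b (Eta i) (Xi j)
        \<ominus>\<^bsub>cl_free a b\<^esub> ((if i = j then 1 else 0) \<odot>\<^bsub>cl_free a b\<^esub> \<one>\<^bsub>cl_free a b\<^esub>)
      | i j. i \<in> Idx a b \<and> j \<in> Idx a b}"

definition cl_ideal :: "enat \<Rightarrow> enat \<Rightarrow> (gen list \<Rightarrow> complex) set" where
  "cl_ideal a b = Idl\<^bsub>cl_free a b\<^esub> (cl_rels a b)"

definition Cl :: "enat \<Rightarrow> enat \<Rightarrow> cl superspace" where
  "Cl a b = quot (cl_free a b) (cl_ideal a b)"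

definition cl_proj :: "enat \<Rightarrow> enat \<Rightarrow> (gen list \<Rightarrow> complex) \<Rightarrow> cl" where
  "cl_proj a b f = cl_ideal a b +>\<^bsub>cl_free a b\<^esub> f"

definition xi :: "enat \<Rightarrow> enat \<Rightarrow> int \<Rightarrow> cl" where
  "xi a b i = cl_proj a b (single [Xi i])"

definition eta :: "enat \<Rightarrow> enat \<Rightarrow> int \<Rightarrow> cl" where
  "eta a b i = cl_proj a b (single [Eta i])"

definition cl_u :: "enat \<Rightarrow> enat \<Rightarrow> int \<Rightarrow> cl" where
  "cl_u a b i = xi a b i \<otimes>\<^bsub>Cl a b\<^esub> eta a b i"

definition Cl_ev :: "enat \<Rightarrow> enat \<Rightarrow> cl superspace" where
  "Cl_ev a b =
     subsp (Cl a b)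
       (cl_proj a b `
         {f \<in> carrier (cl_free a b). \<forall>w. f w \<noteq> 0 \<longrightarrow> even (\<Sum>g\<leftarrow>w. gen_deg g)})"

text \<open>For \<open>a' \<le> a\<close> and \<open>b' \<le> b\<close>, the homomorphism \<open>Cl(a'|b') \<rightarrow> Cl(a|b)\<close> fixing all generators.\<close>

definition cl_incl :: "enat \<Rightarrow> enat \<Rightarrow> cl \<Rightarrow> cl" where
  "cl_incl a b Z = (\<Union>f\<in>Z. cl_proj a b f)"


section \<open>Orthosymplectic Lie superalgebras\<close>

text \<open>
  All Lie superalgebras below are Lie subsuperalgebras of some \<open>Cl(a|b)\<close>. They are represented by
  superspaces that inherit \<open>mult\<close> from \<open>Cl(a|b)\<close> (they are not closed under it); the Lie
  superbracket of elements of parities \<open>p\<close> and \<open>q\<close> is \<open>scomm L p q\<close>.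

  \<open>osp False a b\<close> is \<open>osp(2a|2b)\<close> and \<open>osp True a b\<close> is \<open>osp(2a+1|2b)\<close>. In particular,
  \<open>osp False a 0 = o(2a)\<close>, \<open>osp True a 0 = o(2a+1)\<close> and \<open>osp False 0 b = sp(2b)\<close>.
\<close>

definition cl_U :: "enat \<Rightarrow> enat \<Rightarrow> cl set" where
  "cl_U a b = lin_span (Cl a b) (xi a b ` Idx a b \<union> eta a b ` Idx a b)"

definition osp :: "bool \<Rightarrow> enat \<Rightarrow> enat \<Rightarrow> cl superspace" where
  "osp \<epsilon> a b =
     subsp (Cl a b)
       (lin_span (Cl a b)
         ({scomm (Cl a b) p q u v | p q u v.
             u \<in> cl_U a b \<inter> part (Cl a b) p \<and> v \<in> cl_U a b \<inter> part (Cl a b) q} \<union>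
          (if \<epsilon> then cl_U a b else {})))"

definition cartan :: "enat \<Rightarrow> enat \<Rightarrow> cl set" where
  "cartan a b =
     lin_span (Cl a b)
       ((\<lambda>i. cl_u a b i \<oplus>\<^bsub>Cl a b\<^esub> ((if 0 < i then - 1 / 2 else 1 / 2) \<odot>\<^bsub>Cl a b\<^esub> \<one>\<^bsub>Cl a b\<^esub>))
          ` Idx a b)"


section \<open>Modules\<close>

record ('x, 'v) rep = "'v superspace" +
  act :: "'x \<Rightarrow> 'v \<Rightarrow> 'v"

definition graded_action :: "('x, 'z) superspace_scheme \<Rightarrow> ('x, 'v) rep \<Rightarrow> bool" where
  "graded_action G M \<longleftrightarrow>
     superspace M \<and>
     (\<forall>x\<in>carrier G. \<forall>v\<in>carrier M. act M x v \<in> carrier M) \<and>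
     (\<forall>x\<in>carrier G. \<forall>v\<in>carrier M. \<forall>w\<in>carrier M.
        act M x (v \<oplus>\<^bsub>M\<^esub> w) = act M x v \<oplus>\<^bsub>M\<^esub> act M x w) \<and>
     (\<forall>x\<in>carrier G. \<forall>v\<in>carrier M. \<forall>c. act M x (c \<odot>\<^bsub>M\<^esub> v) = c \<odot>\<^bsub>M\<^esub> act M x v) \<and>
     (\<forall>x\<in>carrier G. \<forall>y\<in>carrier G. \<forall>v\<in>carrier M.
        act M (x \<oplus>\<^bsub>G\<^esub> y) v = act M x v \<oplus>\<^bsub>M\<^esub> act M y v) \<and>
     (\<forall>x\<in>carrier G. \<forall>v\<in>carrier M. \<forall>c. act M (c \<odot>\<^bsub>G\<^esub> x) v = c \<odot>\<^bsub>M\<^esub> act M x v) \<and>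
     (\<forall>p q. \<forall>x\<in>part G p. \<forall>v\<in>part M q. act M x v \<in> part M (p + q))"

definition assoc_module :: "('x, 'z) superspace_scheme \<Rightarrow> ('x, 'v) rep \<Rightarrow> bool" where
  "assoc_module A M \<longleftrightarrow>
     graded_action A M \<and>
     (\<forall>x\<in>carrier A. \<forall>y\<in>carrier A. \<forall>v\<in>carrier M. act M (x \<otimes>\<^bsub>A\<^esub> y) v = act M x (act M y v)) \<and>
     (\<forall>v\<in>carrier M. act M \<one>\<^bsub>A\<^esub> v = v)"

definition lie_module :: "('x, 'z) superspace_scheme \<Rightarrow> ('x, 'v) rep \<Rightarrow> bool" where
  "lie_module L M \<longleftrightarrow>
     graded_action L M \<and>
     (\<forall>p q. \<forall>x\<in>part L p. \<forall>y\<in>part L q. \<forall>v\<in>carrier M.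
        act M (scomm L p q x y) v =
          act M x (act M y v) \<oplus>\<^bsub>M\<^esub> ((- sign p q) \<odot>\<^bsub>M\<^esub> act M y (act M x v)))"

definition graded_submodule :: "'x set \<Rightarrow> ('x, 'v) rep \<Rightarrow> 'v set \<Rightarrow> bool" where
  "graded_submodule G M W \<longleftrightarrow>
     submodule W CC M \<and>
     (\<forall>w\<in>W. \<exists>x \<in> W \<inter> part M 0. \<exists>y \<in> W \<inter> part M 1. w = x \<oplus>\<^bsub>M\<^esub> y) \<and>
     (\<forall>x\<in>G. \<forall>w\<in>W. act M x w \<in> W)"

definition simple_rep :: "'x set \<Rightarrow> ('x, 'v) rep \<Rightarrow> bool" where
  "simple_rep G M \<longleftrightarrow>
     carrier M \<noteq> {\<zero>\<^bsub>M\<^esub>} \<and>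
     (\<forall>W. graded_submodule G M W \<longrightarrow> W = {\<zero>\<^bsub>M\<^esub>} \<or> W = carrier M)"

definition rep_iso :: "'x set \<Rightarrow> ('x, 'v) rep \<Rightarrow> ('x, 'w) rep \<Rightarrow> bool" where
  "rep_iso G M N \<longleftrightarrow>
     (\<exists>\<phi>. bij_betw \<phi> (carrier M) (carrier N) \<and>
        (\<forall>v\<in>carrier M. \<forall>w\<in>carrier M. \<phi> (v \<oplus>\<^bsub>M\<^esub> w) = \<phi> v \<oplus>\<^bsub>N\<^esub> \<phi> w) \<and>
        (\<forall>c. \<forall>v\<in>carrier M. \<phi> (c \<odot>\<^bsub>M\<^esub> v) = c \<odot>\<^bsub>N\<^esub> \<phi> v) \<and>
        (\<forall>p. \<phi> ` part M p = part N p) \<and>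
        (\<forall>x\<in>G. \<forall>v\<in>carrier M. \<phi> (act M x v) = act N x (\<phi> v)))"

definition pullback :: "('y \<Rightarrow> 'x) \<Rightarrow> ('x, 'v) rep \<Rightarrow> ('y, 'v) rep" where
  "pullback f M = superspace.extend (superspace.truncate M) (rep.fields (\<lambda>y. act M (f y)))"

text \<open>
  The parity change functor, without the sign twist of the action of odd elements: it is only
  applied to modules over purely even algebras.
\<close>

definition parity_shift :: "('x, 'v) rep \<Rightarrow> ('x, 'v) rep" where
  "parity_shift M = M\<lparr>part := (\<lambda>p. part M (p + 1))\<rparr>"

definition dsum :: "('x, 'v) rep \<Rightarrow> ('x, 'w) rep \<Rightarrow> ('x, 'v \<times> 'w) rep" where
  "dsum M N =
     \<lparr>carrier = carrier M \<times> carrier N,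
      monoid.mult = undefined,
      monoid.one = undefined,
      ring.zero = (\<zero>\<^bsub>M\<^esub>, \<zero>\<^bsub>N\<^esub>),
      ring.add = (\<lambda>(v, w) (v', w'). (v \<oplus>\<^bsub>M\<^esub> v', w \<oplus>\<^bsub>N\<^esub> w')),
      module.smult = (\<lambda>c (v, w). (c \<odot>\<^bsub>M\<^esub> v, c \<odot>\<^bsub>N\<^esub> w)),
      part = (\<lambda>p. part M p \<times> part N p),
      act = (\<lambda>x (v, w). (act M x v, act N x w))\<rparr>"

text \<open>
  Outer tensor product of purely even modules over two Lie algebras \<open>L\<close> and \<open>L'\<close>, as a module over
  \<open>L \<oplus> L'\<close>: the quotient of the free space on all pairs \<open>(s, t)\<close> by the bilinearity relations,
  with \<open>(x, y)\<close> acting by \<open>s \<otimes> t \<mapsto> xs \<otimes> t + s \<otimes> yt\<close>.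
\<close>

definition tensor_free :: "('x, 's) rep \<Rightarrow> ('y, 't) rep \<Rightarrow> ('s \<times> 't \<Rightarrow> complex) superspace" where
  "tensor_free S T = free_space (carrier S \<times> carrier T) (\<lambda>_. 0)"

definition tensor_rels :: "('x, 's) rep \<Rightarrow> ('y, 't) rep \<Rightarrow> ('s \<times> 't \<Rightarrow> complex) set" where
  "tensor_rels S T =
     (let F = tensor_free S T in
      lin_span F
        ({single (s \<oplus>\<^bsub>S\<^esub> s', t) \<ominus>\<^bsub>F\<^esub> (single (s, t) \<oplus>\<^bsub>F\<^esub> single (s', t)) | s s' t.
            s \<in> carrier S \<and> s' \<in> carrier S \<and> t \<in> carrier T} \<union>
         {single (s, t \<oplus>\<^bsub>T\<^esub> t') \<ominus>\<^bsub>F\<^esub> (single (s, t) \<oplus>\<^bsub>F\<^esub> single (s, t')) | s t t'.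
            s \<in> carrier S \<and> t \<in> carrier T \<and> t' \<in> carrier T} \<union>
         {single (c \<odot>\<^bsub>S\<^esub> s, t) \<ominus>\<^bsub>F\<^esub> (c \<odot>\<^bsub>F\<^esub> single (s, t)) | c s t.
            s \<in> carrier S \<and> t \<in> carrier T} \<union>
         {single (s, c \<odot>\<^bsub>T\<^esub> t) \<ominus>\<^bsub>F\<^esub> (c \<odot>\<^bsub>F\<^esub> single (s, t)) | c s t.
            s \<in> carrier S \<and> t \<in> carrier T}))"

definition tensor :: "('x, 's) rep \<Rightarrow> ('y, 't) rep \<Rightarrow> ('x \<times> 'y, ('s \<times> 't \<Rightarrow> complex) set) rep" where
  "tensor S T =
     (let F = tensor_free S T; R = tensor_rels S T in
      superspace.extend (quot F R)
        (rep.fields (\<lambda>(x, y) Z. \<Union>f\<in>Z. R +>\<^bsub>F\<^esub>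
           (\<Oplus>\<^bsub>F\<^esub>k\<in>{k. f k \<noteq> 0}.
              f k \<odot>\<^bsub>F\<^esub> (single (act S x (fst k), snd k) \<oplus>\<^bsub>F\<^esub> single (fst k, act T y (snd k)))))))"


subsection \<open>Weight modules\<close>

definition weight_space :: "('x, 'v) rep \<Rightarrow> 'x set \<Rightarrow> ('x \<Rightarrow> complex) \<Rightarrow> 'v set" where
  "weight_space M H \<mu> = {v \<in> carrier M. \<forall>h\<in>H. act M h v = \<mu> h \<odot>\<^bsub>M\<^esub> v}"

text \<open>Simultaneous eigenspaces are linearly independent, so their sum is automatically direct.\<close>

definition weight_module :: "('x, 'v) rep \<Rightarrow> 'x set \<Rightarrow> bool" where
  "weight_module M H \<longleftrightarrow> lin_span M (\<Union>\<mu>. weight_space M H \<mu>) = carrier M"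

definition bounded_module :: "('x, 'v) rep \<Rightarrow> 'x set \<Rightarrow> bool" where
  "bounded_module M H \<longleftrightarrow>
     (\<exists>p q. \<forall>\<mu>. dim_le M (weight_space M H \<mu> \<inter> part M 0) p \<and>
                 dim_le M (weight_space M H \<mu> \<inter> part M 1) q)"

definition simple_weight_Cl :: "enat \<Rightarrow> enat \<Rightarrow> (cl, 'v) rep \<Rightarrow> bool" where
  "simple_weight_Cl a b M \<longleftrightarrow>
     assoc_module (Cl a b) M \<and> simple_rep (carrier (Cl a b)) M \<and>
     weight_module M (cl_u a b ` Idx a b)"

definition simple_weight_Cl_ev :: "enat \<Rightarrow> enat \<Rightarrow> (cl, 'v) rep \<Rightarrow> bool" where
  "simple_weight_Cl_ev a b M \<longleftrightarrow>
     assoc_module (Cl_ev a b) M \<and> simple_rep (carrier (Cl_ev a b)) M \<and>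
     weight_module M (cl_u a b ` Idx a b)"


section \<open>Enveloping algebras and modules of spinor-oscillator type\<close>

text \<open>
  The enveloping algebra is generated by the homogeneous elements of the Lie superalgebra. The zero
  element counts as an even generator; it vanishes in the quotient.
\<close>

definition env_free :: "('x, 'z) superspace_scheme \<Rightarrow> ('x list \<Rightarrow> complex) superspace" where
  "env_free L =
     free_alg (part L 0 \<union> part L 1) (\<lambda>x. if x \<in> part L 0 then 0 else 1)"

definition env_rels :: "('x, 'z) superspace_scheme \<Rightarrow> ('x list \<Rightarrow> complex) set" where
  "env_rels L =
     (let F = env_free L in
      {single [x \<oplus>\<^bsub>L\<^esub> y] \<ominus>\<^bsub>F\<^esub> (single [x] \<oplus>\<^bsub>F\<^esub> single [y]) | p x y.
         x \<in> part L p \<and> y \<in> part L p} \<union>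
      {single [c \<odot>\<^bsub>L\<^esub> x] \<ominus>\<^bsub>F\<^esub> (c \<odot>\<^bsub>F\<^esub> single [x]) | c p x. x \<in> part L p} \<union>
      {scomm F p q (single [x]) (single [y]) \<ominus>\<^bsub>F\<^esub> single [scomm L p q x y] | p q x y.
         x \<in> part L p \<and> y \<in> part L q})"

definition env :: "('x, 'z) superspace_scheme \<Rightarrow> ('x list \<Rightarrow> complex) set superspace" where
  "env L = quot (env_free L) (Idl\<^bsub>env_free L\<^esub> (env_rels L))"

text \<open>
  The homomorphism from \<open>U(L)\<close> to an associative superalgebra \<open>A\<close> containing \<open>L\<close>, and the action of
  \<open>U(L)\<close> on an \<open>L\<close>-module, are computed on any representative; the sets under \<open>the_elem\<close> are
  singletons.
\<close>

definition env_map :: "(complex, 'x, 'z) module_scheme \<Rightarrow> ('x list \<Rightarrow> complex) set \<Rightarrow> 'x" where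
  "env_map A Z =
     the_elem ((\<lambda>f. \<Oplus>\<^bsub>A\<^esub>w\<in>{w. f w \<noteq> 0}. f w \<odot>\<^bsub>A\<^esub> foldr (\<otimes>\<^bsub>A\<^esub>) w \<one>\<^bsub>A\<^esub>) ` Z)"

definition env_act :: "('x, 'v) rep \<Rightarrow> ('x list \<Rightarrow> complex) set \<Rightarrow> 'v \<Rightarrow> 'v" where
  "env_act M Z v =
     the_elem ((\<lambda>f. \<Oplus>\<^bsub>M\<^esub>w\<in>{w. f w \<noteq> 0}. f w \<odot>\<^bsub>M\<^esub> foldr (act M) w v) ` Z)"

text \<open>\<open>J_osp False a b\<close> is the kernel of \<open>\<Psi>\<close>, and \<open>J_osp True a b\<close> is the kernel of \<open>\<Theta>\<close>.\<close>

definition J_osp :: "bool \<Rightarrow> enat \<Rightarrow> enat \<Rightarrow> (cl list \<Rightarrow> complex) set set" where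
  "J_osp \<epsilon> a b = {Z \<in> carrier (env (osp \<epsilon> a b)). env_map (Cl a b) Z = \<zero>\<^bsub>Cl a b\<^esub>}"

definition weight_osp_module :: "bool \<Rightarrow> enat \<Rightarrow> enat \<Rightarrow> (cl, 'v) rep \<Rightarrow> bool" where
  "weight_osp_module \<epsilon> a b M \<longleftrightarrow> lie_module (osp \<epsilon> a b) M \<and> weight_module M (cartan a b)"

definition spinor_oscillator_type :: "bool \<Rightarrow> enat \<Rightarrow> enat \<Rightarrow> (cl, 'v) rep \<Rightarrow> bool" where
  "spinor_oscillator_type \<epsilon> a b M \<longleftrightarrow>
     weight_osp_module \<epsilon> a b M \<and> simple_rep (carrier (osp \<epsilon> a b)) M \<and>
     (\<forall>Z\<in>J_osp \<epsilon> a b. \<forall>v\<in>carrier M. env_act M Z v = \<zero>\<^bsub>M\<^esub>)"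


section \<open>Spinor modules, oscillator modules, twins\<close>

definition spinor :: "bool \<Rightarrow> enat \<Rightarrow> (cl, 's) rep \<Rightarrow> bool" where
  "spinor \<epsilon> a S \<longleftrightarrow>
     lie_module (osp \<epsilon> a 0) S \<and> purely_even S \<and>
     (\<exists>N :: (cl, 's) rep.
        (if \<epsilon> then simple_weight_Cl a 0 N else simple_weight_Cl_ev a 0 N) \<and>
        rep_iso (carrier (osp \<epsilon> a 0)) S N)"

definition oscillator :: "enat \<Rightarrow> (cl, 't) rep \<Rightarrow> bool" where
  "oscillator b T \<longleftrightarrow>
     lie_module (osp False 0 b) T \<and> purely_even T \<and>
     (\<exists>N :: (cl, 't) rep.
        simple_weight_Cl_ev 0 b N \<and> rep_iso (carrier (osp False 0 b)) T N)"

definition twin_spinor :: "bool \<Rightarrow> enat \<Rightarrow> (cl, 's) rep \<Rightarrow> (cl, 'r) rep \<Rightarrow> bool" where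
  "twin_spinor \<epsilon> a S S' \<longleftrightarrow>
     spinor \<epsilon> a S \<and> spinor \<epsilon> a S' \<and>
     (if \<epsilon> then rep_iso (carrier (osp True a 0)) S S'
      else (\<exists>(P :: (cl, 's) rep) (P' :: (cl, 'r) rep) (N :: (cl, 's \<times> 'r) rep).
         simple_weight_Cl_ev a 0 P \<and> rep_iso (carrier (osp False a 0)) S P \<and>
         simple_weight_Cl_ev a 0 P' \<and> rep_iso (carrier (osp False a 0)) S' P' \<and>
         simple_weight_Cl a 0 N \<and> rep_iso (carrier (Cl_ev a 0)) N (dsum P P')))"

text \<open>
  The odd generators of \<open>Cl(0|b)\<close> exchange the two constituents. If the first one is even, then the
  second one is odd, while \<open>T'\<close> is purely even by convention: hence the parity shift.
\<close>

definition twin_oscillator :: "enat \<Rightarrow> (cl, 't) rep \<Rightarrow> (cl, 'r) rep \<Rightarrow> bool" where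
  "twin_oscillator b T T' \<longleftrightarrow>
     oscillator b T \<and> oscillator b T' \<and>
     (\<exists>(P :: (cl, 't) rep) (P' :: (cl, 'r) rep) (N :: (cl, 't \<times> 'r) rep).
         simple_weight_Cl_ev 0 b P \<and> rep_iso (carrier (osp False 0 b)) T P \<and>
         simple_weight_Cl_ev 0 b P' \<and> rep_iso (carrier (osp False 0 b)) T' P' \<and>
         simple_weight_Cl 0 b N \<and> rep_iso (carrier (Cl_ev 0 b)) N (dsum P (parity_shift P')))"


section \<open>The decomposition \<open>M\<^sub>0 \<simeq> S \<otimes> T\<close>, \<open>M\<^sub>1 \<simeq> \<Pi>(S' \<otimes> T')\<close>\<close>

text \<open>
  Modules over the even part of \<open>osp \<epsilon> a b\<close> are regarded as modules over the direct sum of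
  \<open>osp \<epsilon> a 0\<close> and \<open>osp False 0 b\<close> via the isomorphism \<open>g0_embed\<close>.
\<close>

definition g0_embed :: "enat \<Rightarrow> enat \<Rightarrow> cl \<times> cl \<Rightarrow> cl" where
  "g0_embed a b = (\<lambda>(x, y). cl_incl a b x \<oplus>\<^bsub>Cl a b\<^esub> cl_incl a b y)"

definition tensor_decomposition ::
  "bool \<Rightarrow> enat \<Rightarrow> enat \<Rightarrow> (cl, 'm) rep \<Rightarrow>
   (cl, 's) rep \<Rightarrow> (cl, 's1) rep \<Rightarrow> (cl, 't) rep \<Rightarrow> (cl, 't1) rep \<Rightarrow> bool" where
  "tensor_decomposition \<epsilon> a b M S S' T T' \<longleftrightarrow>
     (let G = carrier (osp \<epsilon> a 0) \<times> carrier (osp False 0 b) in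
      rep_iso G (pullback (g0_embed a b) (subsp M (part M 0))) (tensor S T) \<and>
      rep_iso G (pullback (g0_embed a b) (subsp M (part M 1))) (parity_shift (tensor S' T')))"

definition twin_decomposition ::
  "bool \<Rightarrow> enat \<Rightarrow> enat \<Rightarrow> (cl, 'm) rep \<Rightarrow>
   (cl, 's) rep \<Rightarrow> (cl, 's1) rep \<Rightarrow> (cl, 't) rep \<Rightarrow> (cl, 't1) rep \<Rightarrow> bool" where
  "twin_decomposition \<epsilon> a b M S S' T T' \<longleftrightarrow>
     twin_spinor \<epsilon> a S S' \<and> twin_oscillator b T T' \<and> tensor_decomposition \<epsilon> a b M S S' T T'"

definition bounded_spinor_oscillator :: "bool \<Rightarrow> enat \<Rightarrow> enat \<Rightarrow> (cl, 'm) rep \<Rightarrow> bool" where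
  "bounded_spinor_oscillator \<epsilon> a b M \<longleftrightarrow>
     spinor_oscillator_type \<epsilon> a b M \<and> bounded_module M (cartan a b)"

text \<open>
  All modules in question have countable dimension, so each of them is isomorphic to one whose
  elements have type \<open>nat \<Rightarrow> complex\<close>; existence claims are stated for modules on this type.
\<close>

type_synonym cl_rep = "(cl, nat \<Rightarrow> complex) rep"

end

theory Submission imports Defs begin

text \<open>
 The weight zero part of \<open>Cl(a|b)\<close> consists of polynomials in the commuting elements \<open>u_i\<close>, so a simple weight
 module over \<open>Cl(a|b)\<close> or \<open>Cl(a|b)_ev\<close> is determined by any one of its weights. Hence it is isomorphic to a standard
 module with basis \<open>e_d\<close>, where \<open>d\<close> runs over finitely supported shifts of the weight and the generators act by signed
 raising and lowering operators. As \<open>osp\<close> generates the algebra, a module killed by the kernel of the map from the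
 enveloping algebra is a module over the image. The parities of the positive and of the negative part of \<open>d\<close> cut the
 standard module into pieces that are simple over the even part of \<open>osp\<close>, and splitting \<open>d\<close> into these two parts
 turns a piece into the tensor product of a spinor module and a module of oscillator type. Isomorphic modules share
 a weight, which gives all uniqueness claims.
\<close>

text \<open>Positive letters anticommute, up to scalars, with each other and with the negative ones;
  negative letters commute with each other up to scalars. So a positive index contributes an
  exterior algebra in one variable, and a negative index the monomials x^y with y in a fixed class,
  where \<open>Xi i\<close> is multiplication by x, \<open>Eta i\<close> is d/dx and u_i = x d/dx.
  If y is an integer, the class consists of the nonnegative or of the negative integers; this
  barrier is the origin of \<open>okk\<close> and \<open>mag\<close>. With infinitely many indices
  only finitely many coordinates can move away from the base weight, hence the shifts d.

  The obstacle is the sign between the two kinds of letters: a negative letter sees the parity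
  \<open>ps d\<close>, so the module is not a plain tensor product over the whole algebra. Elements
  of sp(2b) use negative letters in pairs and do not see the sign. For osp(2a|2b) the sum
  \<open>ps d + ns d\<close> is constant, so S and T pass to their twins together; for osp(2a+1|2b)
  \<open>ps d\<close> is free and S stays the same. The base weight is chosen at an even vector; the
  index -1 supplied by the nonzero odd part makes this possible.\<close>

abbreviation (input) in_carrier (infix "<:" 50) where "x <: V \<equiv> x \<in> carrier V"

section \<open>Complex vector spaces\<close>

lemma CC_simps [simp]:
 "carrier CC = UNIV" "ring.add CC = (+)" "monoid.mult CC = (*)" "monoid.one CC = 1" "ring.zero CC = 0"
 by (simp_all add: ring_of_type_algebra_def fun_eq_iff)

text \<open>Every complex number is a scalar, so the carrier conditions on scalars in
  \<open>module\<close> vanish; \<open>module_CC_iff\<close> passes between the two forms.\<close>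

locale vspace = abelian_group V for V :: "(complex, 'v, 'z) module_scheme" (structure) +
 assumes vs_sc [simp, intro]: "x <: V ==> c \<odot> x <: V"
  and vs_ladd: "x <: V ==> (c + d) \<odot> x = c \<odot> x \<oplus> d \<odot> x"
  and vs_radd: "x <: V ==> y <: V ==> c \<odot> (x \<oplus> y) = c \<odot> x \<oplus> c \<odot> y"
  and vs_assoc: "x <: V ==> (c * d) \<odot> x = c \<odot> (d \<odot> x)"
  and vs_one [simp]: "x <: V ==> 1 \<odot> x = x"

lemma module_CC_iff: "module CC V \<longleftrightarrow> vspace V"
proof
 assume "module CC V"
 then interpret module CC V .
 show "vspace V"
  using smult_l_distr smult_r_distr smult_assoc1 smult_one
  by unfold_locales auto
next
 assume "vspace V"
 then interpret vspace V .
 show "module CC V"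
  by (rule moduleI) (auto simp: vs_ladd vs_radd vs_assoc intro: abelian_group_axioms)
qed

context vspace
begin

lemma is_module: "module CC V"
 using vspace_axioms by (simp add: module_CC_iff)

lemma vs_lzero [simp]: "x <: V ==> 0 \<odot> x = \<zero>"
 using module.smult_l_null[OF is_module] by simp

lemma vs_rzero [simp]: "c \<odot> \<zero> = \<zero>"
 using module.smult_r_null[OF is_module] by simp

lemma vs_neg: "x <: V ==> \<ominus> x = (-1) \<odot> x"
proof -
 assume x: "x <: V"
 have "(-1) \<odot> x \<oplus> x = (-1 + 1) \<odot> x" using x vs_ladd[of x "-1" 1] by (metis vs_one)
 also have "\<dots> = \<zero>" using x by simp
 finally show ?thesis using x by (metis minus_equality vs_sc)
qed

lemma vs_minus: "x <: V ==> y <: V ==> x \<ominus> y = x \<oplus> (-1) \<odot> y"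
 by (simp add: a_minus_def vs_neg)

lemma vs_eq_iff: "x <: V ==> y <: V ==> x \<ominus> y = \<zero> \<longleftrightarrow> x = y"
 by (metis a_minus_def r_neg minus_equality minus_minus a_inv_closed local.add.inv_equality)

lemma vs_cancel: "x <: V ==> c \<noteq> 0 ==> c \<odot> x = \<zero> ==> x = \<zero>"
 by (metis vs_assoc vs_one vs_rzero left_inverse)

lemma vs_cancel_scalar: "x <: V ==> x \<noteq> \<zero> ==> c \<odot> x = d \<odot> x ==> c = d"
proof -
 assume x: "x <: V" "x \<noteq> \<zero>" and e: "c \<odot> x = d \<odot> x"
 have "(c - d) \<odot> x = c \<odot> x \<oplus> (- d) \<odot> x" using x vs_ladd[of x c "-d"] by simp
 also have "\<dots> = d \<odot> x \<oplus> (- d) \<odot> x" by (simp add: e)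
 also have "\<dots> = (d + - d) \<odot> x" using x vs_ladd[of x d "-d"] by simp
 also have "\<dots> = \<zero>" using x by simp
 finally have "(c - d) \<odot> x = \<zero>" .
 thus "c = d" using vs_cancel[of x "c - d"] x by auto
qed

lemma sub_iff: "submodule W CC V \<longleftrightarrow> W \<subseteq> carrier V \<and> \<zero> \<in> W \<and> (\<forall>x\<in>W. \<forall>y\<in>W. x \<oplus> y \<in> W) \<and> (\<forall>c. \<forall>x\<in>W. c \<odot> x \<in> W)"
proof
 assume "submodule W CC V"
 then interpret submodule W CC V .
 show "W \<subseteq> carrier V \<and> \<zero> \<in> W \<and> (\<forall>x\<in>W. \<forall>y\<in>W. x \<oplus> y \<in> W) \<and> (\<forall>c. \<forall>x\<in>W. c \<odot> x \<in> W)"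
  using subset one_closed m_closed smult_closed by auto
next
 assume a: "W \<subseteq> carrier V \<and> \<zero> \<in> W \<and> (\<forall>x\<in>W. \<forall>y\<in>W. x \<oplus> y \<in> W) \<and> (\<forall>c. \<forall>x\<in>W. c \<odot> x \<in> W)"
 show "submodule W CC V"
 proof (rule module.submoduleI[OF is_module])
  fix x assume "x \<in> W" thus "\<ominus> x \<in> W" using a by (metis vs_neg subsetD)
 qed (use a in auto)
qed

lemma subI: "W \<subseteq> carrier V ==> \<zero> \<in> W ==> (\<And>x y. x \<in> W ==> y \<in> W ==> x \<oplus> y \<in> W) ==>
 (\<And>c x. x \<in> W ==> c \<odot> x \<in> W) ==> submodule W CC V"
 by (simp add: sub_iff)

lemma sub_carrier: "submodule W CC V ==> x \<in> W ==> x <: V"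
 by (auto simp: sub_iff)
lemma sub_zero: "submodule W CC V ==> \<zero> \<in> W"
 by (auto simp: sub_iff)
lemma sub_add: "submodule W CC V ==> x \<in> W ==> y \<in> W ==> x \<oplus> y \<in> W"
 by (auto simp: sub_iff)
lemma sub_smult: "submodule W CC V ==> x \<in> W ==> c \<odot> x \<in> W"
 by (auto simp: sub_iff)
lemma sub_minus: "submodule W CC V ==> x \<in> W ==> y \<in> W ==> x \<ominus> y \<in> W"
 by (simp add: vs_minus sub_carrier sub_add sub_smult)

lemma sub_Int: "submodule W CC V ==> submodule W' CC V ==> submodule (W \<inter> W') CC V"
 by (auto simp: sub_iff)

lemma sub_full: "submodule (carrier V) CC V"
 by (auto simp: sub_iff)

lemma sub_trivial: "submodule {\<zero>} CC V"
 by (auto simp: sub_iff)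

lemma span_sub: assumes "S \<subseteq> carrier V" shows "submodule (lin_span V S) CC V"
proof -
 have c: "submodule (carrier V) CC V" by (rule sub_full)
 show ?thesis
 proof (rule subI)
  show "lin_span V S \<subseteq> carrier V" unfolding lin_span_def using c assms by blast
 qed (auto simp: lin_span_def sub_iff)
qed

lemma span_superset: "S \<subseteq> lin_span V S"
 by (auto simp: lin_span_def)

lemma span_minimal: "submodule W CC V ==> S \<subseteq> W ==> lin_span V S \<subseteq> W"
 by (auto simp: lin_span_def)

lemma span_mono: "S \<subseteq> S' ==> lin_span V S \<subseteq> lin_span V S'"
 by (auto simp: lin_span_def)

lemma span_carrier: "S \<subseteq> carrier V ==> x \<in> lin_span V S ==> x <: V"
 using span_sub sub_carrier by blast

lemma span_induct [consumes 2, case_names base zero add smult]: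
 assumes "x \<in> lin_span V S" "S \<subseteq> carrier V"
  and "\<And>x. x \<in> S ==> P x" "P \<zero>"
  and "\<And>x y. x <: V ==> y <: V ==> P x ==> P y ==> P (x \<oplus> y)"
  and "\<And>c x. x <: V ==> P x ==> P (c \<odot> x)"
 shows "P x"
proof -
 have "submodule {x \<in> carrier V. P x} CC V"
  by (rule subI) (use assms in auto)
 moreover have "S \<subseteq> {x \<in> carrier V. P x}" using assms by auto
 ultimately show ?thesis using span_minimal assms(1) by blast
qed

end

text \<open>Negatives are produced by the scalar -1, so all assumptions are equations or closure
  properties that unfold directly for the concrete spaces below.\<close>

lemma vspaceI:
 assumes "\<zero>\<^bsub>V\<^esub> <: V"
  "\<And>x y. x <: V ==> y <: V ==> x \<oplus>\<^bsub>V\<^esub> y <: V"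
  "\<And>c x. x <: V ==> c \<odot>\<^bsub>V\<^esub> x <: V"
  "\<And>x y. x <: V ==> y <: V ==> x \<oplus>\<^bsub>V\<^esub> y = y \<oplus>\<^bsub>V\<^esub> x"
  "\<And>x y z. x <: V ==> y <: V ==> z <: V ==> (x \<oplus>\<^bsub>V\<^esub> y) \<oplus>\<^bsub>V\<^esub> z = x \<oplus>\<^bsub>V\<^esub> (y \<oplus>\<^bsub>V\<^esub> z)"
  "\<And>x. x <: V ==> \<zero>\<^bsub>V\<^esub> \<oplus>\<^bsub>V\<^esub> x = x"
  "\<And>x. x <: V ==> ((-1) \<odot>\<^bsub>V\<^esub> x) \<oplus>\<^bsub>V\<^esub> x = \<zero>\<^bsub>V\<^esub>"
  "\<And>c d x. x <: V ==> (c + d) \<odot>\<^bsub>V\<^esub> x = c \<odot>\<^bsub>V\<^esub> x \<oplus>\<^bsub>V\<^esub> d \<odot>\<^bsub>V\<^esub> x"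
  "\<And>c x y. x <: V ==> y <: V ==> c \<odot>\<^bsub>V\<^esub> (x \<oplus>\<^bsub>V\<^esub> y) = c \<odot>\<^bsub>V\<^esub> x \<oplus>\<^bsub>V\<^esub> c \<odot>\<^bsub>V\<^esub> y"
  "\<And>c d x. x <: V ==> (c * d) \<odot>\<^bsub>V\<^esub> x = c \<odot>\<^bsub>V\<^esub> (d \<odot>\<^bsub>V\<^esub> x)"
  "\<And>x. x <: V ==> 1 \<odot>\<^bsub>V\<^esub> x = x"
 shows "vspace V"
proof -
 have e: "\<exists>y\<in>carrier V. y \<oplus>\<^bsub>V\<^esub> x = \<zero>\<^bsub>V\<^esub>" if "x <: V" for x
  using assms(3)[OF that, of "-1"] assms(7)[OF that] by blast
 interpret abelian_group V
  by (intro abelian_groupI) (fact assms e)+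
 show ?thesis by unfold_locales (fact assms)+
qed

definition linear_on :: "(complex, 'v, 'y) module_scheme => (complex, 'w, 'z) module_scheme => ('v => 'w) => bool" where
 "linear_on V W T \<longleftrightarrow> (\<forall>x\<in>carrier V. T x <: W) \<and>
   (\<forall>x\<in>carrier V. \<forall>y\<in>carrier V. T (x \<oplus>\<^bsub>V\<^esub> y) = T x \<oplus>\<^bsub>W\<^esub> T y) \<and>
   (\<forall>c. \<forall>x\<in>carrier V. T (c \<odot>\<^bsub>V\<^esub> x) = c \<odot>\<^bsub>W\<^esub> T x)"

lemma linear_onD:
 assumes "linear_on V W T"
 shows "x <: V ==> T x <: W"
  "x <: V ==> y <: V ==> T (x \<oplus>\<^bsub>V\<^esub> y) = T x \<oplus>\<^bsub>W\<^esub> T y"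
  "x <: V ==> T (c \<odot>\<^bsub>V\<^esub> x) = c \<odot>\<^bsub>W\<^esub> T x"
 using assms by (auto simp: linear_on_def)

lemma linear_on_zero: "vspace V ==> vspace W ==> linear_on V W T ==> T \<zero>\<^bsub>V\<^esub> = \<zero>\<^bsub>W\<^esub>"
proof -
 assume a: "vspace V" "vspace W" "linear_on V W T"
 interpret V: vspace V by fact
 interpret W: vspace W by fact
 have "T \<zero>\<^bsub>V\<^esub> = T (0 \<odot>\<^bsub>V\<^esub> \<zero>\<^bsub>V\<^esub>)" by simp
 also have "\<dots> = 0 \<odot>\<^bsub>W\<^esub> T \<zero>\<^bsub>V\<^esub>" using linear_onD(3)[OF a(3)] V.zero_closed by blast
 also have "\<dots> = \<zero>\<^bsub>W\<^esub>" using linear_onD(1)[OF a(3)] by simp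
 finally show ?thesis .
qed

lemma linear_on_comp: "linear_on U V S ==> linear_on V W T ==> linear_on U W (\<lambda>x. T (S x))"
 by (auto simp: linear_on_def)

lemma linear_on_id: "linear_on V V (\<lambda>x. x)"
 by (simp add: linear_on_def)

lemma linear_on_const_zero: "vspace W ==> linear_on V W (\<lambda>x. \<zero>\<^bsub>W\<^esub>)"
proof -
 assume "vspace W"
 then interpret vspace W .
 show ?thesis by (simp add: linear_on_def)
qed

lemma linear_on_add:
 assumes "vspace W" "linear_on V W S" "linear_on V W T"
 shows "linear_on V W (\<lambda>x. S x \<oplus>\<^bsub>W\<^esub> T x)"
proof -
 interpret vspace W by fact
 show ?thesis
  using assms(2,3) by (auto simp: linear_on_def vs_radd a_ac)
qed

lemma linear_on_smult:
 assumes "vspace W" "linear_on V W T"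
 shows "linear_on V W (\<lambda>x. c \<odot>\<^bsub>W\<^esub> T x)"
proof -
 interpret vspace W by fact
 show ?thesis
  using assms(2) by (auto simp: linear_on_def vs_radd vs_assoc[symmetric] mult.commute)
qed

lemma linear_on_minus:
 assumes "vspace V" "vspace W" "linear_on V W T" "x <: V" "y <: V"
 shows "T (x \<ominus>\<^bsub>V\<^esub> y) = T x \<ominus>\<^bsub>W\<^esub> T y"
 using assms by (simp add: vspace.vs_minus linear_onD[OF assms(3)] vspace.vs_sc)

lemma linear_on_eq_span:
 assumes "vspace V" "vspace W" "linear_on V W S" "linear_on V W T" "B \<subseteq> carrier V"
  "\<And>x. x \<in> B ==> S x = T x" "x \<in> lin_span V B"
 shows "S x = T x"
proof -
 interpret V: vspace V by fact
 show ?thesis using assms(7,5)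
  by (induction rule: V.span_induct)
   (use assms in \<open>auto simp: linear_onD[OF assms(3)] linear_onD[OF assms(4)] linear_on_zero\<close>)
qed

lemma linear_on_span_into:
 assumes "vspace V" "vspace W" "linear_on V W T" "B \<subseteq> carrier V" "submodule U CC W"
  "\<And>x. x \<in> B ==> T x \<in> U" "x \<in> lin_span V B"
 shows "T x \<in> U"
proof -
 interpret V: vspace V by fact
 interpret W: vspace W by fact
 show ?thesis using assms(7,4)
  by (induction rule: V.span_induct)
   (use assms in \<open>auto simp: linear_onD[OF assms(3)] linear_on_zero W.sub_zero W.sub_add W.sub_smult\<close>)
qed

section \<open>Free spaces\<close>

lemma free_space_simps [simp]:
 "carrier (free_space G par) = {f. finite {i. f i \<noteq> 0} \<and> {i. f i \<noteq> 0} \<subseteq> G}"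
 "ring.zero (free_space G par) = (\<lambda>_. 0)"
 "ring.add (free_space G par) = (\<lambda>f g i. f i + g i)"
 "module.smult (free_space G par) = (\<lambda>c f i. c * f i)"
 "part (free_space G par) = (\<lambda>p. {f. finite {i. f i \<noteq> 0} \<and> {i. f i \<noteq> 0} \<subseteq> {i\<in>G. par i = p}})"
 by (simp_all add: free_space_def)

lemma fs_add: "finite {i. f i \<noteq> 0} \<and> {i. f i \<noteq> 0} \<subseteq> G ==> finite {i. g i \<noteq> 0} \<and> {i. g i \<noteq> 0} \<subseteq> G ==>
 finite {i. f i + g i \<noteq> (0::complex)} \<and> {i. f i + g i \<noteq> 0} \<subseteq> G"
proof -
 assume a: "finite {i. f i \<noteq> 0} \<and> {i. f i \<noteq> 0} \<subseteq> G" "finite {i. g i \<noteq> 0} \<and> {i. g i \<noteq> 0} \<subseteq> G"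
 have "{i. f i + g i \<noteq> 0} \<subseteq> {i. f i \<noteq> 0} \<union> {i. g i \<noteq> 0}" by auto
 thus ?thesis using a by (meson finite_UnI finite_subset le_sup_iff order_trans)
qed

lemma fs_smult: "finite {i. f i \<noteq> 0} \<and> {i. f i \<noteq> 0} \<subseteq> G ==>
 finite {i. c * f i \<noteq> (0::complex)} \<and> {i. c * f i \<noteq> 0} \<subseteq> G"
 by (cases "c = 0") auto

lemma vspace_free_space: "vspace (free_space G par)"
 by (rule vspaceI) (use fs_add fs_smult in \<open>auto simp: fun_eq_iff algebra_simps\<close>)

lemma sub_part_free_space: "submodule (part (free_space G par) p) CC (free_space G par)"
proof -
 interpret vspace "free_space G par" by (rule vspace_free_space)
 show ?thesis
 proof (rule subI)
  fix x y assume "x \<in> part (free_space G par) p" "y \<in> part (free_space G par) p"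
  thus "x \<oplus>\<^bsub>free_space G par\<^esub> y \<in> part (free_space G par) p"
   using fs_add[of x "{i \<in> G. par i = p}" y] by simp
 next
  fix x c assume "x \<in> part (free_space G par) p"
  thus "c \<odot>\<^bsub>free_space G par\<^esub> x \<in> part (free_space G par) p" using fs_smult[of x] by simp
 qed auto
qed

text \<open>Parities are added in the field of two elements; turning + into xor would take the ring
  laws away from the simplifier.\<close>

declare add_bit_eq_xor [simp del]

lemma bit_add_self [simp]: "(p::bit) + p = 0" by (cases p) auto
lemma bit_add_self2 [simp]: "(p::bit) + (p + q) = q" by (cases p; cases q) auto
lemma superspace_free_space: "superspace (free_space G par)"
proof -
 have "\<exists>x\<in>part (free_space G par) 0. \<exists>y\<in>part (free_space G par) 1. v = x \<oplus>\<^bsub>free_space G par\<^esub> y"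
  if "v <: (free_space G par)" for v
 proof (intro bexI)
  let ?x = "\<lambda>p i. if par i = p then v i else 0"
  have s: "{i. ?x p i \<noteq> 0} \<subseteq> {i. v i \<noteq> 0}" for p by auto
  have f: "finite {i. v i \<noteq> 0}" "{i. v i \<noteq> 0} \<subseteq> G" using that by auto
  have "finite {i. ?x p i \<noteq> 0}" for p using s f(1) by (rule finite_subset)
  moreover have "{i. ?x p i \<noteq> 0} \<subseteq> {i \<in> G. par i = p}" for p using f(2) by auto
  ultimately have p: "?x p \<in> part (free_space G par) p" for p unfolding free_space_simps by blast
  show "?x 0 \<in> part (free_space G par) 0" by (rule p)
  show "?x 1 \<in> part (free_space G par) 1" by (rule p)
  show "v = ?x 0 \<oplus>\<^bsub>free_space G par\<^esub> ?x 1" by (auto simp: fun_eq_iff)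
 qed
 moreover have "part (free_space G par) 0 \<inter> part (free_space G par) 1 = {\<zero>\<^bsub>free_space G par\<^esub>}"
  by (auto simp: fun_eq_iff) (metis (mono_tags, lifting) mem_Collect_eq subsetD zero_neq_one)
 ultimately show ?thesis
  unfolding superspace_def module_CC_iff
  by (intro conjI allI ballI vspace_free_space sub_part_free_space)
qed

lemma single_carrier: "i \<in> G ==> single i <: (free_space G par)"
 by (auto simp: single_def)

text \<open>Induction on a finite set A that contains the support: the value at one point of A is
  split off as a multiple of \<open>single\<close>.\<close>

lemma fs_induct [consumes 1, case_names single zero add smult]:
 assumes "finite {i. f i \<noteq> (0::complex)} \<and> {i. f i \<noteq> 0} \<subseteq> G"
  and s: "\<And>i. i \<in> G ==> P (single i)"
  and z: "P (\<lambda>_. 0)"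
  and a: "\<And>f g. finite {i. f i \<noteq> 0} \<and> {i. f i \<noteq> 0} \<subseteq> G ==> finite {i. g i \<noteq> 0} \<and> {i. g i \<noteq> 0} \<subseteq> G ==> P f ==> P g ==> P (\<lambda>i. f i + g i)"
  and m: "\<And>c f. finite {i. f i \<noteq> 0} \<and> {i. f i \<noteq> 0} \<subseteq> G ==> P f ==> P (\<lambda>i. c * f i)"
 shows "P f"
proof -
 have "P f" if "finite A" "A \<subseteq> G" "{i. f i \<noteq> 0} \<subseteq> A" for A f
  using that
 proof (induction A arbitrary: f)
  case empty
  hence "f = (\<lambda>_. 0)" by auto
  thus ?case using z by simp
 next
  case (insert j A)
  let ?g = "\<lambda>i. if i = j then 0 else f i"
  have fin: "finite {i. f i \<noteq> 0}" using insert.hyps(1) insert.prems(2)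
   by (meson finite.insertI finite_subset)
  have g: "{i. ?g i \<noteq> 0} \<subseteq> A" using insert.prems by auto
  have "A \<subseteq> G" using insert.prems by simp
  hence Pg: "P ?g" using g by (rule insert.IH)
  have fg: "finite {i. ?g i \<noteq> 0} \<and> {i. ?g i \<noteq> 0} \<subseteq> G"
   using g insert.hyps(1) insert.prems(1) by (meson finite_subset insert_subset order_trans)
  have sj: "finite {i. single j i \<noteq> 0} \<and> {i. single j i \<noteq> 0} \<subseteq> G"
   using insert.prems by (auto simp: single_def)
  have "P (\<lambda>i. f j * single j i)" using m[OF sj s] insert.prems by auto
  hence "P (\<lambda>i. ?g i + f j * single j i)"
   using a[OF fg fs_smult[OF sj] Pg] by simp
  moreover have "(\<lambda>i. ?g i + f j * single j i) = f" by (auto simp: single_def)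
  ultimately show ?case by simp
 qed
 thus ?thesis using assms(1) by blast
qed

lemma free_space_span: "carrier (free_space G par) = lin_span (free_space G par) (single ` G)"
proof -
 interpret vspace "free_space G par" by (rule vspace_free_space)
 have s: "single ` G \<subseteq> carrier (free_space G par)" by (rule image_subsetI, rule single_carrier)
 note sub = span_sub[OF s]
 have "f \<in> lin_span (free_space G par) (single ` G)" if "f <: (free_space G par)" for f
  using that[unfolded free_space_simps mem_Collect_eq]
 proof (induction rule: fs_induct)
  case (single i) thus ?case using span_superset by blast
 next
  case zero thus ?case using sub_zero[OF sub] by simp
 next
  case (add f g) thus ?case using sub_add[OF sub] by simp
 next
  case (smult c f) thus ?case using sub_smult[OF sub] by simp
 qed
 thus ?thesis using sub_carrier[OF sub] by blast
qed

text \<open>The linear extension of the assignment k -> h k. The sums in \<open>env_map\<close>, in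
  \<open>env_act\<close> and in the action on \<open>tensor\<close> are literally of this form, so
  one linearity lemma serves all of them.\<close>

definition lc :: "(complex, 'v, 'z) module_scheme => ('i => 'v) => ('i => complex) => 'v" where
 "lc V h f = (\<Oplus>\<^bsub>V\<^esub>k\<in>{k. f k \<noteq> 0}. f k \<odot>\<^bsub>V\<^esub> h k)"

context vspace
begin

lemma lc_superset:
 assumes "finite A" "{k. f k \<noteq> 0} \<subseteq> A" "A \<subseteq> G" "\<And>k. k \<in> G ==> h k <: V"
 shows "lc V h f = (\<Oplus>k\<in>A. f k \<odot> h k)"
 unfolding lc_def
 by (rule add.finprod_mono_neutral_cong_left) (use assms in auto)

lemma lc_linear:
 assumes "\<And>k. k \<in> G ==> h k <: V"
 shows "linear_on (free_space G par) V (lc V h)"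
 unfolding linear_on_def
proof (intro conjI ballI allI)
 fix f assume f: "f <: (free_space G par)"
 show "lc V h f <: V" unfolding lc_def
  by (rule finsum_closed) (use f assms in auto)
 fix g assume g: "g <: (free_space G par)"
 \<comment> \<open>\<open>lc\<close> sums over the exact support, which shrinks when values cancel;
   the three sums are therefore rewritten over the union of the two supports.\<close>
 let ?A = "{k. f k \<noteq> 0} \<union> {k. g k \<noteq> 0}"
 have A: "finite ?A" "?A \<subseteq> G" using f g by auto
 have cl: "\<And>k c. k \<in> ?A ==> c \<odot> h k <: V" using A assms by blast
 have "lc V h (\<lambda>i. f i + g i) = (\<Oplus>k\<in>?A. (f k + g k) \<odot> h k)"
  by (rule lc_superset[OF A(1) _ A(2) assms]) auto
 also have "\<dots> = (\<Oplus>k\<in>?A. f k \<odot> h k \<oplus> g k \<odot> h k)"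
  by (rule finsum_cong') (use A assms cl in \<open>auto simp: vs_ladd\<close>)
 also have "\<dots> = (\<Oplus>k\<in>?A. f k \<odot> h k) \<oplus> (\<Oplus>k\<in>?A. g k \<odot> h k)"
  by (rule finsum_addf) (use A assms in auto)
 also have "(\<Oplus>k\<in>?A. f k \<odot> h k) = lc V h f"
  by (rule lc_superset[OF A(1) _ A(2) assms, symmetric]) auto
 also have "(\<Oplus>k\<in>?A. g k \<odot> h k) = lc V h g"
  by (rule lc_superset[OF A(1) _ A(2) assms, symmetric]) auto
 finally show "lc V h (f \<oplus>\<^bsub>free_space G par\<^esub> g) = lc V h f \<oplus> lc V h g" by simp
next
 fix c f assume f: "f <: (free_space G par)"
 let ?A = "{k. f k \<noteq> 0}"
 have A: "finite ?A" "?A \<subseteq> G" using f by auto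
 have "lc V h (\<lambda>i. c * f i) = (\<Oplus>k\<in>?A. (c * f k) \<odot> h k)"
  by (rule lc_superset[OF A(1) _ A(2) assms]) auto
 also have "\<dots> = (\<Oplus>k\<in>?A. c \<odot> (f k \<odot> h k))"
  by (rule finsum_cong') (use A assms in \<open>auto simp: vs_assoc\<close>)
 also have "\<dots> = c \<odot> (\<Oplus>k\<in>?A. f k \<odot> h k)"
  using module.finsum_smult_ldistr[OF is_module, of ?A c "\<lambda>k. f k \<odot> h k", symmetric] A assms
  by (auto simp: Pi_iff subset_iff)
 finally show "lc V h (c \<odot>\<^bsub>free_space G par\<^esub> f) = c \<odot> lc V h f" by (simp add: lc_def)
qed

lemma lc_single [simp]: "h k <: V ==> lc V h (single k) = h k"
 by (simp add: lc_def single_def)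

end

lemma linear_on_eq_free:
 assumes "vspace W" "linear_on (free_space G par) W S" "linear_on (free_space G par) W T"
  "\<And>i. i \<in> G ==> S (single i) = T (single i)" "f <: (free_space G par)"
 shows "S f = T f"
proof (rule linear_on_eq_span[OF vspace_free_space assms(1-3), of "single ` G"])
 show "single ` G \<subseteq> carrier (free_space G par)" by (rule image_subsetI, rule single_carrier)
 show "f \<in> lin_span (free_space G par) (single ` G)" using assms(5) free_space_span by metis
qed (use assms in auto)

section \<open>Free associative algebras and evaluation\<close>

text \<open>The product of \<open>free_alg\<close> detached from alphabet and parity, so that one
  set of laws serves the Clifford-Weyl algebra and the enveloping algebra.\<close>

definition conv :: "('x list => complex) => ('x list => complex) => 'x list => complex" where
 "conv f g = (\<lambda>w. \<Sum>k\<le>length w. f (take k w) * g (drop k w))"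

lemma free_alg_simps [simp]:
 "carrier (free_alg G par) = carrier (free_space (lists G) (\<lambda>_. 0))"
 "ring.zero (free_alg G par) = (\<lambda>_. 0)"
 "ring.add (free_alg G par) = (\<lambda>f g i. f i + g i)"
 "module.smult (free_alg G par) = (\<lambda>c f i. c * f i)"
 "monoid.mult (free_alg G par) = conv"
 "monoid.one (free_alg G par) = single []"
 "part (free_alg G par) = part (free_space (lists G) (\<lambda>w. \<Sum>x\<leftarrow>w. par x))"
 by (simp_all add: free_alg_def free_space_def fun_eq_iff conv_def)

lemma linear_on_free_alg:
 "linear_on (free_alg G par) = linear_on (free_space (lists G) par')"
 "linear_on V (free_alg G par) = linear_on V (free_space (lists G) par')"
 by (simp_all add: linear_on_def fun_eq_iff)

lemma vspace_free_alg: "vspace (free_alg G par)"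
proof (rule vspaceI)
 fix x y assume "x <: (free_alg G par)" "y <: (free_alg G par)"
 thus "x \<oplus>\<^bsub>free_alg G par\<^esub> y <: (free_alg G par)"
  unfolding free_alg_simps free_space_simps mem_Collect_eq by (rule fs_add)
next
 fix x c assume "x <: (free_alg G par)"
 thus "c \<odot>\<^bsub>free_alg G par\<^esub> x <: (free_alg G par)"
  unfolding free_alg_simps free_space_simps mem_Collect_eq by (rule fs_smult)
qed (auto simp: fun_eq_iff algebra_simps)

lemma conv_add_left: "conv (\<lambda>i. f i + f' i) g = (\<lambda>i. conv f g i + conv f' g i)"
 by (simp add: conv_def algebra_simps sum.distrib fun_eq_iff)
lemma conv_add_right: "conv f (\<lambda>i. g i + g' i) = (\<lambda>i. conv f g i + conv f g' i)"
 by (simp add: conv_def algebra_simps sum.distrib fun_eq_iff)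
lemma conv_smult_left: "conv (\<lambda>i. c * f i) g = (\<lambda>i. c * conv f g i)"
 by (simp add: conv_def algebra_simps sum_distrib_left fun_eq_iff)
lemma conv_smult_right: "conv f (\<lambda>i. c * g i) = (\<lambda>i. c * conv f g i)"
 by (simp add: conv_def algebra_simps sum_distrib_left fun_eq_iff)

lemma conv_single: "conv (single u) (single v) = single (u @ v)"
proof
 fix w
 have e: "single u (take k w) * single v (drop k w) = (if k = length u \<and> w = u @ v then 1 else 0)"
  if "k \<le> length w" for k
  using that by (auto simp: single_def)
 have "conv (single u) (single v) w = (\<Sum>k\<le>length w. if k = length u \<and> w = u @ v then 1 else 0)"
  unfolding conv_def by (rule sum.cong) (use e in auto)
 also have "\<dots> = single (u @ v) w" by (auto simp: single_def)
 finally show "conv (single u) (single v) w = single (u @ v) w" .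
qed

lemma conv_carrier:
 assumes "f <: (free_alg G par)" "g <: (free_alg G par)"
 shows "conv f g <: (free_alg G par)"
proof -
 have "{w. conv f g w \<noteq> 0} \<subseteq> (\<lambda>(u, v). u @ v) ` ({u. f u \<noteq> 0} \<times> {v. g v \<noteq> 0})"
 proof
  fix w assume "w \<in> {w. conv f g w \<noteq> 0}"
  then obtain k where "f (take k w) * g (drop k w) \<noteq> 0"
   unfolding conv_def mem_Collect_eq by (meson sum.neutral)
  hence "w = (\<lambda>(u, v). u @ v) (take k w, drop k w)" "f (take k w) \<noteq> 0" "g (drop k w) \<noteq> 0" by auto
  thus "w \<in> (\<lambda>(u, v). u @ v) ` ({u. f u \<noteq> 0} \<times> {v. g v \<noteq> 0})" by blast
 qed
 moreover have "finite ((\<lambda>(u, v). u @ v) ` ({u. f u \<noteq> 0} \<times> {v. g v \<noteq> 0}))"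
  using assms by simp
 moreover have "(\<lambda>(u, v). u @ v) ` ({u. f u \<noteq> 0} \<times> {v. g v \<noteq> 0}) \<subseteq> lists G"
 proof -
  have uv: "u @ v \<in> lists G" if "f u \<noteq> 0" "g v \<noteq> 0" for u v
  proof -
   have "u \<in> lists G" "v \<in> lists G" using assms that by auto
   thus ?thesis by simp
  qed
  show ?thesis
  proof
   fix w assume "w \<in> (\<lambda>(u, v). u @ v) ` ({u. f u \<noteq> 0} \<times> {v. g v \<noteq> 0})"
   then obtain u v where "w = u @ v" "f u \<noteq> 0" "g v \<noteq> 0" by auto
   thus "w \<in> lists G" using uv by simp
  qed
 qed
 ultimately show ?thesis unfolding free_alg_simps free_space_simps mem_Collect_eq
  by (meson finite_subset order_trans)
qed

lemma conv_linear_left: "g <: (free_alg G par) ==> linear_on (free_alg G par) (free_alg G par) (\<lambda>f. conv f g)"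
 using conv_carrier[of _ G par g] by (simp add: linear_on_def conv_add_left conv_smult_left)
lemma conv_linear_right: "f <: (free_alg G par) ==> linear_on (free_alg G par) (free_alg G par) (\<lambda>g. conv f g)"
 using conv_carrier[of f G par] by (simp add: linear_on_def conv_add_right conv_smult_right)

lemma linear_on_eq_free_alg:
 assumes "vspace W" "linear_on (free_alg G par) W S" "linear_on (free_alg G par) W T"
  "\<And>w. w \<in> lists G ==> S (single w) = T (single w)" "f <: (free_alg G par)"
 shows "S f = T f"
 using linear_on_eq_free[OF assms(1), of "lists G" "\<lambda>_. 0" S T f] assms
 by (simp add: linear_on_free_alg[where par' = "\<lambda>_. 0"])

lemma single_carrier_alg: "w \<in> lists G ==> single w <: (free_alg G par)"
 using single_carrier[of w "lists G"] by simp

text \<open>Both sides are linear in each argument, so they are compared on words only, where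
  \<open>conv\<close> is concatenation.\<close>

lemma conv_assoc:
 assumes "f <: (free_alg G par)" "g <: (free_alg G par)" "h <: (free_alg G par)"
 shows "conv (conv f g) h = conv f (conv g h)"
proof (rule linear_on_eq_free_alg[OF vspace_free_alg, where f = f and S = "\<lambda>f. conv (conv f g) h" and T = "\<lambda>f. conv f (conv g h)"])
 show "linear_on (free_alg G par) (free_alg G par) (\<lambda>f. conv (conv f g) h)"
  by (rule linear_on_comp[OF conv_linear_left conv_linear_left]) fact+
 show "linear_on (free_alg G par) (free_alg G par) (\<lambda>f. conv f (conv g h))"
  by (rule conv_linear_left[OF conv_carrier]) fact+
 fix u assume u: "u \<in> lists G"
 hence su: "single u <: (free_alg G par)" by (rule single_carrier_alg)
 show "conv (conv (single u) g) h = conv (single u) (conv g h)"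
 proof (rule linear_on_eq_free_alg[OF vspace_free_alg, where f = g and S = "\<lambda>g. conv (conv (single u) g) h" and T = "\<lambda>g. conv (single u) (conv g h)"])
  show "linear_on (free_alg G par) (free_alg G par) (\<lambda>g. conv (conv (single u) g) h)"
   by (rule linear_on_comp[OF conv_linear_right conv_linear_left]) fact+
  show "linear_on (free_alg G par) (free_alg G par) (\<lambda>g. conv (single u) (conv g h))"
   by (rule linear_on_comp[OF conv_linear_left conv_linear_right]) fact+
  fix v assume v: "v \<in> lists G"
  hence sv: "single v <: (free_alg G par)" by (rule single_carrier_alg)
  show "conv (conv (single u) (single v)) h = conv (single u) (conv (single v) h)"
  proof (rule linear_on_eq_free_alg[OF vspace_free_alg, where f = h and S = "\<lambda>h. conv (conv (single u) (single v)) h" and T = "\<lambda>h. conv (single u) (conv (single v) h)"])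
   show "linear_on (free_alg G par) (free_alg G par) (conv (conv (single u) (single v)))"
    by (rule conv_linear_right[OF conv_carrier]) fact+
   show "linear_on (free_alg G par) (free_alg G par) (\<lambda>h. conv (single u) (conv (single v) h))"
    by (rule linear_on_comp[OF conv_linear_right conv_linear_right]) fact+
  qed (use assms in \<open>simp_all add: conv_single\<close>)
 qed fact
qed fact

lemma conv_one:
 assumes "f <: (free_alg G par)"
 shows "conv (single []) f = f" "conv f (single []) = f"
proof -
 have s: "single [] <: (free_alg G par)" by (rule single_carrier_alg) simp
 show "conv (single []) f = f"
  by (rule linear_on_eq_free_alg[OF vspace_free_alg conv_linear_right[OF s] linear_on_id])
   (use assms in \<open>auto simp: conv_single\<close>)
 show "conv f (single []) = f"
  by (rule linear_on_eq_free_alg[OF vspace_free_alg conv_linear_left[OF s] linear_on_id])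
   (use assms in \<open>auto simp: conv_single\<close>)
qed

lemma ring_free_alg: "ring (free_alg G par)"
proof (rule ringI)
 show "abelian_group (free_alg G par)" using vspace_free_alg vspace.axioms(1) by blast
 show "monoid (free_alg G par)"
 proof
  show "\<one>\<^bsub>free_alg G par\<^esub> <: (free_alg G par)"
   using single_carrier_alg[of "[]" G par] by simp
 qed (use conv_carrier[of _ G par] conv_assoc[of _ G par] conv_one[of _ G par] in \<open>auto simp del: free_alg_simps(1) free_space_simps\<close>)
qed (simp_all add: conv_add_left conv_add_right)

text \<open>The multiple c x is the product of c times the empty word with x, so an ideal absorbs
  scalars.\<close>

lemma ideal_submodule:
 assumes "ideal I (free_alg G par)" shows "submodule I CC (free_alg G par)"
proof -
 interpret ideal I "free_alg G par" by fact
 interpret vspace "free_alg G par" by (rule vspace_free_alg)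
 show ?thesis
 proof (rule subI)
  fix c x assume x: "x \<in> I"
  have xc: "x <: (free_alg G par)" using x a_subset by blast
  have s: "single [] <: (free_alg G par)" by (rule single_carrier_alg) simp
  have "(\<lambda>i. c * single [] i) <: (free_alg G par)" using vs_sc[OF s, of c] by simp
  hence "conv (\<lambda>i. c * single [] i) x \<in> I" using I_l_closed[OF x] by simp
  thus "c \<odot>\<^bsub>free_alg G par\<^esub> x \<in> I" by (simp add: conv_smult_left conv_one(1)[OF xc])
 next
  show "\<zero>\<^bsub>free_alg G par\<^esub> \<in> I" by (rule additive_subgroup.zero_closed[OF is_additive_subgroup])
 next
  fix x y assume "x \<in> I" "y \<in> I"
  thus "x \<oplus>\<^bsub>free_alg G par\<^esub> y \<in> I" by (rule additive_subgroup.a_closed[OF is_additive_subgroup])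
 qed (rule a_subset)
qed

text \<open>The noncommutative polynomial f with operators substituted for its letters, applied to
  v. Passage to a quotient by relations is left to \<open>ev_genideal\<close>.\<close>

abbreviation ev :: "(complex, 'v, 'z) module_scheme => ('x => 'v => 'v) => ('x list => complex) => 'v => 'v" where
 "ev V op f v \<equiv> lc V (\<lambda>w. foldr op w v) f"

locale operators = vspace V for V :: "(complex, 'v, 'z) module_scheme" (structure) +
 fixes G :: "'x set" and op :: "'x => 'v => 'v" and par :: "'x => bit"
 assumes op_linear: "x \<in> G ==> linear_on V V (op x)"
begin

abbreviation F where "F \<equiv> free_alg G par"

lemma word_linear: "w \<in> lists G ==> linear_on V V (foldr op w)"
proof (induction w)
 case Nil show ?case using linear_on_id[of V] by (simp add: id_def)
next
 case (Cons x w)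
 have e: "foldr op (x # w) = (\<lambda>v. op x (foldr op w v))" by (simp add: fun_eq_iff)
 have xw: "x \<in> G" "w \<in> lists G" using Cons(2) by auto
 show ?case unfolding e by (rule linear_on_comp[OF Cons(1)[OF xw(2)] op_linear[OF xw(1)]])
qed

lemma word_closed: "w \<in> lists G ==> v <: V ==> foldr op w v <: V"
 by (rule linear_onD(1)[OF word_linear])

lemma ev_linear: "v <: V ==> linear_on F V (\<lambda>f. ev V op f v)"
 using lc_linear[of "lists G" "\<lambda>w. foldr op w v" "\<lambda>_. 0"] word_closed[of _ v]
 by (simp add: linear_on_free_alg[where par' = "\<lambda>_. 0"])

lemma ev_single: "w \<in> lists G ==> v <: V ==> ev V op (single w) v = foldr op w v"
 using word_closed by simp

lemma ev_closed: "f <: F ==> v <: V ==> ev V op f v <: V"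
 by (rule linear_onD(1)[OF ev_linear])

lemma free_alg_induct [consumes 1, case_names single zero add smult]:
 assumes "f <: F" "\<And>w. w \<in> lists G ==> P (single w)" "P (\<lambda>_. 0)"
  "\<And>f g. f <: F ==> g <: F ==> P f ==> P g ==> P (\<lambda>i. f i + g i)"
  "\<And>c f. f <: F ==> P f ==> P (\<lambda>i. c * f i)"
 shows "P f"
 by (rule fs_induct[of f "lists G"]) (use assms in auto)

lemma ev_linear_right: "f <: F ==> linear_on V V (ev V op f)"
proof (induction rule: free_alg_induct)
 case (single w)
 thus ?case using word_linear[OF single] word_closed[OF single] by (simp add: linear_on_def)
next
 case zero
 have "linear_on V V (ev V op (\<lambda>_. 0)) = linear_on V V (\<lambda>_. \<zero>)" by (simp add: lc_def)
 thus ?case using linear_on_const_zero[OF vspace_axioms] by blast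
next
 case (add f g)
 have e: "ev V op (\<lambda>i. f i + g i) v = ev V op f v \<oplus> ev V op g v" if "v <: V" for v
  using linear_onD(2)[OF ev_linear[OF that]] add by simp
 show ?case using linear_on_add[OF vspace_axioms add(3,4)] e
  by (simp add: linear_on_def)
next
 case (smult c f)
 have e: "ev V op (\<lambda>i. c * f i) v = c \<odot> ev V op f v" if "v <: V" for v
  using linear_onD(3)[OF ev_linear[OF that]] smult by simp
 show ?case using linear_on_smult[OF vspace_axioms smult(2), of c] e
  by (simp add: linear_on_def)
qed

lemma ev_conv:
 assumes "f <: F" "g <: F" "v <: V"
 shows "ev V op (conv f g) v = ev V op f (ev V op g v)"
proof (rule linear_on_eq_free_alg[OF vspace_axioms, where f = f and S = "\<lambda>f. ev V op (conv f g) v" and T = "\<lambda>f. ev V op f (ev V op g v)"])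
 show "linear_on F V (\<lambda>f. ev V op (conv f g) v)"
  by (rule linear_on_comp[OF conv_linear_left ev_linear]) fact+
 show "linear_on F V (\<lambda>f. ev V op f (ev V op g v))"
  by (rule ev_linear[OF ev_closed]) fact+
 fix u assume u: "u \<in> lists G"
 hence su: "single u <: F" by (rule single_carrier_alg)
 show "ev V op (conv (single u) g) v = ev V op (single u) (ev V op g v)"
 proof (rule linear_on_eq_free_alg[OF vspace_axioms, where f = g and S = "\<lambda>g. ev V op (conv (single u) g) v" and T = "\<lambda>g. ev V op (single u) (ev V op g v)"])
  show "linear_on F V (\<lambda>g. ev V op (conv (single u) g) v)"
   by (rule linear_on_comp[OF conv_linear_right ev_linear]) fact+
  show "linear_on F V (\<lambda>g. ev V op (single u) (ev V op g v))"
   by (rule linear_on_comp[OF ev_linear ev_linear_right]) fact+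
  fix w assume w: "w \<in> lists G"
  thus "ev V op (conv (single u) (single w)) v = ev V op (single u) (ev V op (single w) v)"
   using u word_closed[OF _ assms(3)] word_closed[OF u] assms(3) by (simp add: conv_single)
 qed fact
qed fact

text \<open>By \<open>ev_conv\<close>: a product with the annihilating factor on the right vanishes
  because operators fix 0, with the annihilating factor on the left because operators map V into
  V.\<close>

lemma kernel_ideal: "ideal {f \<in> carrier F. \<forall>v\<in>carrier V. ev V op f v = \<zero>} F"
proof (rule idealI[OF ring_free_alg])
 let ?K = "{f \<in> carrier F. \<forall>v\<in>carrier V. ev V op f v = \<zero>}"
 interpret F: vspace F by (rule vspace_free_alg)
 have "submodule ?K CC F"
 proof (rule F.subI)
  show "\<zero>\<^bsub>F\<^esub> \<in> ?K" using F.zero_closed linear_on_zero[OF vspace_free_alg vspace_axioms ev_linear] by auto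
  fix x y assume "x \<in> ?K" "y \<in> ?K" thus "x \<oplus>\<^bsub>F\<^esub> y \<in> ?K"
   using F.a_closed[of x y] linear_onD(2)[OF ev_linear, of _ x y] by (auto simp del: free_alg_simps free_space_simps)
 next
  fix x c assume "x \<in> ?K" thus "c \<odot>\<^bsub>F\<^esub> x \<in> ?K"
   using F.vs_sc[of x c] linear_onD(3)[OF ev_linear, of _ x] by (auto simp del: free_alg_simps free_space_simps)
 qed auto
 thus "subgroup ?K (add_monoid F)" by (simp add: submodule_def)
 fix a x assume a: "a \<in> ?K" and x: "x <: F"
 have "ev V op (conv x a) v = \<zero>" if "v <: V" for v
  using ev_conv[OF x _ that, of a] a that
   linear_on_zero[OF vspace_axioms vspace_axioms ev_linear_right[OF x]] by (simp del: free_alg_simps(1))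
 thus "x \<otimes>\<^bsub>F\<^esub> a \<in> ?K" using a conv_carrier[OF x, of a] by (auto simp del: free_alg_simps(1))
 have "ev V op (conv a x) v = \<zero>" if "v <: V" for v
  using ev_conv[OF _ x that, of a] a ev_closed[OF x that] by (simp del: free_alg_simps(1))
 thus "a \<otimes>\<^bsub>F\<^esub> x \<in> ?K" using a conv_carrier[OF _ x, of a] by (auto simp del: free_alg_simps(1))
qed

lemma ev_genideal:
 assumes "rels \<subseteq> carrier F" "\<And>r v. r \<in> rels ==> v <: V ==> ev V op r v = \<zero>"
  "f \<in> Idl\<^bsub>F\<^esub> rels" "v <: V"
 shows "ev V op f v = \<zero>"
proof -
 interpret F: ring F by (rule ring_free_alg)
 have "Idl\<^bsub>F\<^esub> rels \<subseteq> {f \<in> carrier F. \<forall>v\<in>carrier V. ev V op f v = \<zero>}"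
  by (rule F.genideal_minimal[OF kernel_ideal]) (use assms in auto)
 thus ?thesis using assms(3,4) by blast
qed

end

section \<open>Quotients\<close>

context vspace
begin

lemma coset_mem:
 assumes "submodule W CC V" "x <: V"
 shows "y \<in> W +> x \<longleftrightarrow> y <: V \<and> y \<ominus> x \<in> W"
proof
 assume "y \<in> W +> x"
 then obtain w where w: "w \<in> W" "y = w \<oplus> x" by (auto simp: a_r_coset_def')
 moreover have "w <: V" using w sub_carrier assms by blast
 moreover have "(w \<oplus> x) \<ominus> x = w" using \<open>w <: V\<close> assms(2)
  by (simp add: a_minus_def a_assoc r_neg)
 ultimately show "y <: V \<and> y \<ominus> x \<in> W" using assms(2) by simp
next
 assume a: "y <: V \<and> y \<ominus> x \<in> W"
 have "y = (y \<ominus> x) \<oplus> x" using a assms(2) by (simp add: a_minus_def a_assoc l_neg)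
 thus "y \<in> W +> x" using a unfolding a_r_coset_def' by blast
qed

lemma minus_swap: "x <: V ==> y <: V ==> y \<ominus> x = (-1) \<odot> (x \<ominus> y)"
proof -
 assume a: "x <: V" "y <: V"
 have "(-1) \<odot> (x \<ominus> y) = (-1) \<odot> x \<oplus> ((-1) * (-1)) \<odot> y"
  using a by (simp only: vs_minus vs_radd vs_assoc vs_sc)
 thus ?thesis using a by (simp add: vs_minus a_comm)
qed

lemma coset_eq:
 assumes W: "submodule W CC V" "x <: V" "y <: V"
 shows "W +> x = W +> y \<longleftrightarrow> x \<ominus> y \<in> W"
proof
 have "x \<ominus> x = \<zero>" using assms by (simp add: a_minus_def r_neg)
 hence "x \<in> W +> x" using coset_mem[OF W(1,2), of x] assms sub_zero[OF W(1)] by simp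
 moreover assume "W +> x = W +> y"
 ultimately show "x \<ominus> y \<in> W" using coset_mem[OF W(1,3)] by blast
next
 have tr: "z \<ominus> b \<in> W" if "a \<ominus> b \<in> W" "z \<ominus> a \<in> W" "z <: V" "a <: V" "b <: V" for a b z
 proof -
  have "z \<ominus> b = (z \<ominus> a) \<oplus> (a \<ominus> b)" using that(3-5)
   by (simp add: a_minus_def a_assoc) (metis a_assoc a_inv_closed l_neg l_zero)
  thus ?thesis using sub_add[OF W(1) that(2,1)] by simp
 qed
 assume a: "x \<ominus> y \<in> W"
 hence b: "y \<ominus> x \<in> W" using minus_swap[OF W(2,3)] sub_smult[OF W(1) a] by simp
 show "W +> x = W +> y"
  using tr[OF a _ _ W(2,3)] tr[OF b _ _ W(3,2)] coset_mem[OF W(1,2)] coset_mem[OF W(1,3)] by blast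
qed

lemma coset_self: "submodule W CC V ==> x <: V ==> x \<in> W +> x"
 using coset_mem[of W x x] vs_eq_iff[of x x] sub_zero[of W] by simp

lemma coset_zero: "submodule W CC V ==> x <: V ==> W +> x = W \<longleftrightarrow> x \<in> W"
proof -
 assume a: "submodule W CC V" "x <: V"
 have "W +> \<zero> = W" using coset_mem[OF a(1) zero_closed] sub_carrier[OF a(1)] by (auto simp: vs_minus)
 thus ?thesis using coset_eq[OF a zero_closed] a(2) by (simp add: vs_minus)
qed

text \<open>Scalar multiplication in \<open>quot\<close> and the action on \<open>tensor\<close> are
  unions of cosets over all representatives. Such a union is one coset as soon as D respects the
  coset of x.\<close>

lemma coset_lift:
 assumes W: "submodule W CC V" and x: "x <: V" and D: "\<And>y. y <: V ==> D y <: V"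
  "\<And>y. y \<in> W +> x ==> D y \<ominus> D x \<in> W"
 shows "(\<Union>y\<in>W +> x. W +> D y) = W +> D x"
proof -
 have e: "W +> D y = W +> D x" if "y \<in> W +> x" for y
 proof -
  have "y <: V" using coset_mem[OF W x] that by simp
  thus ?thesis using D(2)[OF that] coset_eq[OF W D(1) D(1)[OF x]] by simp
 qed
 have ne: "W +> x \<noteq> {}" using coset_self[OF W x] by blast
 show ?thesis by (rule SUP_eq_const[OF ne e])
qed

lemma coset_add:
 assumes W: "submodule W CC V" and x: "x <: V" and y: "y <: V"
 shows "(W +> x) <+> (W +> y) = W +> (x \<oplus> y)"
proof -
 have "submodule W CC V" by fact
 hence s: "additive_subgroup W V" by (simp add: submodule_def additive_subgroup_def)
 interpret abelian_subgroup W V by (rule abelian_subgroupI3[OF s abelian_group_axioms])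
 show ?thesis by (rule a_rcos_sum[OF x y])
qed

end

lemma quot_simps [simp]:
 "carrier (quot V W) = (\<lambda>x. W +>\<^bsub>V\<^esub> x) ` carrier V"
 "ring.zero (quot V W) = W"
 "ring.add (quot V W) = set_add V"
 "module.smult (quot V W) = (\<lambda>c Z. \<Union>x\<in>Z. W +>\<^bsub>V\<^esub> (c \<odot>\<^bsub>V\<^esub> x))"
 "monoid.mult (quot V W) = rcoset_mult V W"
 "monoid.one (quot V W) = W +>\<^bsub>V\<^esub> \<one>\<^bsub>V\<^esub>"
 "part (quot V W) = (\<lambda>p. (\<lambda>x. W +>\<^bsub>V\<^esub> x) ` part V p)"
 by (auto simp: quot_def A_RCOSETS_def')

lemma quot_smult:
 assumes "vspace V" and W: "submodule W CC V" and x: "x <: V"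
 shows "c \<odot>\<^bsub>quot V W\<^esub> (W +>\<^bsub>V\<^esub> x) = W +>\<^bsub>V\<^esub> (c \<odot>\<^bsub>V\<^esub> x)"
proof -
 interpret vspace V by fact
 have "c \<odot>\<^bsub>V\<^esub> y \<ominus>\<^bsub>V\<^esub> c \<odot>\<^bsub>V\<^esub> x \<in> W" if "y \<in> W +>\<^bsub>V\<^esub> x" for y
 proof -
  have y: "y <: V" "y \<ominus>\<^bsub>V\<^esub> x \<in> W" using coset_mem[OF W x] that by auto
  have "c \<odot>\<^bsub>V\<^esub> y \<ominus>\<^bsub>V\<^esub> c \<odot>\<^bsub>V\<^esub> x = c \<odot>\<^bsub>V\<^esub> (y \<ominus>\<^bsub>V\<^esub> x)"
   using x y(1) by (simp add: vs_minus vs_radd vs_assoc[symmetric] mult.commute)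
  thus ?thesis using sub_smult[OF W y(2)] by simp
 qed
 thus ?thesis using coset_lift[OF W x, of "\<lambda>y. c \<odot>\<^bsub>V\<^esub> y"] by simp
qed

lemma quot_add:
 assumes "vspace V" and W: "submodule W CC V" and x: "x <: V" "y <: V"
 shows "(W +>\<^bsub>V\<^esub> x) \<oplus>\<^bsub>quot V W\<^esub> (W +>\<^bsub>V\<^esub> y) = W +>\<^bsub>V\<^esub> (x \<oplus>\<^bsub>V\<^esub> y)"
 using vspace.coset_add[OF assms] by simp

lemma vspace_quot:
 assumes "vspace V" and W: "submodule W CC V"
 shows "vspace (quot V W)"
proof -
 interpret V: vspace V by fact
 note add = quot_add[OF assms] and sm = quot_smult[OF assms]
 have z: "W = W +>\<^bsub>V\<^esub> \<zero>\<^bsub>V\<^esub>" using V.coset_zero[OF W V.zero_closed] V.sub_zero[OF W] by simp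
 have c: "carrier (quot V W) = (\<lambda>x. W +>\<^bsub>V\<^esub> x) ` carrier V" and z': "\<zero>\<^bsub>quot V W\<^esub> = W +>\<^bsub>V\<^esub> \<zero>\<^bsub>V\<^esub>" using z by simp_all
 have ex: "\<And>A th. A <: (quot V W) ==> (\<And>x. x <: V ==> A = W +>\<^bsub>V\<^esub> x ==> th) ==> th"
  unfolding c by blast
 have cl: "\<And>x. x <: V ==> W +>\<^bsub>V\<^esub> x <: (quot V W)"
  unfolding c by blast
 show ?thesis
 proof (rule vspaceI)
  show "\<zero>\<^bsub>quot V W\<^esub> <: (quot V W)" unfolding z' by (rule cl) simp
 next
  fix A assume "A <: (quot V W)"
  then obtain x where x: "x <: V" "A = W +>\<^bsub>V\<^esub> x" by (rule ex)
  show "\<zero>\<^bsub>quot V W\<^esub> \<oplus>\<^bsub>quot V W\<^esub> A = A"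
   unfolding z' x(2) using x(1) by (simp only: add V.zero_closed V.l_zero)
  show "1 \<odot>\<^bsub>quot V W\<^esub> A = A"
   unfolding z' x(2) using x(1) by (simp only: sm V.vs_one)
  have "(- 1) \<odot>\<^bsub>V\<^esub> x \<oplus>\<^bsub>V\<^esub> x = \<zero>\<^bsub>V\<^esub>" using x(1) V.vs_neg[OF x(1)] V.l_neg[OF x(1)] by simp
  thus "(- 1) \<odot>\<^bsub>quot V W\<^esub> A \<oplus>\<^bsub>quot V W\<^esub> A = \<zero>\<^bsub>quot V W\<^esub>"
   unfolding z' x(2) using x(1) by (simp only: sm add V.vs_sc)
  fix c d :: complex
  show "c \<odot>\<^bsub>quot V W\<^esub> A <: (quot V W)"
   unfolding x(2) sm[OF x(1)] by (rule cl[OF V.vs_sc[OF x(1)]])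
  show "(c + d) \<odot>\<^bsub>quot V W\<^esub> A = c \<odot>\<^bsub>quot V W\<^esub> A \<oplus>\<^bsub>quot V W\<^esub> d \<odot>\<^bsub>quot V W\<^esub> A"
   unfolding x(2) using x(1) by (simp only: sm add V.vs_sc V.vs_ladd)
  show "(c * d) \<odot>\<^bsub>quot V W\<^esub> A = c \<odot>\<^bsub>quot V W\<^esub> (d \<odot>\<^bsub>quot V W\<^esub> A)"
   unfolding x(2) using x(1) by (simp only: sm add V.vs_sc V.vs_assoc)
  fix Y assume "Y <: (quot V W)"
  then obtain y where y: "y <: V" "Y = W +>\<^bsub>V\<^esub> y" by (rule ex)
  show "A \<oplus>\<^bsub>quot V W\<^esub> Y <: (quot V W)"
   unfolding x(2) y(2) add[OF x(1) y(1)] by (rule cl[OF V.a_closed[OF x(1) y(1)]])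
  show "A \<oplus>\<^bsub>quot V W\<^esub> Y = Y \<oplus>\<^bsub>quot V W\<^esub> A"
   unfolding x(2) y(2) add[OF x(1) y(1)] add[OF y(1) x(1)] using x(1) y(1) by (simp only: V.a_comm)
  show "c \<odot>\<^bsub>quot V W\<^esub> (A \<oplus>\<^bsub>quot V W\<^esub> Y) = c \<odot>\<^bsub>quot V W\<^esub> A \<oplus>\<^bsub>quot V W\<^esub> c \<odot>\<^bsub>quot V W\<^esub> Y"
   unfolding x(2) y(2) using x(1) y(1) by (simp only: sm add V.a_closed V.vs_sc V.vs_radd)
  fix Z assume "Z <: (quot V W)"
  then obtain z where z: "z <: V" "Z = W +>\<^bsub>V\<^esub> z" by (rule ex)
  show "(A \<oplus>\<^bsub>quot V W\<^esub> Y) \<oplus>\<^bsub>quot V W\<^esub> Z = A \<oplus>\<^bsub>quot V W\<^esub> (Y \<oplus>\<^bsub>quot V W\<^esub> Z)"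
   unfolding x(2) y(2) z(2) using x(1) y(1) z(1) by (simp only: add V.a_closed V.a_assoc)
 qed
qed

lemma linear_on_proj:
 assumes "vspace V" and W: "submodule W CC V"
 shows "linear_on V (quot V W) (\<lambda>x. W +>\<^bsub>V\<^esub> x)"
 unfolding linear_on_def using quot_add[OF assms] quot_smult[OF assms] by (auto simp del: quot_simps(2-4))

section \<open>The Clifford-Weyl superalgebra\<close>

lemma (in vspace) span_in: "x \<in> S ==> x \<in> lin_span V S"
 using span_superset[of S] by auto

lemma linear_image_span:
 assumes V: "vspace V" and W: "vspace W" and T: "linear_on V W T" and B: "B \<subseteq> carrier V"
 shows "T ` lin_span V B = lin_span W (T ` B)"
proof
 interpret V: vspace V by fact
 interpret W: vspace W by fact
 have TB: "T ` B \<subseteq> carrier W" using linear_onD(1)[OF T] B by blast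
 show "T ` lin_span V B \<subseteq> lin_span W (T ` B)"
 proof (rule image_subsetI)
  fix x assume "x \<in> lin_span V B"
  thus "T x \<in> lin_span W (T ` B)"
   by (rule linear_on_span_into[OF V W T B W.span_sub[OF TB], rotated]) (use W.span_superset in blast)
 qed
 have sb: "submodule (lin_span V B) CC V" by (rule V.span_sub[OF B])
 have "submodule (T ` lin_span V B) CC W"
 proof (rule W.subI)
  show "T ` lin_span V B \<subseteq> carrier W" using linear_onD(1)[OF T] V.sub_carrier[OF sb] by blast
  show "\<zero>\<^bsub>W\<^esub> \<in> T ` lin_span V B" using linear_on_zero[OF V W T] V.sub_zero[OF sb] by (metis imageI)
 next
  fix x y assume "x \<in> T ` lin_span V B" "y \<in> T ` lin_span V B"
  then obtain x' y' where xy: "x = T x'" "y = T y'" "x' \<in> lin_span V B" "y' \<in> lin_span V B" by blast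
  have "x \<oplus>\<^bsub>W\<^esub> y = T (x' \<oplus>\<^bsub>V\<^esub> y')"
   using linear_onD(2)[OF T] V.sub_carrier[OF sb] xy by simp
  thus "x \<oplus>\<^bsub>W\<^esub> y \<in> T ` lin_span V B" using V.sub_add[OF sb xy(3,4)] by blast
 next
  fix c x assume "x \<in> T ` lin_span V B"
  then obtain x' where xy: "x = T x'" "x' \<in> lin_span V B" by blast
  have "c \<odot>\<^bsub>W\<^esub> x = T (c \<odot>\<^bsub>V\<^esub> x')"
   using linear_onD(3)[OF T] V.sub_carrier[OF sb] xy by simp
  thus "c \<odot>\<^bsub>W\<^esub> x \<in> T ` lin_span V B" using V.sub_smult[OF sb xy(2)] by blast
 qed
 moreover have "T ` B \<subseteq> T ` lin_span V B" using V.span_superset by blast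
 ultimately show "lin_span W (T ` B) \<subseteq> T ` lin_span V B" by (rule W.span_minimal)
qed

section \<open>Words in the letters, their parities, signs and weights\<close>

definition letters :: "enat => enat => gen set" where
 "letters a b = {g. idx g \<in> Idx a b}"

definition wpar :: "gen list => bit" where
 "wpar w = (\<Sum>x\<leftarrow>w. gen_par x)"

lemma wpar_simps [simp]: "wpar [] = 0" "wpar (g # w) = gen_par g + wpar w" "wpar (u @ v) = wpar u + wpar v"
 by (simp_all add: wpar_def)

definition gsign :: "gen => gen => complex" where
 "gsign g h = sign (gen_par g) (gen_par h)"

text \<open>The scalar {g, h}: it is 1 for the pair \<open>Eta i\<close>, \<open>Xi i\<close>, and
  for the pair \<open>Xi i\<close>, \<open>Eta i\<close> the sign forced by {u, v} = (-1)^(pq) {v,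
  u}.\<close>

definition kap :: "gen => gen => complex" where
 "kap g h = (if idx g = idx h \<and> g \<noteq> h then (case g of Eta i => 1 | Xi i => gsign g h) else 0)"

definition opp :: "gen => gen" where
 "opp g = (case g of Xi i => Eta i | Eta i => Xi i)"

definition wrd :: "enat => enat => gen list => cl" where
 "wrd a b w = cl_proj a b (single w)"

text \<open>The amount by which the letter g moves the eigenvalue of u_i; \<open>u_letter\<close>
  justifies this reading.\<close>

definition sh :: "int => gen => int" where
 "sh i g = (if idx g = i then gen_deg g else 0)"

definition shift :: "int => gen list => int" where
 "shift i w = (\<Sum>g\<leftarrow>w. sh i g)"

lemma shift_simps [simp]: "shift i [] = 0" "shift i (g # w) = sh i g + shift i w" "shift i (u @ v) = shift i u + shift i v"
 by (simp_all add: shift_def)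

lemma sign_cases [simp]: "sign 0 q = 1" "sign p 0 = 1" "sign 1 1 = -1"
 by (simp_all add: sign_def)
lemma sign_sq [simp]: "sign p q * sign p q = 1" by (simp add: sign_def)
lemma sign_sym: "sign p q = sign q p" by (auto simp: sign_def)
lemma sign_add_left: "sign (p + p') q = sign p q * sign p' q"
 by (cases p; cases p'; cases q) auto
lemma sign_add_right: "sign q (p + p') = sign q p * sign q p'"
 by (cases p; cases p'; cases q) auto
lemma gsign_sym: "gsign g h = gsign h g" by (simp add: gsign_def sign_sym)
lemma gsign_sq [simp]: "gsign g h * gsign g h = 1" by (simp add: gsign_def)

lemma gsign_cases: "gsign g h = 1 \<or> gsign g h = -1" by (simp add: gsign_def sign_def)

text \<open>Each letter has degree 1 or -1, so even degree means even length, and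
  \<open>Cl_ev\<close> becomes the span of the words of even length.\<close>

lemma even_gen_deg: "even (\<Sum>g\<leftarrow>w. gen_deg g) \<longleftrightarrow> even (length w)"
proof (induction w)
 case (Cons g w) thus ?case by (cases g) auto
qed simp

lemma kap_sym: "kap h g = gsign g h * kap g h"
 by (cases g; cases h) (auto simp: kap_def gsign_sym gsign_def gen_par_def)

context
 fixes a b :: enat
begin

private abbreviation (input) "LL \<equiv> letters a b"
private abbreviation (input) "FF \<equiv> cl_free a b"
private abbreviation (input) "II \<equiv> cl_ideal a b"
private abbreviation (input) "C \<equiv> Cl a b"
private abbreviation (input) "W \<equiv> wrd a b"

lemma cl_free_eq: "FF = free_alg LL gen_par"
 by (simp add: cl_free_def letters_def)

lemma vspace_cl_free: "vspace FF" by (simp only: cl_free_eq vspace_free_alg)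
lemma ring_cl_free: "ring FF" by (simp only: cl_free_eq ring_free_alg)

lemma cl_free_ops:
 "ring.add FF = (\<lambda>f g i. f i + g i)" "module.smult FF = (\<lambda>c f i. c * f i)" "monoid.mult FF = conv"
 "monoid.one FF = single []" "ring.zero FF = (\<lambda>_. 0)"
 by (simp_all add: cl_free_eq)

lemma single_cl_free: "w \<in> lists LL ==> single w <: FF"
 unfolding cl_free_eq by (rule single_carrier_alg)

lemma cl_free_minus: "f <: FF ==> g <: FF ==> f \<ominus>\<^bsub>FF\<^esub> g = (\<lambda>i. f i - g i)"
 using vspace.vs_minus[OF vspace_cl_free] by (simp add: cl_free_ops)

lemma gen_anti_eq: "gen_anti a b g h = (\<lambda>w. single [g, h] w + gsign g h * single [h, g] w)"
 by (simp add: gen_anti_def anti_def cl_free_ops conv_single gsign_def)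

lemma gen_anti_carrier: "g \<in> LL ==> h \<in> LL ==> gen_anti a b g h <: FF"
proof -
 assume g: "g \<in> LL" "h \<in> LL"
 interpret vspace FF by (rule vspace_cl_free)
 have "single [g, h] \<oplus>\<^bsub>FF\<^esub> (gsign g h \<odot>\<^bsub>FF\<^esub> single [h, g]) <: FF"
  by (intro a_closed vs_sc single_cl_free) (use g in auto)
 thus ?thesis by (simp add: gen_anti_eq cl_free_ops)
qed

text \<open>One uniform formula for every ordered pair of letters. \<open>cl_rels\<close> lists
  three of the four shapes; the pair \<open>Xi\<close>, \<open>Eta\<close> is recovered in
  \<open>W_rel\<close>.\<close>

definition gen_rel :: "gen => gen => gen list => complex" where
 "gen_rel g h = (\<lambda>w. single [g, h] w + gsign g h * single [h, g] w - kap g h * single [] w)"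

lemma cl_rels_eq: "cl_rels a b =
 {gen_rel (Xi i) (Xi j) | i j. i \<in> Idx a b \<and> j \<in> Idx a b} \<union>
 {gen_rel (Eta i) (Eta j) | i j. i \<in> Idx a b \<and> j \<in> Idx a b} \<union>
 {gen_rel (Eta i) (Xi j) | i j. i \<in> Idx a b \<and> j \<in> Idx a b}"
proof -
 interpret vspace FF by (rule vspace_cl_free)
 have 1: "gen_anti a b (Xi i) (Xi j) = gen_rel (Xi i) (Xi j)" for i j
  by (simp add: gen_anti_eq gen_rel_def kap_def)
 have 2: "gen_anti a b (Eta i) (Eta j) = gen_rel (Eta i) (Eta j)" for i j
  by (simp add: gen_anti_eq gen_rel_def kap_def)
 have 3: "gen_anti a b (Eta i) (Xi j) \<ominus>\<^bsub>FF\<^esub> ((if i = j then 1 else 0) \<odot>\<^bsub>FF\<^esub> \<one>\<^bsub>FF\<^esub>) = gen_rel (Eta i) (Xi j)"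
  if "i \<in> Idx a b" "j \<in> Idx a b" for i j
 proof -
  have "gen_anti a b (Eta i) (Xi j) <: FF" by (rule gen_anti_carrier) (use that in \<open>auto simp: letters_def\<close>)
  moreover have "((if i = j then 1 else 0) \<odot>\<^bsub>FF\<^esub> \<one>\<^bsub>FF\<^esub>) <: FF"
   by (rule vs_sc) (use single_cl_free[of "[]"] in \<open>simp add: cl_free_ops\<close>)
  ultimately show ?thesis
   by (simp add: cl_free_minus) (simp add: cl_free_ops gen_anti_eq gen_rel_def kap_def fun_eq_iff)
 qed
 have 4: "{gen_anti a b (Eta i) (Xi j) \<ominus>\<^bsub>FF\<^esub> ((if i = j then 1 else 0) \<odot>\<^bsub>FF\<^esub> \<one>\<^bsub>FF\<^esub>)
   | i j. i \<in> Idx a b \<and> j \<in> Idx a b} = {gen_rel (Eta i) (Xi j) | i j. i \<in> Idx a b \<and> j \<in> Idx a b}"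
  (is "?A = ?B")
 proof
  show "?A \<subseteq> ?B"
  proof
   fix r assume "r \<in> ?A"
   then obtain i j where "r = gen_anti a b (Eta i) (Xi j) \<ominus>\<^bsub>FF\<^esub> ((if i = j then 1 else 0) \<odot>\<^bsub>FF\<^esub> \<one>\<^bsub>FF\<^esub>)"
    "i \<in> Idx a b" "j \<in> Idx a b" by blast
   thus "r \<in> ?B" using 3[of i j] by (intro CollectI exI[of _ i] exI[of _ j]) simp
  qed
  show "?B \<subseteq> ?A"
  proof
   fix r assume "r \<in> ?B"
   then obtain i j where "r = gen_rel (Eta i) (Xi j)" "i \<in> Idx a b" "j \<in> Idx a b" by blast
   thus "r \<in> ?A" using 3[of i j] by (intro CollectI exI[of _ i] exI[of _ j]) simp
  qed
 qed
 show ?thesis unfolding cl_rels_def 1 2 4 ..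
qed

lemma gen_rel_carrier: "g \<in> LL ==> h \<in> LL ==> gen_rel g h <: FF"
proof -
 assume g: "g \<in> LL" "h \<in> LL"
 interpret vspace FF by (rule vspace_cl_free)
 have "(single [g, h] \<oplus>\<^bsub>FF\<^esub> (gsign g h \<odot>\<^bsub>FF\<^esub> single [h, g])) \<oplus>\<^bsub>FF\<^esub> ((- kap g h) \<odot>\<^bsub>FF\<^esub> single []) <: FF"
  by (intro a_closed vs_sc single_cl_free) (use g in auto)
 thus ?thesis by (simp add: gen_rel_def cl_free_ops)
qed

lemma cl_rels_carrier: "cl_rels a b \<subseteq> carrier FF"
 unfolding cl_rels_eq using gen_rel_carrier by (fastforce simp: letters_def)

lemma ideal_cl: "ideal II FF"
 unfolding cl_ideal_def by (rule ring.genideal_ideal[OF ring_cl_free cl_rels_carrier])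

lemma sub_cl_ideal: "submodule II CC FF"
 using ideal_cl unfolding cl_free_eq by (rule ideal_submodule)

lemma cl_rels_in: "cl_rels a b \<subseteq> II"
 unfolding cl_ideal_def by (rule ring.genideal_self[OF ring_cl_free cl_rels_carrier])

lemma vspace_Cl: "vspace C"
 unfolding Cl_def by (rule vspace_quot[OF vspace_cl_free sub_cl_ideal])

lemma proj_linear: "linear_on FF C (cl_proj a b)"
 using linear_on_proj[OF vspace_cl_free sub_cl_ideal] by (simp add: Cl_def cl_proj_def[abs_def])

lemma Cl_carrier: "carrier C = cl_proj a b ` carrier FF"
 by (simp add: Cl_def cl_proj_def[abs_def])

lemma Cl_part: "part C p = cl_proj a b ` part FF p"
 by (simp add: Cl_def cl_proj_def[abs_def])

lemma proj_eq: "f <: FF ==> g <: FF ==> cl_proj a b f = cl_proj a b g \<longleftrightarrow> f \<ominus>\<^bsub>FF\<^esub> g \<in> II"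
 unfolding cl_proj_def by (rule vspace.coset_eq[OF vspace_cl_free sub_cl_ideal])

lemma proj_zero: "f <: FF ==> cl_proj a b f = \<zero>\<^bsub>C\<^esub> \<longleftrightarrow> f \<in> II"
 unfolding cl_proj_def Cl_def quot_simps by (rule vspace.coset_zero[OF vspace_cl_free sub_cl_ideal])

lemma proj_mult: "f <: FF ==> g <: FF ==> cl_proj a b f \<otimes>\<^bsub>C\<^esub> cl_proj a b g = cl_proj a b (conv f g)"
 unfolding Cl_def quot_simps cl_proj_def
 using ideal.rcoset_mult_add[OF ideal_cl, of f g] by (simp add: cl_free_ops)

lemma Cl_one: "\<one>\<^bsub>C\<^esub> = W []"
 by (simp add: Cl_def cl_proj_def wrd_def cl_free_ops)

lemma W_carrier: "w \<in> lists LL ==> W w <: C"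
 unfolding wrd_def Cl_carrier using single_cl_free by blast

lemma W_mult: "u \<in> lists LL ==> v \<in> lists LL ==> W u \<otimes>\<^bsub>C\<^esub> W v = W (u @ v)"
 by (simp add: wrd_def proj_mult single_cl_free conv_single)

text \<open>Applied to three sets of words, this describes \<open>Cl\<close>, its two parts and
  \<open>Cl_ev\<close> as spans.\<close>

lemma proj_span:
 assumes "S \<subseteq> lists LL"
 shows "cl_proj a b ` carrier (free_space S par) = lin_span C (W ` S)"
proof -
 have sc: "carrier (free_space S par) \<subseteq> carrier FF" using assms by (auto simp: cl_free_eq)
 have "linear_on (free_space S par) C (cl_proj a b)"
  using proj_linear sc unfolding linear_on_def by (simp add: cl_free_ops subset_iff)
 from linear_image_span[OF vspace_free_space vspace_Cl this, of "single ` S"]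
 have "cl_proj a b ` lin_span (free_space S par) (single ` S) = lin_span C (cl_proj a b ` single ` S)"
  by (meson image_subsetI single_carrier)
 thus ?thesis by (simp add: free_space_span[symmetric] image_image wrd_def del: free_space_simps)
qed

lemma Cl_span: "carrier C = lin_span C (W ` lists LL)"
 using proj_span[of "lists LL" "\<lambda>_. 0"] by (simp add: Cl_carrier cl_free_eq)

lemma Cl_part_span: "part C p = lin_span C (W ` {w \<in> lists LL. wpar w = p})"
 using proj_span[of "{w \<in> lists LL. wpar w = p}" "\<lambda>_. 0"] by (simp add: Cl_part cl_free_eq wpar_def)

lemma Cl_ev_span: "carrier (Cl_ev a b) = lin_span C (W ` {w \<in> lists LL. even (length w)})"
proof -
 have "{f \<in> carrier FF. \<forall>w. f w \<noteq> 0 \<longrightarrow> even (\<Sum>g\<leftarrow>w. gen_deg g)} =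
  carrier (free_space {w \<in> lists LL. even (length w)} (\<lambda>_. 0))"
  unfolding even_gen_deg by (auto simp: cl_free_eq)
 thus ?thesis using proj_span[of "{w \<in> lists LL. even (length w)}" "\<lambda>_. 0"]
  by (simp add: Cl_ev_def subsp_def)
qed

lemma W_sub: "W ` {w \<in> lists LL. P w} \<subseteq> carrier C" using W_carrier by blast
lemma W_sub': "W ` lists LL \<subseteq> carrier C" using W_carrier by blast

lemma W_part: "w \<in> lists LL ==> W w \<in> part C (wpar w)"
 unfolding Cl_part_span by (rule vspace.span_in[OF vspace_Cl]) simp

lemma Cl_induct [consumes 1, case_names word add smult]:
 assumes "x <: C" "\<And>w. w \<in> lists LL ==> P (W w)"
  "\<And>x y. x <: C ==> y <: C ==> P x ==> P y ==> P (x \<oplus>\<^bsub>C\<^esub> y)"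
  "\<And>c x. x <: C ==> P x ==> P (c \<odot>\<^bsub>C\<^esub> x)"
 shows "P x"
proof -
 interpret vspace C by (rule vspace_Cl)
 have "P (0 \<odot>\<^bsub>C\<^esub> W [])" by (rule assms(4)[OF W_carrier assms(2)]) simp_all
 hence z: "P \<zero>\<^bsub>C\<^esub>" using W_carrier[of "[]"] by simp
 show ?thesis
  using assms(1)[unfolded Cl_span] W_sub' by (induction rule: span_induct) (use assms z in auto)
qed

lemma Cl_mult_closed: "x <: C ==> y <: C ==> x \<otimes>\<^bsub>C\<^esub> y <: C"
proof -
 assume "x <: C" "y <: C"
 then obtain f g where f: "f <: FF" "g <: FF" "x = cl_proj a b f" "y = cl_proj a b g"
  unfolding Cl_carrier by blast
 have "conv f g <: FF" using f unfolding cl_free_eq by (auto intro: conv_carrier simp del: free_alg_simps)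
 thus ?thesis unfolding f(3,4) proj_mult[OF f(1,2)] Cl_carrier by (rule imageI)
qed

lemma Cl_mult_left: "y <: C ==> linear_on C C (\<lambda>x. x \<otimes>\<^bsub>C\<^esub> y)"
proof -
 assume "y <: C"
 then obtain g where g: "g <: FF" "y = cl_proj a b g" unfolding Cl_carrier by blast
 interpret F: vspace FF by (rule vspace_cl_free)
 note pl = linear_onD[OF proj_linear]
 show ?thesis unfolding linear_on_def
 proof (intro conjI ballI allI)
  fix x assume x: "x <: C"
  show "x \<otimes>\<^bsub>C\<^esub> y <: C" by (rule Cl_mult_closed) fact+
  obtain f where f: "f <: FF" "x = cl_proj a b f" using x unfolding Cl_carrier by blast
  have cc: "conv h g <: FF" if "h <: FF" for h
   using that g(1) unfolding cl_free_eq by (rule conv_carrier)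
  show "(c \<odot>\<^bsub>C\<^esub> x) \<otimes>\<^bsub>C\<^esub> y = c \<odot>\<^bsub>C\<^esub> (x \<otimes>\<^bsub>C\<^esub> y)" for c
   unfolding f g pl(3)[OF f(1), symmetric] proj_mult[OF F.vs_sc[OF f(1)] g(1)] proj_mult[OF f(1) g(1)] pl(3)[OF cc[OF f(1)], symmetric]
   by (simp add: cl_free_ops conv_smult_left)
  fix x' assume x: "x' <: C"
  obtain f' where f': "f' <: FF" "x' = cl_proj a b f'" using x unfolding Cl_carrier by blast
  show "(x \<oplus>\<^bsub>C\<^esub> x') \<otimes>\<^bsub>C\<^esub> y = x \<otimes>\<^bsub>C\<^esub> y \<oplus>\<^bsub>C\<^esub> x' \<otimes>\<^bsub>C\<^esub> y"
   unfolding f f' g pl(2)[OF f(1) f'(1), symmetric] proj_mult[OF F.a_closed[OF f(1) f'(1)] g(1)]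
    proj_mult[OF f(1) g(1)] proj_mult[OF f'(1) g(1)] pl(2)[OF cc[OF f(1)] cc[OF f'(1)], symmetric]
   by (simp add: cl_free_ops conv_add_left)
 qed
qed

lemma Cl_mult_right: "y <: C ==> linear_on C C (\<lambda>x. y \<otimes>\<^bsub>C\<^esub> x)"
proof -
 assume "y <: C"
 then obtain g where g: "g <: FF" "y = cl_proj a b g" unfolding Cl_carrier by blast
 interpret F: vspace FF by (rule vspace_cl_free)
 note pl = linear_onD[OF proj_linear]
 show ?thesis unfolding linear_on_def
 proof (intro conjI ballI allI)
  fix x assume x: "x <: C"
  show "y \<otimes>\<^bsub>C\<^esub> x <: C" by (rule Cl_mult_closed) fact+
  obtain f where f: "f <: FF" "x = cl_proj a b f" using x unfolding Cl_carrier by blast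
  have cc: "conv g h <: FF" if "h <: FF" for h
   using g(1) that unfolding cl_free_eq by (rule conv_carrier)
  show "y \<otimes>\<^bsub>C\<^esub> (c \<odot>\<^bsub>C\<^esub> x) = c \<odot>\<^bsub>C\<^esub> (y \<otimes>\<^bsub>C\<^esub> x)" for c
   unfolding f g pl(3)[OF f(1), symmetric] proj_mult[OF g(1) F.vs_sc[OF f(1)]] proj_mult[OF g(1) f(1)] pl(3)[OF cc[OF f(1)], symmetric]
   by (simp add: cl_free_ops conv_smult_right)
  fix x' assume x: "x' <: C"
  obtain f' where f': "f' <: FF" "x' = cl_proj a b f'" using x unfolding Cl_carrier by blast
  show "y \<otimes>\<^bsub>C\<^esub> (x \<oplus>\<^bsub>C\<^esub> x') = y \<otimes>\<^bsub>C\<^esub> x \<oplus>\<^bsub>C\<^esub> y \<otimes>\<^bsub>C\<^esub> x'"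
   unfolding f f' g pl(2)[OF f(1) f'(1), symmetric] proj_mult[OF g(1) F.a_closed[OF f(1) f'(1)]]
    proj_mult[OF g(1) f(1)] proj_mult[OF g(1) f'(1)] pl(2)[OF cc[OF f(1)] cc[OF f'(1)], symmetric]
   by (simp add: cl_free_ops conv_add_right)
 qed
qed

lemma Cl_one_closed: "\<one>\<^bsub>C\<^esub> <: C"
 unfolding Cl_one by (rule W_carrier) simp

lemma Cl_assoc: "x <: C ==> y <: C ==> z <: C ==>
 (x \<otimes>\<^bsub>C\<^esub> y) \<otimes>\<^bsub>C\<^esub> z = x \<otimes>\<^bsub>C\<^esub> (y \<otimes>\<^bsub>C\<^esub> z)"
proof -
 assume "x <: C" "y <: C" "z <: C"
 then obtain f g h where f: "f <: FF" "g <: FF" "h <: FF"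
  "x = cl_proj a b f" "y = cl_proj a b g" "z = cl_proj a b h" unfolding Cl_carrier by blast
 have "conv f g <: FF" "conv g h <: FF"
  using f unfolding cl_free_eq by (auto intro: conv_carrier simp del: free_alg_simps)
 thus ?thesis using f conv_assoc[of f LL gen_par g h] by (simp add: proj_mult cl_free_eq del: free_alg_simps)
qed

lemma Cl_one_left: "x <: C ==> \<one>\<^bsub>C\<^esub> \<otimes>\<^bsub>C\<^esub> x = x"
proof -
 assume "x <: C"
 then obtain f where f: "f <: FF" "x = cl_proj a b f" unfolding Cl_carrier by blast
 show ?thesis unfolding Cl_one wrd_def f(2) proj_mult[OF single_cl_free[of "[]", simplified] f(1)]
  by (simp only: conv_one(1)[OF f(1)[unfolded cl_free_eq]])
qed

lemma Cl_one_right: "x <: C ==> x \<otimes>\<^bsub>C\<^esub> \<one>\<^bsub>C\<^esub> = x"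
proof -
 assume "x <: C"
 then obtain f where f: "f <: FF" "x = cl_proj a b f" unfolding Cl_carrier by blast
 show ?thesis unfolding Cl_one wrd_def f(2) proj_mult[OF f(1) single_cl_free[of "[]", simplified]]
  by (simp only: conv_one(2)[OF f(1)[unfolded cl_free_eq]])
qed

lemma W_rel:
 assumes "g \<in> LL" "h \<in> LL"
 shows "W [g, h] = ((- gsign g h) \<odot>\<^bsub>C\<^esub> W [h, g]) \<oplus>\<^bsub>C\<^esub> (kap g h \<odot>\<^bsub>C\<^esub> W [])"
proof -
 interpret F: vspace FF by (rule vspace_cl_free)
 note pl = linear_onD[OF proj_linear]
 have "gen_rel g h \<in> II"
 proof (cases g; cases h)
  fix i j assume gh: "g = Xi i" "h = Eta j"
  have "gen_rel (Eta j) (Xi i) \<in> cl_rels a b" using assms gh unfolding cl_rels_eq by (auto simp: letters_def)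
  hence r: "gen_rel (Eta j) (Xi i) \<in> II" using cl_rels_in by blast
  \<comment> \<open>Since {u, v} = (-1)^(pq) {v, u}, the relation for \<open>Xi\<close>,
    \<open>Eta\<close> is the listed one for \<open>Eta\<close>, \<open>Xi\<close> times a
    sign.\<close>
  have "gen_rel g h = gsign g h \<odot>\<^bsub>FF\<^esub> gen_rel (Eta j) (Xi i)"
   using gsign_cases[of g h] gsign_sym[of g h] kap_sym[of h g] gh unfolding gen_rel_def cl_free_ops fun_eq_iff
   by (auto simp: algebra_simps)
  thus ?thesis using F.sub_smult[OF sub_cl_ideal r] by simp
 qed (rule subsetD[OF cl_rels_in], use assms in \<open>auto simp: cl_rels_eq letters_def\<close>)+
 moreover have s: "single [g, h] <: FF" "single [h, g] <: FF" "single [] <: FF"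
  using assms by (auto intro: single_cl_free)
 define r where "r = ((- gsign g h) \<odot>\<^bsub>FF\<^esub> single [h, g]) \<oplus>\<^bsub>FF\<^esub> (kap g h \<odot>\<^bsub>FF\<^esub> single [])"
 have r: "r <: FF" unfolding r_def using s by blast
 have "single [g, h] \<ominus>\<^bsub>FF\<^esub> r = gen_rel g h"
  unfolding cl_free_minus[OF s(1) r] by (simp add: r_def cl_free_ops gen_rel_def fun_eq_iff)
 ultimately have "cl_proj a b (single [g, h]) = cl_proj a b r"
  using proj_eq[OF s(1) r] by simp
 thus ?thesis unfolding r_def wrd_def using s by (simp add: pl)
qed

lemma W_ctx:
 assumes u: "u \<in> lists LL" and v: "v \<in> lists LL"
 shows "linear_on C C (\<lambda>x. W u \<otimes>\<^bsub>C\<^esub> (x \<otimes>\<^bsub>C\<^esub> W v))"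
 by (rule linear_on_comp[OF Cl_mult_left Cl_mult_right]) (intro W_carrier u v)+

lemma W_swap:
 assumes u: "u \<in> lists LL" and g: "g \<in> LL" "h \<in> LL" and v: "v \<in> lists LL"
 shows "W (u @ g # h # v) = ((- gsign g h) \<odot>\<^bsub>C\<^esub> W (u @ h # g # v)) \<oplus>\<^bsub>C\<^esub> (kap g h \<odot>\<^bsub>C\<^esub> W (u @ v))"
proof -
 interpret vspace C by (rule vspace_Cl)
 let ?T = "\<lambda>x. W u \<otimes>\<^bsub>C\<^esub> (x \<otimes>\<^bsub>C\<^esub> W v)"
 note T = linear_onD[OF W_ctx[OF u v]]
 have c: "W [h, g] <: C" "W [] <: C" using g W_carrier by simp_all
 have e: "?T (W w) = W (u @ w @ v)" if "w \<in> lists LL" for w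
  using that u v by (simp add: W_mult)
 have "?T (W [g, h]) = ?T (((- gsign g h) \<odot>\<^bsub>C\<^esub> W [h, g]) \<oplus>\<^bsub>C\<^esub> (kap g h \<odot>\<^bsub>C\<^esub> W []))"
  using W_rel[OF g] by simp
 also have "\<dots> = ((- gsign g h) \<odot>\<^bsub>C\<^esub> ?T (W [h, g])) \<oplus>\<^bsub>C\<^esub> (kap g h \<odot>\<^bsub>C\<^esub> ?T (W []))"
  using c by (simp add: T)
 finally show ?thesis using g e[of "[g, h]"] e[of "[h, g]"] e[of "[]"] by simp
qed

text \<open>Swapping two equal letters of positive index gives x = -x, because
  \<open>gsign g g\<close> is 1 and \<open>kap g g\<close> is 0.\<close>

lemma W_square_zero:
 assumes "u \<in> lists LL" "g \<in> LL" "v \<in> lists LL" "idx g > 0"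
 shows "W (u @ g # g # v) = \<zero>\<^bsub>C\<^esub>"
proof -
 interpret vspace C by (rule vspace_Cl)
 let ?x = "W (u @ g # g # v)"
 have x: "?x <: C" "W (u @ v) <: C"
  by (rule W_carrier; use assms in auto)+
 have "?x = (- 1) \<odot>\<^bsub>C\<^esub> ?x"
  using W_swap[OF assms(1,2,2,3)] assms(4) x by (simp add: gsign_def gen_par_def kap_def)
 hence "(1::complex) = - 1 \<or> ?x = \<zero>\<^bsub>C\<^esub>" using vs_cancel_scalar[OF x(1), of 1 "-1"] x(1) by auto
 thus ?thesis by simp
qed

text \<open>Super parity is well defined on the quotient because the parity automorphism of the free algebra
 multiplies each relation by a sign.\<close>

definition spar :: "(gen list => complex) => gen list => complex" where
 "spar f = (\<lambda>w. (if wpar w = 0 then 1 else -1) * f w)"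

lemma spar_carrier: "f <: FF ==> spar f <: FF"
proof -
 have "{w. spar f w \<noteq> 0} = {w. f w \<noteq> 0}" by (auto simp: spar_def)
 thus "f <: FF ==> spar f <: FF" by (simp add: cl_free_eq)
qed

lemma spar_conv: "spar (conv f g) = conv (spar f) (spar g)"
proof
 fix w
 have e: "(if wpar w = 0 then 1 else -1::complex) = (if wpar (take k w) = 0 then 1 else -1) * (if wpar (drop k w) = 0 then 1 else -1)" for k
 proof -
  have "wpar w = wpar (take k w) + wpar (drop k w)" by (metis append_take_drop_id wpar_simps(3))
  thus ?thesis by (cases "wpar (take k w)"; cases "wpar (drop k w)") auto
 qed
 have "spar (conv f g) w = (\<Sum>k\<le>length w. (if wpar w = 0 then 1 else -1) * (f (take k w) * g (drop k w)))"
  by (simp add: spar_def conv_def sum_distrib_left del: mult_minus1)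
 also have "\<dots> = conv (spar f) (spar g) w"
  unfolding conv_def
 proof (rule sum.cong[OF refl])
  fix k
  show "(if wpar w = 0 then 1 else -1) * (f (take k w) * g (drop k w)) = spar f (take k w) * spar g (drop k w)"
   unfolding e[of k] spar_def by (simp only: mult_ac)
 qed
 finally show "spar (conv f g) w = conv (spar f) (spar g) w" .
qed

lemma spar_linear: "linear_on FF FF spar"
 unfolding linear_on_def using spar_carrier by (simp add: cl_free_ops) (simp add: spar_def fun_eq_iff algebra_simps)

lemma spar_ideal: "f \<in> II ==> spar f \<in> II"
proof -
 interpret F: vspace FF by (rule vspace_cl_free)
 interpret I: ideal II FF by (rule ideal_cl)
 let ?J = "{f \<in> carrier FF. spar f \<in> II}"
 note sl = linear_onD[OF spar_linear]
 have "submodule ?J CC FF"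
  by (rule F.subI) (auto simp: sl linear_on_zero[OF vspace_cl_free vspace_cl_free spar_linear]
   intro: F.sub_zero[OF sub_cl_ideal] F.sub_add[OF sub_cl_ideal] F.sub_smult[OF sub_cl_ideal])
 hence "ideal ?J FF"
 proof (intro idealI[OF ring_cl_free])
  assume "submodule ?J CC FF" thus "subgroup ?J (add_monoid FF)" by (simp add: submodule_def)
  fix f x assume f: "f \<in> ?J" and x: "x <: FF"
  have cc: "conv u v <: FF" if "u <: FF" "v <: FF" for u v
   using that unfolding cl_free_eq by (rule conv_carrier)
  show "x \<otimes>\<^bsub>FF\<^esub> f \<in> ?J" "f \<otimes>\<^bsub>FF\<^esub> x \<in> ?J"
   using f x cc I.I_l_closed[of "spar f" "spar x"] I.I_r_closed[of "spar f" "spar x"] spar_carrier[OF x]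
   by (auto simp: cl_free_ops spar_conv)
 qed
 moreover have "cl_rels a b \<subseteq> ?J"
 proof
  fix r assume r: "r \<in> cl_rels a b"
  \<comment> \<open>The constant term of a relation occurs only next to even words, so each relation
    is homogeneous.\<close>
  have p: "kap g h = 0 \<or> gen_par g + gen_par h = 0" for g h
   by (auto simp: kap_def gen_par_def split: if_splits)
  obtain g h where gh: "r = gen_rel g h" using r unfolding cl_rels_eq by blast
  have "spar (gen_rel g h) = (if wpar [g, h] = 0 then 1 else -1) \<odot>\<^bsub>FF\<^esub> gen_rel g h"
   unfolding cl_free_ops spar_def gen_rel_def fun_eq_iff using p[of g h]
   by (auto simp: single_def add.commute)
  moreover have "gen_rel g h \<in> II" using r gh cl_rels_in by blast
  ultimately show "r \<in> ?J" using F.sub_smult[OF sub_cl_ideal] cl_rels_carrier r gh by auto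
 qed
 ultimately have "II \<subseteq> ?J" unfolding cl_ideal_def by (rule ring.genideal_minimal[OF ring_cl_free])
 thus "f \<in> II ==> spar f \<in> II" by blast
qed

lemma Cl_part_sub: "submodule (part C p) CC C"
 unfolding Cl_part_span by (rule vspace.span_sub[OF vspace_Cl W_sub])

lemma superspace_Cl: "superspace C"
proof -
 interpret F: vspace FF by (rule vspace_cl_free)
 interpret C: vspace C by (rule vspace_Cl)
 have 1: "part C 0 \<inter> part C 1 \<subseteq> {\<zero>\<^bsub>C\<^esub>}"
 proof
  fix x assume "x \<in> part C 0 \<inter> part C 1"
  then obtain f g where f: "f \<in> part FF 0" "x = cl_proj a b f" and g: "g \<in> part FF 1" "x = cl_proj a b g"
   unfolding Cl_part by blast
  have fc: "f <: FF" "g <: FF" using f g by (auto simp: cl_free_eq)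
  have fg: "(\<lambda>i. f i - g i) \<in> II" using proj_eq[OF fc] f g cl_free_minus[OF fc] by simp
  \<comment> \<open>f is even and g is odd. With f - g the ideal contains its image f + g, hence
    also half of their sum, which is f.\<close>
  have e: "spar (\<lambda>i. f i - g i) = (\<lambda>i. f i + g i)"
  proof
   fix w
   have "f w = 0 \<or> wpar w = 0" "g w = 0 \<or> wpar w = 1"
    using f(1) g(1) by (auto simp: cl_free_eq wpar_def)
   thus "spar (\<lambda>i. f i - g i) w = f w + g w" by (auto simp: spar_def)
  qed
  have "(\<lambda>i. f i + g i) \<in> II" using spar_ideal[OF fg] e by simp
  from F.sub_smult[OF sub_cl_ideal F.sub_add[OF sub_cl_ideal fg this], of "1/2"]
  have "f \<in> II" by (simp add: cl_free_ops)
  thus "x \<in> {\<zero>\<^bsub>C\<^esub>}" using proj_zero[OF fc(1)] f(2) by simp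
 qed
 have 2: "\<exists>x\<in>part C 0. \<exists>y\<in>part C 1. v = x \<oplus>\<^bsub>C\<^esub> y" if "v <: C" for v
  using that
 proof (induction rule: Cl_induct)
  case (word w)
  have c: "W w <: C" using word by (rule W_carrier)
  show ?case
  proof (cases "wpar w = 0")
   case True
   thus ?thesis using W_part[OF word] c C.sub_zero[OF Cl_part_sub[of 1]] by (metis C.r_zero)
  next
   case False
   hence "wpar w = 1" by simp
   thus ?thesis using W_part[OF word] c C.sub_zero[OF Cl_part_sub[of 0]] by (metis C.l_zero)
  qed
 next
  case (add x y)
  then obtain x0 x1 y0 y1 where d: "x0 \<in> part C 0" "x1 \<in> part C 1" "y0 \<in> part C 0" "y1 \<in> part C 1"
   "x = x0 \<oplus>\<^bsub>C\<^esub> x1" "y = y0 \<oplus>\<^bsub>C\<^esub> y1" by blast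
  have "x \<oplus>\<^bsub>C\<^esub> y = (x0 \<oplus>\<^bsub>C\<^esub> y0) \<oplus>\<^bsub>C\<^esub> (x1 \<oplus>\<^bsub>C\<^esub> y1)"
   unfolding d(5,6) using C.sub_carrier[OF Cl_part_sub] d(1-4) by (simp add: C.a_ac)
  thus ?case using C.sub_add[OF Cl_part_sub] d(1-4) by blast
 next
  case (smult c x)
  then obtain x0 x1 where d: "x0 \<in> part C 0" "x1 \<in> part C 1" "x = x0 \<oplus>\<^bsub>C\<^esub> x1" by blast
  have "c \<odot>\<^bsub>C\<^esub> x = c \<odot>\<^bsub>C\<^esub> x0 \<oplus>\<^bsub>C\<^esub> c \<odot>\<^bsub>C\<^esub> x1"
   unfolding d(3) using C.sub_carrier[OF Cl_part_sub] d(1,2) by (simp add: C.vs_radd)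
  thus ?case using C.sub_smult[OF Cl_part_sub] d(1,2) by blast
 qed
 have 3: "part C 0 \<inter> part C 1 = {\<zero>\<^bsub>C\<^esub>}" using 1 C.sub_zero[OF Cl_part_sub] by blast
 show ?thesis unfolding superspace_def module_CC_iff using vspace_Cl Cl_part_sub 2 3 by blast
qed

end

section \<open>Letters of equal index, homogeneous elements of spans\<close>

lemma letters_iff [simp]: "g \<in> letters a b \<longleftrightarrow> idx g \<in> Idx a b" by (simp add: letters_def)

lemma idx_opp [simp]: "idx (opp g) = idx g" by (cases g) (auto simp: opp_def)

lemma opp_cases: "idx h = idx g ==> h = g \<or> h = opp g" by (cases g; cases h) (auto simp: opp_def)

text \<open>Weight zero at i forces both letters of index i to occur. Let x be the first of them;
  before the first \<open>opp x\<close> the last letter of index i must again be x, and this pair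
  has no letter of index i in between.\<close>

lemma opposite_pair:
 assumes "\<exists>g\<in>set w. idx g = i" "shift i w = 0"
 shows "\<exists>w1 g w2 w3. w = w1 @ g # w2 @ opp g # w3 \<and> idx g = i \<and> (\<forall>k\<in>set w2. idx k \<noteq> i)"
proof -
 obtain u x v where w: "w = u @ x # v" "idx x = i" "\<forall>k\<in>set u. idx k \<noteq> i"
  using split_list_first_prop[of w "\<lambda>k. idx k = i"] assms(1) by blast
 have all: "shift i l = gen_deg x * int (length (filter (\<lambda>k. idx k = i) l))" if "\<forall>k\<in>set l. idx k = i \<longrightarrow> k = x" for l
  using that by (induction l) (auto simp: sh_def algebra_simps)
 have "opp x \<in> set v"
 proof (rule ccontr)
  assume "opp x \<notin> set v"
  hence "\<forall>k\<in>set w. idx k = i \<longrightarrow> k = x" using w opp_cases[of _ x] by auto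
  from all[OF this] have "gen_deg x * int (length (filter (\<lambda>k. idx k = i) w)) = 0" using assms(2) by simp
  thus False using w by (cases x) simp_all
 qed
 then obtain v1 v2 where v: "v = v1 @ opp x # v2" "opp x \<notin> set v1" using split_list_first by fastforce
 obtain u' y w2 where y: "x # v1 = u' @ y # w2" "idx y = i" "\<forall>k\<in>set w2. idx k \<noteq> i"
  using split_list_last_prop[of "x # v1" "\<lambda>k. idx k = i"] w(2) by auto
 have "y \<in> set (x # v1)" unfolding y(1) by simp
 hence "y = x" using opp_cases[of y x] y(2) w(2) v(2) by auto
 hence "w = (u @ u') @ x # w2 @ opp x # v2" using w(1) v(1) y(1) by simp
 thus ?thesis using w(2) y(3) by blast
qed

lemma span_decompose:
 assumes V: "superspace V" and B: "B \<subseteq> part V 0 \<union> part V 1" and x: "x \<in> lin_span V B"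
 shows "\<exists>x0\<in>lin_span V (B \<inter> part V 0). \<exists>x1\<in>lin_span V (B \<inter> part V 1). x = x0 \<oplus>\<^bsub>V\<^esub> x1"
proof -
 interpret vspace V using V by (simp add: superspace_def module_CC_iff)
 have ps: "submodule (part V q) CC V" for q using V by (simp add: superspace_def)
 have Bc: "B \<subseteq> carrier V" using B sub_carrier[OF ps] by blast
 let ?S = "\<lambda>q. lin_span V (B \<inter> part V q)"
 have ss: "submodule (?S q) CC V" for q by (rule span_sub) (use Bc in blast)
 have Sp: "?S q \<subseteq> part V q" for q by (rule span_minimal[OF ps]) blast
 show ?thesis using x Bc
 proof (induction rule: span_induct)
  case (base x)
  have xc: "x <: V" using base Bc by blast
  show ?case
  proof (cases "x \<in> part V 0")
   case True
   hence "x \<in> ?S 0" using base span_in by simp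
   thus ?thesis using sub_zero[OF ss[of 1]] xc by (metis r_zero)
  next
   case False
   hence "x \<in> ?S 1" using base B span_in by blast
   thus ?thesis using sub_zero[OF ss[of 0]] xc by (metis l_zero)
  qed
 next
  case zero thus ?case using sub_zero[OF ss] by (metis l_zero zero_closed)
 next
  case (add x y)
  then obtain x0 x1 y0 y1 where d: "x0 \<in> ?S 0" "x1 \<in> ?S 1" "y0 \<in> ?S 0" "y1 \<in> ?S 1"
   "x = x0 \<oplus>\<^bsub>V\<^esub> x1" "y = y0 \<oplus>\<^bsub>V\<^esub> y1" by blast
  have dc: "x0 <: V" "x1 <: V" "y0 <: V" "y1 <: V"
   using d(1-4) sub_carrier[OF ss] by blast+
  have "x \<oplus>\<^bsub>V\<^esub> y = (x0 \<oplus>\<^bsub>V\<^esub> y0) \<oplus>\<^bsub>V\<^esub> (x1 \<oplus>\<^bsub>V\<^esub> y1)" unfolding d(5,6) using dc by (simp add: a_ac)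
  thus ?case using sub_add[OF ss] d(1-4) by blast
 next
  case (smult c x)
  then obtain x0 x1 where d: "x0 \<in> ?S 0" "x1 \<in> ?S 1" "x = x0 \<oplus>\<^bsub>V\<^esub> x1" by blast
  have dc: "x0 <: V" "x1 <: V" using d(1,2) sub_carrier[OF ss] by blast+
  have "c \<odot>\<^bsub>V\<^esub> x = c \<odot>\<^bsub>V\<^esub> x0 \<oplus>\<^bsub>V\<^esub> c \<odot>\<^bsub>V\<^esub> x1" unfolding d(3) using dc by (simp add: vs_radd)
  thus ?case using sub_smult[OF ss] d(1,2) by blast
 qed
qed

lemma span_homogeneous:
 assumes V: "superspace V" and B: "B \<subseteq> part V 0 \<union> part V 1" and x: "x \<in> lin_span V B" "x \<in> part V p"
 shows "x \<in> lin_span V (B \<inter> part V p)"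
proof -
 interpret vspace V using V by (simp add: superspace_def module_CC_iff)
 have ps: "submodule (part V q) CC V" for q using V by (simp add: superspace_def)
 let ?S = "\<lambda>q. lin_span V (B \<inter> part V q)"
 have Sp: "?S q \<subseteq> part V q" for q by (rule span_minimal[OF ps]) blast
 from span_decompose[OF V B x(1)] obtain x0 x1 where d: "x0 \<in> ?S 0" "x1 \<in> ?S 1" "x = x0 \<oplus>\<^bsub>V\<^esub> x1" by blast
 have dp: "x0 \<in> part V 0" "x1 \<in> part V 1" using d(1,2) Sp by blast+
 have dc: "x0 <: V" "x1 <: V" using dp sub_carrier[OF ps] by blast+
 have z: "part V 0 \<inter> part V 1 = {\<zero>\<^bsub>V\<^esub>}" using V by (simp add: superspace_def)
 show ?thesis
 proof (cases "p = 0")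
  case True
  have "x1 = x \<ominus>\<^bsub>V\<^esub> x0" unfolding d(3) using dc by (simp add: a_minus_def a_comm[of x0 x1] a_assoc r_neg)
  hence "x1 \<in> part V 0" using sub_minus[OF ps] x(2) True dp by simp
  hence "x1 = \<zero>\<^bsub>V\<^esub>" using dp z by blast
  thus ?thesis using d True dc by simp
 next
  case False
  hence p: "p = 1" by simp
  have "x0 = x \<ominus>\<^bsub>V\<^esub> x1" unfolding d(3) using dc by (simp add: a_minus_def a_assoc r_neg)
  hence "x0 \<in> part V 1" using sub_minus[OF ps] x(2) p dp by simp
  hence "x0 = \<zero>\<^bsub>V\<^esub>" using dp z by blast
  thus ?thesis using d p dc by simp
 qed
qed

lemma subsp_simps [simp]:
 "carrier (subsp V W) = W" "part (subsp V W) p = W \<inter> part V p" "ring.add (subsp V W) = ring.add V"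
 "ring.zero (subsp V W) = ring.zero V" "module.smult (subsp V W) = module.smult V"
 "monoid.mult (subsp V W) = monoid.mult V" "monoid.one (subsp V W) = monoid.one V"
 by (simp_all add: subsp_def)

lemma scomm_subsp [simp]: "scomm (subsp V W) = scomm V"
 by (simp add: scomm_def fun_eq_iff)

text \<open>The supercommutator of two letters (\<open>qq_scomm\<close>). These elements span
  osp(2a|2b), and together with the letters they span osp(2a+1|2b).\<close>

definition qq :: "enat => enat => gen => gen => cl" where
 "qq a b g h = wrd a b [g, h] \<oplus>\<^bsub>Cl a b\<^esub> ((- gsign g h) \<odot>\<^bsub>Cl a b\<^esub> wrd a b [h, g])"

definition osp_gens :: "bool => enat => enat => cl set" where
 "osp_gens eps a b = {qq a b g h | g h. g \<in> letters a b \<and> h \<in> letters a b} \<union>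
   (if eps then (\<lambda>g. wrd a b [g]) ` letters a b else {})"

context
 fixes a b :: enat
begin

private abbreviation (input) "Ca \<equiv> Cl a b"
private abbreviation (input) "C0 \<equiv> \<zero>\<^bsub>Cl a b\<^esub>"
private abbreviation (input) "Wd \<equiv> wrd a b"
private abbreviation (input) "Le \<equiv> letters a b"
private abbreviation (input) "br \<equiv> scomm (Cl a b)"
private abbreviation (input) add_Cl (infixl "+." 65) where "x +. y \<equiv> x \<oplus>\<^bsub>Cl a b\<^esub> y"
private abbreviation (input) mult_Cl (infixl "*." 70) where "x *. y \<equiv> x \<otimes>\<^bsub>Cl a b\<^esub> y"
private abbreviation (input) smult_Cl (infixr ".*" 70) where "c .* x \<equiv> c \<odot>\<^bsub>Cl a b\<^esub> x"

interpretation C: vspace "Cl a b" by (rule vspace_Cl)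

section \<open>Weights of words under the elements u_i\<close>

lemma W_append3: "u \<in> lists Le ==> v \<in> lists Le ==> w \<in> lists Le ==>
 Wd (u @ v @ w) = Wd u *. (Wd v *. Wd w)"
 by (simp add: W_mult)

lemma cl_u_eq: "i \<in> Idx a b ==> cl_u a b i = Wd [Xi i, Eta i]"
 using W_mult[of "[Xi i]" a b "[Eta i]"] by (simp add: cl_u_def xi_def eta_def wrd_def)

lemma cl_u_closed: "i \<in> Idx a b ==> cl_u a b i <: Ca"
 by (simp add: cl_u_eq W_carrier)

text \<open>All letters that g passes have another index, so \<open>kap\<close> vanishes at every
  swap and only a sign remains. The scalar c is chosen before the context u, v; the induction uses
  it in the context lengthened by k.\<close>

lemma W_move:
 assumes "w \<in> lists Le" "\<forall>k\<in>set w. idx k \<noteq> idx g" "g \<in> Le"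
 shows "\<exists>c. \<forall>u v. u \<in> lists Le \<longrightarrow> v \<in> lists Le \<longrightarrow>
  Wd (u @ g # w @ v) = c .* Wd (u @ w @ g # v)"
 using assms(1,2)
proof (induction w rule: list.induct)
 case Nil
 have "Wd (u @ g # [] @ v) = 1 .* Wd (u @ [] @ g # v)"
  if "u \<in> lists Le" "v \<in> lists Le" for u v
  by (subst C.vs_one) (use that assms(3) in \<open>auto intro!: W_carrier\<close>)
 thus ?case by blast
next
 case (Cons k w)
 have k: "k \<in> Le" "w \<in> lists Le" "idx k \<noteq> idx g" using Cons(2,3) by auto
 then obtain c where c: "\<And>u v. u \<in> lists Le ==> v \<in> lists Le ==>
  Wd (u @ g # w @ v) = c .* Wd (u @ w @ g # v)"
  using Cons by auto
 have "Wd (u @ g # (k # w) @ v) = (- gsign g k * c) .* Wd (u @ (k # w) @ g # v)"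
  if u: "u \<in> lists Le" and v: "v \<in> lists Le" for u v
 proof -
  have cl: "Wd (u @ k # g # w @ v) <: Ca" "Wd (u @ w @ v) <: Ca"
   "Wd (u @ k # w @ g # v) <: Ca"
   by (rule W_carrier; use u v k assms(3) in auto)+
  have "Wd (u @ g # k # w @ v) = (- gsign g k) .* Wd (u @ k # g # w @ v) +. (kap g k .* Wd (u @ w @ v))"
   by (rule W_swap) (use u v k assms(3) in auto)
  also have "kap g k = 0" using k by (simp add: kap_def)
  also have "(- gsign g k) .* Wd (u @ k # g # w @ v) +. (0 .* Wd (u @ w @ v)) =
   (- gsign g k) .* Wd (u @ k # g # w @ v)" using cl by simp
  also have "Wd (u @ k # g # w @ v) = c .* Wd (u @ k # w @ g # v)"
   using c[of "u @ [k]" v] u v k by simp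
  finally show ?thesis using cl by (simp add: C.vs_assoc[symmetric])
 qed
 thus ?case by blast
qed

text \<open>For i < 0 these are [x d/dx, x] = x and [x d/dx, d/dx] = - d/dx. For i > 0 the word with
  a repeated letter vanishes. A letter of another index passes \<open>Xi i\<close> and
  \<open>Eta i\<close> with equal signs, which cancel.\<close>

lemma u_letter:
 assumes i: "i \<in> Idx a b" and g: "g \<in> Le"
 shows "Wd [Xi i, Eta i, g] = Wd [g, Xi i, Eta i] +. (of_int (sh i g) .* Wd [g])"
proof -
 note sw = W_swap[of _ a b]
 have cl: "\<And>w. set w \<subseteq> {Xi i, Eta i, g} ==> Wd w <: Ca"
  by (rule W_carrier) (use i g in auto)
 have gs: "gsign (Eta i) (Xi i) = (if i < 0 then -1 else 1)" "gsign (Xi i) (Eta i) = (if i < 0 then -1 else 1)"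
  by (simp_all add: gsign_def gen_par_def)
 have kp: "kap (Eta i) (Xi i) = 1" by (simp add: kap_def)
 consider "g = Xi i" | "g = Eta i" | "idx g \<noteq> i" using opp_cases[of g "Xi i"] by (auto simp: opp_def)
 thus ?thesis
 proof cases
  case 1
  have s: "Wd [Xi i, Eta i, Xi i] = (- gsign (Eta i) (Xi i)) .* Wd [Xi i, Xi i, Eta i] +. (1 .* Wd [Xi i])"
   using sw[of "[Xi i]" "Eta i" "Xi i" "[]"] i kp by simp
  show ?thesis
  proof (cases "i < 0")
   case True thus ?thesis using s 1 gs cl by (simp add: sh_def)
  next
   case False
   hence "i > 0" using i by (auto simp: Idx_def)
   hence "Wd [Xi i, Xi i, Eta i] = C0" using W_square_zero[of "[]" a b "Xi i" "[Eta i]"] i by simp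
   thus ?thesis using s 1 by (simp add: sh_def)
  qed
 next
  case 2
  have s: "Wd [Eta i, Xi i, Eta i] = (- gsign (Eta i) (Xi i)) .* Wd [Xi i, Eta i, Eta i] +. (1 .* Wd [Eta i])"
   using sw[of "[]" "Eta i" "Xi i" "[Eta i]"] i kp by simp
  have c1: "Wd [Eta i] <: Ca" "Wd [Xi i, Eta i, Eta i] <: Ca" using cl by auto
  have n: "Wd [Eta i] +. ((- 1) .* Wd [Eta i]) = C0"
   using c1 by (metis C.r_neg C.vs_neg)
  show ?thesis
  proof (cases "i < 0")
   case True
   have "Wd [Eta i, Xi i, Eta i] +. ((- 1) .* Wd [Eta i]) = Wd [Xi i, Eta i, Eta i]"
    using s True gs c1 n by (simp add: C.a_assoc)
   thus ?thesis using 2 by (simp add: sh_def)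
  next
   case False
   hence "i > 0" using i by (auto simp: Idx_def)
   hence "Wd [Xi i, Eta i, Eta i] = C0" using W_square_zero[of "[Xi i]" a b "Eta i" "[]"] i by simp
   thus ?thesis using s 2 c1 n by (simp add: sh_def)
  qed
 next
  case 3
  have k: "kap (Xi i) g = 0" "kap (Eta i) g = 0" using 3 by (auto simp: kap_def)
  have c: "Wd [Xi i, g, Eta i] <: Ca" "Wd [g, Xi i, Eta i] <: Ca"
   "Wd [Xi i] <: Ca" "Wd [Eta i] <: Ca" "Wd [g] <: Ca"
   using cl by auto
  have "Wd [Xi i, Eta i, g] = (- gsign (Eta i) g) .* Wd [Xi i, g, Eta i]"
   using sw[of "[Xi i]" "Eta i" g "[]"] i g k c by simp
  also have "Wd [Xi i, g, Eta i] = (- gsign (Xi i) g) .* Wd [g, Xi i, Eta i]"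
   using sw[of "[]" "Xi i" g "[Eta i]"] i g k c by simp
  also have "(- gsign (Eta i) g) .* ((- gsign (Xi i) g) .* Wd [g, Xi i, Eta i]) =
   (gsign (Eta i) g * gsign (Xi i) g) .* Wd [g, Xi i, Eta i]"
   using c by (simp add: C.vs_assoc[symmetric])
  also have "gsign (Eta i) g * gsign (Xi i) g = 1" by (simp add: gsign_def gen_par_def)
  finally show ?thesis using 3 c by (simp add: sh_def)
 qed
qed

lemma u_word:
 assumes i: "i \<in> Idx a b" and w: "w \<in> lists Le"
 shows "cl_u a b i *. Wd w =
  Wd w *. cl_u a b i +. (of_int (shift i w) .* Wd w)"
 using w
proof (induction w rule: list.induct)
 case Nil
 show ?case using Cl_one_left[OF cl_u_closed[OF i]] Cl_one_right[OF cl_u_closed[OF i]] cl_u_closed[OF i] W_carrier[of "[]" a b]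
  by (simp add: Cl_one)
next
 case (Cons g w)
 have gw: "g \<in> Le" "w \<in> lists Le" using Cons(2) by auto
 let ?u = "cl_u a b i"
 have c: "?u <: Ca" "Wd [g] <: Ca" "Wd w <: Ca"
  using cl_u_closed[OF i] gw by (simp_all add: W_carrier)
 note ml = linear_onD[OF Cl_mult_left] and mr = linear_onD[OF Cl_mult_right] and cc = Cl_mult_closed
 have e: "Wd (g # w) = Wd [g] *. Wd w" using W_mult[of "[g]" a b w] gw by simp
 have ug: "?u *. Wd [g] = Wd [g] *. ?u +. (of_int (sh i g) .* Wd [g])"
  using u_letter[OF i gw(1)] W_mult[of "[Xi i, Eta i]" a b "[g]"] W_mult[of "[g]" a b "[Xi i, Eta i]"] gw i
  by (simp add: cl_u_eq)
 have "?u *. Wd (g # w) = (?u *. Wd [g]) *. Wd w"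
  unfolding e using c by (simp add: Cl_assoc)
 also have "\<dots> = (Wd [g] *. (?u *. Wd w)) +. (of_int (sh i g) .* Wd (g # w))"
  unfolding ug e using c by (simp add: ml cc Cl_assoc)
 also have "?u *. Wd w = Wd w *. ?u +. (of_int (shift i w) .* Wd w)"
  using Cons(1) gw by simp
 also have "Wd [g] *. (Wd w *. ?u +. (of_int (shift i w) .* Wd w)) =
  Wd (g # w) *. ?u +. (of_int (shift i w) .* Wd (g # w))"
  unfolding e using c by (simp add: mr cc Cl_assoc)
 finally show ?case using c cc unfolding e by (simp add: C.vs_ladd C.a_ac)
qed

text \<open>The polynomials in the u_i. Closing under right multiplication by a single u_i makes
  \<open>Up_scalar\<close> a direct induction: on a weight vector the rightmost factor acts first
  and is a scalar.\<close>

inductive_set Up :: "cl set" where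
 one: "Wd [] \<in> Up"
| add: "x \<in> Up ==> y \<in> Up ==> x +. y \<in> Up"
| smult: "x \<in> Up ==> c .* x \<in> Up"
| mult: "x \<in> Up ==> i \<in> Idx a b ==> x *. cl_u a b i \<in> Up"

text \<open>Induction on the length. The two letters from \<open>opposite_pair\<close> are brought
  together, the resulting u_i is pushed to the right end by \<open>u_word\<close>, and what remains
  is a shorter word of weight zero.\<close>

lemma zero_shift_Up:
 assumes "w \<in> lists Le" "\<forall>i. shift i w = 0"
 shows "Wd w \<in> Up"
 using assms
proof (induction "length w" arbitrary: w rule: less_induct)
 case less
 show ?case
 proof (cases w)
  case Nil thus ?thesis using Up.one by simp
 next
  case (Cons x w')
  hence "\<exists>g\<in>set w. idx g = idx x" by auto
  from opposite_pair[OF this] less(3) obtain w1 g w2 w3 where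
   w: "w = w1 @ g # w2 @ opp g # w3" and g: "\<forall>k\<in>set w2. idx k \<noteq> idx g" by metis
  let ?i = "idx g"
  have gl: "g \<in> Le" "opp g \<in> Le" and wl: "w1 \<in> lists Le" "w2 \<in> lists Le" "w3 \<in> lists Le"
   using less(2) w by auto
  have il: "?i \<in> Idx a b" using gl by simp
  let ?v = "w1 @ w2 @ w3"
  have shv: "\<forall>i. shift i ?v = 0"
  proof
   fix i
   have "sh i g + sh i (opp g) = 0" by (cases g) (auto simp: sh_def opp_def)
   thus "shift i ?v = 0" using less(3)[rule_format, of i] w by simp
  qed
  have vl: "?v \<in> lists Le" using wl by simp
  have vU: "Wd ?v \<in> Up" by (rule less(1)) (use w shv vl in auto)
  have c: "Wd (w1 @ w2) <: Ca" "Wd w3 <: Ca" "cl_u a b ?i <: Ca"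
   using wl il cl_u_closed by (auto intro!: W_carrier)
  have m: "Wd (w1 @ w2) *. Wd w3 = Wd ?v" using W_mult[of "w1 @ w2" a b w3] wl by simp
  have uU: "Wd (w1 @ w2 @ Xi ?i # Eta ?i # w3) \<in> Up"
  proof -
   have "Wd (w1 @ w2 @ Xi ?i # Eta ?i # w3) = Wd (w1 @ w2) *. (cl_u a b ?i *. Wd w3)"
    using W_append3[of "w1 @ w2" "[Xi ?i, Eta ?i]" w3] wl il by (simp add: cl_u_eq)
   also have "\<dots> = (Wd ?v *. cl_u a b ?i) +. (of_int (shift ?i w3) .* Wd ?v)"
    unfolding u_word[OF il wl(3)] m[symmetric] using c
    by (simp add: linear_onD[OF Cl_mult_right] Cl_mult_closed Cl_assoc)
   finally show ?thesis using Up.add Up.mult Up.smult vU il by simp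
  qed
  obtain k where "Wd (w1 @ g # w2 @ opp g # w3) = k .* Wd (w1 @ w2 @ g # opp g # w3)"
   using W_move[OF wl(2) g gl(1)] wl gl by (metis Cons_in_lists_iff)
  moreover have "Wd (w1 @ w2 @ g # opp g # w3) \<in> Up"
  proof (cases g)
   case (Xi i) thus ?thesis using uU by (simp add: opp_def)
  next
   case (Eta i)
   have "Wd ((w1 @ w2) @ Eta i # Xi i # w3) = ((- gsign (Eta i) (Xi i)) .* Wd ((w1 @ w2) @ Xi i # Eta i # w3)) +.
    (kap (Eta i) (Xi i) .* Wd ((w1 @ w2) @ w3))"
    by (rule W_swap) (use wl il Eta in auto)
   thus ?thesis using uU vU Up.add Up.smult Eta by (simp add: opp_def)
  qed
  ultimately show ?thesis using w Up.smult by simp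
 qed
qed

text \<open>Swapping the two middle letters gives u_i plus a multiple of a word with a repeated
  letter, which is zero. This restricts positive weights to 0 and 1.\<close>

lemma u_idem:
 assumes "i \<in> Idx a b" "i > 0"
 shows "cl_u a b i *. cl_u a b i = cl_u a b i"
proof -
 have c: "Wd [Xi i, Eta i] <: Ca" by (rule W_carrier) (use assms in simp)
 have "Wd [Xi i, Eta i, Xi i, Eta i] = (- gsign (Eta i) (Xi i)) .* Wd [Xi i, Xi i, Eta i, Eta i] +. (1 .* Wd [Xi i, Eta i])"
  using W_swap[of "[Xi i]" a b "Eta i" "Xi i" "[Eta i]"] assms by (simp add: kap_def)
 moreover have "Wd [Xi i, Xi i, Eta i, Eta i] = C0"
  using W_square_zero[of "[]" a b "Xi i" "[Eta i, Eta i]"] assms by simp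
 ultimately show ?thesis using c assms W_mult[of "[Xi i, Eta i]" a b "[Xi i, Eta i]"] by (simp add: cl_u_eq)
qed

section \<open>Orthosymplectic Lie superalgebras\<close>

lemma Wg: "g \<in> Le ==> Wd [g] <: Ca" "g \<in> Le ==> Wd [g] \<in> part Ca (gen_par g)"
 using W_carrier[of "[g]" a b] W_part[of "[g]" a b] by simp_all

lemma Cl_part_zero: "x \<in> part Ca p ==> x \<in> part Ca q ==> p \<noteq> q ==> x = C0"
 using superspace_Cl[of a b] unfolding superspace_def by (cases p; cases q) auto

lemma Cl_part_carrier: "x \<in> part Ca p ==> x <: Ca"
 by (rule C.sub_carrier[OF Cl_part_sub])

lemma Cl_part_mult:
 assumes x: "x \<in> part Ca p" and y: "y \<in> part Ca q"
 shows "x *. y \<in> part Ca (p + q)"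
proof (rule linear_on_span_into[OF vspace_Cl vspace_Cl Cl_mult_left[OF Cl_part_carrier[OF y]] W_sub Cl_part_sub _ x[unfolded Cl_part_span]])
 fix u assume "u \<in> Wd ` {w \<in> lists Le. wpar w = p}"
 then obtain w where w: "u = Wd w" "w \<in> lists Le" "wpar w = p" by auto
 show "u *. y \<in> part Ca (p + q)"
 proof (rule linear_on_span_into[OF vspace_Cl vspace_Cl Cl_mult_right W_sub Cl_part_sub _ y[unfolded Cl_part_span]])
  show "u <: Ca" using w W_carrier by simp
  fix v assume "v \<in> Wd ` {w \<in> lists Le. wpar w = q}"
  then obtain w' where w': "v = Wd w'" "w' \<in> lists Le" "wpar w' = q" by auto
  show "u *. v \<in> part Ca (p + q)"
   using W_mult[OF w(2) w'(2)] W_part[of "w @ w'" a b] w w' by simp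
 qed
qed

lemma scomm_closed: "x <: Ca ==> y <: Ca ==> br p q x y <: Ca"
 by (simp add: scomm_def Cl_mult_closed)

lemma scomm_part: "x \<in> part Ca p ==> y \<in> part Ca q ==> br p q x y \<in> part Ca (p + q)"
 unfolding scomm_def using Cl_part_mult[of x p y q] Cl_part_mult[of y q x p]
 by (simp add: add.commute C.sub_add[OF Cl_part_sub] C.sub_smult[OF Cl_part_sub])

lemma scomm_linear_left: "y <: Ca ==> linear_on Ca Ca (\<lambda>x. br p q x y)"
 unfolding scomm_def by (intro linear_on_add linear_on_smult Cl_mult_left Cl_mult_right vspace_Cl)

lemma scomm_linear_right: "x <: Ca ==> linear_on Ca Ca (\<lambda>y. br p q x y)"
 unfolding scomm_def by (intro linear_on_add linear_on_smult Cl_mult_left Cl_mult_right vspace_Cl)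

lemma scomm_swap:
 assumes "x <: Ca" "y <: Ca"
 shows "br p q x y = (- sign p q) .* br q p y x"
proof -
 have "(- sign p q) .* br q p y x =
  (- sign p q) .* (y *. x) +. ((- sign p q) * (- sign q p)) .* (x *. y)"
  unfolding scomm_def using assms by (simp only: C.vs_radd C.vs_sc Cl_mult_closed C.vs_assoc)
 also have "(- sign p q) * (- sign q p) = 1" by (simp add: sign_sym[of q p])
 finally show ?thesis unfolding scomm_def using assms by (simp add: Cl_mult_closed C.a_comm)
qed

text \<open>The two terms y x z, one from each summand on the right, cancel.\<close>

lemma scomm_leibniz:
 assumes "x <: Ca" "y <: Ca" "z <: Ca"
 shows "br p (q + r) x (y *. z) =
  br p q x y *. z +. (sign p q .* (y *. br p r x z))"
proof -
 let ?m = "monoid.mult Ca"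
 have c: "?m x (?m y z) <: Ca" "?m y (?m x z) <: Ca" "?m y (?m z x) <: Ca"
  using assms by (simp_all add: Cl_mult_closed)
 have 1: "?m (br p q x y) z = ?m x (?m y z) +. ((- sign p q) .* ?m y (?m x z))"
  unfolding scomm_def using assms by (simp add: linear_onD[OF Cl_mult_left] Cl_mult_closed Cl_assoc)
 have 2: "?m y (br p r x z) = ?m y (?m x z) +. ((- sign p r) .* ?m y (?m z x))"
  unfolding scomm_def using assms by (simp add: linear_onD[OF Cl_mult_right] Cl_mult_closed Cl_assoc)
 have z: "((- sign p q) .* ?m y (?m x z)) +. (sign p q .* ?m y (?m x z)) = C0"
  using C.vs_ladd[OF c(2), of "- sign p q" "sign p q"] c by simp
 have "?m (br p q x y) z +. (sign p q .* ?m y (br p r x z)) =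
  ?m x (?m y z) +. ((((- sign p q) .* ?m y (?m x z)) +. (sign p q .* ?m y (?m x z)))
   +. ((sign p q * (- sign p r)) .* ?m y (?m z x)))"
  unfolding 1 2 using c by (simp only: C.vs_radd C.vs_sc C.a_assoc C.a_closed C.vs_assoc)
 also have "\<dots> = ?m x (?m y z) +. ((- sign p (q + r)) .* ?m y (?m z x))"
  unfolding z using c by (simp add: sign_add_right)
 finally show ?thesis unfolding scomm_def[of _ p "q + r"] using assms by (simp add: Cl_assoc)
qed

text \<open>The inner bracket is written out as y z and z y, and \<open>scomm_leibniz\<close> is
  applied to each product.\<close>

lemma super_jacobi:
 assumes "x <: Ca" "y <: Ca" "z <: Ca"
 shows "br p (q + r) x (br q r y z) =
  br (p + q) r (br p q x y) z +.
  (sign p q .* br q (p + r) y (br p r x z))"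
proof -
 let ?m = "monoid.mult Ca"
 let ?d = "br p q x y" and ?e = "br p r x z"
 have c: "?d <: Ca" "?e <: Ca" using assms by (simp_all add: scomm_closed)
 have cc: "?m ?d z <: Ca" "?m z ?d <: Ca" "?m y ?e <: Ca" "?m ?e y <: Ca"
  using c assms by (simp_all add: Cl_mult_closed)
 have "br p (q + r) x (br q r y z) =
  br p (q + r) x (?m y z) +. ((- sign q r) .* br p (r + q) x (?m z y))"
  unfolding scomm_def[of _ q r] using assms by (simp add: linear_onD[OF scomm_linear_right] Cl_mult_closed add.commute)
 also have "\<dots> = (?m ?d z +. (sign p q .* ?m y ?e)) +.
   ((- sign q r) .* (?m ?e y +. (sign p r .* ?m z ?d)))"
  using assms by (simp add: scomm_leibniz)
 also have "\<dots> = (?m ?d z +. ((- sign q r * sign p r) .* ?m z ?d)) +.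
   ((sign p q .* ?m y ?e) +. ((- sign q r) .* ?m ?e y))"
  using cc by (simp add: C.vs_radd C.vs_assoc[symmetric] C.a_ac)
 also have "- sign q r * sign p r = - sign (p + q) r" by (simp add: sign_add_left)
 also have "- sign q r = sign p q * (- sign q (p + r))"
  by (simp add: sign_add_right sign_sym[of q p] mult.assoc[symmetric])
 also have "(sign p q .* ?m y ?e) +. ((sign p q * (- sign q (p + r))) .* ?m ?e y) =
  sign p q .* br q (p + r) y ?e"
  unfolding scomm_def[of _ q "p + r"] using cc by (simp only: C.vs_radd C.vs_sc C.vs_assoc)
 also have "?m ?d z +. ((- sign (p + q) r) .* ?m z ?d) = br (p + q) r ?d z"
  unfolding scomm_def[of _ "p + q" r] ..
 finally show ?thesis .
qed

lemma qq_closed: "g \<in> Le ==> h \<in> Le ==> qq a b g h <: Ca"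
 unfolding qq_def by (intro C.a_closed C.vs_sc W_carrier) auto

lemma qq_scomm: "g \<in> Le ==> h \<in> Le ==>
 br (gen_par g) (gen_par h) (Wd [g]) (Wd [h]) = qq a b g h"
 by (simp add: scomm_def qq_def W_mult gsign_def)

lemma qq_part: "g \<in> Le ==> h \<in> Le ==> qq a b g h \<in> part Ca (gen_par g + gen_par h)"
 using scomm_part[OF Wg(2) Wg(2)] by (simp add: qq_scomm)

text \<open>The superanticommutator of two letters is the scalar \<open>kap g h\<close>, so their
  supercommutator is twice their product up to a scalar. Hence words of even length are reached from
  \<open>osp\<close>.\<close>

lemma qq_word:
 assumes "g \<in> Le" "h \<in> Le"
 shows "qq a b g h = 2 .* Wd [g, h] +. ((- kap g h) .* Wd [])"
  and "Wd [g, h] = (1/2) .* qq a b g h +. ((kap g h / 2) .* Wd [])"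
proof -
 let ?x = "Wd [g, h]" and ?y = "(- gsign g h) .* Wd [h, g]" and ?o = "Wd []"
 have c: "?x <: Ca" "?y <: Ca" "?o <: Ca"
  by (intro C.vs_sc W_carrier; use assms in simp)+
 have r: "?x = ?y +. (kap g h .* ?o)" by (rule W_rel[OF assms])
 have z: "(kap g h .* ?o) +. ((- kap g h) .* ?o) = C0"
  using C.vs_ladd[OF c(3), of "kap g h" "- kap g h"] c by simp
 have "?x +. ((- kap g h) .* ?o) = ?y"
  by (subst r) (use c z in \<open>simp add: C.a_assoc\<close>)
 hence q: "qq a b g h = ?x +. (?x +. ((- kap g h) .* ?o))" by (simp add: qq_def)
 have "2 .* ?x = ?x +. ?x" using C.vs_ladd[OF c(1), of 1 1] c by simp
 thus 1: "qq a b g h = 2 .* ?x +. ((- kap g h) .* ?o)" using q c by (simp add: C.a_assoc)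
 have z2: "((- kap g h / 2) .* ?o) +. ((kap g h / 2) .* ?o) = C0"
  using C.vs_ladd[OF c(3), of "- kap g h / 2" "kap g h / 2"] c by simp
 have "(1/2) .* qq a b g h = ?x +. ((- kap g h / 2) .* ?o)"
  unfolding 1 using c by (simp add: C.vs_radd C.vs_assoc[symmetric])
 thus "?x = (1/2) .* qq a b g h +. ((kap g h / 2) .* ?o)"
  using z2 c by (simp add: C.a_assoc)
qed

lemma cl_U_eq: "cl_U a b = lin_span Ca ((\<lambda>g. Wd [g]) ` Le)"
proof -
 have "xi a b ` Idx a b \<union> eta a b ` Idx a b = (\<lambda>g. Wd [g]) ` Le"
 proof
  show "(\<lambda>g. Wd [g]) ` Le \<subseteq> xi a b ` Idx a b \<union> eta a b ` Idx a b"
  proof (rule image_subsetI)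
   fix g assume "g \<in> Le"
   thus "Wd [g] \<in> xi a b ` Idx a b \<union> eta a b ` Idx a b"
    by (cases g) (auto simp: xi_def eta_def wrd_def)
  qed
  show "xi a b ` Idx a b \<union> eta a b ` Idx a b \<subseteq> (\<lambda>g. Wd [g]) ` Le"
  proof
   fix x assume "x \<in> xi a b ` Idx a b \<union> eta a b ` Idx a b"
   then obtain i where "i \<in> Idx a b" "x = Wd [Xi i] \<or> x = Wd [Eta i]"
    by (auto simp: xi_def eta_def wrd_def)
   thus "x \<in> (\<lambda>g. Wd [g]) ` Le" by (auto intro: image_eqI[of _ _ "Xi i"] image_eqI[of _ _ "Eta i"])
  qed
 qed
 thus ?thesis by (simp add: cl_U_def)
qed

lemma U_gens: "(\<lambda>g. Wd [g]) ` Le \<subseteq> part Ca 0 \<union> part Ca 1"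
 "(\<lambda>g. Wd [g]) ` Le \<subseteq> carrier Ca"
proof -
 show "(\<lambda>g. Wd [g]) ` Le \<subseteq> part Ca 0 \<union> part Ca 1"
 proof (rule image_subsetI)
  fix g assume "g \<in> Le"
  thus "Wd [g] \<in> part Ca 0 \<union> part Ca 1" using Wg(2)[of g] by (cases "gen_par g") auto
 qed
 show "(\<lambda>g. Wd [g]) ` Le \<subseteq> carrier Ca" using Wg(1) by blast
qed

lemma cl_U_part: "x \<in> cl_U a b ==> x \<in> part Ca p ==>
 x \<in> lin_span Ca ((\<lambda>g. Wd [g]) ` Le \<inter> part Ca p)"
 unfolding cl_U_eq by (rule span_homogeneous[OF superspace_Cl U_gens(1)])

lemma sub_cl_U: "submodule (cl_U a b) CC Ca"
 unfolding cl_U_eq by (rule C.span_sub[OF U_gens(2)])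

lemma osp_gens_closed: "osp_gens eps a b \<subseteq> carrier Ca"
 unfolding osp_gens_def using qq_closed Wg(1) by auto

lemma osp_gens_homog: "osp_gens eps a b \<subseteq> part Ca 0 \<union> part Ca 1"
proof -
 have "part Ca p \<subseteq> part Ca 0 \<union> part Ca 1" for p by (cases p) auto
 hence "qq a b g h \<in> part Ca 0 \<union> part Ca 1" if "g \<in> Le" "h \<in> Le" for g h
  using qq_part[OF that] by blast
 thus ?thesis unfolding osp_gens_def using U_gens(1) by auto
qed

lemma scomm_U_in:
 assumes u: "u \<in> cl_U a b" "u \<in> part Ca p" and v: "v \<in> cl_U a b" "v \<in> part Ca q"
 shows "br p q u v \<in> lin_span Ca (osp_gens eps a b)"
proof -
 let ?X = "\<lambda>p. (\<lambda>g. Wd [g]) ` Le \<inter> part Ca p"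
 note sub = C.span_sub[OF osp_gens_closed, of eps]
 have vc: "v <: Ca" by (rule Cl_part_carrier[OF v(2)])
 have Xc: "?X p \<subseteq> carrier Ca" for p using U_gens(2) by blast
 show ?thesis
 proof (rule linear_on_span_into[OF vspace_Cl vspace_Cl scomm_linear_left[OF vc] Xc sub _ cl_U_part[OF u]])
  fix x assume x: "x \<in> ?X p"
  then obtain g where g: "g \<in> Le" "x = Wd [g]" by blast
  have xc: "x <: Ca" using x Xc by blast
  show "br p q x v \<in> lin_span Ca (osp_gens eps a b)"
  proof (rule linear_on_span_into[OF vspace_Cl vspace_Cl scomm_linear_right[OF xc] Xc sub _ cl_U_part[OF v]])
   fix y assume y: "y \<in> ?X q"
   then obtain h where h: "h \<in> Le" "y = Wd [h]" by blast
   have yc: "y <: Ca" using y Xc by blast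
   \<comment> \<open>\<open>scomm\<close> takes the parities as arguments, while a generator might
     lie in \<open>part Ca p\<close> without having parity p; it is then zero.\<close>
   consider "gen_par g = p" "gen_par h = q" | "x = C0" | "y = C0"
    using Cl_part_zero[of x "gen_par g" p] Cl_part_zero[of y "gen_par h" q] x y g h Wg(2)[OF g(1)] Wg(2)[OF h(1)] by auto
   thus "br p q x y \<in> lin_span Ca (osp_gens eps a b)"
   proof cases
    case 1
    hence "br p q x y = qq a b g h" using qq_scomm[OF g(1) h(1)] g h by simp
    moreover have "qq a b g h \<in> osp_gens eps a b" using g(1) h(1) by (auto simp: osp_gens_def)
    ultimately show ?thesis by (simp add: C.span_in)
   next
    case 2 thus ?thesis using linear_on_zero[OF vspace_Cl vspace_Cl scomm_linear_left[OF yc]] C.sub_zero[OF sub] by simp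
   next
    case 3 thus ?thesis using linear_on_zero[OF vspace_Cl vspace_Cl scomm_linear_right[OF xc]] C.sub_zero[OF sub] by simp
   qed
  qed
 qed
qed

text \<open>Bilinearity of the bracket replaces arbitrary elements of U by letters; later arguments
  about \<open>osp\<close> only meet \<open>qq\<close> and single letters.\<close>

lemma osp_carrier: "carrier (osp eps a b) = lin_span Ca (osp_gens eps a b)"
proof -
 let ?S = "{br p q u v | p q u v. u \<in> cl_U a b \<inter> part Ca p \<and> v \<in> cl_U a b \<inter> part Ca q} \<union>
     (if eps then cl_U a b else {})"
 note sub = C.span_sub[OF osp_gens_closed, of eps]
 have wU: "Wd [g] \<in> cl_U a b" if "g \<in> Le" for g
  unfolding cl_U_eq using that C.span_in by simp
 have 1: "?S \<subseteq> lin_span Ca (osp_gens eps a b)"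
 proof -
  have "cl_U a b \<subseteq> lin_span Ca (osp_gens eps a b)" if eps
   unfolding cl_U_eq by (rule C.span_mono) (use that in \<open>auto simp: osp_gens_def\<close>)
  thus ?thesis using scomm_U_in by auto
 qed
 have Sc: "?S \<subseteq> carrier Ca" using 1 C.sub_carrier[OF sub] by blast
 have 2: "osp_gens eps a b \<subseteq> ?S"
 proof
  fix x assume "x \<in> osp_gens eps a b"
  then consider g h where "x = qq a b g h" "g \<in> Le" "h \<in> Le"
   | g where "x = Wd [g]" "g \<in> Le" eps
   unfolding osp_gens_def by (auto split: if_splits)
  thus "x \<in> ?S"
  proof cases
   case 1
   have "x = br (gen_par g) (gen_par h) (Wd [g]) (Wd [h])" using qq_scomm 1 by simp
   thus ?thesis using wU Wg(2) 1 by blast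
  next
   case 2 thus ?thesis using wU by simp
  qed
 qed
 have "carrier (osp eps a b) = lin_span Ca ?S" by (simp add: osp_def)
 also have "\<dots> = lin_span Ca (osp_gens eps a b)"
  using C.span_minimal[OF sub 1] C.span_mono[OF 2] by blast
 finally show ?thesis .
qed

lemma osp_ops [simp]:
 "part (osp eps a b) p = carrier (osp eps a b) \<inter> part Ca p" "ring.add (osp eps a b) = ring.add Ca"
 "ring.zero (osp eps a b) = ring.zero Ca" "module.smult (osp eps a b) = module.smult Ca"
 "monoid.mult (osp eps a b) = monoid.mult Ca" "scomm (osp eps a b) = br"
 by (simp_all add: osp_def)

lemma sub_osp: "submodule (carrier (osp eps a b)) CC Ca"
 unfolding osp_carrier by (rule C.span_sub[OF osp_gens_closed])

lemma osp_Cl: "x <: (osp eps a b) ==> x <: Ca"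
 by (rule C.sub_carrier[OF sub_osp])

lemma osp_part_span: "x <: (osp eps a b) ==> x \<in> part Ca p ==>
 x \<in> lin_span Ca (osp_gens eps a b \<inter> part Ca p)"
 unfolding osp_carrier by (rule span_homogeneous[OF superspace_Cl osp_gens_homog])

lemma qq_osp: "g \<in> Le ==> h \<in> Le ==> qq a b g h <: (osp eps a b)"
 unfolding osp_carrier by (rule C.span_in) (auto simp: osp_gens_def)

lemma letter_osp: "g \<in> Le ==> Wd [g] <: (osp True a b)"
 unfolding osp_carrier by (rule C.span_in) (auto simp: osp_gens_def)

text \<open>The bracket with k moves k through g h; the words with three letters cancel and the
  \<open>kap\<close> terms leave a combination of g and h. A nonzero scalar term of
  \<open>qq\<close> is even and commutes with k.\<close>

lemma scomm_qq_letter: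
 assumes "g \<in> Le" "h \<in> Le" "k \<in> Le"
 shows "br (gen_par g + gen_par h) (gen_par k) (qq a b g h) (Wd [k]) \<in> cl_U a b"
proof -
 let ?P = "gen_par g + gen_par h" and ?p = "gen_par k" and ?o = "Wd []"
 have kc: "Wd [k] <: Ca" using Wg assms by simp
 have oc: "?o <: Ca" using W_carrier[of "[]"] by simp
 have ghc: "Wd [g, h] <: Ca" using W_carrier[of "[g, h]" a b] assms by simp
 have c: "Wd [g, h, k] <: Ca" "Wd [g, k, h] <: Ca" "Wd [k, g, h] <: Ca"
  "Wd [g] <: Ca" "Wd [h] <: Ca"
  by (rule W_carrier; use assms in simp)+
 have gU: "Wd [g] \<in> cl_U a b" "Wd [h] \<in> cl_U a b" using assms C.span_in unfolding cl_U_eq by simp_all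
 have 1: "br ?P ?p ((- kap g h) .* ?o) (Wd [k]) = C0"
 proof (cases "kap g h = 0")
  case True
  thus ?thesis using oc linear_on_zero[OF vspace_Cl vspace_Cl scomm_linear_left[OF kc]] by simp
 next
  case False
  hence "?P = 0" by (auto simp: kap_def gen_par_def split: if_splits)
  hence "br ?P ?p ?o (Wd [k]) = Wd [k] +. (- 1) .* Wd [k]"
   using Cl_one_left[OF kc] Cl_one_right[OF kc] by (simp add: scomm_def Cl_one)
  also have "\<dots> = C0" using kc by (metis C.r_neg C.vs_neg)
  finally show ?thesis using linear_onD(3)[OF scomm_linear_left[OF kc] oc] by simp
 qed
 have 2: "Wd [g, h, k] = (- gsign h k) .* Wd [g, k, h] +. kap h k .* Wd [g]"
  using W_swap[of "[g]" a b h k "[]"] assms by simp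
 have 3: "Wd [g, k, h] = (- gsign g k) .* Wd [k, g, h] +. kap g k .* Wd [h]"
  using W_swap[of "[]" a b g k "[h]"] assms by simp
 have s: "sign ?P ?p = gsign h k * gsign g k" by (simp add: sign_add_left gsign_def mult.commute)
 have "Wd [g, h, k] = (gsign h k * gsign g k) .* Wd [k, g, h] +.
   ((- gsign h k * kap g k) .* Wd [h] +. kap h k .* Wd [g])"
  unfolding 2 3 using c by (simp add: C.vs_radd C.vs_assoc[symmetric] C.a_assoc)
 hence 4: "br ?P ?p (Wd [g, h]) (Wd [k]) =
   (- (gsign h k * gsign g k)) .* Wd [k, g, h] +. ((gsign h k * gsign g k) .* Wd [k, g, h] +.
   ((- gsign h k * kap g k) .* Wd [h] +. kap h k .* Wd [g]))"
  using c assms W_mult[of "[g, h]" a b "[k]"] W_mult[of "[k]" a b "[g, h]"] by (simp add: scomm_def s C.a_comm)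
 also have "\<dots> = ((- gsign h k * kap g k) .* Wd [h] +. kap h k .* Wd [g])"
  using c C.vs_ladd[OF c(3), of "- (gsign h k * gsign g k)" "gsign h k * gsign g k"]
  by (simp add: C.a_assoc[symmetric])
 finally have 5: "br ?P ?p (Wd [g, h]) (Wd [k]) \<in> cl_U a b"
  using gU C.sub_add[OF sub_cl_U] C.sub_smult[OF sub_cl_U] by simp
 have "br ?P ?p (qq a b g h) (Wd [k]) = 2 .* br ?P ?p (Wd [g, h]) (Wd [k])"
  unfolding qq_word(1)[OF assms(1,2)] using 1 oc ghc kc
  by (simp add: linear_onD[OF scomm_linear_left] scomm_closed)
 thus ?thesis using 5 C.sub_smult[OF sub_cl_U] by simp
qed

text \<open>For two elements \<open>qq\<close> the Jacobi identity writes the bracket through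
  brackets of \<open>qq\<close> with letters, which lie in U by \<open>scomm_qq_letter\<close>;
  brackets of two elements of U lie in \<open>osp\<close>.\<close>

lemma scomm_gens:
 assumes x: "x \<in> osp_gens eps a b" "x \<in> part Ca p" and y: "y \<in> osp_gens eps a b" "y \<in> part Ca q"
 shows "br p q x y <: (osp eps a b)"
proof -
 note xc = Cl_part_carrier[OF x(2)] and yc = Cl_part_carrier[OF y(2)]
 have z0: "C0 <: (osp eps a b)" by (rule C.sub_zero[OF sub_osp])
 have zl: "br p q C0 y = C0" by (rule linear_on_zero[OF vspace_Cl vspace_Cl scomm_linear_left[OF yc]])
 have zr: "br p q x C0 = C0" by (rule linear_on_zero[OF vspace_Cl vspace_Cl scomm_linear_right[OF xc]])
 have wU: "Wd [g] \<in> cl_U a b" if "g \<in> Le" for g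
  unfolding cl_U_eq using that C.span_in by simp
 have UO: "cl_U a b \<subseteq> carrier (osp eps a b)" if eps
  unfolding osp_carrier cl_U_eq by (rule C.span_mono) (use that in \<open>auto simp: osp_gens_def\<close>)
 consider g h k l where "x = qq a b g h" "g \<in> Le" "h \<in> Le" "y = qq a b k l" "k \<in> Le" "l \<in> Le"
  | g h k where "x = qq a b g h" "g \<in> Le" "h \<in> Le" "y = Wd [k]" "k \<in> Le" eps
  | g h k where "y = qq a b g h" "g \<in> Le" "h \<in> Le" "x = Wd [k]" "k \<in> Le" eps
  | "x \<in> cl_U a b" "y \<in> cl_U a b"
  using x(1) y(1) wU unfolding osp_gens_def by (auto split: if_splits)
 thus ?thesis
 proof cases
  case 1
  let ?P = "gen_par g + gen_par h" and ?k = "gen_par k" and ?l = "gen_par l"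
  note kc = Wg(1)[OF 1(5)] and lc = Wg(1)[OF 1(6)]
  have D: "br ?P ?k x (Wd [k]) \<in> cl_U a b" "br ?P ?l x (Wd [l]) \<in> cl_U a b"
   using scomm_qq_letter[OF 1(2,3)] 1 by simp_all
  have xp: "x \<in> part Ca ?P" using qq_part 1 by simp
  have D': "br ?P ?k x (Wd [k]) \<in> part Ca (?P + ?k)" "br ?P ?l x (Wd [l]) \<in> part Ca (?P + ?l)"
   using scomm_part[OF xp Wg(2)] 1 by simp_all
  show ?thesis
  proof (cases "p = ?P \<and> q = ?k + ?l")
   case True
   have "br p q x y = br ?P (?k + ?l) x (br ?k ?l (Wd [k]) (Wd [l]))"
    using True qq_scomm[OF 1(5,6)] 1(4) by simp
   also have "\<dots> = br (?P + ?k) ?l (br ?P ?k x (Wd [k])) (Wd [l]) +.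
     (sign ?P ?k .* br ?k (?P + ?l) (Wd [k]) (br ?P ?l x (Wd [l])))"
    by (rule super_jacobi[OF xc kc lc])
   finally show ?thesis
    using scomm_U_in[OF D(1) D'(1) wU[OF 1(6)] Wg(2)[OF 1(6)], of eps]
     scomm_U_in[OF wU[OF 1(5)] Wg(2)[OF 1(5)] D(2) D'(2), of eps]
     C.sub_add[OF sub_osp] C.sub_smult[OF sub_osp] unfolding osp_carrier by simp
  next
   case False
   hence "x = C0 \<or> y = C0"
    using Cl_part_zero[OF x(2) xp] Cl_part_zero[OF y(2), of "?k + ?l"] qq_part[OF 1(5,6)] 1(4) by blast
   thus ?thesis using zl zr z0 by auto
  qed
 next
  case 2
  have xp: "x \<in> part Ca (gen_par g + gen_par h)" using qq_part 2 by simp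
  show ?thesis
  proof (cases "p = gen_par g + gen_par h \<and> q = gen_par k")
   case True
   thus ?thesis using scomm_qq_letter[OF 2(2,3,5)] UO 2 by auto
  next
   case False
   hence "x = C0 \<or> y = C0"
    using Cl_part_zero[OF x(2) xp] Cl_part_zero[OF y(2), of "gen_par k"] Wg(2)[OF 2(5)] 2(4) by blast
   thus ?thesis using zl zr z0 by auto
  qed
 next
  case 3
  have yp: "y \<in> part Ca (gen_par g + gen_par h)" using qq_part 3 by simp
  show ?thesis
  proof (cases "q = gen_par g + gen_par h \<and> p = gen_par k")
   case True
   have "br q p y x <: (osp eps a b)" using True scomm_qq_letter[OF 3(2,3,5)] UO 3 by auto
   thus ?thesis unfolding scomm_swap[OF xc yc, of p q] by (rule C.sub_smult[OF sub_osp])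
  next
   case False
   hence "x = C0 \<or> y = C0"
    using Cl_part_zero[OF y(2) yp] Cl_part_zero[OF x(2), of "gen_par k"] Wg(2)[OF 3(5)] 3(4) by blast
   thus ?thesis using zl zr z0 by auto
  qed
 next
  case 4
  thus ?thesis using scomm_U_in[OF 4(1) x(2) 4(2) y(2)] unfolding osp_carrier by blast
 qed
qed

lemma scomm_osp:
 assumes x: "x \<in> part (osp eps a b) p" and y: "y \<in> part (osp eps a b) q"
 shows "br p q x y \<in> part (osp eps a b) (p + q)"
proof -
 have xs: "x \<in> lin_span Ca (osp_gens eps a b \<inter> part Ca p)"
  and ys: "y \<in> lin_span Ca (osp_gens eps a b \<inter> part Ca q)"
  using x y by (auto intro: osp_part_span)
 have c: "osp_gens eps a b \<inter> part Ca p \<subseteq> carrier Ca" for p using osp_gens_closed by blast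
 have yc: "y <: Ca" using y osp_Cl by auto
 have "br p q x y <: (osp eps a b)"
 proof (rule linear_on_span_into[OF vspace_Cl vspace_Cl scomm_linear_left[OF yc] c sub_osp _ xs])
  fix u assume u: "u \<in> osp_gens eps a b \<inter> part Ca p"
  hence uc: "u <: Ca" using c by blast
  show "br p q u y <: (osp eps a b)"
   by (rule linear_on_span_into[OF vspace_Cl vspace_Cl scomm_linear_right[OF uc] c sub_osp _ ys])
    (use u scomm_gens in blast)
 qed
 thus ?thesis using scomm_part[of x p y q] x y by simp
qed

end

section \<open>Modules and isomorphisms\<close>

lemma superspaceD:
 assumes "superspace V"
 shows "vspace V" "submodule (part V p) CC V" "part V 0 \<inter> part V 1 = {\<zero>\<^bsub>V\<^esub>}"
  "v <: V ==> \<exists>x\<in>part V 0. \<exists>y\<in>part V 1. v = x \<oplus>\<^bsub>V\<^esub> y"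
  "v \<in> part V p ==> v <: V"
proof -
 show 1: "vspace V" using assms by (simp add: superspace_def module_CC_iff)
 show 2: "submodule (part V p) CC V" using assms by (simp add: superspace_def)
 show "part V 0 \<inter> part V 1 = {\<zero>\<^bsub>V\<^esub>}" using assms by (simp add: superspace_def)
 show "v <: V ==> \<exists>x\<in>part V 0. \<exists>y\<in>part V 1. v = x \<oplus>\<^bsub>V\<^esub> y" using assms by (simp add: superspace_def)
 show "v \<in> part V p ==> v <: V" by (rule vspace.sub_carrier[OF 1 2])
qed

lemma superspaceI:
 assumes "vspace V" "\<And>p. submodule (part V p) CC V" "\<And>x. x \<in> part V 0 ==> x \<in> part V 1 ==> x = \<zero>\<^bsub>V\<^esub>"
  "\<And>v. v <: V ==> \<exists>x\<in>part V 0. \<exists>y\<in>part V 1. v = x \<oplus>\<^bsub>V\<^esub> y"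
 shows "superspace V"
 unfolding superspace_def module_CC_iff
 using assms vspace.sub_zero[OF assms(1,2)] by blast

lemma part_unique:
 assumes V: "superspace V" and x: "x0 \<in> part V 0" "x1 \<in> part V 1" "y0 \<in> part V 0" "y1 \<in> part V 1"
  and e: "x0 \<oplus>\<^bsub>V\<^esub> x1 = y0 \<oplus>\<^bsub>V\<^esub> y1"
 shows "x0 = y0" "x1 = y1"
proof -
 interpret vspace V by (rule superspaceD[OF V])
 note c = superspaceD(5)[OF V]
 note xc = c[OF x(1)] c[OF x(2)] c[OF x(3)] c[OF x(4)]
 have "x0 \<ominus>\<^bsub>V\<^esub> y0 = y1 \<ominus>\<^bsub>V\<^esub> x1"
 proof -
  have "x0 \<ominus>\<^bsub>V\<^esub> y0 = (x0 \<oplus>\<^bsub>V\<^esub> x1) \<ominus>\<^bsub>V\<^esub> x1 \<ominus>\<^bsub>V\<^esub> y0" using xc by (simp add: a_minus_def a_assoc r_neg)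
  also have "\<dots> = (y0 \<oplus>\<^bsub>V\<^esub> y1) \<ominus>\<^bsub>V\<^esub> x1 \<ominus>\<^bsub>V\<^esub> y0" by (simp add: e)
  also have "(y0 \<oplus>\<^bsub>V\<^esub> y1) \<ominus>\<^bsub>V\<^esub> x1 = (y1 \<ominus>\<^bsub>V\<^esub> x1) \<oplus>\<^bsub>V\<^esub> y0" using xc by (simp add: a_minus_def a_ac)
  also have "(y1 \<ominus>\<^bsub>V\<^esub> x1) \<oplus>\<^bsub>V\<^esub> y0 \<ominus>\<^bsub>V\<^esub> y0 = y1 \<ominus>\<^bsub>V\<^esub> x1" using xc by (simp add: a_minus_def a_assoc r_neg)
  finally show ?thesis .
 qed
 moreover have "x0 \<ominus>\<^bsub>V\<^esub> y0 \<in> part V 0" "y1 \<ominus>\<^bsub>V\<^esub> x1 \<in> part V 1"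
  using sub_minus[OF superspaceD(2)[OF V]] x by auto
 ultimately have "x0 \<ominus>\<^bsub>V\<^esub> y0 = \<zero>\<^bsub>V\<^esub>" "y1 \<ominus>\<^bsub>V\<^esub> x1 = \<zero>\<^bsub>V\<^esub>" using superspaceD(3)[OF V] by auto
 thus "x0 = y0" "x1 = y1" using vs_eq_iff xc by auto
qed

text \<open>Exactly what inverting an isomorphism uses. It refers to a bare set of operators, so it
  applies alike to algebras, to \<open>osp\<close>, to its even part and to pairs.\<close>

definition wf_rep :: "'x set => ('x, 'v) rep => bool" where
 "wf_rep G M \<longleftrightarrow> superspace M \<and> (\<forall>x\<in>G. \<forall>v\<in>carrier M. act M x v <: M)"

lemma wf_repI: "superspace M ==> (\<And>x v. x \<in> G ==> v <: M ==> act M x v <: M) ==> wf_rep G M"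
 by (simp add: wf_rep_def)

definition iso_map :: "'x set => ('x, 'v) rep => ('x, 'w) rep => ('v => 'w) => bool" where
 "iso_map G M N \<phi> \<longleftrightarrow> bij_betw \<phi> (carrier M) (carrier N) \<and> linear_on M N \<phi> \<and>
   (\<forall>p. \<phi> ` part M p = part N p) \<and> (\<forall>x\<in>G. \<forall>v\<in>carrier M. \<phi> (act M x v) = act N x (\<phi> v))"

lemma rep_iso_iff: "rep_iso G M N \<longleftrightarrow> (\<exists>\<phi>. iso_map G M N \<phi>)"
proof
 assume "rep_iso G M N"
 then obtain \<phi> where p: "bij_betw \<phi> (carrier M) (carrier N)"
  "\<forall>v\<in>carrier M. \<forall>w\<in>carrier M. \<phi> (v \<oplus>\<^bsub>M\<^esub> w) = \<phi> v \<oplus>\<^bsub>N\<^esub> \<phi> w"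
  "\<forall>c. \<forall>v\<in>carrier M. \<phi> (c \<odot>\<^bsub>M\<^esub> v) = c \<odot>\<^bsub>N\<^esub> \<phi> v" "\<forall>p. \<phi> ` part M p = part N p"
  "\<forall>x\<in>G. \<forall>v\<in>carrier M. \<phi> (act M x v) = act N x (\<phi> v)" unfolding rep_iso_def by blast
 have "linear_on M N \<phi>" unfolding linear_on_def using p(2,3) bij_betwE[OF p(1)] by simp
 hence "iso_map G M N \<phi>" unfolding iso_map_def using p by simp
 thus "\<exists>\<phi>. iso_map G M N \<phi>" by (intro exI[where x = \<phi>])
next
 assume "\<exists>\<phi>. iso_map G M N \<phi>"
 then obtain \<phi> where "iso_map G M N \<phi>" by (rule exE)
 thus "rep_iso G M N" unfolding rep_iso_def iso_map_def linear_on_def by (intro exI[of _ \<phi>]) simp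
qed

lemma iso_mapD:
 assumes "iso_map G M N \<phi>"
 shows "bij_betw \<phi> (carrier M) (carrier N)" "linear_on M N \<phi>" "\<phi> ` part M p = part N p"
  "x \<in> G ==> v <: M ==> \<phi> (act M x v) = act N x (\<phi> v)"
  "v <: M ==> \<phi> v <: N" "w <: N ==> \<exists>v\<in>carrier M. w = \<phi> v"
  "v <: M ==> u <: M ==> \<phi> v = \<phi> u ==> v = u"
proof -
 note a = assms[unfolded iso_map_def]
 show b: "bij_betw \<phi> (carrier M) (carrier N)" using a by simp
 show "linear_on M N \<phi>" using a by simp
 show "\<phi> ` part M p = part N p" using a by simp
 show "x \<in> G ==> v <: M ==> \<phi> (act M x v) = act N x (\<phi> v)" using a by simp
 show "v <: M ==> \<phi> v <: N" using b by (rule bij_betwE[rule_format])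
 show "w <: N ==> \<exists>v\<in>carrier M. w = \<phi> v" using b unfolding bij_betw_def by blast
 show "v <: M ==> u <: M ==> \<phi> v = \<phi> u ==> v = u"
  using b unfolding bij_betw_def inj_on_def by blast
qed

lemma rep_iso_refl: "rep_iso G M M"
 unfolding rep_iso_iff iso_map_def
 by (rule exI[of _ "\<lambda>x. x"]) (simp add: linear_on_def bij_betw_def inj_on_def)

lemma iso_map_mono: "iso_map G M N \<phi> ==> H \<subseteq> G ==> iso_map H M N \<phi>"
 by (simp add: iso_map_def subset_iff)

lemma rep_iso_mono: "rep_iso G M N ==> H \<subseteq> G ==> rep_iso H M N"
 unfolding rep_iso_iff by (elim exE, rule exI, rule iso_map_mono)

lemma iso_map_inv:
 assumes wf: "wf_rep G M" and i: "iso_map G M N \<phi>"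
 shows "iso_map G N M (inv_into (carrier M) \<phi>)"
proof -
 let ?g = "inv_into (carrier M) \<phi>"
 note d = iso_mapD[OF i]
 have ss: "superspace M" using wf by (simp add: wf_rep_def)
 interpret M: vspace M by (rule superspaceD[OF ss])
 have inj: "inj_on \<phi> (carrier M)" using d(1) by (simp add: bij_betw_def)
 have g: "?g (\<phi> v) = v" if "v <: M" for v using inj that by (rule inv_into_f_f)
 have ac: "act M x v <: M" if "x \<in> G" "v <: M" for x v using wf that by (simp add: wf_rep_def)
 show ?thesis unfolding iso_map_def
 proof (intro conjI allI ballI)
  show "bij_betw ?g (carrier N) (carrier M)" by (rule bij_betw_inv_into[OF d(1)])
  show "linear_on N M ?g" unfolding linear_on_def
  proof (intro conjI allI ballI)
   fix x assume x: "x <: N"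
   then obtain x' where x': "x' <: M" "x = \<phi> x'" using d(6) by blast
   show "?g x <: M" using x' g by simp
   show "?g (c \<odot>\<^bsub>N\<^esub> x) = c \<odot>\<^bsub>M\<^esub> ?g x" for c
    using x' g linear_onD(3)[OF d(2) x'(1), of c] M.vs_sc by metis
   fix y assume y: "y <: N"
   then obtain y' where y': "y' <: M" "y = \<phi> y'" using d(6) by blast
   show "?g (x \<oplus>\<^bsub>N\<^esub> y) = ?g x \<oplus>\<^bsub>M\<^esub> ?g y"
    using x' y' g linear_onD(2)[OF d(2) x'(1) y'(1)] M.a_closed by metis
  qed
  fix p
  have "?g ` \<phi> ` part M p = part M p"
   using g superspaceD(5)[OF ss] by (auto simp: image_image)
  thus "?g ` part N p = part M p" by (simp add: d(3))
 next
  fix x v assume x: "x \<in> G" and v: "v <: N"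
  then obtain v' where v': "v' <: M" "v = \<phi> v'" using d(6) by blast
  show "?g (act N x v) = act M x (?g v)" using d(4)[OF x v'(1)] g v' ac[OF x v'(1)] by metis
 qed
qed

lemma rep_iso_sym: "wf_rep G M ==> rep_iso G M N ==> rep_iso G N M"
 unfolding rep_iso_iff by (elim exE, rule exI, rule iso_map_inv)

lemma iso_map_comp:
 assumes i: "iso_map G M N \<phi>" and j: "iso_map G N P \<psi>"
 shows "iso_map G M P (\<lambda>x. \<psi> (\<phi> x))"
proof -
 note d = iso_mapD[OF i] and e = iso_mapD[OF j]
 show ?thesis unfolding iso_map_def
 proof (intro conjI allI ballI)
  show "bij_betw (\<lambda>x. \<psi> (\<phi> x)) (carrier M) (carrier P)" using bij_betw_trans[OF d(1) e(1)] by (simp add: comp_def)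
  show "linear_on M P (\<lambda>x. \<psi> (\<phi> x))" by (rule linear_on_comp[OF d(2) e(2)])
  show "(\<lambda>x. \<psi> (\<phi> x)) ` part M p = part P p" for p using d(3)[of p] e(3)[of p] by (metis image_image)
 next
  fix x v assume "x \<in> G" "v <: M"
  thus "\<psi> (\<phi> (act M x v)) = act P x (\<psi> (\<phi> v))" using d(4,5) e(4) by simp
 qed
qed

lemma rep_iso_trans: "rep_iso G M N ==> rep_iso G N P ==> rep_iso G M P"
 unfolding rep_iso_iff by (elim exE, rule exI, rule iso_map_comp)

lemma iso_map_wf:
 assumes "wf_rep G M" "iso_map G M N \<phi>" "x \<in> G" "w <: N"
 shows "act N x w <: N"
proof -
 obtain v where "v <: M" "w = \<phi> v" using iso_mapD(6)[OF assms(2,4)] by blast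
 thus ?thesis using assms iso_mapD(4,5)[OF assms(2)] unfolding wf_rep_def by metis
qed

lemma simple_rep_iso:
 assumes wf: "wf_rep G M" and N: "superspace N" and i: "rep_iso G M N" and s: "simple_rep G M"
 shows "simple_rep G N"
proof -
 obtain \<phi> where \<phi>: "iso_map G M N \<phi>" using i rep_iso_iff by blast
 note d = iso_mapD[OF \<phi>]
 have M: "superspace M" using wf by (simp add: wf_rep_def)
 interpret M: vspace M by (rule superspaceD[OF M])
 interpret N: vspace N by (rule superspaceD[OF N])
 have z: "\<phi> \<zero>\<^bsub>M\<^esub> = \<zero>\<^bsub>N\<^esub>" by (rule linear_on_zero[OF M.vspace_axioms N.vspace_axioms d(2)])
 have ne: "carrier N \<noteq> {\<zero>\<^bsub>N\<^esub>}"
 proof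
  assume e: "carrier N = {\<zero>\<^bsub>N\<^esub>}"
  have "v = \<zero>\<^bsub>M\<^esub>" if "v <: M" for v
   using d(7)[OF that M.zero_closed] d(5)[OF that] e z by simp
  thus False using s M.zero_closed unfolding simple_rep_def by blast
 qed
 have "W = {\<zero>\<^bsub>N\<^esub>} \<or> W = carrier N" if W: "graded_submodule G N W" for W
 proof -
  let ?W = "{v \<in> carrier M. \<phi> v \<in> W}"
  have sW: "submodule W CC N" and gW: "\<And>w. w \<in> W ==> \<exists>x\<in>W \<inter> part N 0. \<exists>y\<in>W \<inter> part N 1. w = x \<oplus>\<^bsub>N\<^esub> y"
   and aW: "\<And>x w. x \<in> G ==> w \<in> W ==> act N x w \<in> W"
   using W unfolding graded_submodule_def by blast+
  have "graded_submodule G M ?W" unfolding graded_submodule_def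
  proof (intro conjI ballI)
   show "submodule ?W CC M"
    by (rule M.subI) (auto simp: z linear_onD[OF d(2)] N.sub_zero[OF sW] N.sub_add[OF sW] N.sub_smult[OF sW])
  next
   fix v assume v: "v \<in> ?W"
   then obtain x y where xy: "x \<in> W \<inter> part N 0" "y \<in> W \<inter> part N 1" "\<phi> v = x \<oplus>\<^bsub>N\<^esub> y" using gW by blast
   obtain x' where x': "x' \<in> part M 0" "x = \<phi> x'" using xy(1) d(3)[of 0] by blast
   obtain y' where y': "y' \<in> part M 1" "y = \<phi> y'" using xy(2) d(3)[of 1] by blast
   note c = superspaceD(5)[OF M x'(1)] superspaceD(5)[OF M y'(1)]
   have "\<phi> v = \<phi> (x' \<oplus>\<^bsub>M\<^esub> y')" using xy x' y' c by (simp add: linear_onD[OF d(2)])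
   hence "v = x' \<oplus>\<^bsub>M\<^esub> y'" using d(7) v c by simp
   moreover have "x' \<in> ?W \<inter> part M 0" "y' \<in> ?W \<inter> part M 1" using xy x' y' c by auto
   ultimately show "\<exists>x\<in>?W \<inter> part M 0. \<exists>y\<in>?W \<inter> part M 1. v = x \<oplus>\<^bsub>M\<^esub> y" by blast
  next
   fix x v assume "x \<in> G" "v \<in> ?W"
   thus "act M x v \<in> ?W" using wf d(4) aW unfolding wf_rep_def by auto
  qed
  hence "?W = {\<zero>\<^bsub>M\<^esub>} \<or> ?W = carrier M" using s unfolding simple_rep_def by blast
  moreover have "W = \<phi> ` ?W" using d(6) N.sub_carrier[OF sW] by blast
  moreover have "\<phi> ` carrier M = carrier N" using d(1) by (simp add: bij_betw_def)
  ultimately show ?thesis using z by force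
 qed
 thus ?thesis unfolding simple_rep_def using ne by blast
qed

section \<open>Graded actions, their transport and direct sums\<close>

lemma graded_actionD:
 assumes "graded_action G M"
 shows "superspace M" "x <: G ==> linear_on M M (act M x)"
  "x <: G ==> y <: G ==> v <: M ==> act M (x \<oplus>\<^bsub>G\<^esub> y) v = act M x v \<oplus>\<^bsub>M\<^esub> act M y v"
  "x <: G ==> v <: M ==> act M (c \<odot>\<^bsub>G\<^esub> x) v = c \<odot>\<^bsub>M\<^esub> act M x v"
  "x \<in> part G p ==> v \<in> part M q ==> act M x v \<in> part M (p + q)"
  "v <: M ==> linear_on G M (\<lambda>x. act M x v)"
  "x <: G ==> v <: M ==> act M x v <: M"
  "wf_rep (carrier G) M"
 using assms unfolding graded_action_def linear_on_def wf_rep_def by simp_all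

text \<open>N is only given as a superspace with some action; surjectivity of the isomorphism
  carries every module law over from M.\<close>

lemma assoc_module_iso:
 assumes M: "assoc_module A M" and N: "superspace N" and i: "rep_iso (carrier A) M N"
  and pA: "\<And>p. part A p \<subseteq> carrier A"
  and cl: "\<And>x y. x <: A ==> y <: A ==> x \<oplus>\<^bsub>A\<^esub> y <: A"
   "\<And>x c. x <: A ==> c \<odot>\<^bsub>A\<^esub> x <: A"
   "\<And>x y. x <: A ==> y <: A ==> x \<otimes>\<^bsub>A\<^esub> y <: A" "\<one>\<^bsub>A\<^esub> <: A"
 shows "assoc_module A N"
proof -
 obtain \<phi> where \<phi>: "iso_map (carrier A) M N \<phi>" using i rep_iso_iff by blast
 note d = iso_mapD[OF \<phi>]
 have gM: "graded_action A M" using M by (simp add: assoc_module_def)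
 note g = graded_actionD[OF gM]
 interpret M: vspace M by (rule superspaceD[OF g(1)])
 note l = linear_onD[OF d(2)]
 have e: "act N x (\<phi> v) = \<phi> (act M x v)" if "x <: A" "v <: M" for x v using d(4) that by simp
 have "graded_action A N" unfolding graded_action_def
 proof (intro conjI ballI allI)
  fix x v assume x: "x <: A" and v: "v <: N"
  then obtain v' where v': "v' <: M" "v = \<phi> v'" using d(6) by blast
  show "act N x v <: N" using e[OF x v'(1)] v' g(7)[OF x v'(1)] l(1) by simp
  show "act N x (c \<odot>\<^bsub>N\<^esub> v) = c \<odot>\<^bsub>N\<^esub> act N x v" for c
   using v' x e[OF x M.vs_sc[OF v'(1)]] by (simp add: l(3)[symmetric] e linear_onD[OF g(2)])
  show "act N (c \<odot>\<^bsub>A\<^esub> x) v = c \<odot>\<^bsub>N\<^esub> act N x v" for c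
   using v' x cl(2)[OF x] by (simp add: l(3)[symmetric] e g(4,7))
  fix w assume w: "w <: N"
  then obtain w' where w': "w' <: M" "w = \<phi> w'" using d(6) by blast
  show "act N x (v \<oplus>\<^bsub>N\<^esub> w) = act N x v \<oplus>\<^bsub>N\<^esub> act N x w"
   using v' w' x by (simp add: l(2)[symmetric] e linear_onD[OF g(2)])
 next
  fix x y v assume x: "x <: A" and y: "y <: A" and v: "v <: N"
  then obtain v' where v': "v' <: M" "v = \<phi> v'" using d(6) by blast
  show "act N (x \<oplus>\<^bsub>A\<^esub> y) v = act N x v \<oplus>\<^bsub>N\<^esub> act N y v"
   using v' x y cl(1)[OF x y] by (simp add: l(2)[symmetric] e g(3,7))
 next
  fix p q x v assume x: "x \<in> part A p" and v: "v \<in> part N q"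
  then obtain v' where v': "v' \<in> part M q" "v = \<phi> v'" using d(3)[of q] by blast
  have "\<phi> (act M x v') \<in> part N (p + q)" using g(5)[OF x v'(1)] d(3) by blast
  thus "act N x v \<in> part N (p + q)" using e[OF subsetD[OF pA x] superspaceD(5)[OF g(1) v'(1)]] v' by simp
 qed (rule N)
 moreover have "act N (x \<otimes>\<^bsub>A\<^esub> y) v = act N x (act N y v)" if xy: "x <: A" "y <: A" and v: "v <: N" for x y v
 proof -
  obtain v' where v': "v' <: M" "v = \<phi> v'" using d(6)[OF v] by blast
  show ?thesis using v' xy cl(3)[OF xy] M by (simp add: e g(7) assoc_module_def)
 qed
 moreover have "act N \<one>\<^bsub>A\<^esub> v = v" if v: "v <: N" for v
 proof -
  obtain v' where v': "v' <: M" "v = \<phi> v'" using d(6)[OF v] by blast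
  show ?thesis using v' cl(4) M by (simp add: e assoc_module_def)
 qed
 ultimately show ?thesis unfolding assoc_module_def by blast
qed

lemma weight_module_iso:
 assumes M: "wf_rep G M" and N: "superspace N" and i: "rep_iso G M N" and H: "H \<subseteq> G" and w: "weight_module M H"
 shows "weight_module N H"
proof -
 obtain \<phi> where \<phi>: "iso_map G M N \<phi>" using i rep_iso_iff by blast
 note d = iso_mapD[OF \<phi>]
 have M': "superspace M" using M by (simp add: wf_rep_def)
 interpret M: vspace M by (rule superspaceD[OF M'])
 interpret N: vspace N by (rule superspaceD[OF N])
 have wc: "(\<Union>\<mu>. weight_space M H \<mu>) \<subseteq> carrier M" "(\<Union>\<mu>. weight_space N H \<mu>) \<subseteq> carrier N" by (auto simp: weight_space_def)
 have "carrier N = \<phi> ` carrier M" using d(1) by (simp add: bij_betw_def)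
 also have "\<dots> = lin_span N (\<phi> ` (\<Union>\<mu>. weight_space M H \<mu>))"
  using linear_image_span[OF M.vspace_axioms N.vspace_axioms d(2) wc(1)] w by (simp add: weight_module_def)
 also have "\<dots> \<subseteq> lin_span N (\<Union>\<mu>. weight_space N H \<mu>)"
 proof (rule N.span_mono, rule image_subsetI)
  fix v assume "v \<in> (\<Union>\<mu>. weight_space M H \<mu>)"
  then obtain \<mu> where v: "v <: M" "\<forall>h\<in>H. act M h v = \<mu> h \<odot>\<^bsub>M\<^esub> v" by (auto simp: weight_space_def)
  have "act N h (\<phi> v) = \<mu> h \<odot>\<^bsub>N\<^esub> \<phi> v" if "h \<in> H" for h
   using d(4)[of h v] v that H by (auto simp: linear_onD[OF d(2)])
  hence "\<phi> v \<in> weight_space N H \<mu>" using v d(5) by (simp add: weight_space_def)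
  thus "\<phi> v \<in> (\<Union>\<mu>. weight_space N H \<mu>)" by blast
 qed
 finally have "carrier N \<subseteq> lin_span N (\<Union>\<mu>. weight_space N H \<mu>)" .
 thus ?thesis unfolding weight_module_def using N.span_carrier[OF wc(2)] by blast
qed

lemma dsum_simps [simp]:
 "carrier (dsum M N) = carrier M \<times> carrier N" "\<zero>\<^bsub>dsum M N\<^esub> = (\<zero>\<^bsub>M\<^esub>, \<zero>\<^bsub>N\<^esub>)"
 "(v, w) \<oplus>\<^bsub>dsum M N\<^esub> (v', w') = (v \<oplus>\<^bsub>M\<^esub> v', w \<oplus>\<^bsub>N\<^esub> w')" "c \<odot>\<^bsub>dsum M N\<^esub> (v, w) = (c \<odot>\<^bsub>M\<^esub> v, c \<odot>\<^bsub>N\<^esub> w)"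
 "part (dsum M N) p = part M p \<times> part N p" "act (dsum M N) x (v, w) = (act M x v, act N x w)"
 by (simp_all add: dsum_def)

lemma superspace_dsum:
 assumes M: "superspace M" and N: "superspace N" shows "superspace (dsum M N)"
proof -
 interpret M: vspace M by (rule superspaceD[OF M])
 interpret N: vspace N by (rule superspaceD[OF N])
 have 1: "vspace (dsum M N)"
 proof (rule vspaceI)
  fix x assume x: "x <: (dsum M N)"
  obtain v w where [simp]: "x = (v, w)" by (cases x)
  have c: "v <: M" "w <: N" using x by auto
  show "(- 1) \<odot>\<^bsub>dsum M N\<^esub> x \<oplus>\<^bsub>dsum M N\<^esub> x = \<zero>\<^bsub>dsum M N\<^esub>"
   using M.vs_neg[OF c(1)] M.l_neg[OF c(1)] N.vs_neg[OF c(2)] N.l_neg[OF c(2)] by simp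
 qed (auto simp: M.vs_ladd N.vs_ladd M.vs_radd N.vs_radd M.vs_assoc N.vs_assoc M.a_ac N.a_ac)
 then interpret D: vspace "dsum M N" .
 note pM = superspaceD(2)[OF M] and pN = superspaceD(2)[OF N]
 show ?thesis
 proof (rule superspaceI[OF 1])
  show "submodule (part (dsum M N) p) CC (dsum M N)" for p
   by (rule D.subI) (auto simp: M.sub_zero[OF pM] N.sub_zero[OF pN] M.sub_add[OF pM] N.sub_add[OF pN]
     M.sub_smult[OF pM] N.sub_smult[OF pN] M.sub_carrier[OF pM] N.sub_carrier[OF pN])
 next
  fix x assume "x \<in> part (dsum M N) 0" "x \<in> part (dsum M N) 1"
  thus "x = \<zero>\<^bsub>dsum M N\<^esub>" using superspaceD(3)[OF M] superspaceD(3)[OF N] by auto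
 next
  fix v assume "v <: (dsum M N)"
  then obtain m n where v: "v = (m, n)" "m <: M" "n <: N" by auto
  obtain m0 m1 where m: "m0 \<in> part M 0" "m1 \<in> part M 1" "m = m0 \<oplus>\<^bsub>M\<^esub> m1" using superspaceD(4)[OF M v(2)] by blast
  obtain n0 n1 where n: "n0 \<in> part N 0" "n1 \<in> part N 1" "n = n0 \<oplus>\<^bsub>N\<^esub> n1" using superspaceD(4)[OF N v(3)] by blast
  show "\<exists>x\<in>part (dsum M N) 0. \<exists>y\<in>part (dsum M N) 1. v = x \<oplus>\<^bsub>dsum M N\<^esub> y"
   by (rule bexI[of _ "(m0, n0)"], rule bexI[of _ "(m1, n1)"]) (use v m n in auto)
 qed
qed

lemma assoc_module_dsum:
 assumes M: "assoc_module A M" and N: "assoc_module A N"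
 shows "assoc_module A (dsum M N)"
proof -
 have gM: "graded_action A M" and gN: "graded_action A N" using M N by (simp_all add: assoc_module_def)
 note m = graded_actionD[OF gM] and n = graded_actionD[OF gN]
 have "graded_action A (dsum M N)" unfolding graded_action_def
  using superspace_dsum[OF m(1) n(1)]
  by (auto simp: m(3-5,7) n(3-5,7) linear_onD[OF m(2)] linear_onD[OF n(2)])
 thus ?thesis using M N by (auto simp: assoc_module_def)
qed

text \<open>The induction hypotheses also record that x and y lie in the span. The operators in
  \<open>cyclic_weight_space\<close> are shown to commute only there.\<close>

lemma (in vspace) span_induct_strong [consumes 2, case_names base zero add smult]:
 assumes x: "x \<in> lin_span V S" and S: "S \<subseteq> carrier V"
  and b: "\<And>x. x \<in> S ==> P x" and z: "P \<zero>"
  and a: "\<And>x y. x \<in> lin_span V S ==> y \<in> lin_span V S ==> P x ==> P y ==> P (x \<oplus> y)"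
  and m: "\<And>c x. x \<in> lin_span V S ==> P x ==> P (c \<odot> x)"
 shows "P x"
proof -
 note s = span_sub[OF S]
 have "x \<in> lin_span V S \<and> P x" using x S
  by (induction rule: span_induct) (use b z a m span_in sub_zero[OF s] sub_add[OF s] sub_smult[OF s] in auto)
 thus ?thesis ..
qed

section \<open>Weight modules\<close>

text \<open>The image of the enveloping algebra of \<open>osp eps a b\<close>, so that both series
  are treated at once.\<close>

definition Calg :: "bool => enat => enat => cl superspace" where
 "Calg eps a b = (if eps then Cl a b else Cl_ev a b)"

definition aw :: "bool => enat => enat => gen list set" where
 "aw eps a b = {w \<in> lists (letters a b). eps \<or> even (length w)}"

lemma Calg_ops [simp]:
 "ring.add (Calg eps a b) = ring.add (Cl a b)" "ring.zero (Calg eps a b) = ring.zero (Cl a b)"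
 "module.smult (Calg eps a b) = module.smult (Cl a b)" "monoid.mult (Calg eps a b) = monoid.mult (Cl a b)"
 "monoid.one (Calg eps a b) = wrd a b []"
 by (simp_all add: Calg_def Cl_ev_def Cl_one)

lemma Calg_carrier: "carrier (Calg eps a b) = lin_span (Cl a b) (wrd a b ` aw eps a b)"
 unfolding Calg_def aw_def using Cl_span[of a b] Cl_ev_span[of a b] by auto

lemma aw_lists: "w \<in> aw eps a b ==> w \<in> lists (letters a b)" by (simp add: aw_def)
lemma aw_append: "u \<in> aw eps a b ==> w \<in> aw eps a b ==> u @ w \<in> aw eps a b" by (auto simp: aw_def)
lemma aw_Nil [simp]: "[] \<in> aw eps a b" by (simp add: aw_def)
lemma aw_u: "i \<in> Idx a b ==> [Xi i, Eta i] \<in> aw eps a b" by (simp add: aw_def)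
lemma aw_Cl: "wrd a b ` aw eps a b \<subseteq> carrier (Cl a b)" using W_carrier aw_lists by blast

lemma sub_Calg: "submodule (carrier (Calg eps a b)) CC (Cl a b)"
 unfolding Calg_carrier by (rule vspace.span_sub[OF vspace_Cl aw_Cl])

lemma Calg_Cl: "x <: (Calg eps a b) ==> x <: (Cl a b)"
 by (rule vspace.sub_carrier[OF vspace_Cl sub_Calg])

lemma aw_Calg: "w \<in> aw eps a b ==> wrd a b w <: (Calg eps a b)"
 unfolding Calg_carrier by (rule vspace.span_in[OF vspace_Cl]) simp

lemma Calg_part [simp]: "part (Calg eps a b) p = carrier (Calg eps a b) \<inter> part (Cl a b) p"
 using Cl_part_carrier[of _ a b p] by (auto simp: Calg_def Cl_ev_def)

lemma cl_u_Calg: "i \<in> Idx a b ==> cl_u a b i <: (Calg eps a b)"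
 using aw_Calg[OF aw_u] by (simp add: cl_u_eq)

lemma vspace_Calg: "vspace (Calg eps a b)"
proof -
 interpret C: vspace "Cl a b" by (rule vspace_Cl)
 note s = sub_Calg[of eps a b]
 note c = Calg_Cl[of _ eps a b]
 show ?thesis
 proof (rule vspaceI)
  fix x assume "x <: (Calg eps a b)"
  hence x: "x <: (Cl a b)" by (rule c)
  show "(- 1) \<odot>\<^bsub>Calg eps a b\<^esub> x \<oplus>\<^bsub>Calg eps a b\<^esub> x = \<zero>\<^bsub>Calg eps a b\<^esub>"
   using C.vs_neg[OF x] C.l_neg[OF x] by simp
 qed (auto simp: C.sub_zero[OF s] C.sub_add[OF s] C.sub_smult[OF s] C.vs_ladd C.vs_radd C.vs_assoc C.a_ac c)
qed

lemma Calg_mult_closed: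
 assumes x: "x <: (Calg eps a b)" and y: "y <: (Calg eps a b)"
 shows "x \<otimes>\<^bsub>Cl a b\<^esub> y <: (Calg eps a b)"
proof (rule linear_on_span_into[OF vspace_Cl vspace_Cl Cl_mult_left[OF Calg_Cl[OF y]] aw_Cl sub_Calg _ x[unfolded Calg_carrier]])
 fix u assume "u \<in> wrd a b ` aw eps a b"
 then obtain w where w: "u = wrd a b w" "w \<in> aw eps a b" by blast
 show "u \<otimes>\<^bsub>Cl a b\<^esub> y <: (Calg eps a b)"
 proof (rule linear_on_span_into[OF vspace_Cl vspace_Cl Cl_mult_right aw_Cl sub_Calg _ y[unfolded Calg_carrier]])
  show "u <: (Cl a b)" using w aw_Cl by blast
  fix v assume "v \<in> wrd a b ` aw eps a b"
  then obtain w' where w': "v = wrd a b w'" "w' \<in> aw eps a b" by blast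
  show "u \<otimes>\<^bsub>Cl a b\<^esub> v <: (Calg eps a b)"
   using W_mult[OF aw_lists[OF w(2)] aw_lists[OF w'(2)]] aw_Calg[OF aw_append[OF w(2) w'(2)]] w w' by simp
 qed
qed

lemma aw_homog: "wrd a b ` aw eps a b \<subseteq> part (Cl a b) 0 \<union> part (Cl a b) 1"
proof (rule image_subsetI)
 fix w assume "w \<in> aw eps a b"
 thus "wrd a b w \<in> part (Cl a b) 0 \<union> part (Cl a b) 1" using W_part[OF aw_lists, of w eps a b] by (cases "wpar w") auto
qed

lemma Calg_part_span:
 assumes "x \<in> part (Calg eps a b) p"
 shows "x \<in> lin_span (Cl a b) (wrd a b ` {w \<in> aw eps a b. wpar w = p})"
proof -
 interpret C: vspace "Cl a b" by (rule vspace_Cl)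
 let ?S = "lin_span (Cl a b) (wrd a b ` {w \<in> aw eps a b. wpar w = p})"
 have S: "submodule ?S CC (Cl a b)" by (rule C.span_sub) (use aw_Cl in blast)
 have "wrd a b ` aw eps a b \<inter> part (Cl a b) p \<subseteq> ?S"
 proof clarify
  fix w assume w: "w \<in> aw eps a b" "wrd a b w \<in> part (Cl a b) p"
  show "wrd a b w \<in> ?S"
  proof (cases "wpar w = p")
   case True thus ?thesis using w(1) C.span_in by simp
  next
   case False
   thus ?thesis using Cl_part_zero[OF W_part[OF aw_lists[OF w(1)]] w(2)] C.sub_zero[OF S] by simp
  qed
 qed
 hence "lin_span (Cl a b) (wrd a b ` aw eps a b \<inter> part (Cl a b) p) \<subseteq> ?S" by (rule C.span_minimal[OF S])
 thus ?thesis using span_homogeneous[OF superspace_Cl aw_homog] assms unfolding Calg_part Calg_carrier by blast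
qed

lemma Calg_decompose:
 assumes "x <: (Calg eps a b)"
 shows "\<exists>x0\<in>part (Calg eps a b) 0. \<exists>x1\<in>part (Calg eps a b) 1. x = x0 \<oplus>\<^bsub>Cl a b\<^esub> x1"
proof -
 interpret C: vspace "Cl a b" by (rule vspace_Cl)
 let ?B = "wrd a b ` aw eps a b"
 have s: "lin_span (Cl a b) (?B \<inter> part (Cl a b) p) \<subseteq> part (Calg eps a b) p" for p
  using C.span_minimal[OF Cl_part_sub, of "?B \<inter> part (Cl a b) p" p] C.span_mono[of "?B \<inter> part (Cl a b) p" ?B]
  by (auto simp: Calg_carrier)
 show ?thesis using span_decompose[OF superspace_Cl aw_homog assms[unfolded Calg_carrier]] s by blast
qed

lemma Up_Calg: "x \<in> Up a b ==> x <: (Calg eps a b)"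
proof (induction rule: Up.induct)
 case one thus ?case by (rule aw_Calg) simp
next
 case (add x y) thus ?case using vspace.sub_add[OF vspace_Cl sub_Calg] by blast
next
 case (smult x c) thus ?case using vspace.sub_smult[OF vspace_Cl sub_Calg] by blast
next
 case (mult x i) thus ?case using Calg_mult_closed cl_u_Calg by blast
qed

text \<open>The weight is a function of the index i instead of the operator u_i, so that integer
  shifts can be added to it. The zero vector is allowed.\<close>

definition wvec :: "enat => enat => (cl, 'v) rep => (int => complex) => 'v => bool" where
 "wvec a b M lam v \<longleftrightarrow> v <: M \<and> (\<forall>i\<in>Idx a b. act M (cl_u a b i) v = lam i \<odot>\<^bsub>M\<^esub> v)"

locale amod =
 fixes eps :: bool and a b :: enat and M :: "(cl, 'v) rep"
 assumes am: "assoc_module (Calg eps a b) M"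
begin

abbreviation (input) "A \<equiv> carrier (Calg eps a b)"

lemma ga: "graded_action (Calg eps a b) M" using am by (simp add: assoc_module_def)

lemmas gaD = graded_actionD[OF ga]

lemma ss: "superspace M" by (rule gaD(1))

sublocale vspace M by (rule superspaceD(1)[OF ss])

lemma act_closed: "x \<in> A ==> v <: M ==> act M x v <: M" by (rule gaD(7))

lemma act_mult: "x \<in> A ==> y \<in> A ==> v <: M ==> act M (x \<otimes>\<^bsub>Cl a b\<^esub> y) v = act M x (act M y v)"
 using am by (simp add: assoc_module_def)

lemma act_one: "v <: M ==> act M (wrd a b []) v = v"
 using am by (simp add: assoc_module_def)

lemma act_word: "u \<in> aw eps a b ==> w \<in> aw eps a b ==> v <: M ==>
 act M (wrd a b (u @ w)) v = act M (wrd a b u) (act M (wrd a b w) v)"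
 using act_mult[of "wrd a b u" "wrd a b w" v] W_mult[OF aw_lists aw_lists] by (simp add: aw_Calg)

lemma act_add: "x \<in> A ==> y \<in> A ==> v <: M ==> act M (x \<oplus>\<^bsub>Cl a b\<^esub> y) v = act M x v \<oplus>\<^bsub>M\<^esub> act M y v"
 using gaD(3) by simp
lemma act_smult: "x \<in> A ==> v <: M ==> act M (c \<odot>\<^bsub>Cl a b\<^esub> x) v = c \<odot>\<^bsub>M\<^esub> act M x v"
 using gaD(4)[of x] by simp
lemmas act_lin = linear_onD[OF gaD(2)]

lemma act_zero: "x \<in> A ==> act M x \<zero>\<^bsub>M\<^esub> = \<zero>\<^bsub>M\<^esub>"
 by (rule linear_on_zero[OF vspace_axioms vspace_axioms gaD(2)])

lemma act_span:
 assumes v: "v <: M" and x: "x \<in> A"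
 shows "act M x v \<in> lin_span M ((\<lambda>w. act M (wrd a b w) v) ` aw eps a b)"
proof -
 have c: "(\<lambda>w. act M (wrd a b w) v) ` aw eps a b \<subseteq> carrier M" using act_closed aw_Calg v by blast
 have l: "linear_on (Calg eps a b) M (\<lambda>x. act M x v)" by (rule gaD(6)[OF v])
 have x': "x \<in> lin_span (Calg eps a b) (wrd a b ` aw eps a b)"
 proof -
  interpret A: vspace "Calg eps a b" by (rule vspace_Calg)
  interpret C: vspace "Cl a b" by (rule vspace_Cl)
  have ac: "wrd a b ` aw eps a b \<subseteq> A" using aw_Calg by blast
  show ?thesis using x[unfolded Calg_carrier] aw_Cl
  proof (induction rule: C.span_induct)
   case (base x) thus ?case by (rule A.span_in)
  next
   case zero thus ?case using A.sub_zero[OF A.span_sub[OF ac]] by simp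
  next
   case (add x y) thus ?case using A.sub_add[OF A.span_sub[OF ac]] by simp
  next
   case (smult c x) thus ?case using A.sub_smult[OF A.span_sub[OF ac]] by simp
  qed
 qed
 show ?thesis
  by (rule linear_on_span_into[OF vspace_Calg vspace_axioms l _ span_sub[OF c] _ x'])
   (use aw_Calg span_in in auto)
qed

lemma word_shift:
 assumes v: "wvec a b M lam v" and w: "w \<in> aw eps a b"
 shows "wvec a b M (\<lambda>i. lam i + of_int (shift i w)) (act M (wrd a b w) v)"
proof -
 have vc: "v <: M" using v by (simp add: wvec_def)
 have wc: "wrd a b w \<in> A" by (rule aw_Calg[OF w])
 have "act M (cl_u a b i) (act M (wrd a b w) v) = (lam i + of_int (shift i w)) \<odot>\<^bsub>M\<^esub> act M (wrd a b w) v"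
  if i: "i \<in> Idx a b" for i
 proof -
  have uc: "cl_u a b i \<in> A" by (rule cl_u_Calg[OF i])
  have "act M (cl_u a b i) (act M (wrd a b w) v) = act M (cl_u a b i \<otimes>\<^bsub>Cl a b\<^esub> wrd a b w) v"
   using act_mult[OF uc wc vc] by simp
  also have "\<dots> = act M (wrd a b w) (act M (cl_u a b i) v) \<oplus>\<^bsub>M\<^esub> of_int (shift i w) \<odot>\<^bsub>M\<^esub> act M (wrd a b w) v"
   unfolding u_word[OF i aw_lists[OF w]]
   using uc wc vc Calg_mult_closed[OF wc uc] vspace.sub_smult[OF vspace_Cl sub_Calg wc]
   by (simp add: act_add act_smult act_mult)
  also have "act M (wrd a b w) (act M (cl_u a b i) v) = lam i \<odot>\<^bsub>M\<^esub> act M (wrd a b w) v"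
   using v i act_lin(3)[OF wc vc] by (simp add: wvec_def)
  finally show ?thesis using act_closed[OF wc vc] by (simp add: vs_ladd)
 qed
 thus ?thesis using act_closed[OF wc vc] by (simp add: wvec_def)
qed

lemma Up_scalar: "x \<in> Up a b ==> wvec a b M lam v ==> \<exists>c. act M x v = c \<odot>\<^bsub>M\<^esub> v"
proof (induction rule: Up.induct)
 case one
 hence "act M (wrd a b []) v = 1 \<odot>\<^bsub>M\<^esub> v" by (simp add: act_one wvec_def)
 thus ?case by blast
next
 case (add x y)
 then obtain c d where "act M x v = c \<odot>\<^bsub>M\<^esub> v" "act M y v = d \<odot>\<^bsub>M\<^esub> v" by blast
 hence "act M (x \<oplus>\<^bsub>Cl a b\<^esub> y) v = (c + d) \<odot>\<^bsub>M\<^esub> v"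
  using add Up_Calg[of _ a b eps] by (simp add: act_add vs_ladd wvec_def)
 thus ?case by blast
next
 case (smult x k)
 then obtain c where "act M x v = c \<odot>\<^bsub>M\<^esub> v" by blast
 hence "act M (k \<odot>\<^bsub>Cl a b\<^esub> x) v = (k * c) \<odot>\<^bsub>M\<^esub> v"
  using smult Up_Calg[of _ a b eps] by (simp add: act_smult vs_assoc wvec_def)
 thus ?case by blast
next
 case (mult x i)
 then obtain c where c: "act M x v = c \<odot>\<^bsub>M\<^esub> v" by blast
 have x: "x \<in> A" using mult Up_Calg by blast
 have v: "v <: M" "act M (cl_u a b i) v = lam i \<odot>\<^bsub>M\<^esub> v" using mult by (auto simp: wvec_def)
 have "act M (x \<otimes>\<^bsub>Cl a b\<^esub> cl_u a b i) v = (lam i * c) \<odot>\<^bsub>M\<^esub> v"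
  using act_mult[OF x cl_u_Calg[OF mult(2)] v(1)] v c act_lin(3)[OF x v(1)] by (simp add: vs_assoc)
 thus ?case by blast
qed

text \<open>The operator u_i - c for the pair (i, c): it kills the vectors whose i-th weight is
  c.\<close>

definition eig :: "int \<times> complex => 'v => 'v" where
 "eig ic x = act M (cl_u a b (fst ic)) x \<oplus>\<^bsub>M\<^esub> (- snd ic) \<odot>\<^bsub>M\<^esub> x"

lemma eig_linear: "fst ic \<in> Idx a b ==> linear_on M M (eig ic)"
 unfolding eig_def[abs_def]
 by (intro linear_on_add linear_on_smult linear_on_id vspace_axioms gaD(2) cl_u_Calg)

lemma eig_wvec: "wvec a b M mu v ==> fst ic \<in> Idx a b ==> eig ic v = (mu (fst ic) - snd ic) \<odot>\<^bsub>M\<^esub> v"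
 unfolding eig_def wvec_def using vs_ladd[of v "mu (fst ic)" "- snd ic"] by simp

lemma eigs_linear: "\<forall>ic\<in>set js. fst ic \<in> Idx a b ==> linear_on M M (foldr eig js)"
proof (induction js)
 case Nil show ?case using linear_on_id[of M] by (simp add: id_def)
next
 case (Cons ic js)
 have e: "foldr eig (ic # js) = (\<lambda>v. eig ic (foldr eig js v))" by (simp add: fun_eq_iff)
 show ?case unfolding e by (rule linear_on_comp[OF _ eig_linear]) (use Cons in auto)
qed

lemma eigs_wvec: "wvec a b M mu v ==> \<forall>ic\<in>set js. fst ic \<in> Idx a b ==>
 foldr eig js v = (\<Prod>ic\<leftarrow>js. mu (fst ic) - snd ic) \<odot>\<^bsub>M\<^esub> v"
proof (induction js)
 case Nil thus ?case by (simp add: wvec_def)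
next
 case (Cons ic js)
 have "v <: M" using Cons(2) by (simp add: wvec_def)
 thus ?case using Cons linear_onD(3)[OF eig_linear, of ic v] eig_wvec[OF Cons(2), of ic]
  by (simp add: vs_assoc[symmetric] mult.commute)
qed

text \<open>Products of operators u_i - c with c different from the i-th weight of v project the submodule
 generated by v to its weight space.\<close>

lemma cyclic_weight_space:
 assumes v: "wvec a b M lam v" and x: "x \<in> A" and k: "wvec a b M lam (act M x v)"
 shows "\<exists>c. act M x v = c \<odot>\<^bsub>M\<^esub> v"
proof -
 have vc: "v <: M" using v by (simp add: wvec_def)
 let ?B = "(\<lambda>w. act M (wrd a b w) v) ` aw eps a b"
 have Bc: "?B \<subseteq> carrier M" using act_closed aw_Calg vc by blast
 let ?ok = "\<lambda>js. \<forall>ic\<in>set js. fst ic \<in> Idx a b \<and> snd ic \<noteq> lam (fst ic)"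
 \<comment> \<open>The cyclic submodule is spanned by weight vectors, and on each of them both
   operators act by scalars.\<close>
 have comm: "foldr eig js (foldr eig js' y) = foldr eig js' (foldr eig js y)"
  if ok: "?ok js" "?ok js'" and y: "y \<in> lin_span M ?B" for js js' y
 proof (rule linear_on_eq_span[OF vspace_axioms vspace_axioms _ _ Bc _ y])
  have l: "linear_on M M (foldr eig js)" "linear_on M M (foldr eig js')" using ok by (auto intro: eigs_linear)
  show "linear_on M M (\<lambda>y. foldr eig js (foldr eig js' y))" by (rule linear_on_comp[OF l(2) l(1)])
  show "linear_on M M (\<lambda>y. foldr eig js' (foldr eig js y))" by (rule linear_on_comp[OF l(1) l(2)])
  fix b' assume "b' \<in> ?B"
  then obtain w where w: "w \<in> aw eps a b" "b' = act M (wrd a b w) v" by blast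
  note e = word_shift[OF v w(1), folded w(2)]
  have bc: "b' <: M" using e by (simp add: wvec_def)
  show "foldr eig js (foldr eig js' b') = foldr eig js' (foldr eig js b')"
   using ok eigs_wvec[OF e, of js] eigs_wvec[OF e, of js'] linear_onD(3)[OF l(1) bc] linear_onD(3)[OF l(2) bc] bc
   by (simp add: vs_assoc[symmetric] mult.commute)
 qed
 have cv: "\<exists>d. foldr eig js (c \<odot>\<^bsub>M\<^esub> v) = d \<odot>\<^bsub>M\<^esub> v" if "?ok js" for js c
 proof -
  have "foldr eig js (c \<odot>\<^bsub>M\<^esub> v) = (c * (\<Prod>ic\<leftarrow>js. lam (fst ic) - snd ic)) \<odot>\<^bsub>M\<^esub> v"
   using eigs_wvec[OF v, of js] that linear_onD(3)[OF eigs_linear[of js] vc] vc by (simp add: vs_assoc)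
  thus ?thesis by blast
 qed
 have "\<exists>js c. ?ok js \<and> foldr eig js y = c \<odot>\<^bsub>M\<^esub> v" if "y \<in> lin_span M ?B" for y
  using that Bc
 proof (induction rule: span_induct_strong)
  case (base y)
  then obtain w where w: "w \<in> aw eps a b" "y = act M (wrd a b w) v" by blast
  note e = word_shift[OF v w(1), folded w(2)]
  have yc: "y <: M" using e by (simp add: wvec_def)
  show ?case
  proof (cases "\<exists>i\<in>Idx a b. shift i w \<noteq> 0")
   case True
   then obtain i where i: "i \<in> Idx a b" "shift i w \<noteq> 0" by blast
   have "foldr eig [(i, lam i + of_int (shift i w))] y = 0 \<odot>\<^bsub>M\<^esub> v"
    using eig_wvec[OF e, of "(i, lam i + of_int (shift i w))"] i yc vc by simp
   moreover have "?ok [(i, lam i + of_int (shift i w))]" using i by simp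
   ultimately show ?thesis by blast
  next
   case False
   have "shift i w = 0" if "i \<notin> Idx a b" for i
    using aw_lists[OF w(1)] that unfolding shift_def
    by (induction w) (auto simp: sh_def)
   hence "\<forall>i. shift i w = 0" using False by blast
   hence "wrd a b w \<in> Up a b" by (rule zero_shift_Up[OF aw_lists[OF w(1)]])
   then obtain c where "y = c \<odot>\<^bsub>M\<^esub> v" using Up_scalar v w by blast
   hence "foldr eig [] y = c \<odot>\<^bsub>M\<^esub> v" by simp
   thus ?thesis by (intro exI[of _ "[]"]) auto
  qed
 next
  case zero
  have "foldr eig [] \<zero>\<^bsub>M\<^esub> = 0 \<odot>\<^bsub>M\<^esub> v" using vc by simp
  thus ?case by (intro exI[of _ "[]"]) auto
 next
  case (add x y)
  then obtain js c js' c' where j: "?ok js" "foldr eig js x = c \<odot>\<^bsub>M\<^esub> v" "?ok js'" "foldr eig js' y = c' \<odot>\<^bsub>M\<^esub> v" by blast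
  have l: "linear_on M M (foldr eig (js @ js'))" using j by (intro eigs_linear) auto
  have xy: "x <: M" "y <: M" using add span_carrier[OF Bc] by blast+
  obtain d where d: "foldr eig js' (c \<odot>\<^bsub>M\<^esub> v) = d \<odot>\<^bsub>M\<^esub> v" using cv[OF j(3)] by blast
  obtain d' where d': "foldr eig js (c' \<odot>\<^bsub>M\<^esub> v) = d' \<odot>\<^bsub>M\<^esub> v" using cv[OF j(1)] by blast
  have "foldr eig (js @ js') x = d \<odot>\<^bsub>M\<^esub> v" using comm[OF j(1,3) add(1)] j(2) d by simp
  moreover have "foldr eig (js @ js') y = d' \<odot>\<^bsub>M\<^esub> v" using j(4) d' by simp
  ultimately have "foldr eig (js @ js') (x \<oplus>\<^bsub>M\<^esub> y) = (d + d') \<odot>\<^bsub>M\<^esub> v"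
   using linear_onD(2)[OF l xy] vs_ladd[OF vc] by simp
  moreover have "?ok (js @ js')" using j by auto
  ultimately show ?case by blast
 next
  case (smult k x)
  then obtain js c where j: "?ok js" "foldr eig js x = c \<odot>\<^bsub>M\<^esub> v" by blast
  have l: "linear_on M M (foldr eig js)" using j by (intro eigs_linear) auto
  have "x <: M" using smult span_carrier[OF Bc] by blast
  hence "foldr eig js (k \<odot>\<^bsub>M\<^esub> x) = (k * c) \<odot>\<^bsub>M\<^esub> v" using linear_onD(3)[OF l] j vc by (simp add: vs_assoc)
  thus ?case using j(1) by blast
 qed
 from this[OF act_span[OF vc x]] obtain js c where j: "?ok js" "foldr eig js (act M x v) = c \<odot>\<^bsub>M\<^esub> v" by blast
 \<comment> \<open>The vector \<open>act M x v\<close> has weight \<open>lam\<close>, so the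
   operator just found multiplies it by the scalar ?s. No factor of ?s is zero, and ?s can be
   divided out.\<close>
 let ?s = "\<Prod>ic\<leftarrow>js. lam (fst ic) - snd ic"
 have "?s \<noteq> 0" using j(1) by (induction js) auto
 have "?s \<odot>\<^bsub>M\<^esub> act M x v = c \<odot>\<^bsub>M\<^esub> v" using eigs_wvec[OF k, of js] j by simp
 hence "(1 / ?s) \<odot>\<^bsub>M\<^esub> (?s \<odot>\<^bsub>M\<^esub> act M x v) = (1 / ?s * c) \<odot>\<^bsub>M\<^esub> v" using vc by (simp only: vs_assoc)
 hence "act M x v = (1 / ?s * c) \<odot>\<^bsub>M\<^esub> v"
  using \<open>?s \<noteq> 0\<close> act_closed[OF x vc] by (simp add: vs_assoc[symmetric])
 thus ?thesis by blast
qed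

end

lemma (in amod) Calg_split:
 assumes x: "x \<in> A"
 shows "\<exists>x0\<in>part (Calg eps a b) q. \<exists>x1\<in>part (Calg eps a b) (q + 1). x = x0 \<oplus>\<^bsub>Cl a b\<^esub> x1"
proof -
 interpret C: vspace "Cl a b" by (rule vspace_Cl)
 obtain x0 x1 where d: "x0 \<in> part (Calg eps a b) 0" "x1 \<in> part (Calg eps a b) 1" "x = x0 \<oplus>\<^bsub>Cl a b\<^esub> x1"
  using Calg_decompose[OF x] by blast
 have "x = x1 \<oplus>\<^bsub>Cl a b\<^esub> x0" unfolding d(3) by (rule C.a_comm) (use d Calg_Cl in auto)
 thus ?thesis using d by (cases q) (auto simp del: Calg_part)
qed

text \<open>A nonzero homogeneous vector generates a graded submodule, hence everything. Comparing
  parities shows that a homogeneous vector is the image of a homogeneous element of the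
  algebra.\<close>

lemma (in amod) cyclic:
 assumes s: "simple_rep A M" and v: "v \<in> part M q" "v \<noteq> \<zero>\<^bsub>M\<^esub>"
 shows "(\<lambda>x. act M x v) ` A = carrier M" "(\<lambda>x. act M x v) ` part (Calg eps a b) (r + q) = part M r"
proof -
 let ?T = "\<lambda>x. act M x v"
 have vc: "v <: M" by (rule superspaceD(5)[OF ss v(1)])
 interpret C: vspace "Calg eps a b" by (rule vspace_Calg)
 have pA: "x \<in> A" if "x \<in> part (Calg eps a b) p" for x p using that by simp
 have parts: "?T x \<in> part M r" if "x \<in> part (Calg eps a b) (r + q)" for x r
  using gaD(5)[OF that v(1)] by (simp add: add.assoc)
 have "lin_span (Calg eps a b) A = A" using C.span_superset C.span_minimal[OF C.sub_full] by blast
 hence "submodule (?T ` A) CC M"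
  using linear_image_span[OF vspace_Calg vspace_axioms gaD(6)[OF vc], of A] span_sub[of "?T ` A"] act_closed vc by fastforce
 moreover have "\<exists>x\<in>?T ` A \<inter> part M 0. \<exists>y\<in>?T ` A \<inter> part M 1. w = x \<oplus>\<^bsub>M\<^esub> y" if "w \<in> ?T ` A" for w
 proof -
  obtain x where x: "x \<in> A" "w = ?T x" using \<open>w \<in> ?T ` A\<close> by blast
  obtain x0 x1 where d: "x0 \<in> part (Calg eps a b) (0 + q)" "x1 \<in> part (Calg eps a b) (1 + q)" "x = x0 \<oplus>\<^bsub>Cl a b\<^esub> x1"
   using Calg_split[OF x(1), of q] by (metis add_0 add.commute)
  thus ?thesis using act_add[OF pA[OF d(1)] pA[OF d(2)] vc] parts[OF d(1)] parts[OF d(2)] pA x(2) by blast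
 qed
 moreover have "act M x w \<in> ?T ` A" if "x \<in> A" "w \<in> ?T ` A" for x w
  using that act_mult[OF that(1) _ vc] Calg_mult_closed[OF that(1)] by (auto simp: image_iff) metis
 ultimately have "graded_submodule A M (?T ` A)" unfolding graded_submodule_def by blast
 moreover have "v \<in> ?T ` A" using act_one[OF vc] aw_Calg[OF aw_Nil] by (metis imageI)
 ultimately show full: "?T ` A = carrier M" using s v(2) unfolding simple_rep_def by blast
 show "?T ` part (Calg eps a b) (r + q) = part M r"
 proof (intro subset_antisym subsetI)
  fix w assume w: "w \<in> part M r"
  then obtain x where x: "x \<in> A" "w = ?T x" using full superspaceD(5)[OF ss] by blast
  obtain x0 x1 where d: "x0 \<in> part (Calg eps a b) (r + q)" "x1 \<in> part (Calg eps a b) (r + q + 1)" "x = x0 \<oplus>\<^bsub>Cl a b\<^esub> x1"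
   using Calg_split[OF x(1)] by blast
  have e: "w = ?T x0 \<oplus>\<^bsub>M\<^esub> ?T x1" using act_add[OF pA[OF d(1)] pA[OF d(2)] vc] d(3) x(2) by simp
  have c: "?T x0 <: M" "?T x1 <: M" using act_closed pA d vc by blast+
  have "?T x1 = w \<ominus>\<^bsub>M\<^esub> ?T x0" unfolding e using c by (simp add: a_minus_def a_comm[of "?T x0"] a_assoc r_neg)
  hence "?T x1 \<in> part M r" using sub_minus[OF superspaceD(2)[OF ss] w parts[OF d(1)]] by simp
  moreover have "?T x1 \<in> part M (r + 1)" using d(2) by (intro parts) (simp add: ac_simps)
  ultimately have "?T x1 = \<zero>\<^bsub>M\<^esub>" using superspaceD(3)[OF ss] by (cases r) auto
  thus "w \<in> ?T ` part (Calg eps a b) (r + q)" using e c d(1) by simp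
 qed (use parts in blast)
qed

text \<open>If x kills m but not n, then some product y x maps (m, n) to (0, n), a vector of the same weight in the
 cyclic module generated by (m, n); this contradicts the one-dimensionality of that weight space.\<close>

lemma weight_annihilator:
 assumes aM: "assoc_module (Calg eps a b) M" and aN: "assoc_module (Calg eps a b) N" and sN: "simple_rep (carrier (Calg eps a b)) N"
  and m: "wvec a b M lam m" "m \<noteq> \<zero>\<^bsub>M\<^esub>" "m \<in> part M p"
  and n: "wvec a b N lam n" "n \<noteq> \<zero>\<^bsub>N\<^esub>" "n \<in> part N p"
  and x: "x <: (Calg eps a b)" "act M x m = \<zero>\<^bsub>M\<^esub>"
 shows "act N x n = \<zero>\<^bsub>N\<^esub>"
proof -
 interpret M: amod eps a b M by (rule amod.intro[OF aM])
 interpret N: amod eps a b N by (rule amod.intro[OF aN])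
 let ?A = "carrier (Calg eps a b)" and ?V = "dsum M N"
 interpret V: amod eps a b ?V by (rule amod.intro[OF assoc_module_dsum[OF aM aN]])
 have mc: "m <: M" and nc: "n <: N" using m n by (auto simp: wvec_def)
 have hom: "act N x n = \<zero>\<^bsub>N\<^esub>" if x: "x \<in> part (Calg eps a b) q" "act M x m = \<zero>\<^bsub>M\<^esub>" for x q
 proof (rule ccontr)
  assume "act N x n \<noteq> \<zero>\<^bsub>N\<^esub>"
  hence "n \<in> (\<lambda>y. act N y (act N x n)) ` ?A" using N.cyclic(1)[OF sN N.gaD(5)[OF x(1) n(3)]] nc by simp
  then obtain y where y: "y \<in> ?A" "n = act N y (act N x n)" by (rule imageE)
  have xA: "x \<in> ?A" using x(1) by simp
  let ?z = "y \<otimes>\<^bsub>Cl a b\<^esub> x"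
  have z: "act M ?z m = \<zero>\<^bsub>M\<^esub>" "act N ?z n = n"
   using M.act_mult[OF y(1) xA mc] N.act_mult[OF y(1) xA nc] x(2) y M.act_zero by auto
  have "wvec a b ?V lam (m, n)" "wvec a b ?V lam (act ?V ?z (m, n))"
   using m n z M.act_zero[OF cl_u_Calg] by (simp_all add: wvec_def)
  from V.cyclic_weight_space[OF this(1) Calg_mult_closed[OF y(1) xA] this(2)]
  obtain c where c: "c \<odot>\<^bsub>M\<^esub> m = \<zero>\<^bsub>M\<^esub>" "c \<odot>\<^bsub>N\<^esub> n = n" using z by auto
  have "c = 0" using c(1) M.vs_cancel[OF mc] m(2) by blast
  thus False using c(2) nc n(2) by simp
 qed
 \<comment> \<open>The split is relative to the parity p of m, so x0 m is even and x1 m is odd;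
   their sum is zero, hence both are.\<close>
 obtain x0 x1 where d: "x0 \<in> part (Calg eps a b) p" "x1 \<in> part (Calg eps a b) (p + 1)" "x = x0 \<oplus>\<^bsub>Cl a b\<^esub> x1"
  using M.Calg_split[OF x(1)] by blast
 have dA: "x0 \<in> ?A" "x1 \<in> ?A" using d by auto
 have p: "act M x0 m \<in> part M 0" "act M x1 m \<in> part M 1"
  using M.gaD(5)[OF d(1) m(3)] M.gaD(5)[OF d(2) m(3)] by (simp_all add: ac_simps)
 note zp = M.sub_zero[OF superspaceD(2)[OF M.ss]]
 have "act M x0 m \<oplus>\<^bsub>M\<^esub> act M x1 m = \<zero>\<^bsub>M\<^esub> \<oplus>\<^bsub>M\<^esub> \<zero>\<^bsub>M\<^esub>" using x(2) d M.act_add[OF dA mc] by simp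
 from part_unique[OF M.ss p zp zp this] show ?thesis using hom[OF d(1)] hom[OF d(2)] N.act_add[OF dA nc] d(3) by simp
qed

text \<open>By \<open>weight_annihilator\<close> in both directions m and n have the same
  annihilator. So x m -> x n is well defined and injective, and \<open>cyclic\<close> makes it
  surjective on each part.\<close>

theorem simple_common_weight_iso:
 assumes aM: "assoc_module (Calg eps a b) M" and aN: "assoc_module (Calg eps a b) N"
  and sM: "simple_rep (carrier (Calg eps a b)) M" and sN: "simple_rep (carrier (Calg eps a b)) N"
  and m: "wvec a b M lam m" "m \<noteq> \<zero>\<^bsub>M\<^esub>" "m \<in> part M p"
  and n: "wvec a b N lam n" "n \<noteq> \<zero>\<^bsub>N\<^esub>" "n \<in> part N p"
 shows "rep_iso (carrier (Calg eps a b)) M N"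
proof -
 interpret M: amod eps a b M by (rule amod.intro[OF aM])
 interpret N: amod eps a b N by (rule amod.intro[OF aN])
 interpret A: vspace "Calg eps a b" by (rule vspace_Calg)
 let ?A = "carrier (Calg eps a b)" let ?S = "\<lambda>x. act M x m" let ?T = "\<lambda>x. act N x n"
 have mc: "m <: M" and nc: "n <: N" using m n by (auto simp: wvec_def)
 note S = linear_onD[OF M.gaD(6)[OF mc]] and T = linear_onD[OF N.gaD(6)[OF nc]]
 have eq: "?S x = ?S y \<longleftrightarrow> ?T x = ?T y" if xy: "x \<in> ?A" "y \<in> ?A" for x y
 proof -
  note z = A.minus_closed[OF xy]
  have "?S (x \<ominus>\<^bsub>Calg eps a b\<^esub> y) = \<zero>\<^bsub>M\<^esub> \<longleftrightarrow> ?T (x \<ominus>\<^bsub>Calg eps a b\<^esub> y) = \<zero>\<^bsub>N\<^esub>"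
   using weight_annihilator[OF aM aN sN m n z] weight_annihilator[OF aN aM sM n m z] by blast
  thus ?thesis
   unfolding linear_on_minus[OF vspace_Calg M.vspace_axioms M.gaD(6)[OF mc] xy] linear_on_minus[OF vspace_Calg N.vspace_axioms N.gaD(6)[OF nc] xy]
   using M.vs_eq_iff[OF S(1)[OF xy(1)] S(1)[OF xy(2)]] N.vs_eq_iff[OF T(1)[OF xy(1)] T(1)[OF xy(2)]] by simp
 qed
 define \<phi> where "\<phi> v = ?T (SOME x. x \<in> ?A \<and> ?S x = v)" for v
 have ph: "\<phi> (?S x) = ?T x" if x: "x \<in> ?A" for x
  using someI[of "\<lambda>y. y \<in> ?A \<and> ?S y = ?S x" x] eq x unfolding \<phi>_def by blast
 have ex: "\<exists>x\<in>?A. v = ?S x" if "v <: M" for v using M.cyclic(1)[OF sM m(3,2)] that by blast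
 have im: "\<phi> ` ?S ` P = ?T ` P" if "P \<subseteq> ?A" for P unfolding image_image by (rule image_cong[OF refl ph]) (use that in blast)
 have "inj_on \<phi> (carrier M)" by (rule inj_onI) (use ex ph eq in metis)
 moreover have "\<phi> ` carrier M = carrier N" using im[of ?A] M.cyclic(1)[OF sM m(3,2)] N.cyclic(1)[OF sN n(3,2)] by simp
 moreover have "\<phi> ` part M q = part N q" for q
  using im[of "part (Calg eps a b) (q + p)"] M.cyclic(2)[OF sM m(3,2)] N.cyclic(2)[OF sN n(3,2)] by simp
 moreover have "linear_on M N \<phi>" unfolding linear_on_def
 proof (intro conjI ballI allI)
  fix v assume "v <: M"
  then obtain x where x: "x \<in> ?A" "v = ?S x" using ex by blast
  show "\<phi> v <: N" using x ph T(1) by simp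
  show "\<phi> (c \<odot>\<^bsub>M\<^esub> v) = c \<odot>\<^bsub>N\<^esub> \<phi> v" for c using x ph S(3)[OF x(1), of c] T(3)[OF x(1), of c] A.vs_sc[OF x(1), of c] by metis
  fix w assume "w <: M"
  then obtain y where y: "y \<in> ?A" "w = ?S y" using ex by blast
  show "\<phi> (v \<oplus>\<^bsub>M\<^esub> w) = \<phi> v \<oplus>\<^bsub>N\<^esub> \<phi> w" using x y ph S(2)[OF x(1) y(1)] T(2)[OF x(1) y(1)] A.a_closed[OF x(1) y(1)] by metis
 qed
 moreover have "\<phi> (act M x v) = act N x (\<phi> v)" if x: "x \<in> ?A" and "v <: M" for x v
 proof -
  obtain y where y: "y \<in> ?A" "v = ?S y" using ex \<open>v <: M\<close> by blast
  show ?thesis using ph[OF y(1)] ph[OF Calg_mult_closed[OF x y(1)]] M.act_mult[OF x y(1) mc] N.act_mult[OF x y(1) nc] y by simp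
 qed
 ultimately have "iso_map ?A M N \<phi>" unfolding iso_map_def bij_betw_def by blast
 thus ?thesis unfolding rep_iso_iff by blast
qed

section \<open>Standard modules\<close>

definition Fin :: "(int => int) set" where "Fin = {d. finite {i. d i \<noteq> 0}}"

text \<open>The finitely supported shifts are countable; coding them by natural numbers places the
  standard modules on the type \<open>nat => complex\<close> that the existence claims
  demand.\<close>

definition code :: "(int => int) => nat" where "code = to_nat_on Fin"
definition dec :: "nat => int => int" where "dec n = inv_into Fin code n"

lemma countable_Fin: "countable Fin"
proof -
 let ?f = "\<lambda>d::int=>int. (\<lambda>i. (i, d i)) ` {i. d i \<noteq> 0}"
 have "inj_on ?f Fin"
 proof (rule inj_onI)
  fix d e :: "int => int" assume a: "?f d = ?f e"
  show "d = e"
  proof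
   fix i
   have "(i, d i) \<in> ?f d \<longleftrightarrow> d i \<noteq> 0" "(i, d i) \<in> ?f e \<longleftrightarrow> d i \<noteq> 0 \<and> e i = d i"
    "(i, e i) \<in> ?f d \<longleftrightarrow> e i \<noteq> 0 \<and> e i = d i" "(i, e i) \<in> ?f e \<longleftrightarrow> e i \<noteq> 0" by auto
   thus "d i = e i" using a by metis
  qed
 qed
 moreover have "countable (?f ` Fin)"
 proof (rule countable_subset)
  show "?f ` Fin \<subseteq> Collect finite" by (auto simp: Fin_def)
  show "countable (Collect finite :: (int \<times> int) set set)" by (rule countable_Collect_finite)
 qed
 ultimately show ?thesis by (rule countable_image_inj_on[rotated])
qed

lemma inj_code: "inj_on code Fin" unfolding code_def by (rule inj_on_to_nat_on[OF countable_Fin])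
lemma dec_code [simp]: "d \<in> Fin ==> dec (code d) = d" unfolding dec_def by (rule inv_into_f_f[OF inj_code])
lemma code_eq [simp]: "d \<in> Fin ==> e \<in> Fin ==> code d = code e \<longleftrightarrow> d = e" using inj_code by (auto simp: inj_on_def)

definition dl :: "gen => int => int" where "dl g = (\<lambda>j. sh j g)"

definition fadd :: "(int => int) => (int => int) => int => int" (infixl "\<lhd>+" 65) where "d \<lhd>+ e = (\<lambda>i. d i + e i)"
definition fsub :: "(int => int) => (int => int) => int => int" (infixl "\<lhd>-" 65) where "d \<lhd>- e = (\<lambda>i. d i - e i)"

lemma Fin_plus [simp]: "d \<in> Fin ==> e \<in> Fin ==> d \<lhd>+ e \<in> Fin"
proof -
 assume "d \<in> Fin" "e \<in> Fin"
 moreover have "{i. d i + e i \<noteq> 0} \<subseteq> {i. d i \<noteq> 0} \<union> {i. e i \<noteq> 0}" by auto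
 ultimately show ?thesis by (auto simp: Fin_def fadd_def intro: finite_subset)
qed

lemma Fin_minus [simp]: "d \<in> Fin ==> e \<in> Fin ==> d \<lhd>- e \<in> Fin"
proof -
 assume "d \<in> Fin" "e \<in> Fin"
 moreover have "{i. d i - e i \<noteq> 0} \<subseteq> {i. d i \<noteq> 0} \<union> {i. e i \<noteq> 0}" by auto
 ultimately show ?thesis by (auto simp: Fin_def fsub_def intro: finite_subset)
qed

lemma Fin_dl [simp]: "dl g \<in> Fin"
proof -
 have "{i. dl g i \<noteq> 0} \<subseteq> {idx g}" by (auto simp: dl_def sh_def)
 thus ?thesis unfolding Fin_def by (auto intro: finite_subset)
qed

lemma Fin_zero [simp]: "(\<lambda>_. 0) \<in> Fin" by (simp add: Fin_def)

lemma plus_minus [simp]: "(d \<lhd>+ e) \<lhd>- e = d" "(d \<lhd>- e) \<lhd>+ e = d"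
 by (simp_all add: fadd_def fsub_def)

text \<open>The parity of the total shift over the indices satisfying P; the integers are mapped
  into the field of two elements.\<close>

definition sm :: "(int => bool) => (int => int) => bit" where
 "sm P d = (\<Sum>i | d i \<noteq> 0. if P i then of_int (d i) else 0)"

lemma sm_superset: "finite B ==> {i. d i \<noteq> 0} \<subseteq> B ==> sm P d = (\<Sum>i\<in>B. if P i then of_int (d i) else 0)"
 unfolding sm_def by (rule sum.mono_neutral_left) auto

lemma sm_plus: assumes "d \<in> Fin" "e \<in> Fin" shows "sm P (d \<lhd>+ e) = sm P d + sm P e"
proof -
 let ?B = "{i. d i \<noteq> 0} \<union> {i. e i \<noteq> 0}"
 have B: "finite ?B" using assms by (simp add: Fin_def)
 have s: "{i. (d \<lhd>+ e) i \<noteq> 0} \<subseteq> ?B" by (auto simp: fadd_def)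
 have "sm P (d \<lhd>+ e) = (\<Sum>i\<in>?B. if P i then of_int (d i + e i) else 0)"
  unfolding sm_superset[OF B s] by (intro sum.cong refl if_cong) (simp add: fadd_def)
 also have "\<dots> = (\<Sum>i\<in>?B. (if P i then of_int (d i) else 0) + (if P i then of_int (e i) else 0))"
  by (rule sum.cong) auto
 also have "\<dots> = sm P d + sm P e"
  using sm_superset[OF B, of d P] sm_superset[OF B, of e P] by (simp add: sum.distrib)
 finally show ?thesis .
qed

lemma bit_uminus [simp]: "- (p::bit) = p" by (cases p) auto

lemma sm_dl: "sm P (dl g) = (if P (idx g) then 1 else 0)"
proof -
 have "sm P (dl g) = (\<Sum>i\<in>{idx g}. if P i then of_int (dl g i) else 0)"
  by (rule sm_superset) (auto simp: dl_def sh_def)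
 thus ?thesis by (cases g) (auto simp: dl_def sh_def)
qed

lemma sm_minus: assumes "d \<in> Fin" "e \<in> Fin" shows "sm P (d \<lhd>- e) = sm P d + sm P e"
proof -
 have "sm P d = sm P (d \<lhd>- e) + sm P e" using sm_plus[of "d \<lhd>- e" e P] assms by simp
 thus ?thesis by (simp add: add.assoc)
qed

lemma sm_zero [simp]: "sm P (\<lambda>_. 0) = 0" by (simp add: sm_def)

lemma sm_none: "(\<And>i. d i \<noteq> 0 ==> \<not> P i) ==> sm P d = 0"
 unfolding sm_def by (rule sum.neutral) auto

abbreviation "ps \<equiv> sm (\<lambda>i. 0 < i)"
abbreviation "ns \<equiv> sm (\<lambda>i. i < 0)"

definition bsg :: "bit => complex" where "bsg p = (if p = 0 then 1 else -1)"

lemma bsg_simps [simp]: "bsg 0 = 1" "bsg 1 = -1" "bsg (p + q) = bsg p * bsg q" "bsg p * bsg p = 1" "bsg p \<noteq> 0"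
 by (cases p; cases q; simp add: bsg_def)+

text \<open>Jordan-Wigner signs: a letter anticommutes past the positive coordinates that precede it, and negative
 indices come after all positive ones.\<close>

definition lsg :: "gen => (int => int) => complex" where
 "lsg g d = bsg (sm (\<lambda>j. 0 < j \<and> (idx g < 0 \<or> j < idx g)) d)"

text \<open>With y = lam i + d i, a negative index is the monomial model: e_d stands for x^y,
  \<open>Xi i\<close> multiplies by x and \<open>Eta i\<close> is d/dx. The product of x and 1/x is
  set to 0, which separates the negative powers from the polynomials. At a positive index y is 0 or
  1 and the letters create and annihilate.\<close>

definition mag :: "(int => complex) => gen => (int => int) => complex" where
 "mag lam g d = (case g of
   Xi i => if (0 < i \<and> lam i + of_int (d i) \<noteq> 0) \<or> (i < 0 \<and> lam i + of_int (d i) = -1) then 0 else 1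
  | Eta i => lam i + of_int (d i))"

definition coef :: "(int => complex) => gen => (int => int) => complex" where
 "coef lam g d = lsg g d * mag lam g d"

text \<open>The linear map e_d -> \<open>coef lam g d\<close> e_(d + dl g) in terms of coefficients:
  the value at a shift is read off at the shift before the step. Numbers that code no shift get
  0.\<close>

definition opg :: "(int => complex) => gen => (nat => complex) => nat => complex" where
 "opg lam g v = (\<lambda>n. if n \<in> code ` Fin then v (code (dec n \<lhd>- dl g)) * coef lam g (dec n \<lhd>- dl g) else 0)"

text \<open>The shifts d for which lam + d is again a weight: for i > 0 the eigenvalues of u_i are 0 and 1, while for i < 0
 the passage between -1 and 0 is blocked, because one of the two letters of index i vanishes there.\<close>

definition okk :: "int => complex => complex => bool" where
 "okk i x y = (if 0 < i then x \<in> {0, 1} \<and> y \<in> {0, 1} else (x \<in> \<nat> \<longleftrightarrow> y \<in> \<nat>))"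

definition DD :: "enat => enat => (int => complex) => (int => int) set" where
 "DD a b lam = {d \<in> Fin. \<forall>i. (i \<notin> Idx a b \<longrightarrow> d i = 0) \<and> (i \<in> Idx a b \<longrightarrow> okk i (lam i) (lam i + of_int (d i)))}"

lemma DD_Fin: "d \<in> DD a b lam ==> d \<in> Fin" by (simp add: DD_def)

lemma code_DD [simp]: "e \<in> Fin ==> code e \<in> code ` DD a b lam \<longleftrightarrow> e \<in> DD a b lam"
proof
 assume e: "e \<in> Fin" and "code e \<in> code ` DD a b lam"
 then obtain x where x: "x \<in> DD a b lam" "code e = code x" by blast
 thus "e \<in> DD a b lam" using code_eq[OF e DD_Fin[OF x(1)]] by simp
qed simp

lemma Idx_nonzero: "i \<in> Idx a b ==> i \<noteq> 0" by (auto simp: Idx_def)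

abbreviation "VV a b lam \<equiv> free_space (code ` DD a b lam) (\<lambda>_. 0)"

lemma opg_code [simp]: "d \<in> Fin ==> opg lam g v (code d) = v (code (d \<lhd>- dl g)) * coef lam g (d \<lhd>- dl g)"
 by (simp add: opg_def)

lemma dl_same [simp]: "dl g (idx g) = gen_deg g" by (simp add: dl_def sh_def)
lemma dl_gen [simp]: "dl (Xi j) j = 1" "dl (Eta j) j = -1" by (simp_all add: dl_def sh_def)
lemma dl_other [simp]: "i \<noteq> idx g ==> dl g i = 0" by (simp add: dl_def sh_def)

lemma Nats_shift: "(y::complex) \<in> \<nat> ==> y + 1 \<in> \<nat>" by simp
lemma Nats_unshift: "(y::complex) + 1 \<in> \<nat> ==> y \<noteq> -1 ==> y \<in> \<nat>"
proof -
 assume a: "y + 1 \<in> \<nat>" "y \<noteq> -1"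
 then obtain n where n: "y + 1 = of_nat n" by (auto elim: Nats_cases)
 hence "n \<noteq> 0" using a by (metis add_eq_0_iff2 of_nat_0)
 then obtain m where "n = Suc m" using not0_implies_Suc by blast
 hence "y = of_nat m" using n by simp
 thus "y \<in> \<nat>" by simp
qed

text \<open>The steps that would leave \<open>DD\<close> are those across a barrier (out of 0, 1 at
  a positive index, between -1 and 0 at a negative one), and there \<open>mag\<close> is
  zero.\<close>

lemma DD_step:
 assumes d: "d \<in> DD a b lam" and g: "idx g \<in> Idx a b" and c: "mag lam g d \<noteq> 0"
 shows "d \<lhd>+ dl g \<in> DD a b lam"
proof -
 have "okk i (lam i) (lam i + of_int ((d \<lhd>+ dl g) i))" if i: "i \<in> Idx a b" for i
 proof (cases "i = idx g")
  case False
  thus ?thesis using d i by (simp add: DD_def fadd_def)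
 next
  case True
  define y where "y = lam i + of_int (d i)"
  have o: "okk i (lam i) y" using d i by (simp add: DD_def y_def)
  have i0: "i \<noteq> 0" using i Idx_nonzero by blast
  show ?thesis
  proof (cases g)
   case (Xi j)
   have e: "lam i + of_int ((d \<lhd>+ dl g) i) = y + 1" using True Xi by (simp add: fadd_def y_def)
   have m: "0 < i ==> y = 0" "i < 0 ==> y \<noteq> -1" using c Xi True by (auto simp: mag_def y_def split: if_splits)
   show ?thesis
   proof (cases "0 < i")
    case True
    thus ?thesis unfolding e using o m(1) by (simp add: okk_def)
   next
    case False
    hence "y + 1 \<in> \<nat> \<longleftrightarrow> y \<in> \<nat>" using Nats_shift[of y] Nats_unshift[of y] m(2) i0 by linarith
    thus ?thesis unfolding e using o False by (simp add: okk_def)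
   qed
  next
   case (Eta j)
   have e: "lam i + of_int ((d \<lhd>+ dl g) i) = y - 1" using True Eta by (simp add: fadd_def y_def)
   have m: "y \<noteq> 0" using c Eta True by (auto simp: mag_def y_def split: if_splits)
   have n: "y - 1 \<in> \<nat> \<longleftrightarrow> y \<in> \<nat>"
    using Nats_shift[of "y - 1"] Nats_unshift[of "y - 1"] m by auto
   show ?thesis
   proof (cases "0 < i")
    case True
    thus ?thesis unfolding e using o m by (simp add: okk_def)
   next
    case False
    thus ?thesis unfolding e using o n by (simp add: okk_def)
   qed
  qed
 qed
 moreover have "(d \<lhd>+ dl g) i = 0" if "i \<notin> Idx a b" for i
  using d g that by (cases "i = idx g") (auto simp: DD_def fadd_def)
 ultimately show ?thesis using d by (simp add: DD_def)
qed

lemma opg_support: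
 assumes v: "v <: (VV a b lam)" and g: "idx g \<in> Idx a b" and n: "opg lam g v n \<noteq> 0"
 shows "\<exists>d\<in>DD a b lam. v (code d) \<noteq> 0 \<and> n = code (d \<lhd>+ dl g) \<and> d \<lhd>+ dl g \<in> DD a b lam"
proof -
 obtain e where e: "e \<in> Fin" "n = code e" using n by (auto simp: opg_def split: if_splits)
 let ?d = "e \<lhd>- dl g"
 have nz: "v (code ?d) \<noteq> 0" "coef lam g ?d \<noteq> 0" using n e by auto
 have "code ?d \<in> code ` DD a b lam" using v nz(1) by auto
 hence d: "?d \<in> DD a b lam" using e(1) by simp
 have "mag lam g ?d \<noteq> 0" using nz by (simp add: coef_def)
 from DD_step[OF d g this] show ?thesis using nz e d by auto
qed

lemma opg_closed:
 assumes v: "v <: (VV a b lam)" and g: "idx g \<in> Idx a b"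
 shows "opg lam g v <: (VV a b lam)"
proof -
 have "{n. opg lam g v n \<noteq> 0} \<subseteq> (\<lambda>n. code (dec n \<lhd>+ dl g)) ` {n. v n \<noteq> 0}"
  using opg_support[OF v g] by (force simp: image_iff dest: DD_Fin)
 moreover have "finite {n. v n \<noteq> 0}" using v by simp
 ultimately have "finite {n. opg lam g v n \<noteq> 0}" by (meson finite_imageI finite_subset)
 moreover have "{n. opg lam g v n \<noteq> 0} \<subseteq> code ` DD a b lam" using opg_support[OF v g] by blast
 ultimately show ?thesis by simp
qed

lemma opg_linear: "idx g \<in> Idx a b ==> linear_on (VV a b lam) (VV a b lam) (opg lam g)"
 unfolding linear_on_def using opg_closed[of _ a b lam g]
 by (auto simp: fun_eq_iff opg_def algebra_simps simp del: free_space_simps(1))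

lemma VV_eqI:
 assumes v: "v <: (VV a b lam)" and w: "w <: (VV a b lam)"
  and e: "\<And>d. d \<in> DD a b lam ==> v (code d) = w (code d)"
 shows "v = w"
proof
 fix n
 show "v n = w n"
 proof (cases "n \<in> code ` DD a b lam")
  case True thus ?thesis using e by auto
 next
  case False
  hence "v n = 0" "w n = 0" using v w by auto
  thus ?thesis by simp
 qed
qed

section \<open>The signed operators satisfy the Clifford-Weyl relations\<close>

lemma operators_std: "operators (VV a b lam) (letters a b) (opg lam)"
 by (intro operators.intro operators_axioms.intro vspace_free_space opg_linear) simp

lemma lsg_plus: "e \<in> Fin ==> lsg g (e \<lhd>+ dl h) = lsg g e * (if 0 < idx h \<and> (idx g < 0 \<or> idx h < idx g) then -1 else 1)"
 by (simp add: lsg_def sm_plus sm_dl)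

definition magy :: "gen => complex => complex" where
 "magy g y = (case g of Xi i => if (0 < i \<and> y \<noteq> 0) \<or> (i < 0 \<and> y = -1) then 0 else 1 | Eta i => y)"

lemma mag_eq: "mag lam g e = magy g (lam (idx g) + of_int (e (idx g)))"
 by (cases g) (simp_all add: mag_def magy_def)

text \<open>At different indices the factors \<open>mag\<close> do not interact: two negative
  letters commute without signs, and otherwise exactly one of the two orders picks up the
  Jordan-Wigner sign. At equal indices the signs square to 1 and one variable remains.\<close>

lemma coef_rel:
 assumes e: "e \<in> DD a b lam" and g: "idx g \<in> Idx a b" and h: "idx h \<in> Idx a b"
 shows "coef lam h e * coef lam g (e \<lhd>+ dl h) + gsign g h * (coef lam g e * coef lam h (e \<lhd>+ dl g)) = kap g h"
proof -
 have eF: "e \<in> Fin" by (rule DD_Fin[OF e])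
 have n0: "idx g \<noteq> 0" "idx h \<noteq> 0" using g h Idx_nonzero by blast+
 show ?thesis
 proof (cases "idx g = idx h")
  case False
  have m: "mag lam g (e \<lhd>+ dl h) = mag lam g e" "mag lam h (e \<lhd>+ dl g) = mag lam h e"
   using False by (cases g; cases h; simp add: mag_def fadd_def)+
  have "(if 0 < idx h \<and> (idx g < 0 \<or> idx h < idx g) then -1 else 1) +
    gsign g h * (if 0 < idx g \<and> (idx h < 0 \<or> idx g < idx h) then -1 else 1) = (0::complex)"
   using False n0 by (auto simp: gsign_def gen_par_def)
  hence "(lsg h e * mag lam h e) * (lsg g e * mag lam g e) * ((if 0 < idx h \<and> (idx g < 0 \<or> idx h < idx g) then -1 else 1) +
    gsign g h * (if 0 < idx g \<and> (idx h < 0 \<or> idx g < idx h) then -1 else 1)) = 0" by simp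
  moreover have "kap g h = 0" using False by (simp add: kap_def)
  ultimately show ?thesis unfolding coef_def m lsg_plus[OF eF] by (simp add: algebra_simps del: mult_eq_0_iff)
 next
  case True
  have ls: "lsg g = lsg h" using True by (simp add: lsg_def fun_eq_iff)
  have sq: "lsg h e * lsg h e = 1" by (simp add: lsg_def)
  have m1: "lsg h e * x * (lsg h e * y) = x * y" for x y
   using sq by (metis (no_types, lifting) mult.assoc mult.commute mult_1)
  have o: "0 < idx g ==> lam (idx g) + of_int (e (idx g)) \<in> {0, 1}"
  proof -
   assume "0 < idx g"
   moreover have "okk (idx g) (lam (idx g)) (lam (idx g) + of_int (e (idx g)))" using e g by (simp add: DD_def)
   ultimately show ?thesis by (simp add: okk_def)
  qed
  have l1: "lsg h (e \<lhd>+ dl h) = lsg h e" "lsg h (e \<lhd>+ dl g) = lsg h e" using True n0 by (auto simp: lsg_plus[OF eF])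
  have "mag lam h e * mag lam g (e \<lhd>+ dl h) + gsign g h * (mag lam g e * mag lam h (e \<lhd>+ dl g)) = kap g h"
  proof -
   define y where "y = lam (idx g) + of_int (e (idx g))"
   have yg: "0 < idx g ==> y = 0 \<or> y = 1" using o by (auto simp: y_def)
   have y2: "lam (idx g) + of_int ((e \<lhd>+ dl h) (idx g)) = y + of_int (gen_deg h)"
    "lam (idx h) + of_int ((e \<lhd>+ dl g) (idx h)) = y + of_int (gen_deg g)" "lam (idx h) + of_int (e (idx h)) = y"
    using True dl_same[of g] dl_same[of h] by (simp_all add: fadd_def y_def)
   show ?thesis unfolding mag_eq y2 y_def[symmetric]
   proof (cases "0 < idx g")
    case pos: True
    from yg[OF pos] show "magy h y * magy g (y + of_int (gen_deg h)) + gsign g h * (magy g y * magy h (y + of_int (gen_deg g))) = kap g h"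
     using pos True by (elim disjE; cases g; cases h; simp add: magy_def kap_def gsign_def gen_par_def)
   next
    case neg: False
    hence "idx g < 0" using n0 by simp
    \<comment> \<open>At y = 0, -1, -2 one of the letters \<open>Xi\<close> may be applied at -1,
      where its factor jumps to 0; elsewhere the identity is polynomial in y.\<close>
    thus "magy h y * magy g (y + of_int (gen_deg h)) + gsign g h * (magy g y * magy h (y + of_int (gen_deg g))) = kap g h"
     using True by (cases g; cases h; cases "y = 0"; cases "y = -1"; cases "y = -2"; simp add: magy_def kap_def gsign_def gen_par_def add_eq_0_iff2)
   qed
  qed
  thus ?thesis unfolding coef_def ls l1 by (simp add: m1)
 qed
qed

lemma minus_plus_swap: "e \<lhd>- dl g \<lhd>- dl h \<lhd>+ dl h = e \<lhd>- dl g" "e \<lhd>- dl g \<lhd>- dl h \<lhd>+ dl g = e \<lhd>- dl h"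
 "e \<lhd>- dl h \<lhd>- dl g = e \<lhd>- dl g \<lhd>- dl h"
 by (simp_all add: fadd_def fsub_def fun_eq_iff)

lemma kap_shift: "kap g h \<noteq> 0 ==> d \<lhd>- dl g \<lhd>- dl h = d"
proof
 fix i assume "kap g h \<noteq> 0"
 hence "idx g = idx h" "g \<noteq> h" by (auto simp: kap_def split: if_splits)
 hence "dl g i + dl h i = 0" by (cases g; cases h) (auto simp: dl_def sh_def)
 thus "(d \<lhd>- dl g \<lhd>- dl h) i = d i" by (simp add: fsub_def)
qed

lemma opg_rel:
 assumes v: "v <: (VV a b lam)" and g: "idx g \<in> Idx a b" and h: "idx h \<in> Idx a b" and d: "d \<in> Fin"
 shows "opg lam g (opg lam h v) (code d) + gsign g h * opg lam h (opg lam g v) (code d) = kap g h * v (code d)"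
proof -
 let ?e = "d \<lhd>- dl g \<lhd>- dl h"
 have eF: "?e \<in> Fin" using d by simp
 have 1: "opg lam g (opg lam h v) (code d) + gsign g h * opg lam h (opg lam g v) (code d) =
  v (code ?e) * (coef lam h ?e * coef lam g (?e \<lhd>+ dl h) + gsign g h * (coef lam g ?e * coef lam h (?e \<lhd>+ dl g)))"
  using d by (simp add: minus_plus_swap algebra_simps)
 show ?thesis
 proof (cases "v (code ?e) = 0")
  case True
  have "kap g h = 0 \<or> ?e = d" using kap_shift by blast
  thus ?thesis using 1 True by auto
 next
  case False
  hence "code ?e \<in> code ` DD a b lam" using v by auto
  hence e: "?e \<in> DD a b lam" using eF by simp
  have "kap g h = 0 \<or> ?e = d" using kap_shift by blast
  thus ?thesis using 1 coef_rel[OF e g h] by auto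
 qed
qed

text \<open>An element of \<open>Cl a b\<close> is a coset, so the action evaluates a
  representative; by \<open>std_act_proj\<close> every representative gives the same value.\<close>

definition std_act :: "enat => enat => (int => complex) => cl => (nat => complex) => nat => complex" where
 "std_act a b lam Z v = the_elem ((\<lambda>f. ev (VV a b lam) (opg lam) f v) ` Z)"

lemma the_elem_const: "(\<And>g. g \<in> S ==> h g = h f) ==> f \<in> S ==> the_elem (h ` S) = h f"
proof -
 assume a: "\<And>g. g \<in> S ==> h g = h f" "f \<in> S"
 have "h ` S \<subseteq> {h f}" using a(1) by blast
 hence "h ` S = {h f}" using a(2) by blast
 thus ?thesis by simp
qed

text \<open>If the relations evaluate to zero, so does the ideal they generate, and evaluation is
  constant on cosets. Used for the standard modules as well as for \<open>env_map\<close> and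
  \<open>env_act\<close>.\<close>

lemma the_elem_ev:
 assumes op: "operators V G op" and r: "rels \<subseteq> carrier (free_alg G par)"
  and z: "\<And>r v. r \<in> rels ==> v <: V ==> ev V op r v = \<zero>\<^bsub>V\<^esub>"
  and f: "f <: (free_alg G par)" and v: "v <: V"
 shows "the_elem ((\<lambda>f. ev V op f v) ` (Idl\<^bsub>free_alg G par\<^esub> rels +>\<^bsub>free_alg G par\<^esub> f)) = ev V op f v"
proof -
 interpret op: operators V G op by fact
 let ?F = "free_alg G par" let ?I = "Idl\<^bsub>?F\<^esub> rels"
 interpret F: vspace ?F by (rule vspace_free_alg)
 have I: "submodule ?I CC ?F" by (rule ideal_submodule[OF ring.genideal_ideal[OF ring_free_alg r]])
 have e: "ev V op g v = ev V op f v" if g: "g \<in> ?I +>\<^bsub>?F\<^esub> f" for g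
 proof -
  have gf: "g <: ?F" "g \<ominus>\<^bsub>?F\<^esub> f \<in> ?I" using F.coset_mem[OF I f] g by auto
  have l: "linear_on ?F V (\<lambda>f. ev V op f v)" by (rule op.ev_linear[OF v])
  have "ev V op g v \<ominus>\<^bsub>V\<^esub> ev V op f v = ev V op (g \<ominus>\<^bsub>?F\<^esub> f) v"
   using linear_on_minus[OF vspace_free_alg op.vspace_axioms l gf(1) f] by simp
  also have "\<dots> = \<zero>\<^bsub>V\<^esub>" by (rule op.ev_genideal[OF r z gf(2) v])
  finally show ?thesis using op.vs_eq_iff[OF op.ev_closed[OF gf(1) v] op.ev_closed[OF f v]] by simp
 qed
 show ?thesis by (rule the_elem_const, erule e, rule F.coset_self[OF I f])
qed

lemma std_act_proj:
 assumes f: "f <: (cl_free a b)" and v: "v <: (VV a b lam)"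
 shows "std_act a b lam (cl_proj a b f) v = ev (VV a b lam) (opg lam) f v"
proof -
 interpret op: operators "VV a b lam" "letters a b" "opg lam" gen_par by (rule operators_std)
 let ?V = "VV a b lam"
 have z: "ev ?V (opg lam) r u = \<zero>\<^bsub>?V\<^esub>" if r: "r \<in> cl_rels a b" and u: "u <: ?V" for r u
 proof -
  obtain g h where gh: "r = gen_rel g h" "idx g \<in> Idx a b" "idx h \<in> Idx a b" using r unfolding cl_rels_eq by auto
  have s: "single w <: (free_alg (letters a b) gen_par)" if "set w \<subseteq> {g, h}" for w
   by (rule single_carrier_alg) (use that gh in auto)
  let ?F = "free_alg (letters a b) gen_par"
  note l = linear_onD[OF op.ev_linear[OF u]]
  interpret F: vspace ?F by (rule vspace_free_alg)
  have "r = (single [g, h] \<oplus>\<^bsub>?F\<^esub> (gsign g h \<odot>\<^bsub>?F\<^esub> single [h, g])) \<oplus>\<^bsub>?F\<^esub> ((- kap g h) \<odot>\<^bsub>?F\<^esub> single [])"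
   unfolding gh(1) gen_rel_def by (simp add: fun_eq_iff)
  hence "ev ?V (opg lam) r u = (ev ?V (opg lam) (single [g, h]) u \<oplus>\<^bsub>?V\<^esub> (gsign g h \<odot>\<^bsub>?V\<^esub> ev ?V (opg lam) (single [h, g]) u))
    \<oplus>\<^bsub>?V\<^esub> ((- kap g h) \<odot>\<^bsub>?V\<^esub> ev ?V (opg lam) (single []) u)"
   using l(2)[OF F.a_closed[OF s F.vs_sc[OF s]] F.vs_sc[OF s]] l(2)[OF s F.vs_sc[OF s]] l(3)[OF s]
   by (simp del: free_alg_simps free_space_simps)
  also have "ev ?V (opg lam) (single [g, h]) u = opg lam g (opg lam h u)" using op.ev_single[of "[g, h]" u] u gh by simp
  also have "ev ?V (opg lam) (single [h, g]) u = opg lam h (opg lam g u)" using op.ev_single[of "[h, g]" u] u gh by simp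
  also have "ev ?V (opg lam) (single []) u = u" using op.ev_single[of "[]" u] u by simp
  also have "(opg lam g (opg lam h u) \<oplus>\<^bsub>?V\<^esub> (gsign g h \<odot>\<^bsub>?V\<^esub> opg lam h (opg lam g u))) \<oplus>\<^bsub>?V\<^esub> ((- kap g h) \<odot>\<^bsub>?V\<^esub> u) = \<zero>\<^bsub>?V\<^esub>"
  proof (rule VV_eqI)
   note c = opg_closed[OF opg_closed[OF u gh(3)] gh(2)] opg_closed[OF opg_closed[OF u gh(2)] gh(3)]
   show "(opg lam g (opg lam h u) \<oplus>\<^bsub>?V\<^esub> (gsign g h \<odot>\<^bsub>?V\<^esub> opg lam h (opg lam g u))) \<oplus>\<^bsub>?V\<^esub> ((- kap g h) \<odot>\<^bsub>?V\<^esub> u) <: ?V"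
    by (intro op.a_closed op.vs_sc c u)
   show "\<zero>\<^bsub>?V\<^esub> <: ?V" by (rule op.zero_closed)
   fix d assume "d \<in> DD a b lam"
   thus "((opg lam g (opg lam h u) \<oplus>\<^bsub>?V\<^esub> (gsign g h \<odot>\<^bsub>?V\<^esub> opg lam h (opg lam g u))) \<oplus>\<^bsub>?V\<^esub> ((- kap g h) \<odot>\<^bsub>?V\<^esub> u)) (code d) = \<zero>\<^bsub>?V\<^esub> (code d)"
    using opg_rel[OF u gh(2,3) DD_Fin] by (simp del: opg_code)
  qed
  finally show ?thesis .
 qed
 show ?thesis unfolding std_act_def cl_proj_def cl_ideal_def cl_free_eq
  by (rule the_elem_ev[OF operators_std _ z _ v])
   (use f cl_rels_carrier[of a b] in \<open>simp_all only: cl_free_eq\<close>)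
qed

lemma std_act_linear: "v <: (VV a b lam) ==> linear_on (Cl a b) (VV a b lam) (\<lambda>Z. std_act a b lam Z v)"
proof -
 assume v: "v <: (VV a b lam)"
 interpret op: operators "VV a b lam" "letters a b" "opg lam" gen_par by (rule operators_std)
 interpret F: vspace "cl_free a b" by (rule vspace_cl_free)
 have l: "linear_on (cl_free a b) (VV a b lam) (\<lambda>f. ev (VV a b lam) (opg lam) f v)"
  unfolding cl_free_eq by (rule op.ev_linear[OF v])
 note l = linear_onD[OF l]
 note pl = linear_onD[OF proj_linear[of a b]]
 show ?thesis unfolding linear_on_def
 proof (intro conjI ballI allI)
  fix x assume "x <: (Cl a b)"
  then obtain f where f: "f <: (cl_free a b)" "x = cl_proj a b f" unfolding Cl_carrier by blast
  show "std_act a b lam x v <: (VV a b lam)" unfolding f(2) std_act_proj[OF f(1) v] by (rule l(1)[OF f(1)])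
  show "std_act a b lam (c \<odot>\<^bsub>Cl a b\<^esub> x) v = c \<odot>\<^bsub>VV a b lam\<^esub> std_act a b lam x v" for c
   unfolding f(2) pl(3)[OF f(1), symmetric] std_act_proj[OF f(1) v] std_act_proj[OF F.vs_sc[OF f(1)] v] by (rule l(3)[OF f(1)])
  fix y assume "y <: (Cl a b)"
  then obtain g where g: "g <: (cl_free a b)" "y = cl_proj a b g" unfolding Cl_carrier by blast
  show "std_act a b lam (x \<oplus>\<^bsub>Cl a b\<^esub> y) v = std_act a b lam x v \<oplus>\<^bsub>VV a b lam\<^esub> std_act a b lam y v"
   unfolding f(2) g(2) pl(2)[OF f(1) g(1), symmetric] std_act_proj[OF f(1) v] std_act_proj[OF g(1) v]
    std_act_proj[OF F.a_closed[OF f(1) g(1)] v] by (rule l(2)[OF f(1) g(1)])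
 qed
qed

lemma std_act_linear_right: "x <: (Cl a b) ==> linear_on (VV a b lam) (VV a b lam) (std_act a b lam x)"
proof -
 assume "x <: (Cl a b)"
 then obtain f where f: "f <: (cl_free a b)" "x = cl_proj a b f" unfolding Cl_carrier by blast
 interpret op: operators "VV a b lam" "letters a b" "opg lam" gen_par by (rule operators_std)
 have "linear_on (VV a b lam) (VV a b lam) (ev (VV a b lam) (opg lam) f)"
  by (rule op.ev_linear_right) (use f in \<open>simp only: cl_free_eq\<close>)
 thus ?thesis unfolding linear_on_def f(2)
  using std_act_proj[OF f(1)] op.a_closed op.vs_sc by (simp del: free_space_simps)
qed

lemma std_act_word:
 "w \<in> lists (letters a b) ==> v <: (VV a b lam) ==> std_act a b lam (wrd a b w) v = foldr (opg lam) w v"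
proof -
 assume w: "w \<in> lists (letters a b)" and v: "v <: (VV a b lam)"
 interpret op: operators "VV a b lam" "letters a b" "opg lam" gen_par by (rule operators_std)
 show ?thesis unfolding wrd_def std_act_proj[OF single_cl_free[OF w] v] by (rule op.ev_single[OF w v])
qed

lemma std_act_mult:
 assumes "x <: (Cl a b)" "y <: (Cl a b)" and v: "v <: (VV a b lam)"
 shows "std_act a b lam (x \<otimes>\<^bsub>Cl a b\<^esub> y) v = std_act a b lam x (std_act a b lam y v)"
proof -
 obtain f where f: "f <: (cl_free a b)" "x = cl_proj a b f" using assms unfolding Cl_carrier by blast
 obtain g where g: "g <: (cl_free a b)" "y = cl_proj a b g" using assms unfolding Cl_carrier by blast
 interpret op: operators "VV a b lam" "letters a b" "opg lam" gen_par by (rule operators_std)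
 have fg: "conv f g <: (cl_free a b)" using f g unfolding cl_free_eq by (auto intro: conv_carrier simp del: free_alg_simps)
 have c: "ev (VV a b lam) (opg lam) g v <: (VV a b lam)" using op.ev_closed[of g v] g v by (simp only: cl_free_eq)
 show ?thesis
  unfolding f(2) g(2) proj_mult[OF f(1) g(1)] std_act_proj[OF fg v] std_act_proj[OF g(1) v] std_act_proj[OF f(1) c]
  by (rule op.ev_conv) (use f g v in \<open>simp_all only: cl_free_eq\<close>)
qed

text \<open>The predicate K selects shifts by the parities of their positive and negative parts; the vector of the shift d
 has parity p0 + ns d.\<close>

definition DK :: "(bit => bit => bool) => enat => enat => (int => complex) => (int => int) set" where
 "DK K a b lam = {d \<in> DD a b lam. K (ps d) (ns d)}"

definition Std :: "(bit => bit => bool) => enat => enat => (int => complex) => bit => cl_rep" where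
 "Std K a b lam p0 = superspace.extend (free_space (code ` DK K a b lam) (\<lambda>n. p0 + ns (dec n))) (rep.fields (std_act a b lam))"

lemma Std_simps [simp]:
 "carrier (Std K a b lam p0) = {f. finite {i. f i \<noteq> 0} \<and> {i. f i \<noteq> 0} \<subseteq> code ` DK K a b lam}"
 "ring.zero (Std K a b lam p0) = (\<lambda>_. 0)"
 "ring.add (Std K a b lam p0) = (\<lambda>f g i. f i + g i)"
 "module.smult (Std K a b lam p0) = (\<lambda>c f i. c * f i)"
 "part (Std K a b lam p0) = (\<lambda>p. {f. finite {i. f i \<noteq> 0} \<and> {i. f i \<noteq> 0} \<subseteq> {i\<in>code ` DK K a b lam. p0 + ns (dec i) = p}})"
 "act (Std K a b lam p0) = std_act a b lam"
 by (simp_all add: Std_def superspace.extend_def rep.fields_def free_space_def)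

text \<open>The structure depends on four fields only, so facts pass between records of different
  types, here from \<open>free_space\<close> to \<open>Std\<close> and later to modules with a
  changed action.\<close>

lemma vspace_cong:
 assumes "vspace V" "carrier V' = carrier V" "ring.zero V' = ring.zero V" "ring.add V' = ring.add V" "module.smult V' = module.smult V"
 shows "vspace V'"
proof -
 interpret vspace V by fact
 show ?thesis
 proof (rule vspaceI)
  fix x assume "x <: V'"
  thus "(- 1) \<odot>\<^bsub>V'\<^esub> x \<oplus>\<^bsub>V'\<^esub> x = \<zero>\<^bsub>V'\<^esub>" using vs_neg[of x] l_neg[of x] by (simp add: assms)
 qed (auto simp: assms vs_ladd vs_radd vs_assoc a_ac)
qed

lemma submodule_cong:
 assumes "vspace V" "carrier V' = carrier V" "ring.zero V' = ring.zero V" "ring.add V' = ring.add V" "module.smult V' = module.smult V"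
 shows "submodule W CC V' \<longleftrightarrow> submodule W CC V"
 using vspace.sub_iff[OF assms(1)] vspace.sub_iff[OF vspace_cong[OF assms]] by (simp add: assms)

lemma lin_span_cong:
 assumes "vspace V" "carrier V' = carrier V" "ring.zero V' = ring.zero V" "ring.add V' = ring.add V" "module.smult V' = module.smult V"
 shows "lin_span V' S = lin_span V S"
 unfolding lin_span_def submodule_cong[OF assms] ..

lemma Std_free:
 "carrier (Std K a b lam p0) = carrier (free_space (code ` DK K a b lam) par)"
 "ring.zero (Std K a b lam p0) = ring.zero (free_space (code ` DK K a b lam) par)"
 "ring.add (Std K a b lam p0) = ring.add (free_space (code ` DK K a b lam) par)"
 "module.smult (Std K a b lam p0) = module.smult (free_space (code ` DK K a b lam) par)"
 by simp_all

lemma superspace_Std: "superspace (Std K a b lam p0)"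
proof -
 let ?F = "free_space (code ` DK K a b lam) (\<lambda>n. p0 + ns (dec n))"
 note cg = Std_free[of K a b lam p0 "\<lambda>n. p0 + ns (dec n)"]
 note F = superspace_free_space[of "code ` DK K a b lam" "\<lambda>n. p0 + ns (dec n)"]
 have p: "part (Std K a b lam p0) = part ?F" by simp
 show ?thesis
 proof (rule superspaceI)
  show "vspace (Std K a b lam p0)" by (rule vspace_cong[OF vspace_free_space cg])
  show "submodule (part (Std K a b lam p0) q) CC (Std K a b lam p0)" for q
   unfolding p submodule_cong[OF vspace_free_space cg] by (rule superspaceD(2)[OF F])
  show "x = \<zero>\<^bsub>Std K a b lam p0\<^esub>" if "x \<in> part (Std K a b lam p0) 0" "x \<in> part (Std K a b lam p0) 1" for x
   using superspaceD(3)[OF F] that unfolding p cg(2) by blast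
  show "\<exists>x\<in>part (Std K a b lam p0) 0. \<exists>y\<in>part (Std K a b lam p0) 1. v = x \<oplus>\<^bsub>Std K a b lam p0\<^esub> y"
   if "v <: (Std K a b lam p0)" for v
   using superspaceD(4)[OF F, of v] that unfolding p cg .
 qed
qed

lemma vspace_Std: "vspace (Std K a b lam p0)" by (rule superspaceD(1)[OF superspace_Std])

lemma DK_DD: "d \<in> DK K a b lam ==> d \<in> DD a b lam" by (simp add: DK_def)

lemma DK_Fin: "d \<in> DK K a b lam ==> d \<in> Fin" by (simp add: DK_def DD_def)

lemma code_DK [simp]: "e \<in> Fin ==> code e \<in> code ` DK K a b lam \<longleftrightarrow> e \<in> DK K a b lam"
proof
 assume e: "e \<in> Fin" and "code e \<in> code ` DK K a b lam"
 then obtain x where x: "x \<in> DK K a b lam" "code e = code x" by blast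
 thus "e \<in> DK K a b lam" using code_eq[OF e DK_Fin[OF x(1)]] by simp
qed simp

lemma Std_VV: "v <: (Std K a b lam p0) \<longleftrightarrow> v <: (VV a b lam) \<and> (\<forall>d\<in>DD a b lam. v (code d) \<noteq> 0 \<longrightarrow> K (ps d) (ns d))"
proof
 assume v: "v <: (Std K a b lam p0)"
 have "K (ps d) (ns d)" if "d \<in> DD a b lam" "v (code d) \<noteq> 0" for d
 proof -
  have "code d \<in> code ` DK K a b lam" using v that by auto
  hence "d \<in> DK K a b lam" using code_DK[OF DD_Fin[OF that(1)]] by blast
  thus ?thesis by (simp add: DK_def)
 qed
 moreover have "code ` DK K a b lam \<subseteq> code ` DD a b lam" by (auto simp: DK_def)
 ultimately show "v <: (VV a b lam) \<and> (\<forall>d\<in>DD a b lam. v (code d) \<noteq> 0 \<longrightarrow> K (ps d) (ns d))"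
  using v by auto
next
 assume v: "v <: (VV a b lam) \<and> (\<forall>d\<in>DD a b lam. v (code d) \<noteq> 0 \<longrightarrow> K (ps d) (ns d))"
 have "{n. v n \<noteq> 0} \<subseteq> code ` DK K a b lam"
 proof
  fix n assume n: "n \<in> {n. v n \<noteq> 0}"
  then obtain d where "d \<in> DD a b lam" "n = code d" using v by auto
  thus "n \<in> code ` DK K a b lam" using v n by (auto simp: DK_def)
 qed
 thus "v <: (Std K a b lam p0)" using v by auto
qed

lemma Std_part_iff: "v \<in> part (Std K a b lam p0) q \<longleftrightarrow>
 v <: (Std K a b lam p0) \<and> (\<forall>d\<in>DD a b lam. v (code d) \<noteq> 0 \<longrightarrow> p0 + ns d = q)"
proof -
 have "{i. v i \<noteq> 0} \<subseteq> {i\<in>code ` DK K a b lam. p0 + ns (dec i) = q} \<longleftrightarrow> (\<forall>d\<in>DD a b lam. v (code d) \<noteq> 0 \<longrightarrow> p0 + ns d = q)"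
  if v: "{i. v i \<noteq> 0} \<subseteq> code ` DK K a b lam"
 proof
  assume a: "{i. v i \<noteq> 0} \<subseteq> {i\<in>code ` DK K a b lam. p0 + ns (dec i) = q}"
  show "\<forall>d\<in>DD a b lam. v (code d) \<noteq> 0 \<longrightarrow> p0 + ns d = q"
  proof (intro ballI impI)
   fix d assume d: "d \<in> DD a b lam" "v (code d) \<noteq> 0"
   hence "p0 + ns (dec (code d)) = q" using a by blast
   thus "p0 + ns d = q" using DD_Fin[OF d(1)] by simp
  qed
 next
  assume a: "\<forall>d\<in>DD a b lam. v (code d) \<noteq> 0 \<longrightarrow> p0 + ns d = q"
  show "{i. v i \<noteq> 0} \<subseteq> {i\<in>code ` DK K a b lam. p0 + ns (dec i) = q}"
  proof
   fix i assume i: "i \<in> {i. v i \<noteq> 0}"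
   then obtain d where d: "d \<in> DK K a b lam" "i = code d" using v by blast
   thus "i \<in> {i\<in>code ` DK K a b lam. p0 + ns (dec i) = q}" using a i DK_DD[OF d(1)] DK_Fin[OF d(1)] by auto
  qed
 qed
 thus ?thesis by auto
qed

text \<open>The parity of the number of positive letters; \<open>wpar\<close> counts the negative
  ones.\<close>

definition wps :: "gen list => bit" where "wps w = (\<Sum>g\<leftarrow>w. if 0 < idx g then 1 else 0)"

lemma wps_simps [simp]: "wps [] = 0" "wps (g # w) = (if 0 < idx g then 1 else 0) + wps w" "wps (u @ v) = wps u + wps v"
 by (simp_all add: wps_def)

lemma wps_wpar: "w \<in> lists (letters a b) ==> wps w + wpar w = (if even (length w) then 0 else 1)"
proof (induction w)
 case (Cons g w)
 have "idx g \<noteq> 0" using Cons Idx_nonzero by auto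
 thus ?case using Cons by (auto simp: gen_par_def add.assoc add.left_commute)
qed simp

lemma ps_dl: "idx g \<noteq> 0 ==> ps (dl g) = (if 0 < idx g then 1 else 0)" "ns (dl g) = gen_par g"
 by (simp_all add: sm_dl gen_par_def)

lemma word_closed: "w \<in> lists (letters a b) ==> v <: (VV a b lam) ==> foldr (opg lam) w v <: (VV a b lam)"
 by (rule operators.word_closed[OF operators_std])

text \<open>A positive letter changes only \<open>ps\<close> and a negative letter only
  \<open>ns\<close>, each by 1, so parities of shifts are controlled by parities of words.\<close>

lemma word_support:
 assumes "w \<in> lists (letters a b)" "v <: (VV a b lam)" "d \<in> DD a b lam" "foldr (opg lam) w v (code d) \<noteq> 0"
 shows "\<exists>e\<in>DD a b lam. v (code e) \<noteq> 0 \<and> ps d = ps e + wps w \<and> ns d = ns e + wpar w"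
 using assms(1,3,4)
proof (induction w arbitrary: d rule: list.induct)
 case Nil thus ?case by auto
next
 case (Cons g w)
 have g: "idx g \<in> Idx a b" "w \<in> lists (letters a b)" using Cons(2) by auto
 have g0: "idx g \<noteq> 0" using g Idx_nonzero by blast
 have "opg lam g (foldr (opg lam) w v) (code d) \<noteq> 0" using Cons(4) by simp
 from opg_support[OF word_closed[OF g(2) assms(2)] g(1) this] obtain d' where
  d': "d' \<in> DD a b lam" "foldr (opg lam) w v (code d') \<noteq> 0" "code d = code (d' \<lhd>+ dl g)" by blast
 have dF: "d \<in> Fin" "d' \<in> Fin" using Cons(3) d'(1) DD_Fin by blast+
 have d: "d = d' \<lhd>+ dl g" using d'(3) dF by simp
 from Cons(1)[OF g(2) d'(1,2)] obtain e where
  e: "e \<in> DD a b lam" "v (code e) \<noteq> 0" "ps d' = ps e + wps w" "ns d' = ns e + wpar w" by blast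
 have "ps d = ps e + wps (g # w)" "ns d = ns e + wpar (g # w)"
  unfolding d using dF e(3,4) g0 by (simp_all add: sm_plus ps_dl add.commute add.left_commute)
 thus ?case using e by blast
qed

text \<open>K is stable under the changes of the pair (\<open>ps\<close>, \<open>ns\<close>) that
  words of \<open>Calg eps\<close> can make: all changes if eps holds, those that keep the sum
  otherwise.\<close>

definition adm :: "bool => (bit => bit => bool) => bool" where
 "adm eps K \<longleftrightarrow> (\<forall>p n p' n'. K p n \<longrightarrow> (eps \<or> p + n = p' + n') \<longrightarrow> K p' n')"

lemma sub_Std_VV: "submodule (carrier (Std K a b lam p0)) CC (VV a b lam)"
proof -
 interpret V: vspace "VV a b lam" by (rule vspace_free_space)
 interpret S: vspace "Std K a b lam p0" by (rule vspace_Std)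
 show ?thesis
 proof (rule V.subI)
  show "carrier (Std K a b lam p0) \<subseteq> carrier (VV a b lam)" using Std_VV by blast
  show "\<zero>\<^bsub>VV a b lam\<^esub> <: (Std K a b lam p0)" using S.zero_closed by simp
  show "x \<oplus>\<^bsub>VV a b lam\<^esub> y <: (Std K a b lam p0)" if "x <: (Std K a b lam p0)" "y <: (Std K a b lam p0)" for x y
   using S.a_closed[OF that] by simp
  show "c \<odot>\<^bsub>VV a b lam\<^esub> x <: (Std K a b lam p0)" if "x <: (Std K a b lam p0)" for x c
   using S.vs_sc[OF that] by simp
 qed
qed

lemma Std_in_VV: "v <: (Std K a b lam p0) ==> v <: (VV a b lam)" using Std_VV by blast

lemma aw_parity: "w \<in> aw eps a b ==> eps \<or> wps w + wpar w = 0"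
 using wps_wpar[OF aw_lists] by (auto simp: aw_def)

lemma Std_word_closed:
 assumes K: "adm eps K" and w: "w \<in> aw eps a b" and v: "v <: (Std K a b lam p0)"
 shows "std_act a b lam (wrd a b w) v <: (Std K a b lam p0)"
proof -
 have wl: "w \<in> lists (letters a b)" and vV: "v <: (VV a b lam)" using w v aw_lists Std_in_VV by blast+
 have "K (ps d) (ns d)" if d: "d \<in> DD a b lam" "foldr (opg lam) w v (code d) \<noteq> 0" for d
 proof -
  obtain e where e: "e \<in> DD a b lam" "v (code e) \<noteq> 0" "ps d = ps e + wps w" "ns d = ns e + wpar w"
   using word_support[OF wl vV d] by blast
  have "K (ps e) (ns e)" using v e Std_VV by blast
  moreover have "eps \<or> ps e + ns e = ps d + ns d"
  proof -
   have "ps d + ns d = ps e + ns e + (wps w + wpar w)" unfolding e(3,4) by (simp add: add_ac)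
   thus ?thesis using aw_parity[OF w] by auto
  qed
  ultimately show ?thesis using K unfolding adm_def by blast
 qed
 thus ?thesis unfolding std_act_word[OF wl vV] Std_VV using word_closed[OF wl vV] by blast
qed

lemma Std_act_closed:
 assumes K: "adm eps K" and x: "x <: (Calg eps a b)" and v: "v <: (Std K a b lam p0)"
 shows "std_act a b lam x v <: (Std K a b lam p0)"
 by (rule linear_on_span_into[OF vspace_Cl vspace_free_space std_act_linear[OF Std_in_VV[OF v]] aw_Cl sub_Std_VV _ x[unfolded Calg_carrier]])
  (use Std_word_closed[OF K _ v] in blast)

lemma sub_Std_part_VV: "submodule (part (Std K a b lam p0) q) CC (VV a b lam)"
proof -
 interpret V: vspace "VV a b lam" by (rule vspace_free_space)
 interpret S: vspace "Std K a b lam p0" by (rule vspace_Std)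
 note p = superspaceD(2)[OF superspace_Std, of K a b lam p0 q]
 show ?thesis
 proof (rule V.subI)
  show "part (Std K a b lam p0) q \<subseteq> carrier (VV a b lam)" using S.sub_carrier[OF p] Std_in_VV by blast
  show "\<zero>\<^bsub>VV a b lam\<^esub> \<in> part (Std K a b lam p0) q" using S.sub_zero[OF p] by simp
  show "x \<oplus>\<^bsub>VV a b lam\<^esub> y \<in> part (Std K a b lam p0) q" if "x \<in> part (Std K a b lam p0) q" "y \<in> part (Std K a b lam p0) q" for x y
   using S.sub_add[OF p that] by simp
  show "c \<odot>\<^bsub>VV a b lam\<^esub> x \<in> part (Std K a b lam p0) q" if "x \<in> part (Std K a b lam p0) q" for x c
   using S.sub_smult[OF p that] by simp
 qed
qed

lemma Std_act_part:
 assumes K: "adm eps K" and x: "x <: (Calg eps a b)" "x \<in> part (Cl a b) p" and v: "v \<in> part (Std K a b lam p0) q"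
 shows "std_act a b lam x v \<in> part (Std K a b lam p0) (p + q)"
proof -
 have vc: "v <: (Std K a b lam p0)" by (rule superspaceD(5)[OF superspace_Std v])
 have vV: "v <: (VV a b lam)" by (rule Std_in_VV[OF vc])
 have Bc: "wrd a b ` {w \<in> aw eps a b. wpar w = p} \<subseteq> carrier (Cl a b)" using aw_Cl by blast
 have x': "x \<in> part (Calg eps a b) p" using x by simp
 show ?thesis
 proof (rule linear_on_span_into[OF vspace_Cl vspace_free_space std_act_linear[OF vV] Bc sub_Std_part_VV _ Calg_part_span[OF x']])
  fix y assume "y \<in> wrd a b ` {w \<in> aw eps a b. wpar w = p}"
  then obtain w where w: "w \<in> aw eps a b" "wpar w = p" "y = wrd a b w" by blast
  have "p0 + ns d = p + q" if d: "d \<in> DD a b lam" "std_act a b lam (wrd a b w) v (code d) \<noteq> 0" for d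
  proof -
   obtain e where e: "e \<in> DD a b lam" "v (code e) \<noteq> 0" "ns d = ns e + wpar w"
    using word_support[OF aw_lists[OF w(1)] vV d(1)] d(2) unfolding std_act_word[OF aw_lists[OF w(1)] vV] by blast
   have "p0 + ns e = q" using v e(1,2) unfolding Std_part_iff by blast
   thus ?thesis using e(3) w(2) by (auto simp: add_ac)
  qed
  thus "std_act a b lam y v \<in> part (Std K a b lam p0) (p + q)"
   unfolding Std_part_iff w(3) using Std_word_closed[OF K w(1) vc] by blast
 qed
qed

lemma assoc_module_Std:
 assumes K: "adm eps K"
 shows "assoc_module (Calg eps a b) (Std K a b lam p0)"
proof -
 let ?M = "Std K a b lam p0"
 have V: "v <: (VV a b lam)" if "v <: ?M" for v using Std_in_VV that by blast
 note l = linear_onD[OF std_act_linear[OF V]] and r = linear_onD[OF std_act_linear_right[OF Calg_Cl]]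
 have "graded_action (Calg eps a b) ?M" unfolding graded_action_def
 proof (intro conjI ballI allI)
  fix x v assume x: "x <: (Calg eps a b)" and v: "v <: ?M"
  show "act ?M x v <: ?M" using Std_act_closed[OF K x v] by simp
  show "act ?M x (c \<odot>\<^bsub>?M\<^esub> v) = c \<odot>\<^bsub>?M\<^esub> act ?M x v" for c using r(3)[OF x V[OF v], where c = c] by simp
  show "act ?M (c \<odot>\<^bsub>Calg eps a b\<^esub> x) v = c \<odot>\<^bsub>?M\<^esub> act ?M x v" for c using l(3)[OF v Calg_Cl[OF x], where c = c] by simp
  fix w assume w: "w <: ?M"
  show "act ?M x (v \<oplus>\<^bsub>?M\<^esub> w) = act ?M x v \<oplus>\<^bsub>?M\<^esub> act ?M x w" using r(2)[OF x V[OF v] V[OF w]] by simp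
 next
  fix x y v assume x: "x <: (Calg eps a b)" and y: "y <: (Calg eps a b)" and v: "v <: ?M"
  show "act ?M (x \<oplus>\<^bsub>Calg eps a b\<^esub> y) v = act ?M x v \<oplus>\<^bsub>?M\<^esub> act ?M y v" using l(2)[OF v Calg_Cl[OF x] Calg_Cl[OF y]] by simp
 next
  fix p q x v assume x: "x \<in> part (Calg eps a b) p" and v: "v \<in> part ?M q"
  show "act ?M x v \<in> part ?M (p + q)" using Std_act_part[OF K _ _ v, where x = x and p = p] x by (simp del: Std_simps(1-5))
 qed (rule superspace_Std)
 moreover have "act ?M (x \<otimes>\<^bsub>Calg eps a b\<^esub> y) v = act ?M x (act ?M y v)"
  if "x <: (Calg eps a b)" "y <: (Calg eps a b)" "v <: ?M" for x y v
  using std_act_mult[OF Calg_Cl[OF that(1)] Calg_Cl[OF that(2)] V[OF that(3)]] by simp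
 moreover have "act ?M \<one>\<^bsub>Calg eps a b\<^esub> v = v" if "v <: ?M" for v
  using std_act_word[of "[]" a b v lam] V[OF that] by simp
 ultimately show ?thesis unfolding assoc_module_def by blast
qed

section \<open>Basis vectors and weights of a standard module\<close>

abbreviation E :: "(int => int) => nat => complex" where "E d \<equiv> single (code d)"

lemma E_Std: "d \<in> DK K a b lam ==> E d <: (Std K a b lam p0)" by (auto simp: single_def)
lemma E_VV: "d \<in> DD a b lam ==> E d <: (VV a b lam)" by (auto simp: single_def)
lemma E_self [simp]: "E d (code d) = 1" by (simp add: single_def)
lemma E_nonzero: "E d \<noteq> (\<lambda>_. 0)" by (metis E_self zero_neq_one)

lemma opg_E:
 assumes d: "d \<in> Fin"
 shows "opg lam g (E d) = (\<lambda>n. coef lam g d * E (d \<lhd>+ dl g) n)"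
proof
 fix n
 show "opg lam g (E d) n = coef lam g d * E (d \<lhd>+ dl g) n"
 proof (cases "n \<in> code ` Fin")
  case True
  then obtain e where e: "e \<in> Fin" "n = code e" by blast
  have "e \<lhd>- dl g = d \<longleftrightarrow> e = d \<lhd>+ dl g" by auto
  thus ?thesis using e d by (auto simp: single_def)
 next
  case False
  moreover have "code (d \<lhd>+ dl g) \<in> code ` Fin" using d by simp
  ultimately show ?thesis by (auto simp: opg_def single_def)
 qed
qed

lemma std_act_u:
 assumes i: "i \<in> Idx a b" and v: "v <: (VV a b lam)"
 shows "std_act a b lam (cl_u a b i) v = (\<lambda>n. (lam i + of_int (dec n i)) * v n)"
proof
 fix n
 let ?g = "Xi i" let ?h = "Eta i"
 have i0: "i \<noteq> 0" using i Idx_nonzero by blast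
 have e: "std_act a b lam (cl_u a b i) v = opg lam ?g (opg lam ?h v)"
  using std_act_word[of "[?g, ?h]" a b v lam] i v by (simp add: cl_u_eq)
 have c: "opg lam ?g (opg lam ?h v) <: (VV a b lam)" using opg_closed[OF opg_closed[OF v]] i by simp
 show "std_act a b lam (cl_u a b i) v n = (lam i + of_int (dec n i)) * v n"
 proof (cases "n \<in> code ` DD a b lam")
  case False
  hence "v n = 0" "opg lam ?g (opg lam ?h v) n = 0" using v c by auto
  thus ?thesis unfolding e by simp
 next
  case True
  then obtain d where d: "d \<in> DD a b lam" "n = code d" by blast
  have dF: "d \<in> Fin" by (rule DD_Fin[OF d(1)])
  have s: "d \<lhd>- dl ?g \<lhd>- dl ?h = d" by (rule kap_shift) (simp add: kap_def gsign_def sign_def)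
  have l: "lsg ?g (d \<lhd>- dl ?g) = lsg ?h d" using dF by (simp add: lsg_def sm_minus sm_dl)
  have sq: "lsg ?h d * lsg ?h d = 1" by (simp add: lsg_def)
  define y where "y = lam i + of_int (d i)"
  have o: "0 < i ==> y = 0 \<or> y = 1"
  proof -
   assume "0 < i"
   moreover have "okk i (lam i) (lam i + of_int (d i))" using d i by (simp add: DD_def)
   ultimately show ?thesis by (simp add: okk_def y_def)
  qed
  have m1: "mag lam ?h d = y" by (simp add: mag_def y_def)
  have "lam i + of_int ((d \<lhd>- dl ?g) i) = y - 1" by (simp add: fsub_def y_def)
  hence m2: "mag lam ?g (d \<lhd>- dl ?g) = magy ?g (y - 1)" by (simp add: mag_eq)
  \<comment> \<open>\<open>Eta i\<close> contributes the factor y. Then \<open>Xi i\<close> acts at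
    y - 1 and has factor 1 unless y = 0, where the product vanishes anyway.\<close>
  have m: "y * magy ?g (y - 1) = y"
   using o i0 by (cases "0 < i") (auto simp: magy_def)
  have "opg lam ?g (opg lam ?h v) n = v (code d) * coef lam ?h d * coef lam ?g (d \<lhd>- dl ?g)"
   unfolding d(2) using dF s by simp
  also have "\<dots> = v (code d) * (lsg ?h d * lsg ?h d) * (y * magy ?g (y - 1))"
   unfolding coef_def l m1 m2 by (simp add: mult_ac)
  finally show ?thesis unfolding e sq m using d(2) dF by (simp add: y_def)
 qed
qed

lemma wvec_E:
 assumes "d \<in> DK K a b lam"
 shows "wvec a b (Std K a b lam p0) (\<lambda>i. lam i + of_int (d i)) (E d)"
 unfolding wvec_def
proof (intro conjI ballI)
 show "E d <: (Std K a b lam p0)" by (rule E_Std[OF assms])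
 fix i assume i: "i \<in> Idx a b"
 show "act (Std K a b lam p0) (cl_u a b i) (E d) = (lam i + of_int (d i)) \<odot>\<^bsub>Std K a b lam p0\<^esub> E d"
  using std_act_u[OF i E_VV[OF DK_DD[OF assms]]] DK_Fin[OF assms] by (auto simp: single_def fun_eq_iff)
qed

lemma wvec_Std_iff:
 assumes v: "v <: (Std K a b lam p0)"
 shows "wvec a b (Std K a b lam p0) mu v \<longleftrightarrow> (\<forall>d\<in>DD a b lam. v (code d) \<noteq> 0 \<longrightarrow> (\<forall>i\<in>Idx a b. mu i = lam i + of_int (d i)))"
proof
 assume w: "wvec a b (Std K a b lam p0) mu v"
 show "\<forall>d\<in>DD a b lam. v (code d) \<noteq> 0 \<longrightarrow> (\<forall>i\<in>Idx a b. mu i = lam i + of_int (d i))"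
 proof (intro ballI impI)
  fix d i assume d: "d \<in> DD a b lam" "v (code d) \<noteq> 0" and i: "i \<in> Idx a b"
  have "(\<lambda>n. (lam i + of_int (dec n i)) * v n) = (\<lambda>n. mu i * v n)"
   using w i std_act_u[OF i Std_in_VV[OF v]] by (simp add: wvec_def)
  from fun_cong[OF this, of "code d"] show "mu i = lam i + of_int (d i)" using d DD_Fin[OF d(1)] by simp
 qed
next
 assume a: "\<forall>d\<in>DD a b lam. v (code d) \<noteq> 0 \<longrightarrow> (\<forall>i\<in>Idx a b. mu i = lam i + of_int (d i))"
 have "(lam i + of_int (dec n i)) * v n = mu i * v n" if i: "i \<in> Idx a b" for i n
 proof (cases "v n = 0")
  case False
  then obtain d where d: "d \<in> DK K a b lam" "n = code d" using v by auto
  thus ?thesis using a i False DK_DD[OF d(1)] DK_Fin[OF d(1)] by simp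
 qed simp
 hence "(\<lambda>n. (lam i + of_int (dec n i)) * v n) = (\<lambda>n. mu i * v n)" if "i \<in> Idx a b" for i
  using that by (intro ext)
 thus "wvec a b (Std K a b lam p0) mu v"
  unfolding wvec_def using v std_act_u[OF _ Std_in_VV[OF v]] by simp
qed

text \<open>Two shifts in \<open>DD\<close> lie on the same side of the barrier, so the first step
  from one towards the other does not cross it.\<close>

lemma mag_towards:
 assumes d: "d \<in> DD a b lam" and d': "d' \<in> DD a b lam" and i: "i \<in> Idx a b"
 shows "d i < d' i ==> mag lam (Xi i) d \<noteq> 0" "d' i < d i ==> mag lam (Eta i) d \<noteq> 0"
proof -
 define y where "y = lam i + of_int (d i)"
 define y' where "y' = lam i + of_int (d' i)"
 have o: "okk i (lam i) y" "okk i (lam i) y'" using d d' i by (simp_all add: DD_def y_def y'_def)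
 have r: "y' = y + of_int (d' i - d i)" by (simp add: y_def y'_def)
 have i0: "i \<noteq> 0" using i Idx_nonzero by blast
 show "mag lam (Xi i) d \<noteq> 0" if lt: "d i < d' i"
 proof
  assume m: "mag lam (Xi i) d = 0"
  obtain k where k: "d' i - d i = int (Suc k)" using lt zero_less_imp_eq_int[of "d' i - d i"] by (metis diff_gt_0_iff_gt gr0_implies_Suc)
  show False
  proof (cases "0 < i")
   case True
   hence "y = 1" "y' = 0 \<or> y' = 1" using m o by (auto simp: mag_def y_def okk_def split: if_splits)
   hence "of_nat (Suc k) = (0::complex) \<or> of_nat (Suc k) = (-1::complex)" using r unfolding k by (auto simp: algebra_simps)
   hence "of_int (int (Suc k)) = (of_int 0::complex) \<or> of_int (int (Suc k)) = (of_int (-1)::complex)" by simp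
   thus False unfolding of_int_eq_iff by linarith
  next
   case False
   hence "y = -1" using m i0 by (auto simp: mag_def y_def split: if_splits)
   moreover from this have "y' = of_nat k" using r unfolding k by simp
   moreover have "(-1::complex) \<notin> \<nat>"
   proof
    assume "(-1::complex) \<in> \<nat>"
    then obtain n where "(-1::complex) = of_nat n" by (auto elim: Nats_cases)
    hence "of_int (-1) = (of_int (int n) :: complex)" by simp
    thus False unfolding of_int_eq_iff by linarith
   qed
   ultimately show False using o False by (simp add: okk_def)
  qed
 qed
 show "mag lam (Eta i) d \<noteq> 0" if lt: "d' i < d i"
 proof
  assume m: "mag lam (Eta i) d = 0"
  hence y: "y = 0" by (simp add: mag_def y_def)
  have y': "y' = of_int (d' i - d i)" using r y by simp
  show False
  proof (cases "0 < i")
   case True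
   hence "of_int (d' i - d i) = (of_int 0::complex) \<or> of_int (d' i - d i) = (of_int 1 :: complex)" using o y' by (simp add: okk_def)
   thus False unfolding of_int_eq_iff using lt by linarith
  next
   case False
   hence "y' \<in> \<nat>" using o y by (simp add: okk_def)
   then obtain n where "y' = of_nat n" by (auto elim: Nats_cases)
   hence "of_int (d' i - d i) = (of_int (int n) :: complex)" using y' by simp
   thus False unfolding of_int_eq_iff using lt by linarith
  qed
 qed
qed

definition mix :: "(int => bool) => (int => int) => (int => int) => int => int" where
 "mix P d d' = (\<lambda>i. if P i then d' i else d i)"

lemma mix_DD: assumes "d \<in> DD a b lam" "d' \<in> DD a b lam" shows "mix P d d' \<in> DD a b lam"
proof -
 have "{i. mix P d d' i \<noteq> 0} \<subseteq> {i. d i \<noteq> 0} \<union> {i. d' i \<noteq> 0}" by (auto simp: mix_def)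
 moreover have "finite ({i. d i \<noteq> 0} \<union> {i. d' i \<noteq> 0})" using assms by (simp add: DD_def Fin_def)
 ultimately have "finite {i. mix P d d' i \<noteq> 0}" by (rule finite_subset)
 thus ?thesis using assms by (auto simp: DD_def mix_def Fin_def)
qed

text \<open>Induction on the total distance in the coordinates satisfying P. With P as a parameter
  the positive and the negative coordinates are moved by separate words.\<close>

lemma path:
 assumes "d \<in> DD a b lam" "d' \<in> DD a b lam"
 shows "\<exists>w c. w \<in> lists (letters a b) \<and> (\<forall>g\<in>set w. P (idx g)) \<and> c \<noteq> 0 \<and> foldr (opg lam) w (E d) = (\<lambda>n. c * E (mix P d d') n)"
 using assms
proof (induction "\<Sum>i\<in>{i. P i \<and> d i \<noteq> d' i}. nat \<bar>d' i - d i\<bar>" arbitrary: d rule: less_induct)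
 case less
 let ?S = "{i. P i \<and> d i \<noteq> d' i}"
 have "?S \<subseteq> {i. d i \<noteq> 0} \<union> {i. d' i \<noteq> 0}" by auto
 moreover have "finite ({i. d i \<noteq> 0} \<union> {i. d' i \<noteq> 0})" using less(2,3) by (simp add: DD_def Fin_def)
 ultimately have fin: "finite ?S" by (rule finite_subset)
 show ?case
 proof (cases "?S = {}")
  case True
  hence "mix P d d' = d" by (auto simp: mix_def fun_eq_iff)
  thus ?thesis by (intro exI[of _ "[]"] exI[of _ 1]) auto
 next
  case False
  then obtain i where i: "P i" "d i \<noteq> d' i" by blast
  have iI: "i \<in> Idx a b" using i less(2,3) by (auto simp: DD_def)
  define g where "g = (if d i < d' i then Xi i else Eta i)"
  have gi: "idx g = i" by (simp add: g_def)
  have m: "mag lam g d \<noteq> 0" unfolding g_def using mag_towards[OF less(2,3) iI] i by auto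
  have d1: "d \<lhd>+ dl g \<in> DD a b lam" by (rule DD_step[OF less(2) _ m]) (simp add: gi iI)
  have S1: "{j. P j \<and> (d \<lhd>+ dl g) j \<noteq> d' j} \<subseteq> ?S" using i gi by (auto simp: fadd_def) (metis add_0_right dl_other)
  have lt: "(\<Sum>j\<in>{j. P j \<and> (d \<lhd>+ dl g) j \<noteq> d' j}. nat \<bar>d' j - (d \<lhd>+ dl g) j\<bar>) < (\<Sum>j\<in>?S. nat \<bar>d' j - d j\<bar>)"
  proof -
   have "(\<Sum>j\<in>{j. P j \<and> (d \<lhd>+ dl g) j \<noteq> d' j}. nat \<bar>d' j - (d \<lhd>+ dl g) j\<bar>) = (\<Sum>j\<in>?S. nat \<bar>d' j - (d \<lhd>+ dl g) j\<bar>)"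
    by (rule sum.mono_neutral_left[OF fin S1]) auto
   also have "\<dots> < (\<Sum>j\<in>?S. nat \<bar>d' j - d j\<bar>)"
   proof (rule sum_strict_mono_ex1[OF fin])
    have e: "nat \<bar>d' j - (d \<lhd>+ dl g) j\<bar> \<le> nat \<bar>d' j - d j\<bar>" for j
     by (cases "j = i") (use gi i in \<open>auto simp: fadd_def g_def\<close>)
    thus "\<forall>j\<in>?S. nat \<bar>d' j - (d \<lhd>+ dl g) j\<bar> \<le> nat \<bar>d' j - d j\<bar>" by blast
    have "nat \<bar>d' i - (d \<lhd>+ dl g) i\<bar> < nat \<bar>d' i - d i\<bar>" using i by (auto simp: fadd_def g_def)
    thus "\<exists>j\<in>?S. nat \<bar>d' j - (d \<lhd>+ dl g) j\<bar> < nat \<bar>d' j - d j\<bar>" using i by blast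
   qed
   finally show ?thesis .
  qed
  from less(1)[OF lt d1 less(3)] obtain w c where
   w: "w \<in> lists (letters a b)" "\<forall>g\<in>set w. P (idx g)" "c \<noteq> 0"
    "foldr (opg lam) w (E (d \<lhd>+ dl g)) = (\<lambda>n. c * E (mix P (d \<lhd>+ dl g) d') n)" by blast
  have mx: "mix P (d \<lhd>+ dl g) d' = mix P d d'"
  proof
   fix j show "mix P (d \<lhd>+ dl g) d' j = mix P d d' j" using i(1) gi by (cases "j = i") (auto simp: mix_def fadd_def)
  qed
  have dF: "d \<in> Fin" by (rule DD_Fin[OF less(2)])
  have l: "linear_on (VV a b lam) (VV a b lam) (foldr (opg lam) w)" by (rule operators.word_linear[OF operators_std w(1)])
  have "foldr (opg lam) (w @ [g]) (E d) = foldr (opg lam) w (\<lambda>n. coef lam g d * E (d \<lhd>+ dl g) n)" by (simp add: opg_E[OF dF])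
  also have "\<dots> = (\<lambda>n. coef lam g d * foldr (opg lam) w (E (d \<lhd>+ dl g)) n)"
   using linear_onD(3)[OF l E_VV[OF d1], of "coef lam g d"] by simp
  finally have "foldr (opg lam) (w @ [g]) (E d) = (\<lambda>n. (coef lam g d * c) * E (mix P d d') n)" unfolding w(4) mx by (simp add: mult.assoc)
  moreover have "coef lam g d * c \<noteq> 0" using w(3) m by (simp add: coef_def lsg_def)
  moreover have "w @ [g] \<in> lists (letters a b)" using w(1) gi iI by simp
  moreover have "\<forall>h\<in>set (w @ [g]). P (idx h)" using w(2) gi i by simp
  ultimately show ?thesis by blast
 qed
qed

lemma sm_eq: assumes "d \<in> Fin" "e \<in> Fin" "\<And>i. P i ==> d i = e i" shows "sm P d = sm P e"
proof -
 let ?B = "{i. d i \<noteq> 0} \<union> {i. e i \<noteq> 0}"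
 have B: "finite ?B" using assms by (simp add: Fin_def)
 have "sm P d = (\<Sum>i\<in>?B. if P i then of_int (d i) else 0)" by (rule sm_superset[OF B]) blast
 also have "\<dots> = (\<Sum>i\<in>?B. if P i then of_int (e i) else 0)" by (rule sum.cong) (use assms(3) in auto)
 also have "\<dots> = sm P e" by (rule sm_superset[OF B, symmetric]) blast
 finally show ?thesis .
qed

text \<open>Differences u_i - c reduce the support of a vector until a single basis vector remains,
  and \<open>path\<close> leads from it to all others. The hypotheses on W are abstract, Q naming
  the parities of the words available, so that \<open>osp\<close> and its even part are both
  covered.\<close>

theorem Std_irreducible:
 assumes W: "submodule W CC (Std K a b lam p0)" and ne: "W \<noteq> {\<lambda>_. 0}"
  and u: "\<And>i v. i \<in> Idx a b ==> v \<in> W ==> std_act a b lam (cl_u a b i) v \<in> W"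
  and wd: "\<And>d wp wn. d \<in> DK K a b lam ==> E d \<in> W ==> wp \<in> lists (letters a b) ==> wn \<in> lists (letters a b) ==>
   \<forall>g\<in>set wp. 0 < idx g ==> \<forall>g\<in>set wn. idx g < 0 ==> Q (wps wp) (wpar wn) ==> foldr (opg lam) (wn @ wp) (E d) \<in> W"
  and Q: "\<And>d d'. d \<in> DK K a b lam ==> d' \<in> DK K a b lam ==> Q (ps d + ps d') (ns d + ns d')"
 shows "W = carrier (Std K a b lam p0)"
proof -
 interpret S: vspace "Std K a b lam p0" by (rule vspace_Std)
 let ?S = "Std K a b lam p0"
 have Wc: "W \<subseteq> carrier ?S" using S.sub_carrier[OF W] by blast
 have add: "(\<lambda>n. v n + w n) \<in> W" if "v \<in> W" "w \<in> W" for v w using S.sub_add[OF W that] by simp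
 have sc: "(\<lambda>n. c * v n) \<in> W" if "v \<in> W" for c v using S.sub_smult[OF W that] by simp
 obtain v0 where v0: "v0 \<in> W" "v0 \<noteq> (\<lambda>_. 0)" using ne S.sub_zero[OF W] by auto
 have "\<exists>d\<in>DK K a b lam. E d \<in> W" if "v \<in> W" "v \<noteq> (\<lambda>_. 0)" for v
  using that
 proof (induction "card {n. v n \<noteq> 0}" arbitrary: v rule: less_induct)
  case less
  have vc: "v <: ?S" using less Wc by blast
  have fin: "finite {n. v n \<noteq> 0}" using vc by simp
  obtain n where n: "v n \<noteq> 0" using less(3) by auto
  then obtain d where d: "d \<in> DK K a b lam" "n = code d" using vc by auto
  show ?case
  proof (cases "\<exists>m. m \<noteq> n \<and> v m \<noteq> 0")
   case False
   hence "(\<lambda>k. (1 / v n) * v k) = E d" using n d by (auto simp: single_def fun_eq_iff)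
   hence "E d \<in> W" using sc[OF less(2), of "1 / v n"] by simp
   thus ?thesis using d by blast
  next
   case True
   then obtain m where m: "m \<noteq> n" "v m \<noteq> 0" by blast
   then obtain e where e: "e \<in> DK K a b lam" "m = code e" using vc by auto
   have "d \<noteq> e" using m d e by auto
   then obtain i where i: "d i \<noteq> e i" by auto
   have iI: "i \<in> Idx a b" using i DK_DD[OF d(1)] DK_DD[OF e(1)] by (auto simp: DD_def)
   \<comment> \<open>u_i - c kills the coefficient at e and keeps the one at d, so the support
     becomes smaller but stays nonempty.\<close>
   define c where "c = lam i + of_int (e i)"
   define w where "w = (\<lambda>k. std_act a b lam (cl_u a b i) v k + (- c) * v k)"
   have wW: "w \<in> W" unfolding w_def by (rule add[OF u[OF iI less(2)] sc[OF less(2)]])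
   have we: "w k = (lam i + of_int (dec k i) - c) * v k" for k
    unfolding w_def std_act_u[OF iI Std_in_VV[OF vc]] by (simp add: algebra_simps)
   have "w n \<noteq> 0" unfolding we using n i d DK_Fin[OF d(1)] by (simp add: c_def)
   hence w0: "w \<noteq> (\<lambda>_. 0)" by auto
   have "w m = 0" unfolding we using e DK_Fin[OF e(1)] by (simp add: c_def)
   hence "{k. w k \<noteq> 0} \<subset> {k. v k \<noteq> 0}" using m we by auto
   hence "card {k. w k \<noteq> 0} < card {k. v k \<noteq> 0}" by (rule psubset_card_mono[OF fin])
   thus ?thesis using less(1) wW w0 by blast
  qed
 qed
 from this[OF v0] obtain d where d: "d \<in> DK K a b lam" "E d \<in> W" by blast
 have "E d' \<in> W" if d': "d' \<in> DK K a b lam" for d'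
 proof -
  note dD = DK_DD[OF d(1)] DK_DD[OF d']
  let ?m = "mix (\<lambda>i. 0 < i) d d'"
  have mD: "?m \<in> DD a b lam" by (rule mix_DD[OF dD])
  obtain wp c where wp: "wp \<in> lists (letters a b)" "\<forall>g\<in>set wp. 0 < idx g" "c \<noteq> 0" "foldr (opg lam) wp (E d) = (\<lambda>n. c * E ?m n)"
   using path[OF dD, of "\<lambda>i. 0 < i"] by blast
  obtain wn c' where wn: "wn \<in> lists (letters a b)" "\<forall>g\<in>set wn. idx g < 0" "c' \<noteq> 0"
   "foldr (opg lam) wn (E ?m) = (\<lambda>n. c' * E (mix (\<lambda>i. i < 0) ?m d') n)"
   using path[OF mD dD(2), of "\<lambda>i. i < 0"] by blast
  \<comment> \<open>The index 0 is neither positive nor negative; it lies outside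
    \<open>Idx a b\<close>, so both shifts vanish there.\<close>
  have z: "d 0 = 0" "d' 0 = 0" using dD Idx_nonzero[of 0 a b] unfolding DD_def by blast+
  have mx: "mix (\<lambda>i. i < 0) ?m d' = d'"
  proof
   fix i :: int consider "i < 0" | "i = 0" | "i > 0" by linarith
   thus "mix (\<lambda>i. i < 0) ?m d' i = d' i" by cases (auto simp: mix_def z)
  qed
  have l: "linear_on (VV a b lam) (VV a b lam) (foldr (opg lam) wn)" by (rule operators.word_linear[OF operators_std wn(1)])
  have r: "foldr (opg lam) (wn @ wp) (E d) = (\<lambda>n. (c * c') * E d' n)"
   using linear_onD(3)[OF l E_VV[OF mD], of c] wp(4) wn(4) mx by (simp add: mult.assoc)
  have F: "d \<in> Fin" "d' \<in> Fin" "?m \<in> Fin" using dD mD DD_Fin by blast+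
  have p1: "ps ?m = ps d'" by (rule sm_eq[OF F(3,2)]) (simp add: mix_def)
  have p2: "ns ?m = ns d" by (rule sm_eq[OF F(3,1)]) (simp add: mix_def)
  have uniq: "x = e" if "x \<in> DD a b lam" "E e (code x) \<noteq> 0" "e \<in> Fin" for x e
   using that DD_Fin[OF that(1)] by (auto simp: single_def split: if_splits)
  have nz1: "foldr (opg lam) wp (E d) (code ?m) \<noteq> 0" unfolding wp(4) using wp(3) by simp
  \<comment> \<open>\<open>E d\<close> is supported at d alone, so the parity of the word can be
    read off from the parities at its two ends.\<close>
  obtain x where "x \<in> DD a b lam" "E d (code x) \<noteq> 0" "ps ?m = ps x + wps wp" using word_support[OF wp(1) E_VV[OF dD(1)] mD nz1] by blast
  hence q1: "wps wp = ps d + ps d'" using uniq[of x d] F p1 by (simp add: add.assoc[symmetric])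
  have nz2: "foldr (opg lam) wn (E ?m) (code d') \<noteq> 0" unfolding wn(4) mx using wn(3) by simp
  obtain x where "x \<in> DD a b lam" "E ?m (code x) \<noteq> 0" "ns d' = ns x + wpar wn" using word_support[OF wn(1) E_VV[OF mD] dD(2) nz2] by blast
  hence q2: "wpar wn = ns d + ns d'" using uniq[of x ?m] F p2 by (simp add: add.assoc[symmetric])
  have "foldr (opg lam) (wn @ wp) (E d) \<in> W"
   by (rule wd[OF d wp(1) wn(1) wp(2) wn(2)]) (use Q[OF d(1) d'] q1 q2 in simp)
  from sc[OF this, of "1 / (c * c')"] show ?thesis unfolding r using wp(3) wn(3) by simp
 qed
 hence "single ` (code ` DK K a b lam) \<subseteq> W" by blast
 moreover have "carrier ?S = lin_span ?S (single ` (code ` DK K a b lam))"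
  unfolding lin_span_cong[OF vspace_free_space Std_free[of K a b lam p0 "\<lambda>_. 0"]] Std_free(1)[of K a b lam p0 "\<lambda>_. 0"]
  by (rule free_space_span)
 ultimately show ?thesis using S.span_minimal[OF W] Wc by blast
qed

text \<open>Words of even length preserve \<open>ps + ns\<close>; its value r labels the two
  constituents over \<open>Cl_ev\<close>. Over \<open>Cl\<close> there is no restriction.\<close>

definition Kc :: "bool => bit => bit => bit => bool" where
 "Kc eps r = (\<lambda>p n. eps \<or> p + n = r)"

lemma adm_Kc [simp]: "adm eps (Kc eps r)"
 by (auto simp: adm_def Kc_def)

section \<open>Submodules under \<open>osp\<close> and under its even part\<close>

lemma osp_Calg: "x <: (osp eps a b) ==> x <: (Calg eps a b)"
proof -
 interpret C: vspace "Cl a b" by (rule vspace_Cl)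
 have w: "wrd a b w <: (Calg eps a b)" if "w \<in> aw eps a b" for w using aw_Calg that .
 have "osp_gens eps a b \<subseteq> carrier (Calg eps a b)"
 proof
  fix x assume "x \<in> osp_gens eps a b"
  then consider g h where "x = qq a b g h" "g \<in> letters a b" "h \<in> letters a b"
   | g where "x = wrd a b [g]" "g \<in> letters a b" eps
   unfolding osp_gens_def by (auto split: if_splits)
  thus "x <: (Calg eps a b)"
  proof cases
   case 1
   thus ?thesis unfolding 1(1) qq_def
    by (intro C.sub_add[OF sub_Calg] C.sub_smult[OF sub_Calg] w) (auto simp: aw_def)
  next
   case 2 thus ?thesis unfolding 2(1) by (intro w) (auto simp: aw_def)
  qed
 qed
 thus "x <: (osp eps a b) ==> x <: (Calg eps a b)"
  unfolding osp_carrier using C.span_minimal[OF sub_Calg] by blast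
qed

lemma lie_module_assoc:
 assumes "assoc_module (Calg eps a b) M"
 shows "lie_module (osp eps a b) M"
proof -
 interpret amod eps a b M by (rule amod.intro[OF assms])
 note o = osp_Calg[of _ eps a b]
 have "graded_action (osp eps a b) M" unfolding graded_action_def
 proof (intro conjI ballI allI)
  fix p q x v assume "x \<in> part (osp eps a b) p" "v \<in> part M q"
  thus "act M x v \<in> part M (p + q)" using gaD(5)[of x p v q] o by simp
 qed (use ss act_closed act_lin act_add act_smult o in \<open>auto\<close>)
 moreover have "act M (scomm (osp eps a b) p q x y) v =
   act M x (act M y v) \<oplus>\<^bsub>M\<^esub> ((- sign p q) \<odot>\<^bsub>M\<^esub> act M y (act M x v))"
  if "x \<in> part (osp eps a b) p" "y \<in> part (osp eps a b) q" and v: "v <: M" for p q x y v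
 proof -
  have xy: "x <: (Calg eps a b)" "y <: (Calg eps a b)" using that o by simp_all
  show ?thesis
   using xy v Calg_mult_closed[OF xy] Calg_mult_closed[OF xy(2,1)] vspace.sub_smult[OF vspace_Cl sub_Calg]
   by (simp add: scomm_def act_add act_smult act_mult)
 qed
 ultimately show ?thesis unfolding lie_module_def by blast
qed

context amod
begin

text \<open>By \<open>qq_word\<close> the product of two letters is half of \<open>qq g h\<close>
  plus a scalar, and scalars preserve every subspace.\<close>

lemma pair_closed:
 assumes W: "submodule W CC M" and g: "g \<in> letters a b" "h \<in> letters a b" and v: "v \<in> W" and q: "act M (qq a b g h) v \<in> W"
 shows "act M (wrd a b [g, h]) v \<in> W"
proof -
 have vc: "v <: M" by (rule sub_carrier[OF W v])
 have qc: "qq a b g h \<in> A" using osp_Calg qq_osp[OF g] by blast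
 have oc: "wrd a b [] \<in> A" by (rule aw_Calg) simp
 have s: "c \<odot>\<^bsub>Cl a b\<^esub> x \<in> A" if "x \<in> A" for c x using vspace.sub_smult[OF vspace_Cl sub_Calg that] .
 have "act M (wrd a b [g, h]) v = (1/2) \<odot>\<^bsub>M\<^esub> act M (qq a b g h) v \<oplus>\<^bsub>M\<^esub> (kap g h / 2) \<odot>\<^bsub>M\<^esub> v"
  unfolding qq_word(2)[OF g] act_add[OF s[OF qc] s[OF oc] vc] act_smult[OF qc vc] act_smult[OF oc vc] act_one[OF vc] ..
 thus ?thesis using sub_add[OF W sub_smult[OF W q] sub_smult[OF W v]] by simp
qed

text \<open>The flag e tells whether single letters act; otherwise a word of even length is cut into
  pairs. The alphabet L is a parameter since the even part of \<open>osp\<close> contains only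
  brackets of letters of equal parity.\<close>

lemma words_closed:
 assumes W: "submodule W CC M" and L: "L \<subseteq> letters a b" and e: "e ==> eps"
  and q: "\<And>g h v. g \<in> L ==> h \<in> L ==> v \<in> W ==> act M (qq a b g h) v \<in> W"
  and s: "\<And>g v. e ==> g \<in> L ==> v \<in> W ==> act M (wrd a b [g]) v \<in> W"
  and w: "w \<in> lists L" "e \<or> even (length w)" and v: "v \<in> W"
 shows "act M (wrd a b w) v \<in> W"
 using w
proof (induction w rule: length_induct)
 case (1 w)
 note vc = sub_carrier[OF W v]
 show ?case
 proof (cases w)
  case Nil thus ?thesis using act_one[OF vc] v by simp
 next
  case (Cons g w')
  show ?thesis
  proof (cases "even (length w)")
   case True
   then obtain h w'' where c: "w = [g, h] @ w''" using Cons by (cases w') auto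
   have gh: "g \<in> L" "h \<in> L" "w'' \<in> lists L" "even (length w'')" using 1(2) c True by auto
   have a: "[g, h] \<in> aw eps a b" "w'' \<in> aw eps a b" using gh L by (auto simp: aw_def)
   have W': "act M (wrd a b w'') v \<in> W" using 1(1) gh c by simp
   show ?thesis unfolding c act_word[OF a vc] by (rule pair_closed[OF W _ _ W' q[OF gh(1,2) W']]) (use gh L in auto)
  next
   case False
   hence e': e using 1(3) by simp
   hence eps by (rule e)
   have gh: "g \<in> L" "w' \<in> lists L" using 1(2) Cons by auto
   have a: "[g] \<in> aw eps a b" "w' \<in> aw eps a b" using gh L \<open>eps\<close> by (auto simp: aw_def)
   have W': "act M (wrd a b w') v \<in> W" using 1(1) gh Cons e' by simp
   have c: "w = [g] @ w'" using Cons by simp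
   show ?thesis unfolding c act_word[OF a vc] by (rule s[OF e' gh(1) W'])
  qed
 qed
qed

lemma osp_closed_aw:
 assumes W: "submodule W CC M" and o: "\<And>x v. x <: (osp eps a b) ==> v \<in> W ==> act M x v \<in> W"
  and w: "w \<in> aw eps a b" and v: "v \<in> W"
 shows "act M (wrd a b w) v \<in> W"
 by (rule words_closed[OF W subset_refl, of eps])
  (use o qq_osp letter_osp w v in \<open>auto simp: aw_def simp del: letters_iff\<close>)

end

text \<open>What a weight must satisfy for the zero shift to lie in \<open>DD\<close>
  (\<open>zero_DD\<close>). At negative indices every complex number occurs.\<close>

definition admissible :: "enat => enat => (int => complex) => bool" where
 "admissible a b lam \<longleftrightarrow> (\<forall>i\<in>Idx a b. 0 < i \<longrightarrow> lam i = 0 \<or> lam i = 1)"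

lemma zero_DD: "admissible a b lam ==> (\<lambda>_. 0) \<in> DD a b lam"
 by (auto simp: DD_def admissible_def okk_def)

lemma aw_pos_neg: "wn \<in> lists (letters a b) ==> wp \<in> lists (letters a b) ==> \<forall>g\<in>set wp. 0 < idx g ==> \<forall>g\<in>set wn. idx g < 0 ==>
 wpar wp = 0 \<and> wps wn = 0"
proof -
 assume "\<forall>g\<in>set wp. 0 < idx g" "\<forall>g\<in>set wn. idx g < 0"
 hence "wpar wp = 0" "wps wn = 0" by (induction wp; induction wn; simp add: gen_par_def)+
 thus ?thesis ..
qed

lemma Std_words_irreducible:
 assumes W: "submodule W CC (Std (Kc eps r) a b lam p0)" "W \<noteq> {\<lambda>_. 0}"
  and c: "\<And>w v. w \<in> aw eps a b ==> v \<in> W ==> std_act a b lam (wrd a b w) v \<in> W"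
 shows "W = carrier (Std (Kc eps r) a b lam p0)"
proof (rule Std_irreducible[OF W, where Q = "\<lambda>p n. eps \<or> p + n = 0"])
 show "std_act a b lam (cl_u a b i) v \<in> W" if "i \<in> Idx a b" "v \<in> W" for i v
  unfolding cl_u_eq[OF that(1)] by (rule c[OF aw_u[OF that(1)] that(2)])
next
 fix d wp wn assume d: "d \<in> DK (Kc eps r) a b lam" "E d \<in> W" and w: "wp \<in> lists (letters a b)" "wn \<in> lists (letters a b)"
  "\<forall>g\<in>set wp. 0 < idx g" "\<forall>g\<in>set wn. idx g < 0" and Q: "eps \<or> wps wp + wpar wn = 0"
 have wl: "wn @ wp \<in> lists (letters a b)" using w by simp
 have "eps \<or> even (length (wn @ wp))"
  using Q wps_wpar[OF wl] aw_pos_neg[OF w(2,1,3,4)] by (auto split: if_splits simp: add_ac)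
 hence "wn @ wp \<in> aw eps a b" using wl by (simp add: aw_def)
 from c[OF this d(2)] show "foldr (opg lam) (wn @ wp) (E d) \<in> W"
  unfolding std_act_word[OF wl E_VV[OF DK_DD[OF d(1)]]] .
next
 fix d d' assume "d \<in> DK (Kc eps r) a b lam" "d' \<in> DK (Kc eps r) a b lam"
 hence h: "eps \<or> (ps d + ns d = r \<and> ps d' + ns d' = r)" by (auto simp: DK_def Kc_def)
 have e: "ps d + ps d' + (ns d + ns d') = (ps d + ns d) + (ps d' + ns d')" by (simp add: add_ac)
 show "eps \<or> ps d + ps d' + (ns d + ns d') = 0" unfolding e using h by auto
qed

lemma Std_nonzero: "DK K a b lam \<noteq> {} ==> carrier (Std K a b lam p0) \<noteq> {\<zero>\<^bsub>Std K a b lam p0\<^esub>}"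
proof -
 assume "DK K a b lam \<noteq> {}"
 then obtain d where "d \<in> DK K a b lam" by blast
 hence "E d <: (Std K a b lam p0)" by (rule E_Std)
 thus ?thesis using E_nonzero[of d] by (metis Std_simps(2) singletonD)
qed

text \<open>A subspace stable under \<open>osp\<close> is stable under all words of
  \<open>Calg\<close>. Simplicity over \<open>Calg\<close> then follows, as the larger set of
  operators has fewer submodules.\<close>

lemma simple_Std_osp:
 assumes ne: "DK (Kc eps r) a b lam \<noteq> {}"
 shows "simple_rep (carrier (osp eps a b)) (Std (Kc eps r) a b lam p0)"
proof -
 let ?M = "Std (Kc eps r) a b lam p0"
 interpret M: amod eps a b ?M by (rule amod.intro[OF assoc_module_Std[OF adm_Kc]])
 have "W = {\<zero>\<^bsub>?M\<^esub>} \<or> W = carrier ?M" if gW: "graded_submodule (carrier (osp eps a b)) ?M W" for W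
 proof -
  have W: "submodule W CC ?M" and o: "\<And>x v. x <: (osp eps a b) ==> v \<in> W ==> act ?M x v \<in> W"
   using gW unfolding graded_submodule_def by blast+
  show ?thesis
  proof (cases "W = {\<lambda>_. 0}")
   case True thus ?thesis by simp
  next
   case False
   have "W = carrier ?M"
    by (rule Std_words_irreducible[OF W False]) (use M.osp_closed_aw[OF W o] in simp)
   thus ?thesis ..
  qed
 qed
 thus ?thesis unfolding simple_rep_def using Std_nonzero[OF ne] by blast
qed

lemma simple_rep_mono:
 assumes "H \<subseteq> G" "simple_rep H M" shows "simple_rep G M"
proof -
 have "graded_submodule H M W" if "graded_submodule G M W" for W
  using that assms(1) unfolding graded_submodule_def by (simp add: subset_iff)
 thus ?thesis using assms(2) unfolding simple_rep_def by simp
qed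

lemma simple_Std_Calg:
 "DK (Kc eps r) a b lam \<noteq> {} ==> simple_rep (carrier (Calg eps a b)) (Std (Kc eps r) a b lam p0)"
 by (rule simple_rep_mono[OF _ simple_Std_osp]) (use osp_Calg in blast)

lemma vspace_subsp:
 assumes V: "vspace V" and U: "submodule U CC V"
 shows "vspace (subsp V U)"
proof -
 interpret V: vspace V by fact
 show ?thesis
 proof (rule vspaceI)
  fix x assume "x <: (subsp V U)"
  hence x: "x <: V" using V.sub_carrier[OF U] by simp
  show "(- 1) \<odot>\<^bsub>subsp V U\<^esub> x \<oplus>\<^bsub>subsp V U\<^esub> x = \<zero>\<^bsub>subsp V U\<^esub>"
   using V.vs_neg[OF x] V.l_neg[OF x] by simp
 qed (use V.sub_carrier[OF U] in \<open>auto simp: V.sub_zero[OF U] V.sub_add[OF U] V.sub_smult[OF U] V.vs_ladd V.vs_radd V.vs_assoc V.a_ac\<close>)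
qed

lemma submodule_subsp:
 assumes V: "vspace V" and U: "submodule U CC V"
 shows "submodule W CC (subsp V U) \<longleftrightarrow> submodule W CC V \<and> W \<subseteq> U"
 unfolding vspace.sub_iff[OF V] vspace.sub_iff[OF vspace_subsp[OF assms]]
 using vspace.sub_carrier[OF V U] by auto

lemma subsp_act [simp]: "act (subsp M U) = act M"
 by (simp add: subsp_def)

lemma superspace_subsp_part:
 assumes M: "superspace M"
 shows "superspace (subsp M (part M q))"
proof -
 note U = superspaceD(2)[OF M, of q]
 note V = superspaceD(1)[OF M]
 interpret V: vspace M by (rule V)
 have z: "v \<in> part M p ==> v \<in> part M q ==> p \<noteq> q ==> v = \<zero>\<^bsub>M\<^esub>" for p q v
  using superspaceD(3)[OF M] by (cases p; cases q) auto
 show ?thesis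
 proof (rule superspaceI[OF vspace_subsp[OF V U]])
  show "submodule (part (subsp M (part M q)) p) CC (subsp M (part M q))" for p
   unfolding submodule_subsp[OF V U] using V.sub_Int[OF U superspaceD(2)[OF M]] by simp
  show "x = \<zero>\<^bsub>subsp M (part M q)\<^esub>" if "x \<in> part (subsp M (part M q)) 0" "x \<in> part (subsp M (part M q)) 1" for x
   using that z[of x 0 1] by simp
  show "\<exists>x\<in>part (subsp M (part M q)) 0. \<exists>y\<in>part (subsp M (part M q)) 1. v = x \<oplus>\<^bsub>subsp M (part M q)\<^esub> y"
   if v: "v <: (subsp M (part M q))" for v
  proof (cases "q = 0")
   case True
   show ?thesis
    by (rule bexI[of _ v], rule bexI[of _ "\<zero>\<^bsub>M\<^esub>"])
     (use v True V.sub_zero[OF superspaceD(2)[OF M]] superspaceD(5)[OF M, of v] in auto)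
  next
   case False
   hence "q = 1" by simp
   show ?thesis
    by (rule bexI[of _ "\<zero>\<^bsub>M\<^esub>"], rule bexI[of _ v])
     (use v \<open>q = 1\<close> V.sub_zero[OF superspaceD(2)[OF M]] superspaceD(5)[OF M, of v] in auto)
  qed
 qed
qed

text \<open>The part of parity q is the carrier of another \<open>Std\<close>, with q built into the
  predicate. The even elements \<open>qq g h\<close> used have both letters positive or both
  negative, so a basis vector is moved by a positive word and then by a negative word of even
  length.\<close>

lemma simple_Std_part:
 assumes ne: "\<exists>d\<in>DK (Kc eps r) a b lam. p0 + ns d = q"
 shows "simple_rep (part (osp eps a b) 0) (subsp (Std (Kc eps r) a b lam p0) (part (Std (Kc eps r) a b lam p0) q))"
proof -
 let ?M = "Std (Kc eps r) a b lam p0"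
 let ?K = "\<lambda>p n. Kc eps r p n \<and> p0 + n = q"
 let ?N = "Std ?K a b lam p0"
 interpret M: amod eps a b ?M by (rule amod.intro[OF assoc_module_Std[OF adm_Kc]])
 have pc: "part ?M q = carrier ?N"
 proof (rule Set.set_eqI)
  fix v show "v \<in> part ?M q \<longleftrightarrow> v <: ?N" unfolding Std_part_iff Std_VV by blast
 qed
 note U = superspaceD(2)[OF superspace_Std, of "Kc eps r" a b lam p0 q]
 have ev_qq: "qq a b g h \<in> part (osp eps a b) 0" if "g \<in> letters a b" "h \<in> letters a b" "gen_par g = gen_par h" for g h
  using qq_osp[OF that(1,2)] qq_part[OF that(1,2)] that(3) by simp
 have "W = {\<zero>\<^bsub>?M\<^esub>} \<or> W = part ?M q" if gW: "graded_submodule (part (osp eps a b) 0) (subsp ?M (part ?M q)) W" for W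
 proof -
  have W: "submodule W CC ?M" "W \<subseteq> part ?M q"
   using gW submodule_subsp[OF vspace_Std U] unfolding graded_submodule_def by blast+
  have o: "std_act a b lam x v \<in> W" if "x \<in> part (osp eps a b) 0" "v \<in> W" for x v
   using gW that unfolding graded_submodule_def by (simp del: osp_ops)
  have WN: "submodule W CC ?N"
   using W pc unfolding vspace.sub_iff[OF vspace_Std] by simp
  show ?thesis
  proof (cases "W = {\<lambda>_. 0}")
   case True thus ?thesis by simp
  next
   case False
   have "W = carrier ?N"
   \<comment> \<open>Inside the part of parity q the value of \<open>ns\<close> is fixed, hence n =
     0; without eps the sum \<open>ps + ns\<close> is fixed too, hence p = 0.\<close>
   proof (rule Std_irreducible[OF WN False, where Q = "\<lambda>p n. n = 0 \<and> (eps \<or> p = 0)"])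
    fix i v assume i: "i \<in> Idx a b" and v: "v \<in> W"
    show "std_act a b lam (cl_u a b i) v \<in> W"
     unfolding cl_u_eq[OF i] using M.pair_closed[OF W(1) _ _ v, of "Xi i" "Eta i"] o[OF ev_qq v] i by (simp add: gen_par_def)
   next
    fix d wp wn assume d: "d \<in> DK ?K a b lam" "E d \<in> W" and w: "wp \<in> lists (letters a b)" "wn \<in> lists (letters a b)"
     "\<forall>g\<in>set wp. 0 < idx g" "\<forall>g\<in>set wn. idx g < 0" and Q: "wpar wn = 0 \<and> (eps \<or> wps wp = 0)"
    note z = aw_pos_neg[OF w(2,1,3,4)]
    have en: "even (length wn)" using wps_wpar[OF w(2)] z Q by (auto split: if_splits)
    have ep: "eps \<or> even (length wp)" using wps_wpar[OF w(1)] z Q by (auto split: if_splits)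
    have oq: "act ?M (qq a b g h) v \<in> W" if "g \<in> letters a b" "h \<in> letters a b" "gen_par g = gen_par h" "v \<in> W" for g h v
     using o[OF ev_qq[OF that(1-3)] that(4)] by simp
    have wp_W: "act ?M (wrd a b wp) (E d) \<in> W"
    proof (rule M.words_closed[OF W(1), of "{g \<in> letters a b. 0 < idx g}" eps])
     show "act ?M (wrd a b [g]) v \<in> W" if eps "g \<in> {g \<in> letters a b. 0 < idx g}" "v \<in> W" for g v
     proof -
      have "wrd a b [g] \<in> part (osp eps a b) 0" using letter_osp[of g a b] Wg(2)[of g a b] that by (simp add: gen_par_def)
      thus ?thesis using o that(3) by simp
     qed
     show "act ?M (qq a b g h) v \<in> W" if "g \<in> {g \<in> letters a b. 0 < idx g}" "h \<in> {g \<in> letters a b. 0 < idx g}" "v \<in> W" for g h v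
      by (rule oq) (use that in \<open>auto simp: gen_par_def\<close>)
     show "wp \<in> lists {g \<in> letters a b. 0 < idx g}" using w by auto
    qed (use d ep in auto)
    have "act ?M (wrd a b wn) (act ?M (wrd a b wp) (E d)) \<in> W"
    proof (rule M.words_closed[OF W(1), of "{g \<in> letters a b. idx g < 0}" False])
     show "act ?M (qq a b g h) v \<in> W" if "g \<in> {g \<in> letters a b. idx g < 0}" "h \<in> {g \<in> letters a b. idx g < 0}" "v \<in> W" for g h v
      by (rule oq) (use that in \<open>auto simp: gen_par_def\<close>)
     show "wn \<in> lists {g \<in> letters a b. idx g < 0}" using w by auto
     show "act ?M (wrd a b wp) (E d) \<in> W" by (rule wp_W)
    qed (use en in auto)
    thus "foldr (opg lam) (wn @ wp) (E d) \<in> W"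
     using std_act_word[OF w(1) E_VV[OF DK_DD[OF d(1)]]] std_act_word[OF w(2) word_closed[OF w(1) E_VV[OF DK_DD[OF d(1)]]]] by simp
   next
    fix d d' assume "d \<in> DK ?K a b lam" "d' \<in> DK ?K a b lam"
    hence a: "p0 + ns d = p0 + ns d'" "eps \<or> ps d + ns d = ps d' + ns d'" by (auto simp: DK_def Kc_def)
    have "ns d = ns d'" using a(1) by simp
    thus "ns d + ns d' = 0 \<and> (eps \<or> ps d + ps d' = 0)" using a(2) by auto
   qed
   thus ?thesis using pc by simp
  qed
 qed
 moreover have "part ?M q \<noteq> {\<zero>\<^bsub>?M\<^esub>}"
 proof -
  have "DK ?K a b lam \<noteq> {}" using ne by (auto simp: DK_def)
  from Std_nonzero[OF this, of p0] show ?thesis unfolding pc by simp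
 qed
 ultimately show ?thesis unfolding simple_rep_def by simp
qed

text \<open>\<open>weight_space\<close> wants the weight as a function of the operator, so its value
  is chosen from the eigenvalue equation of that operator instead of from the index i.\<close>

lemma wvec_weight_space:
 assumes "wvec a b M lam v" "superspace M"
 shows "\<exists>\<mu>. v \<in> weight_space M (cl_u a b ` Idx a b) \<mu>"
proof -
 have e: "act M h v = (SOME c. act M h v = c \<odot>\<^bsub>M\<^esub> v) \<odot>\<^bsub>M\<^esub> v" if h: "h \<in> cl_u a b ` Idx a b" for h
 proof -
  obtain i where i: "i \<in> Idx a b" "h = cl_u a b i" using h by blast
  have "act M h v = lam i \<odot>\<^bsub>M\<^esub> v" using assms i by (simp add: wvec_def)
  thus ?thesis by (rule someI)
 qed
 have "v <: M" using assms by (simp add: wvec_def)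
 hence "v \<in> weight_space M (cl_u a b ` Idx a b) (\<lambda>h. SOME c. act M h v = c \<odot>\<^bsub>M\<^esub> v)"
  unfolding weight_space_def mem_Collect_eq by (intro conjI ballI e)
 thus ?thesis by blast
qed

lemma weight_space_wvec: "v \<in> weight_space M (cl_u a b ` Idx a b) \<mu> ==> wvec a b M (\<lambda>i. \<mu> (cl_u a b i)) v"
 by (simp add: weight_space_def wvec_def)

lemma weight_module_Std: "weight_module (Std K a b lam p0) (cl_u a b ` Idx a b)"
proof -
 let ?M = "Std K a b lam p0"
 interpret M: vspace ?M by (rule vspace_Std)
 let ?W = "\<Union>\<mu>. weight_space ?M (cl_u a b ` Idx a b) \<mu>"
 have c: "?W \<subseteq> carrier ?M" by (auto simp: weight_space_def)
 have "single ` (code ` DK K a b lam) \<subseteq> ?W"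
 proof
  fix v :: "nat => complex" assume "v \<in> single ` (code ` DK K a b lam)"
  then obtain d where d: "d \<in> DK K a b lam" "v = E d" by blast
  obtain \<mu> where "v \<in> weight_space ?M (cl_u a b ` Idx a b) \<mu>"
   using wvec_weight_space[OF wvec_E[OF d(1)] superspace_Std] d(2) by blast
  thus "v \<in> ?W" by auto
 qed
 hence "lin_span ?M (single ` (code ` DK K a b lam)) \<subseteq> lin_span ?M ?W" by (rule M.span_mono)
 moreover have "carrier ?M = lin_span ?M (single ` (code ` DK K a b lam))"
  unfolding lin_span_cong[OF vspace_free_space Std_free[of K a b lam p0 "\<lambda>_. 0"]] Std_free(1)[of K a b lam p0 "\<lambda>_. 0"]
  by (rule free_space_span)
 ultimately have "carrier ?M \<subseteq> lin_span ?M ?W" by (simp only:)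
 thus ?thesis unfolding weight_module_def using M.span_carrier[OF c] by blast
qed

section \<open>Simple weight modules are standard\<close>

definition simple_weight :: "bool => enat => enat => (cl, 'v) rep => bool" where
 "simple_weight eps a b M \<longleftrightarrow> assoc_module (Calg eps a b) M \<and> simple_rep (carrier (Calg eps a b)) M \<and>
   weight_module M (cl_u a b ` Idx a b)"

lemma simple_weight_iff: "simple_weight eps a b M \<longleftrightarrow> (if eps then simple_weight_Cl a b M else simple_weight_Cl_ev a b M)"
 by (simp add: simple_weight_def simple_weight_Cl_def simple_weight_Cl_ev_def Calg_def)

lemma simple_weight_Std: "DK (Kc eps r) a b lam \<noteq> {} ==> simple_weight eps a b (Std (Kc eps r) a b lam p0)"
 by (simp add: simple_weight_def assoc_module_Std simple_Std_Calg weight_module_Std)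

lemma simple_weight_iso:
 assumes M: "simple_weight eps a b M" and N: "superspace N" and i: "rep_iso (carrier (Calg eps a b)) M N"
 shows "simple_weight eps a b N"
proof -
 have aM: "assoc_module (Calg eps a b) M" using M by (simp add: simple_weight_def)
 interpret M: amod eps a b M by (rule amod.intro[OF aM])
 interpret A: vspace "Calg eps a b" by (rule vspace_Calg)
 have u: "cl_u a b ` Idx a b \<subseteq> carrier (Calg eps a b)" using cl_u_Calg by blast
 have o: "\<one>\<^bsub>Calg eps a b\<^esub> <: (Calg eps a b)" using aw_Calg[of "[]"] by simp
 show ?thesis unfolding simple_weight_def
 proof (intro conjI)
  show "assoc_module (Calg eps a b) N"
   by (rule assoc_module_iso[OF aM N i]) (use A.a_closed A.vs_sc Calg_mult_closed o in auto)
  show "simple_rep (carrier (Calg eps a b)) N"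
   using simple_rep_iso[OF M.gaD(8) N i] M by (simp add: simple_weight_def)
  show "weight_module N (cl_u a b ` Idx a b)"
   using weight_module_iso[OF M.gaD(8) N i u] M by (simp add: simple_weight_def)
 qed
qed

text \<open>The elements u_i are even, so the homogeneous components of a weight vector have the
  same weight, and one of them is nonzero.\<close>

lemma simple_weight_vector:
 assumes M: "simple_weight eps a b M"
 shows "\<exists>lam p m. wvec a b M lam m \<and> m \<noteq> \<zero>\<^bsub>M\<^esub> \<and> m \<in> part M p"
proof -
 interpret M: amod eps a b M by (rule amod.intro) (use M in \<open>simp add: simple_weight_def\<close>)
 let ?W = "\<Union>\<mu>. weight_space M (cl_u a b ` Idx a b) \<mu>"
 have "\<not> ?W \<subseteq> {\<zero>\<^bsub>M\<^esub>}"
 proof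
  assume "?W \<subseteq> {\<zero>\<^bsub>M\<^esub>}"
  hence "lin_span M ?W \<subseteq> {\<zero>\<^bsub>M\<^esub>}" by (rule M.span_minimal[OF M.sub_trivial])
  thus False using M M.zero_closed unfolding simple_weight_def weight_module_def simple_rep_def by blast
 qed
 then obtain \<mu> v where v: "v \<in> weight_space M (cl_u a b ` Idx a b) \<mu>" "v \<noteq> \<zero>\<^bsub>M\<^esub>" by blast
 define lam where "lam i = \<mu> (cl_u a b i)" for i
 have w: "wvec a b M lam v" unfolding lam_def[abs_def] by (rule weight_space_wvec[OF v(1)])
 have vc: "v <: M" using w by (simp add: wvec_def)
 obtain x y where xy: "x \<in> part M 0" "y \<in> part M 1" "v = x \<oplus>\<^bsub>M\<^esub> y" using superspaceD(4)[OF M.ss vc] by blast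
 note c = superspaceD(5)[OF M.ss xy(1)] superspaceD(5)[OF M.ss xy(2)]
 have "act M (cl_u a b i) x = lam i \<odot>\<^bsub>M\<^esub> x \<and> act M (cl_u a b i) y = lam i \<odot>\<^bsub>M\<^esub> y" if i: "i \<in> Idx a b" for i
 proof -
  have u: "cl_u a b i <: (Calg eps a b)" by (rule cl_u_Calg[OF i])
  have "wrd a b [Xi i, Eta i] \<in> part (Cl a b) (wpar [Xi i, Eta i])" by (rule W_part) (use i in simp)
  moreover have "wpar [Xi i, Eta i] = 0" by (simp add: gen_par_def)
  ultimately have up: "cl_u a b i \<in> part (Calg eps a b) 0" using u i by (simp add: cl_u_eq)
  have "act M (cl_u a b i) x \<oplus>\<^bsub>M\<^esub> act M (cl_u a b i) y = act M (cl_u a b i) v"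
   unfolding xy(3) by (rule M.act_lin(2)[OF u c, symmetric])
  also have "\<dots> = lam i \<odot>\<^bsub>M\<^esub> v" using w i by (simp add: wvec_def)
  also have "\<dots> = lam i \<odot>\<^bsub>M\<^esub> x \<oplus>\<^bsub>M\<^esub> lam i \<odot>\<^bsub>M\<^esub> y" unfolding xy(3) by (rule M.vs_radd[OF c])
  finally have "act M (cl_u a b i) x \<oplus>\<^bsub>M\<^esub> act M (cl_u a b i) y = lam i \<odot>\<^bsub>M\<^esub> x \<oplus>\<^bsub>M\<^esub> lam i \<odot>\<^bsub>M\<^esub> y" .
  from part_unique[OF M.ss _ _ _ _ this]
  show ?thesis using M.gaD(5)[OF up xy(1)] M.gaD(5)[OF up xy(2)] M.sub_smult[OF superspaceD(2)[OF M.ss]] xy(1,2) by simp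
 qed
 hence "wvec a b M lam x" "wvec a b M lam y" using c by (simp_all add: wvec_def)
 moreover have "x \<noteq> \<zero>\<^bsub>M\<^esub> \<or> y \<noteq> \<zero>\<^bsub>M\<^esub>" using v(2) xy(3) by auto
 ultimately show ?thesis using xy(1,2) by blast
qed

text \<open>For i > 0 the element u_i is idempotent, so its eigenvalues are 0 and 1.\<close>

lemma wvec_admissible:
 assumes M: "simple_weight eps a b M" and m: "wvec a b M lam m" "m \<noteq> \<zero>\<^bsub>M\<^esub>"
 shows "admissible a b lam"
 unfolding admissible_def
proof (intro ballI impI)
 interpret M: amod eps a b M by (rule amod.intro) (use M in \<open>simp add: simple_weight_def\<close>)
 fix i assume i: "i \<in> Idx a b" "0 < i"
 have u: "cl_u a b i <: (Calg eps a b)" by (rule cl_u_Calg[OF i(1)])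
 have mc: "m <: M" and e: "act M (cl_u a b i) m = lam i \<odot>\<^bsub>M\<^esub> m" using m i by (auto simp: wvec_def)
 have "act M (cl_u a b i) (act M (cl_u a b i) m) = act M (cl_u a b i) m"
  using M.act_mult[OF u u mc] u_idem[OF i] by simp
 hence "(lam i * lam i) \<odot>\<^bsub>M\<^esub> m = lam i \<odot>\<^bsub>M\<^esub> m" using e u mc by (simp add: M.act_lin M.vs_assoc)
 hence "lam i * lam i = lam i" by (rule M.vs_cancel_scalar[OF mc m(2)])
 thus "lam i = 0 \<or> lam i = 1" by simp
qed

text \<open>The weight of m becomes the base weight and the parity of m the parity parameter. The
  basis vector at the zero shift then has the weight and parity of m, and
  \<open>simple_common_weight_iso\<close> applies.\<close>

theorem simple_weight_Std_iso:
 assumes M: "simple_weight eps a b M" and m: "wvec a b M lam m" "m \<noteq> \<zero>\<^bsub>M\<^esub>" "m \<in> part M p"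
 shows "rep_iso (carrier (Calg eps a b)) M (Std (Kc eps 0) a b lam p)"
proof -
 have z: "(\<lambda>_. 0) \<in> DK (Kc eps 0) a b lam"
  using zero_DD[OF wvec_admissible[OF M m(1,2)]] by (simp add: DK_def Kc_def)
 let ?N = "Std (Kc eps 0) a b lam p"
 have N: "simple_weight eps a b ?N" by (rule simple_weight_Std) (use z in blast)
 have n: "wvec a b ?N lam (E (\<lambda>_. 0))" using wvec_E[OF z, of p] by simp
 have nz: "E (\<lambda>_. 0) \<noteq> \<zero>\<^bsub>?N\<^esub>" using E_nonzero by simp
 have np: "E (\<lambda>_. 0) \<in> part ?N p"
  unfolding Std_part_iff using E_Std[OF z] DD_Fin by (auto simp: single_def split: if_splits simp del: Std_simps)
 show ?thesis
  by (rule simple_common_weight_iso[OF _ _ _ _ m n nz np]) (use M N in \<open>simp_all add: simple_weight_def\<close>)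
qed

section \<open>Modules of spinor-oscillator type\<close>

abbreviation "LG eps a b \<equiv> part (osp eps a b) 0 \<union> part (osp eps a b) 1"
abbreviation "LF eps a b \<equiv> env_free (osp eps a b)"

text \<open>The i-th spanning element of the Cartan subalgebra; by \<open>h_elt_qq\<close> it is
  half the bracket of \<open>Xi i\<close> and \<open>Eta i\<close>.\<close>

definition h_elt :: "enat => enat => int => cl" where
 "h_elt a b i = cl_u a b i \<oplus>\<^bsub>Cl a b\<^esub> ((if 0 < i then - 1 / 2 else 1 / 2) \<odot>\<^bsub>Cl a b\<^esub> wrd a b [])"

text \<open>The homomorphism from the free algebra on \<open>osp\<close> to \<open>Cl a b\<close>,
  obtained by letting left multiplications act on 1.\<close>

abbreviation "eCl a b f \<equiv> ev (Cl a b) (monoid.mult (Cl a b)) f (wrd a b [])"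

context
 fixes eps :: bool and a b :: enat
begin

private abbreviation (input) "Cb \<equiv> Cl a b"
private abbreviation (input) "mul \<equiv> monoid.mult (Cl a b)"
private abbreviation (input) "OS \<equiv> osp eps a b"
private abbreviation (input) "OP \<equiv> part (osp eps a b)"
private abbreviation (input) "OC \<equiv> carrier (osp eps a b)"
private abbreviation (input) "AA \<equiv> Calg eps a b"
private abbreviation (input) "AC \<equiv> carrier (Calg eps a b)"
private abbreviation (input) "FG \<equiv> LF eps a b"
private abbreviation (input) "FC \<equiv> carrier (LF eps a b)"
private abbreviation (input) "GG \<equiv> LG eps a b"
private abbreviation (input) "gp \<equiv> \<lambda>x. if x \<in> part (osp eps a b) 0 then 0 else (1::bit)"
private abbreviation (input) "hh \<equiv> h_elt a b"
private abbreviation (input) "We \<equiv> wrd a b"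
private abbreviation (input) "IJ \<equiv> Idx a b"
private abbreviation (input) "ee \<equiv> eCl a b"
private abbreviation (input) "C1 \<equiv> \<zero>\<^bsub>Cl a b\<^esub>"
private abbreviation (input) addC (infixl "+." 65) where "x +. y \<equiv> x \<oplus>\<^bsub>Cl a b\<^esub> y"
private abbreviation (input) multC (infixl "*." 70) where "x *. y \<equiv> x \<otimes>\<^bsub>Cl a b\<^esub> y"
private abbreviation (input) smultC (infixr ".*" 70) where "c .* x \<equiv> c \<odot>\<^bsub>Cl a b\<^esub> x"

lemma env_free_eq: "FG = free_alg GG gp"
 by (simp add: env_free_def)

lemma LG_mem: "x \<in> OP p ==> x \<in> GG" by (cases p) auto

lemma LG_osp: "x \<in> GG ==> x \<in> OC" by auto

lemma osp_part_add: "x \<in> OP p ==> y \<in> OP p ==> x +. y \<in> OP p"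
 using vspace.sub_add[OF vspace_Cl sub_osp] vspace.sub_add[OF vspace_Cl Cl_part_sub] by simp

lemma osp_part_smult: "x \<in> OP p ==> c .* x \<in> OP p"
 using vspace.sub_smult[OF vspace_Cl sub_osp] vspace.sub_smult[OF vspace_Cl Cl_part_sub] by simp

lemma LF_single: "w \<in> lists GG ==> single w \<in> FC"
 unfolding env_free_eq by (rule single_carrier_alg)

lemma vspace_LF: "vspace FG" unfolding env_free_eq by (rule vspace_free_alg)

lemma env_rels_cases:
 assumes "r \<in> env_rels OS"
 obtains (add) p x y where "x \<in> OP p" "y \<in> OP p"
   "r = single [x +. y] \<ominus>\<^bsub>FG\<^esub> (single [x] \<oplus>\<^bsub>FG\<^esub> single [y])"
  | (smult) p x c where "x \<in> OP p"
   "r = single [c .* x] \<ominus>\<^bsub>FG\<^esub> (c \<odot>\<^bsub>FG\<^esub> single [x])"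
  | (bracket) p q x y where "x \<in> OP p" "y \<in> OP q"
   "r = (single [x, y] \<oplus>\<^bsub>FG\<^esub> (- sign p q) \<odot>\<^bsub>FG\<^esub> single [y, x]) \<ominus>\<^bsub>FG\<^esub> single [scomm Cb p q x y]"
proof -
 have m: "single [x] \<otimes>\<^bsub>FG\<^esub> single [y] = single [x, y]" for x y
  by (simp add: env_free_eq conv_single)
 have "(\<exists>p x y. x \<in> OP p \<and> y \<in> OP p \<and>
   r = single [x +. y] \<ominus>\<^bsub>FG\<^esub> (single [x] \<oplus>\<^bsub>FG\<^esub> single [y])) \<or>
  (\<exists>p x c. x \<in> OP p \<and> r = single [c .* x] \<ominus>\<^bsub>FG\<^esub> (c \<odot>\<^bsub>FG\<^esub> single [x])) \<or>
  (\<exists>p q x y. x \<in> OP p \<and> y \<in> OP q \<and>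
   r = (single [x, y] \<oplus>\<^bsub>FG\<^esub> (- sign p q) \<odot>\<^bsub>FG\<^esub> single [y, x]) \<ominus>\<^bsub>FG\<^esub> single [scomm Cb p q x y])"
  using assms unfolding env_rels_def Let_def scomm_def[of "FG"] m osp_ops(2,4,6)
  by (simp only: Un_iff mem_Collect_eq) blast
 thus ?thesis using that by blast
qed

lemma env_rels_carrier: "env_rels OS \<subseteq> FC"
proof
 interpret F: vspace "FG" by (rule vspace_LF)
 fix r assume "r \<in> env_rels OS"
 thus "r \<in> FC"
 proof (cases rule: env_rels_cases)
  case (add p x y)
  show ?thesis unfolding add(3)
   by (intro F.minus_closed F.a_closed LF_single) (use LG_mem[OF add(1)] LG_mem[OF add(2)] LG_mem[OF osp_part_add[OF add(1,2)]] in simp_all)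
 next
  case (smult p x c)
  show ?thesis unfolding smult(2)
   by (intro F.minus_closed F.vs_sc LF_single) (use LG_mem[OF smult(1)] LG_mem[OF osp_part_smult[OF smult(1)]] in simp_all)
 next
  case (bracket p q x y)
  show ?thesis unfolding bracket(3)
   by (intro F.minus_closed F.a_closed F.vs_sc LF_single) (use LG_mem[OF bracket(1)] LG_mem[OF bracket(2)] LG_mem[OF scomm_osp[OF bracket(1,2)]] in simp_all)
 qed
qed

text \<open>Stated for arbitrary operators, so that it applies to left multiplication on
  \<open>Cl a b\<close> and to the action on a Lie module.\<close>

lemma ev_env_rels:
 assumes op: "operators V GG op"
  and add: "\<And>p x y v. x \<in> OP p ==> y \<in> OP p ==> v <: V ==> op (x +. y) v = op x v \<oplus>\<^bsub>V\<^esub> op y v"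
  and smult: "\<And>p x c v. x \<in> OP p ==> v <: V ==> op (c .* x) v = c \<odot>\<^bsub>V\<^esub> op x v"
  and bracket: "\<And>p q x y v. x \<in> OP p ==> y \<in> OP q ==> v <: V ==>
   op (scomm Cb p q x y) v = op x (op y v) \<oplus>\<^bsub>V\<^esub> ((- sign p q) \<odot>\<^bsub>V\<^esub> op y (op x v))"
  and r: "r \<in> env_rels OS" and v: "v <: V"
 shows "ev V op r v = \<zero>\<^bsub>V\<^esub>"
proof -
 interpret op: operators V "GG" op "\<lambda>x. if x \<in> OP 0 then 0 else 1" by fact
 interpret F: vspace "FG" by (rule vspace_LF)
 have l: "linear_on FG V (\<lambda>f. ev V op f v)" using op.ev_linear[OF v] unfolding env_free_eq .
 note ld = linear_onD[OF l] and lm = linear_on_minus[OF F.vspace_axioms op.vspace_axioms l]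
 have s: "ev V op (single w) v = foldr op w v" if "w \<in> lists GG" for w by (rule op.ev_single[OF that v])
 have c: "foldr op w v <: V" if "w \<in> lists GG" for w by (rule op.word_closed[OF that v])
 from r show ?thesis
 proof (cases rule: env_rels_cases)
  case (add p x y)
  have w: "[x] \<in> lists GG" "[y] \<in> lists GG" "[x +. y] \<in> lists GG"
   using LG_mem[OF add(1)] LG_mem[OF add(2)] LG_mem[OF osp_part_add[OF add(1,2)]] by simp_all
  note sc = LF_single[OF w(1)] LF_single[OF w(2)] LF_single[OF w(3)]
  show ?thesis unfolding add(3) lm[OF sc(3) F.a_closed[OF sc(1,2)]] ld(2)[OF sc(1,2)] s[OF w(1)] s[OF w(2)] s[OF w(3)]
   using assms(2)[OF add(1,2) v] c[OF w(1)] c[OF w(2)] op.vs_eq_iff by simp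
 next
  case (smult p x k)
  have w: "[x] \<in> lists GG" "[k .* x] \<in> lists GG"
   using LG_mem[OF smult(1)] LG_mem[OF osp_part_smult[OF smult(1)]] by simp_all
  note sc = LF_single[OF w(1)] LF_single[OF w(2)]
  show ?thesis unfolding smult(2) lm[OF sc(2) F.vs_sc[OF sc(1)]] ld(3)[OF sc(1)] s[OF w(1)] s[OF w(2)]
   using assms(3)[OF smult(1) v] c[OF w(1)] op.vs_eq_iff by simp
 next
  case (bracket p q x y)
  have w: "[x, y] \<in> lists GG" "[y, x] \<in> lists GG" "[scomm Cb p q x y] \<in> lists GG"
   using LG_mem[OF bracket(1)] LG_mem[OF bracket(2)] LG_mem[OF scomm_osp[OF bracket(1,2)]] by simp_all
  note sc = LF_single[OF w(1)] LF_single[OF w(2)] LF_single[OF w(3)]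
  show ?thesis unfolding bracket(3) lm[OF F.a_closed[OF sc(1) F.vs_sc[OF sc(2)]] sc(3)] ld(2)[OF sc(1) F.vs_sc[OF sc(2)]] ld(3)[OF sc(2)] s[OF w(1)] s[OF w(2)] s[OF w(3)]
   using assms(4)[OF bracket(1,2) v] c[OF w(1)] c[OF w(2)] op.vs_eq_iff by simp
 qed
qed

lemma operators_Cl: "operators Cb GG (mul)"
 by (intro operators.intro operators_axioms.intro vspace_Cl Cl_mult_right) (auto intro: osp_Cl)

lemma operators_lie: "lie_module OS M ==> operators M GG (act M)"
proof -
 assume "lie_module OS M"
 hence g: "graded_action OS M" by (simp add: lie_module_def)
 show ?thesis
  by (intro operators.intro operators_axioms.intro superspaceD(1)[OF graded_actionD(1)[OF g]] graded_actionD(2)[OF g]) auto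
qed

lemma env_map_coset:
 assumes f: "f \<in> FC"
 shows "env_map Cb (Idl\<^bsub>FG\<^esub> (env_rels OS) +>\<^bsub>FG\<^esub> f) =
  ev Cb (mul) f \<one>\<^bsub>Cl a b\<^esub>"
proof -
 have z: "ev Cb (mul) r v = C1" if r: "r \<in> env_rels OS" and v: "v <: Cb" for r v
 proof (rule ev_env_rels[OF operators_Cl _ _ _ r v])
  fix p q x y u assume x: "x \<in> OP p" "y \<in> OP q" and u: "u <: Cb"
  have c: "x <: Cb" "y <: Cb" using x osp_Cl[of x eps a b] osp_Cl[of y eps a b] by simp_all
  show "scomm Cb p q x y *. u = x *. (y *. u) +.
    ((- sign p q) .* (y *. (x *. u)))"
   unfolding scomm_def using c u vspace.vs_sc[OF vspace_Cl]
   by (simp add: linear_onD[OF Cl_mult_left[OF u]] Cl_mult_closed Cl_assoc)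
 next
  show "(x +. y) *. v = x *. v +. y *. v"
   if "x \<in> OP p" "y \<in> OP p" "v <: Cb" for p x y v
   using linear_onD(2)[OF Cl_mult_left[OF that(3)], of x y] osp_Cl[of x eps a b] osp_Cl[of y eps a b] that by simp
  show "(c .* x) *. v = c .* (x *. v)"
   if "x \<in> OP p" "v <: Cb" for p x c v
   using linear_onD(3)[OF Cl_mult_left[OF that(2)], of x c] osp_Cl[of x eps a b] that by simp
 qed
 show ?thesis unfolding env_map_def lc_def[symmetric] env_free_eq
  by (rule the_elem_ev[OF operators_Cl _ z _ Cl_one_closed]) (use f env_rels_carrier in \<open>simp_all only: env_free_eq\<close>)
qed

lemma env_act_coset:
 assumes M: "lie_module OS M" and f: "f \<in> FC" and v: "v <: M"
 shows "env_act M (Idl\<^bsub>FG\<^esub> (env_rels OS) +>\<^bsub>FG\<^esub> f) v = ev M (act M) f v"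
proof -
 have g: "graded_action OS M" using M by (simp add: lie_module_def)
 note gd = graded_actionD[OF g]
 have z: "ev M (act M) r u = \<zero>\<^bsub>M\<^esub>" if r: "r \<in> env_rels OS" and u: "u <: M" for r u
 proof (rule ev_env_rels[OF operators_lie[OF M] _ _ _ r u])
  show "act M (x +. y) v = act M x v \<oplus>\<^bsub>M\<^esub> act M y v" if "x \<in> OP p" "y \<in> OP p" "v <: M" for p x y v
   using gd(3)[of x y v] that by simp
  show "act M (c .* x) v = c \<odot>\<^bsub>M\<^esub> act M x v" if "x \<in> OP p" "v <: M" for p x c v
   using gd(4)[of x v c] that by simp
  show "act M (scomm Cb p q x y) v = act M x (act M y v) \<oplus>\<^bsub>M\<^esub> ((- sign p q) \<odot>\<^bsub>M\<^esub> act M y (act M x v))"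
   if "x \<in> OP p" "y \<in> OP q" "v <: M" for p q x y v
   using M that unfolding lie_module_def osp_ops(6) by blast
 qed
 show ?thesis unfolding env_act_def lc_def[symmetric] env_free_eq
  by (rule the_elem_ev[OF operators_lie[OF M] _ z _ v]) (use f env_rels_carrier in \<open>simp_all only: env_free_eq\<close>)
qed

lemma J_osp_coset:
 "Z \<in> J_osp eps a b \<longleftrightarrow> (\<exists>f\<in>FC. Z = Idl\<^bsub>FG\<^esub> (env_rels OS) +>\<^bsub>FG\<^esub> f \<and>
  ev Cb (mul) f \<one>\<^bsub>Cl a b\<^esub> = C1)"
 unfolding J_osp_def env_def quot_simps(1) using env_map_coset by (auto simp del: osp_ops)

lemma eCl_mult:
 assumes f: "f \<in> FC" and y: "y <: Cb"
 shows "ev Cb (mul) f y = ee f *. y"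
proof -
 interpret op: operators "Cl a b" "GG" mul "\<lambda>x. if x \<in> OP 0 then 0 else 1" by (rule operators_Cl)
 have o: "We [] <: Cb" using Cl_one_closed by (simp add: Cl_one)
 show ?thesis
 proof (rule linear_on_eq_free_alg[OF vspace_Cl op.ev_linear[OF y] linear_on_comp[OF op.ev_linear[OF o] Cl_mult_left[OF y]] _ f[unfolded env_free_eq]])
  fix w assume w: "w \<in> lists GG"
  have "foldr (mul) w y = foldr (mul) w (We []) *. y"
   using w
  proof (induction w rule: list.induct)
   case Nil thus ?case using Cl_one_left[OF y] by (simp add: Cl_one)
  next
   case (Cons x w)
   have "x <: Cb" "w \<in> lists GG" using Cons(2) osp_Cl by auto
   thus ?case using Cons(1) op.word_closed[of w, OF _ o] y by (simp add: Cl_assoc)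
  qed
  thus "ev Cb (mul) (single w) y = ee (single w) *. y"
   unfolding op.ev_single[OF w y] op.ev_single[OF w o] .
 qed
qed

text \<open>On a module that comes from \<open>Calg\<close> the action of a free polynomial factors
  through its value in \<open>Cl a b\<close>. Hence \<open>J_osp\<close> annihilates such a
  module.\<close>

lemma ev_assoc_module:
 assumes M: "assoc_module AA M" and f: "f \<in> FC" and v: "v <: M"
 shows "ee f \<in> AC \<and> ev M (act M) f v = act M (ee f) v"
proof -
 interpret M: amod eps a b M by (rule amod.intro[OF M])
 interpret op: operators "Cl a b" "GG" mul "\<lambda>x. if x \<in> OP 0 then 0 else 1" by (rule operators_Cl)
 interpret om: operators M "GG" "act M" "\<lambda>x. if x \<in> OP 0 then 0 else 1" by (rule operators_lie[OF lie_module_assoc[OF M]])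
 interpret F: vspace "FG" by (rule vspace_LF)
 have o: "We [] <: Cb" using Cl_one_closed by (simp add: Cl_one)
 have oA: "We [] \<in> AC" by (rule aw_Calg) simp
 note l = linear_onD[OF op.ev_linear[OF o]] and lm = linear_onD[OF om.ev_linear[OF v]]
 from f show ?thesis unfolding env_free_eq
 proof (induction rule: op.free_alg_induct)
  case (single w)
  have "foldr (mul) w (We []) \<in> AC \<and>
   foldr (act M) w v = act M (foldr (mul) w (We [])) v"
   using single
  proof (induction w rule: list.induct)
   case Nil thus ?case using oA M.act_one[OF v] by simp
  next
   case (Cons x w)
   have "x \<in> AC" "w \<in> lists GG" using Cons(2) osp_Calg by auto
   thus ?case using Cons(1) v by (simp add: Calg_mult_closed M.act_mult)
  qed
  thus ?case unfolding op.ev_single[OF single o] om.ev_single[OF single v] .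
 next
  case zero
  have "linear_on op.F Cb (\<lambda>f. ee f)" "linear_on om.F M (\<lambda>f. ev M (act M) f v)" by (rule op.ev_linear[OF o], rule om.ev_linear[OF v])
  from linear_on_zero[OF vspace_free_alg vspace_Cl this(1)] linear_on_zero[OF vspace_free_alg M.vspace_axioms this(2)]
  have e: "ee (\<lambda>_. 0) = C1" "ev M (act M) (\<lambda>_. 0) v = \<zero>\<^bsub>M\<^esub>" by simp_all
  show ?case unfolding e using vspace.sub_zero[OF vspace_Cl sub_Calg] linear_on_zero[OF vspace_Calg M.vspace_axioms M.gaD(6)[OF v]] by simp
 next
  case (add f g)
  have e: "ee (\<lambda>i. f i + g i) = ee f +. ee g" using l(2)[OF add(1,2)] by simp
  have e': "ev M (act M) (\<lambda>i. f i + g i) v = ev M (act M) f v \<oplus>\<^bsub>M\<^esub> ev M (act M) g v" using lm(2)[OF add(1,2)] by simp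
  show ?case unfolding e e' using add(3,4) vspace.sub_add[OF vspace_Cl sub_Calg] M.act_add v by simp
 next
  case (smult c f)
  have e: "ee (\<lambda>i. c * f i) = c .* ee f" using l(3)[OF smult(1)] by simp
  have e': "ev M (act M) (\<lambda>i. c * f i) v = c \<odot>\<^bsub>M\<^esub> ev M (act M) f v" using lm(3)[OF smult(1)] by simp
  show ?case unfolding e e' using smult(2) vspace.sub_smult[OF vspace_Cl sub_Calg] M.act_smult v by simp
 qed
qed

lemma J_osp_assoc:
 assumes M: "assoc_module AA M" and Z: "Z \<in> J_osp eps a b" and v: "v <: M"
 shows "env_act M Z v = \<zero>\<^bsub>M\<^esub>"
proof -
 interpret M: amod eps a b M by (rule amod.intro[OF M])
 obtain f where f: "f \<in> FC" "Z = Idl\<^bsub>FG\<^esub> (env_rels OS) +>\<^bsub>FG\<^esub> f"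
  "ee f = C1" using Z unfolding J_osp_coset Cl_one by blast
 have "env_act M Z v = act M (ee f) v"
  unfolding f(2) env_act_coset[OF lie_module_assoc[OF M] f(1) v] using ev_assoc_module[OF M f(1) v] by blast
 thus ?thesis unfolding f(3) using linear_on_zero[OF vspace_Calg M.vspace_axioms M.gaD(6)[OF v]] by simp
qed

section \<open>The Cartan subalgebra and the elements u_i\<close>

lemma cartan_eq: "cartan a b = lin_span Cb (hh ` IJ)"
 by (simp add: cartan_def h_elt_def Cl_one image_def)

text \<open>The constants -1/2 for i > 0 and 1/2 for i < 0 are - \<open>kap (Xi i) (Eta i)\<close> /
  2, the scalar term of \<open>qq_word\<close>.\<close>

lemma h_elt_qq: "i \<in> IJ ==> hh i = (1/2) .* qq a b (Xi i) (Eta i)"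
proof -
 assume i: "i \<in> IJ"
 interpret C: vspace "Cl a b" by (rule vspace_Cl)
 have g: "Xi i \<in> letters a b" "Eta i \<in> letters a b" using i by simp_all
 have c: "We [Xi i, Eta i] <: Cb" "We [] <: Cb" by (rule W_carrier; use i in simp)+
 have k: "kap (Xi i) (Eta i) = (if 0 < i then 1 else -1)"
  using i Idx_nonzero by (auto simp: kap_def gsign_def gen_par_def)
 have "(1/2) .* qq a b (Xi i) (Eta i) = We [Xi i, Eta i] +. (- kap (Xi i) (Eta i) / 2) .* We []"
  unfolding qq_word(1)[OF g] using c by (simp add: C.vs_radd C.vs_assoc[symmetric])
 thus ?thesis unfolding h_elt_def k using i by (simp add: cl_u_eq)
qed

lemma h_elt_osp: "i \<in> IJ ==> hh i \<in> OP 0"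
proof -
 assume i: "i \<in> IJ"
 have g: "Xi i \<in> letters a b" "Eta i \<in> letters a b" using i by simp_all
 have "qq a b (Xi i) (Eta i) \<in> OP 0" using qq_osp[OF g] qq_part[OF g] by (simp add: gen_par_def)
 thus ?thesis unfolding h_elt_qq[OF i] by (rule osp_part_smult)
qed

lemma h_elt_act:
 assumes M: "assoc_module AA M" and i: "i \<in> IJ" and v: "v <: M"
 shows "act M (hh i) v = act M (cl_u a b i) v \<oplus>\<^bsub>M\<^esub> (if 0 < i then - 1 / 2 else 1 / 2) \<odot>\<^bsub>M\<^esub> v"
proof -
 interpret M: amod eps a b M by (rule amod.intro[OF M])
 have o: "We [] \<in> AC" by (rule aw_Calg) simp
 show ?thesis unfolding h_elt_def
  using M.act_add[OF cl_u_Calg[OF i] vspace.sub_smult[OF vspace_Cl sub_Calg o] v] M.act_smult[OF o v] M.act_one[OF v] by simp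
qed

lemma cartan_osp: "cartan a b \<subseteq> OC"
 unfolding cartan_eq by (rule vspace.span_minimal[OF vspace_Cl sub_osp]) (use h_elt_osp in auto)

lemma cartan_wvec:
 assumes M: "assoc_module AA M" and v: "v \<in> weight_space M (cartan a b) \<mu>"
 shows "wvec a b M (\<lambda>i. \<mu> (hh i) - (if 0 < i then - 1 / 2 else 1 / 2)) v"
proof -
 interpret M: amod eps a b M by (rule amod.intro[OF M])
 have vc: "v <: M" using v unfolding weight_space_def by blast
 have "act M (cl_u a b i) v = (\<mu> (hh i) - (if 0 < i then - 1 / 2 else 1 / 2)) \<odot>\<^bsub>M\<^esub> v" if i: "i \<in> IJ" for i
 proof -
  let ?c = "if 0 < i then - 1 / 2 else 1 / 2 :: complex"
  have "hh i \<in> cartan a b" unfolding cartan_eq by (rule vspace.span_in[OF vspace_Cl]) (use i in blast)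
  hence "act M (hh i) v = \<mu> (hh i) \<odot>\<^bsub>M\<^esub> v" using v unfolding weight_space_def by blast
  hence e: "act M (cl_u a b i) v \<oplus>\<^bsub>M\<^esub> ?c \<odot>\<^bsub>M\<^esub> v = \<mu> (hh i) \<odot>\<^bsub>M\<^esub> v" unfolding h_elt_act[OF M i vc] .
  have "act M (cl_u a b i) v = (act M (cl_u a b i) v \<oplus>\<^bsub>M\<^esub> ?c \<odot>\<^bsub>M\<^esub> v) \<oplus>\<^bsub>M\<^esub> (- ?c) \<odot>\<^bsub>M\<^esub> v"
   using vc M.act_closed[OF cl_u_Calg[OF i] vc] M.vs_ladd[OF vc, of ?c "- ?c"] by (simp add: M.a_assoc del: minus_divide_left)
  also have "\<dots> = (\<mu> (hh i) + - ?c) \<odot>\<^bsub>M\<^esub> v" unfolding e by (rule M.vs_ladd[OF vc, symmetric])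
  finally show ?thesis by simp
 qed
 thus ?thesis unfolding wvec_def using vc by blast
qed

text \<open>The elements of the algebra that act on v by a scalar form a subspace, and it contains
  every \<open>h_elt a b i\<close>.\<close>

lemma wvec_cartan:
 assumes M: "assoc_module AA M" and w: "wvec a b M lam v"
 shows "\<exists>\<mu>. v \<in> weight_space M (cartan a b) \<mu>"
proof -
 interpret M: amod eps a b M by (rule amod.intro[OF M])
 interpret C: vspace "Cl a b" by (rule vspace_Cl)
 have vc: "v <: M" using w by (simp add: wvec_def)
 let ?T = "{h \<in> AC. \<exists>c. act M h v = c \<odot>\<^bsub>M\<^esub> v}"
 have "submodule ?T CC Cb"
 proof (rule C.subI)
  show "?T \<subseteq> carrier Cb" using Calg_Cl by blast
  have "act M C1 v = 0 \<odot>\<^bsub>M\<^esub> v" using linear_on_zero[OF vspace_Calg M.vspace_axioms M.gaD(6)[OF vc]] vc by simp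
  thus "C1 \<in> ?T" using C.sub_zero[OF sub_Calg] by blast
 next
  fix x y assume "x \<in> ?T" "y \<in> ?T"
  then obtain c d where cd: "x \<in> AC" "y \<in> AC" "act M x v = c \<odot>\<^bsub>M\<^esub> v" "act M y v = d \<odot>\<^bsub>M\<^esub> v" by blast
  hence "act M (x +. y) v = (c + d) \<odot>\<^bsub>M\<^esub> v" using M.act_add vc M.vs_ladd by simp
  thus "x +. y \<in> ?T" using C.sub_add[OF sub_Calg cd(1,2)] by blast
 next
  fix k x assume "x \<in> ?T"
  then obtain c where cd: "x \<in> AC" "act M x v = c \<odot>\<^bsub>M\<^esub> v" by blast
  hence "act M (k .* x) v = (k * c) \<odot>\<^bsub>M\<^esub> v" using M.act_smult vc M.vs_assoc by simp
  thus "k .* x \<in> ?T" using C.sub_smult[OF sub_Calg cd(1)] by blast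
 qed
 moreover have "hh ` IJ \<subseteq> ?T"
 proof (rule image_subsetI)
  fix i assume i: "i \<in> IJ"
  have "act M (hh i) v = (lam i + (if 0 < i then - 1 / 2 else 1 / 2)) \<odot>\<^bsub>M\<^esub> v"
   unfolding h_elt_act[OF M i vc] using w i vc by (simp add: wvec_def M.vs_ladd)
  thus "hh i \<in> ?T" using h_elt_osp[OF i] osp_Calg by auto
 qed
 ultimately have "cartan a b \<subseteq> ?T" unfolding cartan_eq by (rule C.span_minimal)
 hence e: "act M h v = (SOME c. act M h v = c \<odot>\<^bsub>M\<^esub> v) \<odot>\<^bsub>M\<^esub> v" if "h \<in> cartan a b" for h
  using that someI_ex[of "\<lambda>c. act M h v = c \<odot>\<^bsub>M\<^esub> v"] by blast
 have "v \<in> weight_space M (cartan a b) (\<lambda>h. SOME c. act M h v = c \<odot>\<^bsub>M\<^esub> v)"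
  unfolding weight_space_def mem_Collect_eq by (intro conjI ballI e vc)
 thus ?thesis by blast
qed

text \<open>Different shifts have different weights, so a nonzero weight space is spanned by one
  basis vector and the dimensions are bounded by (1|1).\<close>

theorem Std_bounded_spinor_oscillator:
 assumes ne: "DK (Kc eps r) a b lam \<noteq> {}"
 shows "bounded_spinor_oscillator eps a b (Std (Kc eps r) a b lam p0)"
proof -
 let ?M = "Std (Kc eps r) a b lam p0"
 have aM: "assoc_module AA ?M" by (rule assoc_module_Std) simp
 interpret M: amod eps a b ?M by (rule amod.intro[OF aM])
 let ?W = "\<Union>\<mu>. weight_space ?M (cartan a b) \<mu>"
 have c: "?W \<subseteq> carrier ?M" by (auto simp: weight_space_def)
 have "single ` (code ` DK (Kc eps r) a b lam) \<subseteq> ?W"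
 proof
  fix v :: "nat => complex" assume "v \<in> single ` (code ` DK (Kc eps r) a b lam)"
  then obtain d where d: "d \<in> DK (Kc eps r) a b lam" "v = E d" by blast
  obtain \<mu> where "v \<in> weight_space ?M (cartan a b) \<mu>"
   using wvec_cartan[OF aM wvec_E[OF d(1)]] d(2) by blast
  thus "v \<in> ?W" by auto
 qed
 hence "lin_span ?M (single ` (code ` DK (Kc eps r) a b lam)) \<subseteq> lin_span ?M ?W" by (rule M.span_mono)
 moreover have "carrier ?M = lin_span ?M (single ` (code ` DK (Kc eps r) a b lam))"
  unfolding lin_span_cong[OF vspace_free_space Std_free[of "Kc eps r" a b lam p0 "\<lambda>_. 0"]] Std_free(1)[of "Kc eps r" a b lam p0 "\<lambda>_. 0"]
  by (rule free_space_span)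
 ultimately have "carrier ?M \<subseteq> lin_span ?M ?W" by (simp only:)
 hence wm: "weight_module ?M (cartan a b)" unfolding weight_module_def using M.span_carrier[OF c] by blast
 have dim: "dim_le ?M (weight_space ?M (cartan a b) \<mu>) 1" for \<mu>
 proof (cases "\<exists>v\<in>weight_space ?M (cartan a b) \<mu>. v \<noteq> (\<lambda>_. 0)")
  case False
  hence "weight_space ?M (cartan a b) \<mu> \<subseteq> {\<zero>\<^bsub>?M\<^esub>}" by auto
  also have "\<dots> \<subseteq> lin_span ?M {}" using M.sub_zero[OF M.span_sub[of "{}"]] by blast
  finally show ?thesis unfolding dim_le_def by (intro exI[of _ "{}"]) auto
 next
  case True
  have supp: "lam i + of_int (d i) = \<mu> (hh i) - (if 0 < i then - 1 / 2 else 1 / 2)"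
   if v: "v \<in> weight_space ?M (cartan a b) \<mu>" and d: "d \<in> DD a b lam" "v (code d) \<noteq> 0" and i: "i \<in> IJ" for v d i
  proof -
   have vc: "v <: ?M" using v unfolding weight_space_def by blast
   from iffD1[OF wvec_Std_iff[OF vc] cartan_wvec[OF aM v], rule_format, OF d i] show ?thesis by (rule sym)
  qed
  from True obtain v0 where v0: "v0 \<in> weight_space ?M (cartan a b) \<mu>" "v0 \<noteq> (\<lambda>_. 0)" by blast
  have v0c: "v0 <: ?M" using v0 unfolding weight_space_def by blast
  obtain n where n: "v0 n \<noteq> 0" using v0(2) by auto
  then obtain d0 where d0: "d0 \<in> DK (Kc eps r) a b lam" "n = code d0" using v0c by auto
  have sub: "weight_space ?M (cartan a b) \<mu> \<subseteq> lin_span ?M {E d0}"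
  proof
   fix v assume v: "v \<in> weight_space ?M (cartan a b) \<mu>"
   have vc: "v <: ?M" using v unfolding weight_space_def by blast
   define c where "c = v (code d0)"
   have vm: "v m = c * E d0 m" for m
   proof (cases "v m = 0 \<or> m = code d0")
    case True thus ?thesis by (auto simp: single_def c_def)
   next
    case False
    then obtain d where d: "d \<in> DK (Kc eps r) a b lam" "m = code d" using vc by auto
    have "d = d0"
    proof
     fix i
     show "d i = d0 i"
     proof (cases "i \<in> IJ")
      case True
      have "lam i + of_int (d i) = lam i + (of_int (d0 i) :: complex)"
       using supp[OF v DK_DD[OF d(1)] _ True] supp[OF v0(1) DK_DD[OF d0(1)] _ True] False n d d0 by simp
      thus ?thesis by simp
     next
      case False
      thus ?thesis using DK_DD[OF d(1)] DK_DD[OF d0(1)] by (simp add: DD_def)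
     qed
    qed
    thus ?thesis using False d by simp
   qed
   hence "v = c \<odot>\<^bsub>?M\<^esub> E d0" by (simp add: fun_eq_iff)
   moreover have "c \<odot>\<^bsub>?M\<^esub> E d0 \<in> lin_span ?M {E d0}"
    by (rule M.sub_smult[OF M.span_sub]) (use E_Std[OF d0(1)] M.span_in in auto)
   ultimately show "v \<in> lin_span ?M {E d0}" by (simp only:)
  qed
  show ?thesis unfolding dim_le_def using sub E_Std[OF d0(1), of p0]
   by (intro exI[of _ "{E d0}"]) (simp del: Std_simps)
 qed
 have dim': "dim_le ?M (weight_space ?M (cartan a b) \<mu> \<inter> U) 1" for \<mu> U
  using dim[of \<mu>] unfolding dim_le_def by blast
 have bd: "bounded_module ?M (cartan a b)" unfolding bounded_module_def using dim' by blast
 show ?thesis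
  unfolding bounded_spinor_oscillator_def spinor_oscillator_type_def weight_osp_module_def
  using lie_module_assoc[OF aM] wm bd simple_Std_osp[OF ne] J_osp_assoc[OF aM] by blast
qed

lemma spinor_oscillator_J:
 assumes M: "spinor_oscillator_type eps a b M" and f: "f \<in> FC" "ee f = C1" and v: "v <: M"
 shows "ev M (act M) f v = \<zero>\<^bsub>M\<^esub>"
proof -
 have l: "lie_module OS M" using M by (simp add: spinor_oscillator_type_def weight_osp_module_def)
 let ?Z = "Idl\<^bsub>FG\<^esub> (env_rels OS) +>\<^bsub>FG\<^esub> f"
 have "?Z \<in> J_osp eps a b" unfolding J_osp_coset Cl_one using f by blast
 hence "env_act M ?Z v = \<zero>\<^bsub>M\<^esub>" using M v unfolding spinor_oscillator_type_def by blast
 thus ?thesis unfolding env_act_coset[OF l f(1) v] .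
qed

end

text \<open>A preimage f of x in the free algebra whose action on M shifts parity by p. Parity is
  tracked through the action on M because this is what a graded action of x requires later.\<close>

definition lifted :: "bool => enat => enat => (cl, 'v) rep => bit => cl => (cl list => complex) => bool" where
 "lifted eps a b M p x f \<longleftrightarrow> f <: (LF eps a b) \<and> eCl a b f = x \<and>
   (\<forall>q. \<forall>v\<in>part M q. ev M (act M) f v \<in> part M (p + q))"

section \<open>Lifts of elements of the algebra to the free algebra on \<open>osp\<close>\<close>

locale lie_rep =
 fixes eps :: bool and a b :: enat and M :: "(cl, 'v) rep"
 assumes lie: "lie_module (osp eps a b) M"
begin

lemma ga: "graded_action (osp eps a b) M" using lie by (simp add: lie_module_def)
lemmas gd = graded_actionD[OF ga]
sublocale vspace M by (rule superspaceD(1)[OF gd(1)])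
sublocale oc: operators "Cl a b" "LG eps a b" "monoid.mult (Cl a b)" "\<lambda>x. if x \<in> part (osp eps a b) 0 then 0 else 1" by (rule operators_Cl)
sublocale om: operators M "LG eps a b" "act M" "\<lambda>x. if x \<in> part (osp eps a b) 0 then 0 else 1" by (rule operators_lie[OF lie])
sublocale F: vspace "LF eps a b" by (rule vspace_LF)

lemma oneC: "wrd a b [] <: (Cl a b)" using Cl_one_closed by (simp add: Cl_one)

lemma eCl_linear: "linear_on (LF eps a b) (Cl a b) (\<lambda>f. eCl a b f)"
 using oc.ev_linear[OF oneC] by (simp only: env_free_eq)
lemma eM_linear: "v <: M ==> linear_on (LF eps a b) M (\<lambda>f. ev M (act M) f v)"
 using om.ev_linear by (simp only: env_free_eq)
lemma eM_linear_right: "f <: (LF eps a b) ==> linear_on M M (ev M (act M) f)"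
 using om.ev_linear_right by (simp only: env_free_eq)

lemma eCl_single: "x \<in> LG eps a b ==> eCl a b (single [x]) = x"
 using oc.ev_single[of "[x]", OF _ oneC] Cl_one_right[OF osp_Cl[OF LG_osp]] by (simp add: Cl_one)
lemma eCl_Nil: "eCl a b (single []) = wrd a b []" using oc.ev_single[of "[]", OF _ oneC] by simp
lemma eM_single: "x \<in> LG eps a b ==> v <: M ==> ev M (act M) (single [x]) v = act M x v"
 using om.ev_single[of "[x]" v] by simp
lemma eM_Nil: "v <: M ==> ev M (act M) (single []) v = v" using om.ev_single[of "[]" v] by simp

lemma conv_LF: "f <: (LF eps a b) ==> g <: (LF eps a b) ==> conv f g <: (LF eps a b)"
 unfolding env_free_eq by (rule conv_carrier)
lemma eCl_conv: "f <: (LF eps a b) ==> g <: (LF eps a b) ==> eCl a b (conv f g) = eCl a b f \<otimes>\<^bsub>Cl a b\<^esub> eCl a b g"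
proof -
 assume f: "f <: (LF eps a b)" "g <: (LF eps a b)"
 have "eCl a b (conv f g) = ev (Cl a b) (monoid.mult (Cl a b)) f (eCl a b g)"
  by (rule oc.ev_conv[OF _ _ oneC]) (use f in \<open>simp_all only: env_free_eq\<close>)
 thus ?thesis using eCl_mult[OF f(1) linear_onD(1)[OF eCl_linear f(2)]] by simp
qed
lemma eM_conv: "f <: (LF eps a b) ==> g <: (LF eps a b) ==> v <: M ==>
 ev M (act M) (conv f g) v = ev M (act M) f (ev M (act M) g v)"
 by (rule om.ev_conv) (simp_all only: env_free_eq)

lemma lifted_letter: "x \<in> part (osp eps a b) p ==> lifted eps a b M p x (single [x])"
 unfolding lifted_def using LF_single[of "[x]" eps a b] LG_mem[of x eps a b p] eCl_single[of x] eM_single[of x] gd(5)[of x p] superspaceD(5)[OF gd(1)]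
 by (simp del: osp_ops)

lemma lifted_one: "lifted eps a b M 0 (wrd a b []) (single [])"
 unfolding lifted_def using LF_single[of "[]" eps a b] eCl_Nil eM_Nil superspaceD(5)[OF gd(1)] by simp

lemma lifted_add: "lifted eps a b M p x f ==> lifted eps a b M p y g ==> lifted eps a b M p (x \<oplus>\<^bsub>Cl a b\<^esub> y) (f \<oplus>\<^bsub>LF eps a b\<^esub> g)"
 unfolding lifted_def using F.a_closed[of f g] linear_onD(2)[OF eCl_linear, of f g] linear_onD(2)[OF eM_linear, of _ f g]
  superspaceD(5)[OF gd(1)] sub_add[OF superspaceD(2)[OF gd(1)]] by simp

lemma lifted_smult: "lifted eps a b M p x f ==> lifted eps a b M p (c \<odot>\<^bsub>Cl a b\<^esub> x) (c \<odot>\<^bsub>LF eps a b\<^esub> f)"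
 unfolding lifted_def using F.vs_sc[of f c] linear_onD(3)[OF eCl_linear, of f c] linear_onD(3)[OF eM_linear, of _ f c]
  superspaceD(5)[OF gd(1)] sub_smult[OF superspaceD(2)[OF gd(1)]] by simp

lemma lifted_zero: "\<exists>f. lifted eps a b M p \<zero>\<^bsub>Cl a b\<^esub> f"
proof -
 have "\<zero>\<^bsub>Cl a b\<^esub> \<in> part (osp eps a b) p"
  using vspace.sub_zero[OF vspace_Cl sub_osp] vspace.sub_zero[OF vspace_Cl Cl_part_sub] by simp
 thus ?thesis using lifted_letter by blast
qed

lemma lifted_mult:
 assumes f: "lifted eps a b M p x f" and g: "lifted eps a b M q y g"
 shows "lifted eps a b M (p + q) (x \<otimes>\<^bsub>Cl a b\<^esub> y) (conv f g)"
proof -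
 have c: "f <: (LF eps a b)" "g <: (LF eps a b)" using f g unfolding lifted_def by blast+
 have "ev M (act M) (conv f g) v \<in> part M (p + q + r)" if v: "v \<in> part M r" for r v
 proof -
  have "ev M (act M) g v \<in> part M (q + r)" using g v unfolding lifted_def by blast
  hence "ev M (act M) f (ev M (act M) g v) \<in> part M (p + (q + r))" using f unfolding lifted_def by blast
  thus ?thesis unfolding eM_conv[OF c superspaceD(5)[OF gd(1) v]] by (simp add: add.assoc)
 qed
 thus ?thesis unfolding lifted_def using conv_LF[OF c] eCl_conv[OF c] f g unfolding lifted_def by blast
qed

text \<open>From \<open>qq_word\<close>. If the scalar term is nonzero, the two letters have equal
  parity, so the empty word is a lift of the required parity 0.\<close>

lemma lifted_pair:
 assumes g: "g \<in> letters a b" "h \<in> letters a b"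
 shows "\<exists>f. lifted eps a b M (gen_par g + gen_par h) (wrd a b [g, h]) f"
proof -
 have q: "qq a b g h \<in> part (osp eps a b) (gen_par g + gen_par h)" using qq_osp[OF g] qq_part[OF g] by simp
 have 1: "lifted eps a b M (gen_par g + gen_par h) ((1/2) \<odot>\<^bsub>Cl a b\<^esub> qq a b g h) ((1/2) \<odot>\<^bsub>LF eps a b\<^esub> single [qq a b g h])"
  by (rule lifted_smult[OF lifted_letter[OF q]])
 have "\<exists>f. lifted eps a b M (gen_par g + gen_par h) ((kap g h / 2) \<odot>\<^bsub>Cl a b\<^esub> wrd a b []) f"
 proof (cases "kap g h = 0")
  case True thus ?thesis using lifted_zero oneC vspace.vs_lzero[OF vspace_Cl] by simp
 next
  case False
  hence "gen_par g + gen_par h = 0" by (auto simp: kap_def gen_par_def split: if_splits)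
  thus ?thesis using lifted_smult[OF lifted_one] by metis
 qed
 then obtain f where "lifted eps a b M (gen_par g + gen_par h) ((kap g h / 2) \<odot>\<^bsub>Cl a b\<^esub> wrd a b []) f" by blast
 from lifted_add[OF 1 this] show ?thesis unfolding qq_word(2)[OF g, symmetric] by blast
qed

lemma lifted_word: "w \<in> aw eps a b ==> \<exists>f. lifted eps a b M (wpar w) (wrd a b w) f"
proof (induction w rule: length_induct)
 case (1 w)
 have wl: "w \<in> lists (letters a b)" using 1(2) by (rule aw_lists)
 show ?case
 proof (cases w)
  case Nil thus ?thesis using lifted_one by auto
 next
  case (Cons g w')
  show ?thesis
  proof (cases "even (length w)")
   case True
   then obtain h w'' where c: "w = [g, h] @ w''" using Cons by (cases w') auto
   have gh: "g \<in> letters a b" "h \<in> letters a b" "w'' \<in> aw eps a b" "w'' \<in> lists (letters a b)" using 1(2) wl c True by (auto simp: aw_def)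
   obtain f where f: "lifted eps a b M (gen_par g + gen_par h) (wrd a b [g, h]) f" using lifted_pair[OF gh(1,2)] by blast
   obtain f' where f': "lifted eps a b M (wpar w'') (wrd a b w'') f'" using 1(1)[rule_format, of w''] gh(3) c by auto
   from lifted_mult[OF f f'] show ?thesis using W_mult[of "[g, h]" a b w''] gh c by (auto simp: add.assoc)
  next
   case False
   hence e: eps using 1(2) by (simp add: aw_def)
   have gh: "g \<in> letters a b" "w' \<in> aw eps a b" "w' \<in> lists (letters a b)" using 1(2) wl Cons e by (auto simp: aw_def)
   have "wrd a b [g] \<in> part (osp eps a b) (gen_par g)" using letter_osp[OF gh(1)] Wg(2)[OF gh(1)] e by simp
   hence f: "lifted eps a b M (gen_par g) (wrd a b [g]) (single [wrd a b [g]])" by (rule lifted_letter)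
   obtain f' where f': "lifted eps a b M (wpar w') (wrd a b w') f'" using 1(1)[rule_format, of w'] gh(2) Cons by auto
   from lifted_mult[OF f f'] show ?thesis using W_mult[of "[g]" a b w'] gh Cons by auto
  qed
 qed
qed

lemma lifted_part:
 assumes "x \<in> part (Calg eps a b) p"
 shows "\<exists>f. lifted eps a b M p x f"
proof -
 have "wrd a b ` {w \<in> aw eps a b. wpar w = p} \<subseteq> carrier (Cl a b)" using aw_Cl by blast
 with Calg_part_span[OF assms] show ?thesis
 proof (induction rule: oc.span_induct)
  case (base y) thus ?case using lifted_word by blast
 next
  case zero show ?case by (rule lifted_zero)
 next
  case (add x y) thus ?case using lifted_add by blast
 next
  case (smult c x) thus ?case using lifted_smult by blast
 qed
qed

text \<open>The surjectivity of the homomorphism from the enveloping algebra onto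
  \<open>Calg\<close>.\<close>

lemma lift_exists:
 assumes "x <: (Calg eps a b)"
 shows "\<exists>f\<in>carrier (LF eps a b). eCl a b f = x"
proof -
 obtain x0 x1 where d: "x0 \<in> part (Calg eps a b) 0" "x1 \<in> part (Calg eps a b) 1" "x = x0 \<oplus>\<^bsub>Cl a b\<^esub> x1"
  using Calg_decompose[OF assms] by blast
 obtain f0 f1 where f: "lifted eps a b M 0 x0 f0" "lifted eps a b M 1 x1 f1" using lifted_part[OF d(1)] lifted_part[OF d(2)] by blast
 hence "f0 \<oplus>\<^bsub>LF eps a b\<^esub> f1 <: (LF eps a b)" "eCl a b (f0 \<oplus>\<^bsub>LF eps a b\<^esub> f1) = x"
  unfolding lifted_def d(3) using F.a_closed linear_onD(2)[OF eCl_linear] by simp_all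
 thus ?thesis by blast
qed

end

text \<open>An element of the algebra acts through any of its lifts, because two lifts differ by an
  element that maps to zero and therefore kills M. The graded space of M is kept and only its action
  is extended.\<close>

theorem spinor_oscillator_pullback:
 fixes M :: "(cl, 'v) rep"
 assumes M: "spinor_oscillator_type eps a b M"
 shows "\<exists>N :: (cl, 'v) rep. simple_weight eps a b N \<and> rep_iso (carrier (osp eps a b)) M N"
proof -
 have l: "lie_module (osp eps a b) M" using M by (simp add: spinor_oscillator_type_def weight_osp_module_def)
 interpret M: lie_rep eps a b M by (rule lie_rep.intro[OF l])
 note gd = M.gd
 \<comment> \<open>Some lift of x is chosen here; that all lifts act alike is the next fact
   \<open>ac\<close>, where the annihilation of M by \<open>J_osp\<close> enters.\<close>
 define ac where "ac x v = ev M (act M) (SOME f. f <: (LF eps a b) \<and> eCl a b f = x) v" for x v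
 define N where "N = M\<lparr>act := ac\<rparr>"
 have N: "carrier N = carrier M" "ring.zero N = ring.zero M" "ring.add N = ring.add M" "module.smult N = module.smult M"
  "part N = part M" "act N = ac" by (simp_all add: N_def)
 have ac: "ac x v = ev M (act M) f v" if f: "f <: (LF eps a b)" "eCl a b f = x" and v: "v <: M" for x v f
 proof -
  let ?g = "SOME f. f <: (LF eps a b) \<and> eCl a b f = x"
  have g: "?g <: (LF eps a b) \<and> eCl a b ?g = x" by (rule someI[of _ f]) (use f in simp)
  have "eCl a b (?g \<ominus>\<^bsub>LF eps a b\<^esub> f) = eCl a b ?g \<ominus>\<^bsub>Cl a b\<^esub> eCl a b f"
   by (rule linear_on_minus[OF vspace_LF vspace_Cl M.eCl_linear]) (use g f in auto)
  also have "\<dots> = \<zero>\<^bsub>Cl a b\<^esub>" using g f vspace.vs_eq_iff[OF vspace_Cl] linear_onD(1)[OF M.eCl_linear f(1)] by simp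
  finally have "ev M (act M) (?g \<ominus>\<^bsub>LF eps a b\<^esub> f) v = \<zero>\<^bsub>M\<^esub>"
   by (intro spinor_oscillator_J[OF M _ _ v] M.F.minus_closed) (use g f in auto)
  moreover have "ev M (act M) (?g \<ominus>\<^bsub>LF eps a b\<^esub> f) v = ev M (act M) ?g v \<ominus>\<^bsub>M\<^esub> ev M (act M) f v"
   by (rule linear_on_minus[OF vspace_LF M.vspace_axioms M.eM_linear[OF v]]) (use g f in auto)
  ultimately show ?thesis unfolding ac_def
   using M.vs_eq_iff linear_onD(1)[OF M.eM_linear[OF v]] g f(1) by simp
 qed
 let ?A = "carrier (Calg eps a b)"
 have ssN: "superspace N"
 proof (rule superspaceI)
  show "vspace N" by (rule vspace_cong[OF M.vspace_axioms]) (simp_all add: N)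
  show "submodule (part N p) CC N" for p
   unfolding N(5) using submodule_cong[OF M.vspace_axioms N(1-4)] superspaceD(2)[OF gd(1)] by blast
 qed (use superspaceD(3,4)[OF gd(1)] in \<open>auto simp: N\<close>)
 have gaN: "graded_action (Calg eps a b) N" unfolding graded_action_def N
 proof (intro conjI ballI allI)
  show "superspace N" by (rule ssN)
  fix x v assume x: "x \<in> ?A" and v: "v <: M"
  obtain f where f: "f <: (LF eps a b)" "eCl a b f = x" using M.lift_exists[OF x] by blast
  show "ac x v <: M" unfolding ac[OF f v] by (rule linear_onD(1)[OF M.eM_linear[OF v] f(1)])
  show "ac x (c \<odot>\<^bsub>M\<^esub> v) = c \<odot>\<^bsub>M\<^esub> ac x v" for c
   unfolding ac[OF f v] ac[OF f M.vs_sc[OF v]] by (rule linear_onD(3)[OF M.eM_linear_right[OF f(1)] v])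
  show "ac (c \<odot>\<^bsub>Calg eps a b\<^esub> x) v = c \<odot>\<^bsub>M\<^esub> ac x v" for c
  proof -
   have "eCl a b (c \<odot>\<^bsub>LF eps a b\<^esub> f) = c \<odot>\<^bsub>Calg eps a b\<^esub> x" using linear_onD(3)[OF M.eCl_linear f(1)] f(2) by simp
   from ac[OF M.F.vs_sc[OF f(1)] this v] show ?thesis unfolding ac[OF f v] using linear_onD(3)[OF M.eM_linear[OF v] f(1)] by simp
  qed
  show "ac x (v \<oplus>\<^bsub>M\<^esub> w) = ac x v \<oplus>\<^bsub>M\<^esub> ac x w" if w: "w <: M" for w
   unfolding ac[OF f v] ac[OF f w] ac[OF f M.a_closed[OF v w]] by (rule linear_onD(2)[OF M.eM_linear_right[OF f(1)] v w])
  show "ac (x \<oplus>\<^bsub>Calg eps a b\<^esub> y) v = ac x v \<oplus>\<^bsub>M\<^esub> ac y v" if y: "y \<in> ?A" for y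
  proof -
   obtain g where g: "g <: (LF eps a b)" "eCl a b g = y" using M.lift_exists[OF y] by blast
   have "eCl a b (f \<oplus>\<^bsub>LF eps a b\<^esub> g) = x \<oplus>\<^bsub>Calg eps a b\<^esub> y" using linear_onD(2)[OF M.eCl_linear f(1) g(1)] f(2) g(2) by simp
   from ac[OF M.F.a_closed[OF f(1) g(1)] this v] show ?thesis unfolding ac[OF f v] ac[OF g v] using linear_onD(2)[OF M.eM_linear[OF v] f(1) g(1)] by simp
  qed
 next
  fix p q x v assume x: "x \<in> part (Calg eps a b) p" and v: "v \<in> part M q"
  obtain f where f: "lifted eps a b M p x f" using M.lifted_part[OF x] by blast
  hence f': "f <: (LF eps a b)" "eCl a b f = x" "ev M (act M) f v \<in> part M (p + q)" using v unfolding lifted_def by blast+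
  show "ac x v \<in> part M (p + q)" unfolding ac[OF f'(1,2) superspaceD(5)[OF gd(1) v]] by (rule f'(3))
 qed
 have aN: "assoc_module (Calg eps a b) N" unfolding assoc_module_def
 proof (intro conjI ballI gaN)
  fix x y v assume x: "x \<in> ?A" and y: "y \<in> ?A" and "v <: N"
  hence v: "v <: M" by (simp add: N)
  obtain f where f: "f <: (LF eps a b)" "eCl a b f = x" using M.lift_exists[OF x] by blast
  obtain g where g: "g <: (LF eps a b)" "eCl a b g = y" using M.lift_exists[OF y] by blast
  have "eCl a b (conv f g) = x \<otimes>\<^bsub>Calg eps a b\<^esub> y" using M.eCl_conv[OF f(1) g(1)] f(2) g(2) by simp
  from ac[OF M.conv_LF[OF f(1) g(1)] this v]
  show "act N (x \<otimes>\<^bsub>Calg eps a b\<^esub> y) v = act N x (act N y v)"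
   unfolding N M.eM_conv[OF f(1) g(1) v] using ac[OF g v] ac[OF f linear_onD(1)[OF M.eM_linear[OF v] g(1)]] by simp
 next
  fix v assume "v <: N"
  hence v: "v <: M" by (simp add: N)
  show "act N \<one>\<^bsub>Calg eps a b\<^esub> v = v" unfolding N Calg_ops(5) using ac[OF LF_single M.eCl_Nil v] M.eM_Nil[OF v] by simp
 qed
 have agp: "ac x v = act M x v" if x: "x \<in> part (osp eps a b) p" and v: "v <: M" for p x v
  using ac[OF _ M.eCl_single[OF LG_mem[OF x]] v] LF_single[of "[x]" eps a b] M.eM_single[OF LG_mem[OF x] v] LG_mem[OF x] by simp
 have ag: "ac x v = act M x v" if x: "x <: (osp eps a b)" and v: "v <: M" for x v
 proof -
  have s: "lin_span (Cl a b) (osp_gens eps a b \<inter> part (Cl a b) p) \<subseteq> part (osp eps a b) p" for p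
  proof -
   have "lin_span (Cl a b) (osp_gens eps a b \<inter> part (Cl a b) p) \<subseteq> part (Cl a b) p"
    by (rule vspace.span_minimal[OF vspace_Cl Cl_part_sub]) simp
   moreover have "lin_span (Cl a b) (osp_gens eps a b \<inter> part (Cl a b) p) \<subseteq> lin_span (Cl a b) (osp_gens eps a b)"
    by (rule vspace.span_mono[OF vspace_Cl]) simp
   ultimately show ?thesis by (simp add: osp_carrier)
  qed
  obtain x0 x1 where d: "x0 \<in> part (osp eps a b) 0" "x1 \<in> part (osp eps a b) 1" "x = x0 \<oplus>\<^bsub>Cl a b\<^esub> x1"
   using span_decompose[OF superspace_Cl osp_gens_homog x[unfolded osp_carrier]] s by blast
  have o: "x0 <: (osp eps a b)" "x1 <: (osp eps a b)" using d by auto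
  have "ac x v = ac x0 v \<oplus>\<^bsub>M\<^esub> ac x1 v"
   using graded_actionD(3)[OF gaN osp_Calg[OF o(1)] osp_Calg[OF o(2)]] v by (simp add: N d(3))
  also have "\<dots> = act M x v" unfolding agp[OF d(1) v] agp[OF d(2) v] d(3) using gd(3)[OF o v] by simp
  finally show ?thesis .
 qed
 have iso: "rep_iso (carrier (osp eps a b)) M N"
  unfolding rep_iso_iff iso_map_def
  by (rule exI[of _ "\<lambda>x. x"]) (simp add: linear_on_def bij_betw_def inj_on_def N ag)
 have sM: "simple_rep (carrier (osp eps a b)) M" using M by (simp add: spinor_oscillator_type_def)
 have simple: "simple_rep ?A N"
  by (rule simple_rep_mono[OF _ simple_rep_iso[OF gd(8) ssN iso sM]]) (use osp_Calg in blast)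
 have "weight_module N (cl_u a b ` Idx a b)"
 proof -
  interpret N: vspace N by (rule superspaceD(1)[OF ssN])
  let ?W = "\<Union>\<mu>. weight_space N (cl_u a b ` Idx a b) \<mu>"
  have c: "?W \<subseteq> carrier N" by (auto simp: weight_space_def)
  have "weight_module N (cartan a b)"
   by (rule weight_module_iso[OF M.gd(8) ssN iso cartan_osp]) (use M in \<open>simp add: spinor_oscillator_type_def weight_osp_module_def\<close>)
  moreover have "(\<Union>\<mu>. weight_space N (cartan a b) \<mu>) \<subseteq> ?W" using wvec_weight_space[OF cartan_wvec[OF aN] ssN] by blast
  ultimately have "carrier N \<subseteq> lin_span N ?W" using N.span_mono unfolding weight_module_def by blast
  thus ?thesis unfolding weight_module_def using N.span_carrier[OF c] by blast
 qed
 hence "simple_weight eps a b N" unfolding simple_weight_def using aN simple by blast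
 thus ?thesis using iso by blast
qed

section \<open>The even part of the orthosymplectic Lie superalgebra\<close>

text \<open>Inclusion of index sets is all that \<open>cl_incl\<close> depends on; the two instances
  are (a|0) and (0|b) inside (a|b).\<close>

locale Idx_le =
 fixes a' b' a b :: enat
 assumes Idx_sub: "Idx a' b' \<subseteq> Idx a b"
begin

lemma letters_sub: "letters a' b' \<subseteq> letters a b" using Idx_sub by (auto simp: letters_def)

lemma lists_sub: "w \<in> lists (letters a' b') ==> w \<in> lists (letters a b)" using lists_mono[OF letters_sub] by blast

lemma cl_free_sub: "f <: (cl_free a' b') ==> f <: (cl_free a b)"
 unfolding cl_free_eq using lists_sub by auto

text \<open>The elements of the smaller free algebra that lie in the larger ideal form an ideal
  containing the smaller relations.\<close>

lemma cl_ideal_sub: "f \<in> cl_ideal a' b' ==> f \<in> cl_ideal a b"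
proof -
 let ?F = "cl_free a' b'" let ?J = "{f \<in> carrier ?F. f \<in> cl_ideal a b}"
 interpret F: vspace ?F by (rule vspace_cl_free)
 interpret B: vspace "cl_free a b" by (rule vspace_cl_free)
 interpret I: ideal "cl_ideal a b" "cl_free a b" by (rule ideal_cl)
 note ops = cl_free_ops[of a b, unfolded cl_free_ops[of a' b', symmetric]]
 note s = sub_cl_ideal[of a b]
 have "ideal ?J ?F"
 proof (rule idealI[OF ring_cl_free])
  have "submodule ?J CC ?F"
   by (rule F.subI) (use B.sub_zero[OF s] B.sub_add[OF s] B.sub_smult[OF s] F.a_closed F.vs_sc in \<open>auto simp: ops\<close>)
  thus "subgroup ?J (add_monoid ?F)" by (simp add: submodule_def)
  fix x y assume x: "x \<in> ?J" and y: "y <: ?F"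
  interpret R: ring ?F by (rule ring_cl_free)
  show "y \<otimes>\<^bsub>?F\<^esub> x \<in> ?J" "x \<otimes>\<^bsub>?F\<^esub> y \<in> ?J"
   using x y R.m_closed I.I_l_closed[of x y] I.I_r_closed[of x y] cl_free_sub[OF y] by (simp_all add: ops)
 qed
 moreover have "cl_rels a' b' \<subseteq> ?J"
  using cl_rels_carrier[of a' b'] cl_rels_in[of a b] Idx_sub unfolding cl_rels_eq by blast
 ultimately have "cl_ideal a' b' \<subseteq> ?J" unfolding cl_ideal_def by (rule ring.genideal_minimal[OF ring_cl_free])
 thus "f \<in> cl_ideal a' b' ==> f \<in> cl_ideal a b" by blast
qed

lemma cl_incl_proj:
 assumes f: "f <: (cl_free a' b')"
 shows "cl_incl a b (cl_proj a' b' f) = cl_proj a b f"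
proof -
 interpret F: vspace "cl_free a' b'" by (rule vspace_cl_free)
 note m = F.coset_mem[OF sub_cl_ideal f]
 have "cl_proj a b g = cl_proj a b f" if "g \<in> cl_proj a' b' f" for g
 proof -
  have g: "g <: (cl_free a' b')" "g \<ominus>\<^bsub>cl_free a' b'\<^esub> f \<in> cl_ideal a' b'" using that m unfolding cl_proj_def by blast+
  hence "g \<ominus>\<^bsub>cl_free a b\<^esub> f \<in> cl_ideal a b"
   using cl_ideal_sub cl_free_minus[OF g(1) f] cl_free_minus[OF cl_free_sub[OF g(1)] cl_free_sub[OF f]] by simp
  thus ?thesis using proj_eq cl_free_sub g(1) f by blast
 qed
 moreover have "f \<in> cl_proj a' b' f" unfolding cl_proj_def by (rule F.coset_self[OF sub_cl_ideal f])
 ultimately show ?thesis unfolding cl_incl_def by blast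
qed

lemma cl_incl_linear: "linear_on (Cl a' b') (Cl a b) (cl_incl a b)"
 unfolding linear_on_def
proof (intro conjI ballI allI)
 note P = proj_linear[of a b] note P' = proj_linear[of a' b']
 interpret F: vspace "cl_free a' b'" by (rule vspace_cl_free)
 note ops = cl_free_ops[of a b, unfolded cl_free_ops[of a' b', symmetric]]
 fix x assume "x <: (Cl a' b')"
 then obtain f where f: "x = cl_proj a' b' f" "f <: (cl_free a' b')" unfolding Cl_carrier by blast
 show "cl_incl a b x <: (Cl a b)"
  unfolding f(1) cl_incl_proj[OF f(2)] by (rule linear_onD(1)[OF P cl_free_sub[OF f(2)]])
 show "cl_incl a b (c \<odot>\<^bsub>Cl a' b'\<^esub> x) = c \<odot>\<^bsub>Cl a b\<^esub> cl_incl a b x" for c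
  using linear_onD(3)[OF P' f(2), of c] cl_incl_proj[OF F.vs_sc[OF f(2)], of c] linear_onD(3)[OF P cl_free_sub[OF f(2)], of c]
  unfolding f(1) cl_incl_proj[OF f(2)] ops by simp
 fix y assume "y <: (Cl a' b')"
 then obtain g where g: "y = cl_proj a' b' g" "g <: (cl_free a' b')" unfolding Cl_carrier by blast
 show "cl_incl a b (x \<oplus>\<^bsub>Cl a' b'\<^esub> y) = cl_incl a b x \<oplus>\<^bsub>Cl a b\<^esub> cl_incl a b y"
  using linear_onD(2)[OF P' f(2) g(2)] cl_incl_proj[OF F.a_closed[OF f(2) g(2)]]
   linear_onD(2)[OF P cl_free_sub[OF f(2)] cl_free_sub[OF g(2)]]
  unfolding f(1) g(1) cl_incl_proj[OF f(2)] cl_incl_proj[OF g(2)] ops by simp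
qed

lemma cl_incl_wrd: "w \<in> lists (letters a' b') ==> cl_incl a b (wrd a' b' w) = wrd a b w"
 unfolding wrd_def by (rule cl_incl_proj[OF single_cl_free])

lemma cl_incl_span:
 assumes "B \<subseteq> carrier (Cl a' b')" "\<And>x. x \<in> B ==> cl_incl a b x \<in> W" "submodule W CC (Cl a b)" "x \<in> lin_span (Cl a' b') B"
 shows "cl_incl a b x \<in> W"
 using linear_on_span_into[OF vspace_Cl vspace_Cl cl_incl_linear] assms by blast

lemma cl_incl_qq: "g \<in> letters a' b' ==> h \<in> letters a' b' ==> cl_incl a b (qq a' b' g h) = qq a b g h"
 unfolding qq_def
 using linear_onD(2,3)[OF cl_incl_linear] vspace.vs_sc[OF vspace_Cl] W_carrier[of _ a' b'] cl_incl_wrd by simp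

lemma cl_incl_part: "x \<in> part (Cl a' b') p ==> cl_incl a b x \<in> part (Cl a b) p"
proof -
 have "cl_incl a b y \<in> part (Cl a b) p" if y: "y \<in> wrd a' b' ` {w \<in> lists (letters a' b'). wpar w = p}" for y
 proof -
  obtain w where "w \<in> lists (letters a' b')" "wpar w = p" "y = wrd a' b' w" using y by blast
  thus ?thesis using cl_incl_wrd[of w] W_part[OF lists_sub, of w] by simp
 qed
 note * = this
 assume "x \<in> part (Cl a' b') p"
 hence x: "x \<in> lin_span (Cl a' b') (wrd a' b' ` {w \<in> lists (letters a' b'). wpar w = p})" by (simp only: Cl_part_span)
 show "cl_incl a b x \<in> part (Cl a b) p" by (rule cl_incl_span[OF W_sub * Cl_part_sub x])
qed

lemma cl_incl_osp:
 assumes e: "eps' ==> eps" and x: "x \<in> part (osp eps' a' b') p"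
 shows "cl_incl a b x \<in> part (osp eps a b) p"
proof -
 have "cl_incl a b y <: (osp eps a b)" if "y \<in> osp_gens eps' a' b'" for y
 proof -
  have "(\<exists>g h. y = qq a' b' g h \<and> g \<in> letters a' b' \<and> h \<in> letters a' b') \<or> (eps' \<and> (\<exists>g. y = wrd a' b' [g] \<and> g \<in> letters a' b'))"
   using that unfolding osp_gens_def by (auto split: if_splits)
  thus ?thesis
  proof (elim disjE exE conjE)
   fix g h assume "y = qq a' b' g h" and g: "g \<in> letters a' b'" "h \<in> letters a' b'"
   thus ?thesis using cl_incl_qq[OF g] qq_osp[of g a b h eps] letters_sub by (metis subsetD)
  next
   fix g assume "y = wrd a' b' [g]" and g: "g \<in> letters a' b'" "eps'"
   thus ?thesis using cl_incl_wrd[of "[g]"] letter_osp letters_sub e by auto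
  qed
 qed
 moreover have "osp_gens eps' a' b' \<subseteq> carrier (Cl a' b')" by (rule osp_gens_closed)
 ultimately have "cl_incl a b x <: (osp eps a b)"
  using cl_incl_span[OF _ _ sub_osp] x unfolding osp_ops osp_carrier[of eps'] by blast
 thus ?thesis using cl_incl_part x by simp
qed

end

lemma Idx_iff: "i \<in> Idx a 0 \<longleftrightarrow> i \<in> Idx a b \<and> 0 < i" "i \<in> Idx 0 b \<longleftrightarrow> i \<in> Idx a b \<and> i < 0"
 by (auto simp: Idx_def zero_enat_def)

lemma Idx_sgn: "i \<in> Idx a 0 ==> 0 < i" "i \<in> Idx 0 b ==> i < 0" by (auto simp: Idx_def zero_enat_def)

lemma Idx_le_0: "Idx_le a 0 a b" "Idx_le 0 b a b" unfolding Idx_le_def using Idx_iff by blast+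

lemma part_pos: "x <: (osp eps a 0) ==> x \<in> part (osp eps a 0) 0"
proof -
 have "wpar w = 0" if "w \<in> lists (letters a 0)" for w
  using that by (induction w) (auto simp: gen_par_def dest: Idx_sgn)
 hence "{w \<in> lists (letters a 0). wpar w = 0} = lists (letters a 0)" by blast
 hence "part (Cl a 0) 0 = carrier (Cl a 0)" unfolding Cl_part_span Cl_span by simp
 thus "x <: (osp eps a 0) ==> x \<in> part (osp eps a 0) 0" using osp_Cl by auto
qed

text \<open>All letters are odd here and the generators are brackets of two of them, so sp(2b) is
  purely even although \<open>Cl 0 b\<close> has odd words.\<close>

lemma part_neg: "x <: (osp False 0 b) ==> x \<in> part (osp False 0 b) 0"
proof -
 assume x: "x <: (osp False 0 b)"
 have "osp_gens False 0 b \<subseteq> part (Cl 0 b) 0"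
 proof
  fix y assume "y \<in> osp_gens False 0 b"
  then obtain g h where g: "y = qq 0 b g h" "g \<in> letters 0 b" "h \<in> letters 0 b" unfolding osp_gens_def by auto
  have "gen_par g = 1" "gen_par h = 1" using g Idx_sgn(2) by (auto simp: gen_par_def)
  thus "y \<in> part (Cl 0 b) 0" using qq_part[OF g(2,3)] g(1) by simp
 qed
 hence "carrier (osp False 0 b) \<subseteq> part (Cl 0 b) 0"
  unfolding osp_carrier by (rule vspace.span_minimal[OF vspace_Cl Cl_part_sub])
 thus ?thesis using x by auto
qed

lemma g0_embed_osp:
 assumes "x <: (osp eps a 0)" "y <: (osp False 0 b)"
 shows "g0_embed a b (x, y) \<in> part (osp eps a b) 0"
 unfolding g0_embed_def
 using vspace.sub_add[OF vspace_Cl vspace.sub_Int[OF vspace_Cl sub_osp Cl_part_sub]]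
  Idx_le.cl_incl_osp[OF Idx_le_0(1) _ part_pos[OF assms(1)], of eps b] Idx_le.cl_incl_osp[OF Idx_le_0(2) _ part_neg[OF assms(2)], of eps a]
 by simp

text \<open>Every Cartan element is reached from one of the two summands, so weights can be read off
  from a module over the even part.\<close>

lemma g0_embed_h:
 "i \<in> Idx a 0 ==> g0_embed a b (h_elt a 0 i, \<zero>\<^bsub>Cl 0 b\<^esub>) = h_elt a b i"
 "i \<in> Idx 0 b ==> g0_embed a b (\<zero>\<^bsub>Cl a 0\<^esub>, h_elt 0 b i) = h_elt a b i"
proof -
 have *: "cl_incl a b (h_elt a' b' i) = h_elt a b i" if le: "Idx_le a' b' a b" and i: "i \<in> Idx a' b'" for a' b'
 proof -
  interpret Idx_le a' b' a b by (rule le)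
  have "i \<in> Idx a b" using i Idx_sub by blast
  thus ?thesis unfolding h_elt_qq[OF i] h_elt_qq[OF \<open>i \<in> Idx a b\<close>]
   using linear_onD(3)[OF cl_incl_linear qq_closed[of "Xi i" a' b' "Eta i"]] cl_incl_qq[of "Xi i" "Eta i"] i by simp
 qed
 have z: "cl_incl a b \<zero>\<^bsub>Cl a' b'\<^esub> = \<zero>\<^bsub>Cl a b\<^esub>" if "Idx_le a' b' a b" for a' b'
  by (rule linear_on_zero[OF vspace_Cl vspace_Cl Idx_le.cl_incl_linear[OF that]])
 interpret C: vspace "Cl a b" by (rule vspace_Cl)
 have c: "h_elt a b i <: (Cl a b)" if "i \<in> Idx a b" using h_elt_osp[OF that, of False] osp_Cl by auto
 show "i \<in> Idx a 0 ==> g0_embed a b (h_elt a 0 i, \<zero>\<^bsub>Cl 0 b\<^esub>) = h_elt a b i"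
  using c *[OF Idx_le_0(1)] z[OF Idx_le_0(2)] by (simp add: g0_embed_def Idx_iff(1)[of i a b])
 show "i \<in> Idx 0 b ==> g0_embed a b (\<zero>\<^bsub>Cl a 0\<^esub>, h_elt 0 b i) = h_elt a b i"
  using c *[OF Idx_le_0(2)] z[OF Idx_le_0(1)] by (simp add: g0_embed_def Idx_iff(2)[of i b a])
qed

section \<open>Tensor products of standard modules\<close>

definition posp :: "(int => int) => int => int" where "posp d = (\<lambda>i. if 0 < i then d i else 0)"
definition negp :: "(int => int) => int => int" where "negp d = (\<lambda>i. if 0 < i then 0 else d i)"

lemma Fin_split [simp]: "d \<in> Fin ==> posp d \<in> Fin" "d \<in> Fin ==> negp d \<in> Fin"
proof -
 assume "d \<in> Fin"
 hence f: "finite {i. d i \<noteq> 0}" by (simp add: Fin_def)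
 have "{i. posp d i \<noteq> 0} \<subseteq> {i. d i \<noteq> 0}" "{i. negp d i \<noteq> 0} \<subseteq> {i. d i \<noteq> 0}" by (auto simp: posp_def negp_def)
 thus "posp d \<in> Fin" "negp d \<in> Fin" using finite_subset f unfolding Fin_def by blast+
qed

lemma split_plus [simp]: "posp d \<lhd>+ negp d = d" by (auto simp: fadd_def posp_def negp_def)

lemma split_minus_dl:
 "0 < idx g ==> posp (d \<lhd>- dl g) = posp d \<lhd>- dl g" "0 < idx g ==> negp (d \<lhd>- dl g) = negp d"
 "idx g < 0 ==> posp (d \<lhd>- dl g) = posp d" "idx g < 0 ==> negp (d \<lhd>- dl g) = negp d \<lhd>- dl g"
 by (auto simp: fun_eq_iff fsub_def posp_def negp_def dl_def sh_def)

lemma DD_split: "d \<in> Fin ==> d \<in> DD a b lam \<longleftrightarrow> posp d \<in> DD a 0 lam \<and> negp d \<in> DD 0 b lam"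
proof -
 let ?P = "\<lambda>a b d i. (i \<notin> Idx a b \<longrightarrow> d i = 0) \<and> (i \<in> Idx a b \<longrightarrow> okk i (lam i) (lam i + of_int (d i)))"
 have "?P a b d i \<longleftrightarrow> ?P a 0 (posp d) i \<and> ?P 0 b (negp d) i" for i
  using Idx_iff(1)[of i a b] Idx_iff(2)[of i b a] Idx_nonzero[of i a b] by (cases "0 < i"; cases "i < 0") (auto simp: posp_def negp_def)
 moreover assume "d \<in> Fin"
 ultimately show ?thesis using Fin_split[of d] unfolding DD_def by blast
qed

lemma sm_posp: "d \<in> Fin ==> ps (posp d) = ps d" "ns (posp d) = 0"
 by (rule sm_eq[OF Fin_split(1)]; simp add: posp_def) (rule sm_none, simp add: posp_def split: if_splits)

lemma sm_negp: "d \<in> Fin ==> ns (negp d) = ns d" "ps (negp d) = 0"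
 by (rule sm_eq[OF Fin_split(2)]; simp add: negp_def) (rule sm_none, simp add: negp_def split: if_splits)

lemma DD_split_unique:
 assumes "d1 \<in> DD a 0 lam" "d2 \<in> DD 0 b lam"
 shows "posp (d1 \<lhd>+ d2) = d1" "negp (d1 \<lhd>+ d2) = d2"
proof -
 have "i \<notin> Idx a 0 ==> d1 i = 0" "i \<notin> Idx 0 b ==> d2 i = 0" for i using assms unfolding DD_def by blast+
 hence *: "i \<le> 0 ==> d1 i = 0" "0 < i ==> d2 i = 0" for i using Idx_sgn[of i] by force+
 show "posp (d1 \<lhd>+ d2) = d1" "negp (d1 \<lhd>+ d2) = d2" by (auto simp: * fadd_def posp_def negp_def fun_eq_iff)
qed

text \<open>The arguments 0 stand for the missing coordinates: \<open>ns\<close> vanishes on the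
  first factor and \<open>ps\<close> on the second.\<close>

abbreviation Kt :: "(bit => bit => bool) => (bit => bit => bool) => bit => bit => bool" where
 "Kt K1 K2 \<equiv> \<lambda>p n. K1 p 0 \<and> K2 0 n"

lemma DK_split: "d \<in> Fin ==> d \<in> DK (Kt K1 K2) a b lam \<longleftrightarrow> posp d \<in> DK K1 a 0 lam \<and> negp d \<in> DK K2 0 b lam"
 by (auto simp: DK_def DD_split[of d a b] sm_posp sm_negp)

text \<open>The bilinear map that sends the basis vectors of d1 and d2 to that of d1 + d2
  (\<open>tau_E\<close>), written on coefficients.\<close>

definition tau :: "(nat => complex) => (nat => complex) => nat => complex" where
 "tau u w = (\<lambda>n. if n \<in> code ` Fin then u (code (posp (dec n))) * w (code (negp (dec n))) else 0)"

text \<open>A number in the support is the code of d1 + d2 with d1 and d2 in the supports of u and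
  w, which gives finiteness.\<close>

lemma tau_closed:
 assumes u: "u <: (free_space (code ` A1) par)" and w: "w <: (free_space (code ` A2) par')"
  and A: "A1 \<subseteq> Fin" "A2 \<subseteq> Fin" "\<And>d. d \<in> Fin ==> posp d \<in> A1 ==> negp d \<in> A2 ==> d \<in> A"
 shows "tau u w <: (free_space (code ` A) par'')"
proof -
 have 1: "n \<in> (\<lambda>(k, m). code (dec k \<lhd>+ dec m)) ` ({i. u i \<noteq> 0} \<times> {i. w i \<noteq> 0}) \<and> n \<in> code ` A" if "tau u w n \<noteq> 0" for n
 proof -
  obtain d where d: "d \<in> Fin" "n = code d" using \<open>tau u w n \<noteq> 0\<close> by (auto simp: tau_def split: if_splits)
  hence nz: "u (code (posp d)) \<noteq> 0" "w (code (negp d)) \<noteq> 0" using that by (auto simp: tau_def)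
  hence "code (posp d) \<in> code ` A1" "code (negp d) \<in> code ` A2" using u w by auto
  hence "posp d \<in> A1" "negp d \<in> A2" using inj_on_image_mem_iff[OF inj_code] A(1,2) d(1) by auto
  hence "n \<in> code ` A" using A(3) d by blast
  moreover have "n = code (dec (code (posp d)) \<lhd>+ dec (code (negp d)))" using d by simp
  ultimately show ?thesis using nz by (auto intro!: image_eqI[of _ _ "(code (posp d), code (negp d))"])
 qed
 have "finite ((\<lambda>(k, m). code (dec k \<lhd>+ dec m)) ` ({i. u i \<noteq> 0} \<times> {i. w i \<noteq> 0}))" using u w by simp
 hence "finite {n. tau u w n \<noteq> 0}" by (rule finite_subset[rotated]) (use 1 in blast)
 thus ?thesis using 1 by auto
qed

lemma tau_VV: "u <: (VV a 0 lam) ==> w <: (VV 0 b lam) ==> tau u w <: (VV a b lam)"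
 by (erule tau_closed) (auto simp: DD_Fin DD_split[of _ a b])

lemma tau_lin [simp]:
 "tau (\<lambda>n. u n + u' n) w = (\<lambda>n. tau u w n + tau u' w n)" "tau (\<lambda>n. c * u n) w = (\<lambda>n. c * tau u w n)"
 "tau u (\<lambda>n. w n + w' n) = (\<lambda>n. tau u w n + tau u w' n)" "tau u (\<lambda>n. c * w n) = (\<lambda>n. c * tau u w n)"
 by (auto simp: tau_def fun_eq_iff algebra_simps)

lemma tau_E:
 assumes "d1 \<in> DD a 0 lam" "d2 \<in> DD 0 b lam"
 shows "tau (E d1) (E d2) = E (d1 \<lhd>+ d2)"
proof
 fix n
 have F: "d1 \<in> Fin" "d2 \<in> Fin" using assms DD_Fin by blast+
 show "tau (E d1) (E d2) n = E (d1 \<lhd>+ d2) n"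
 proof (cases "n \<in> code ` Fin")
  case True
  then obtain d where d: "d \<in> Fin" "n = code d" by blast
  have "posp d = d1 \<and> negp d = d2 \<longleftrightarrow> d = d1 \<lhd>+ d2" using DD_split_unique[OF assms] split_plus[of d] by metis
  thus ?thesis using d F by (auto simp: tau_def single_def)
 next
  case False
  hence "n \<noteq> code (d1 \<lhd>+ d2)" using F by auto
  thus ?thesis using False by (simp add: tau_def single_def)
 qed
qed

text \<open>A positive letter sees only positive coordinates. A negative one comes after all of them
  in the Jordan-Wigner order and sees their total sign \<open>bsg (ps d)\<close>.\<close>

lemma coef_split:
 assumes "d \<in> Fin"
 shows "0 < idx g ==> coef lam g d = coef lam g (posp d)" "idx g < 0 ==> coef lam g d = bsg (ps d) * coef lam g (negp d)"
proof -
 assume g: "0 < idx g"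
 have "sm (\<lambda>j. 0 < j \<and> (idx g < 0 \<or> j < idx g)) d = sm (\<lambda>j. 0 < j \<and> (idx g < 0 \<or> j < idx g)) (posp d)"
  by (rule sm_eq[OF assms Fin_split(1)[OF assms]]) (simp add: posp_def)
 thus "coef lam g d = coef lam g (posp d)" using g by (simp add: coef_def lsg_def mag_eq posp_def)
next
 assume g: "idx g < 0"
 thus "coef lam g d = bsg (ps d) * coef lam g (negp d)"
  using sm_negp(2)[of d] by (simp add: coef_def lsg_def mag_eq negp_def)
qed

text \<open>The sign that a negative letter picks up from the first tensor factor; it cancels in words of even length.\<close>

definition psg :: "(nat => complex) => nat => complex" where "psg u = (\<lambda>n. bsg (ps (dec n)) * u n)"

lemma psg_psg [simp]: "psg (psg u) = u"
proof
 fix n have "bsg (ps (dec n)) * (bsg (ps (dec n)) * u n) = (bsg (ps (dec n)) * bsg (ps (dec n))) * u n" by (simp only: mult.assoc)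
 thus "psg (psg u) n = u n" by (simp add: psg_def)
qed

lemma opg_tau: "0 < idx g ==> opg lam g (tau u w) = tau (opg lam g u) w" "idx g < 0 ==> opg lam g (tau u w) = tau (psg u) (opg lam g w)"
proof -
 have *: "coef lam g (d \<lhd>- dl g) = coef lam g (posp d \<lhd>- dl g)" if "0 < idx g" "d \<in> Fin" for d
  using coef_split(1)[of "d \<lhd>- dl g" g lam] that by (simp add: split_minus_dl)
 show "opg lam g (tau u w) = tau (opg lam g u) w" if "0 < idx g"
  using that * by (auto simp: fun_eq_iff opg_def tau_def split_minus_dl)
 have *: "coef lam g (d \<lhd>- dl g) = bsg (ps (posp d)) * coef lam g (negp d \<lhd>- dl g)" if "idx g < 0" "d \<in> Fin" for d
  using coef_split(2)[of "d \<lhd>- dl g" g lam] that by (simp add: split_minus_dl sm_minus sm_dl sm_posp)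
 show "opg lam g (tau u w) = tau (psg u) (opg lam g w)" if "idx g < 0"
  using that * by (auto simp: fun_eq_iff opg_def tau_def psg_def split_minus_dl)
qed

lemma word_tau_pos: "\<forall>g\<in>set l. 0 < idx g ==> foldr (opg lam) l (tau u w) = tau (foldr (opg lam) l u) w"
 by (induction l) (auto simp: opg_tau)

lemma word_tau_neg: "\<forall>g\<in>set l. idx g < 0 ==> foldr (opg lam) l (tau u w) = tau (if even (length l) then u else psg u) (foldr (opg lam) l w)"
 by (induction l) (auto simp: opg_tau)

lemma std_act_tau_pos:
 assumes x: "x <: (Cl a 0)" and u: "u <: (VV a 0 lam)" and w: "w <: (VV 0 b lam)"
 shows "std_act a b lam (cl_incl a b x) (tau u w) = tau (std_act a 0 lam x u) w"
proof (rule linear_on_eq_span[OF vspace_Cl vspace_free_space])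
 interpret Idx_le a 0 a b by (rule Idx_le_0)
 note t = tau_VV[OF u w]
 show "linear_on (Cl a 0) (VV a b lam) (\<lambda>x. std_act a b lam (cl_incl a b x) (tau u w))"
  by (rule linear_on_comp[OF cl_incl_linear std_act_linear[OF t]])
 have "linear_on (VV a 0 lam) (VV a b lam) (\<lambda>u. tau u w)" unfolding linear_on_def using tau_VV[OF _ w] by (simp del: free_space_simps(1))
 thus "linear_on (Cl a 0) (VV a b lam) (\<lambda>x. tau (std_act a 0 lam x u) w)"
  by (rule linear_on_comp[OF std_act_linear[OF u]])
 show "wrd a 0 ` lists (letters a 0) \<subseteq> carrier (Cl a 0)" by (rule W_sub')
 show "x \<in> lin_span (Cl a 0) (wrd a 0 ` lists (letters a 0))" using x by (simp only: Cl_span)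
 fix y assume "y \<in> wrd a 0 ` lists (letters a 0)"
 then obtain l where l: "l \<in> lists (letters a 0)" "y = wrd a 0 l" by blast
 hence "\<forall>g\<in>set l. 0 < idx g" using Idx_sgn by auto
 thus "std_act a b lam (cl_incl a b y) (tau u w) = tau (std_act a 0 lam y u) w"
  using l cl_incl_wrd[OF l(1)] std_act_word[OF lists_sub[OF l(1)] t] std_act_word[OF l(1) u] word_tau_pos[of l lam u w]
  by (simp del: in_lists_conv_set)
qed

text \<open>In contrast to \<open>std_act_tau_pos\<close>, x lies in the even subalgebra: a single
  negative letter would also apply \<open>psg\<close> to u.\<close>

lemma std_act_tau_neg:
 assumes x: "x <: (Calg False 0 b)" and u: "u <: (VV a 0 lam)" and w: "w <: (VV 0 b lam)"
 shows "std_act a b lam (cl_incl a b x) (tau u w) = tau u (std_act 0 b lam x w)"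
proof (rule linear_on_eq_span[OF vspace_Cl vspace_free_space])
 interpret Idx_le 0 b a b by (rule Idx_le_0)
 note t = tau_VV[OF u w]
 show "linear_on (Cl 0 b) (VV a b lam) (\<lambda>x. std_act a b lam (cl_incl a b x) (tau u w))"
  by (rule linear_on_comp[OF cl_incl_linear std_act_linear[OF t]])
 have "linear_on (VV 0 b lam) (VV a b lam) (tau u)" unfolding linear_on_def using tau_VV[OF u] by (simp del: free_space_simps(1))
 thus "linear_on (Cl 0 b) (VV a b lam) (\<lambda>x. tau u (std_act 0 b lam x w))"
  by (rule linear_on_comp[OF std_act_linear[OF w]])
 show "wrd 0 b ` aw False 0 b \<subseteq> carrier (Cl 0 b)" by (rule aw_Cl)
 show "x \<in> lin_span (Cl 0 b) (wrd 0 b ` aw False 0 b)" using x by (simp only: Calg_carrier)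
 fix y assume "y \<in> wrd 0 b ` aw False 0 b"
 then obtain l where l: "l \<in> lists (letters 0 b)" "even (length l)" "y = wrd 0 b l" by (auto simp: aw_def)
 hence "\<forall>g\<in>set l. idx g < 0" using Idx_sgn by auto
 thus "std_act a b lam (cl_incl a b y) (tau u w) = tau u (std_act 0 b lam y w)"
  using l cl_incl_wrd[OF l(1)] std_act_word[OF lists_sub[OF l(1)] t] std_act_word[OF l(1) w] word_tau_neg[of l lam u w]
  by (simp del: in_lists_conv_set)
qed

lemma linear_on_Std:
 "linear_on (Std K a b lam p) W T \<longleftrightarrow> linear_on (free_space (code ` DK K a b lam) par) W T"
 "linear_on U (Std K a b lam p) T' \<longleftrightarrow> linear_on U (free_space (code ` DK K a b lam) par) T'"
 by (simp_all add: linear_on_def)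

lemma linear_on_eq_Std:
 assumes "vspace W" "linear_on (Std K a b lam p) W S" "linear_on (Std K a b lam p) W T"
  "\<And>d. d \<in> DK K a b lam ==> S (E d) = T (E d)" "v <: (Std K a b lam p)"
 shows "S v = T v"
 by (rule linear_on_eq_free[OF assms(1,2)[unfolded linear_on_Std[where par = "\<lambda>_. 0"]] assms(3)[unfolded linear_on_Std[where par = "\<lambda>_. 0"]]])
  (use assms(4,5) in auto)

lemma pullback_simps [simp]:
 "carrier (pullback f M) = carrier M" "ring.zero (pullback f M) = ring.zero M" "ring.add (pullback f M) = ring.add M"
 "module.smult (pullback f M) = module.smult M" "part (pullback f M) = part M" "act (pullback f M) = (\<lambda>y. act M (f y))"
 by (simp_all add: pullback_def superspace.extend_def superspace.truncate_def rep.fields_def)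

text \<open>K2 allows only the parity p for the second factor. With parity parameter p a vector of
  the product has parity p + p = 0, as in \<open>tensor\<close>, whose grading is purely
  even.\<close>

locale tensor_std =
 fixes eps a b lam K1 K2 p1 p2 p and S :: "(cl, 's) rep" and T :: "(cl, 't) rep" and \<phi> \<psi>
 assumes S: "wf_rep (carrier (osp eps a 0)) S" and T: "wf_rep (carrier (osp False 0 b)) T"
  and \<phi>: "iso_map (carrier (osp eps a 0)) S (Std K1 a 0 lam p1) \<phi>"
  and \<psi>: "iso_map (carrier (osp False 0 b)) T (Std K2 0 b lam p2) \<psi>"
  and p: "\<And>n. K2 0 n ==> n = p"
begin

abbreviation "S1 \<equiv> Std K1 a 0 lam p1"
abbreviation "T1 \<equiv> Std K2 0 b lam p2"
abbreviation "V \<equiv> Std (Kt K1 K2) a b lam p"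
abbreviation "FT \<equiv> free_space (carrier S \<times> carrier T) (\<lambda>_. 0)"
abbreviation "R \<equiv> tensor_rels S T"
abbreviation "Q \<equiv> quot FT R"
abbreviation "pr \<equiv> \<lambda>f. R +>\<^bsub>FT\<^esub> f"

lemma ss: "superspace S" "superspace T" using S T by (simp_all add: wf_rep_def)

sublocale S: vspace S by (rule superspaceD(1)[OF ss(1)])
sublocale T: vspace T by (rule superspaceD(1)[OF ss(2)])
sublocale FT: vspace FT by (rule vspace_free_space)

lemma tau_V: "u <: S1 ==> w <: T1 ==> tau u w <: V"
 unfolding Std_free[where par = "\<lambda>_. 0"]
 by (erule tau_closed) (auto simp: DK_Fin DK_split[of _ K1 K2 a b])

lemma tau_linear: "w <: T1 ==> linear_on S1 V (\<lambda>u. tau u w)" "u <: S1 ==> linear_on T1 V (tau u)"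
 using tau_V unfolding linear_on_def by (simp_all del: Std_simps(1))

lemma tau_closed': "s <: S ==> t <: T ==> tau (\<phi> s) (\<psi> t) <: V"
 by (rule tau_V[OF iso_mapD(5)[OF \<phi>] iso_mapD(5)[OF \<psi>]])

text \<open>Its kernel turns out to be the space of bilinearity relations
  (\<open>th_zero_iff\<close>), so it identifies the tensor product with the standard
  module.\<close>

definition th :: "('s \<times> 't => complex) => nat => complex" where
 "th = lc V (\<lambda>k. tau (\<phi> (fst k)) (\<psi> (snd k)))"

lemma th_linear: "linear_on FT V th"
 unfolding th_def by (rule vspace.lc_linear[OF vspace_Std]) (use tau_closed' in \<open>auto simp del: Std_simps(1)\<close>)

lemma th_single: "s <: S ==> t <: T ==> th (single (s, t)) = tau (\<phi> s) (\<psi> t)"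
 unfolding th_def by (subst vspace.lc_single[OF vspace_Std]) (use tau_closed' in \<open>simp_all del: Std_simps\<close>)

abbreviation "rel_gens \<equiv>
 {single (s \<oplus>\<^bsub>S\<^esub> s', t) \<ominus>\<^bsub>FT\<^esub> (single (s, t) \<oplus>\<^bsub>FT\<^esub> single (s', t)) | s s' t.
   s <: S \<and> s' <: S \<and> t \<in> carrier T} \<union>
  {single (s, t \<oplus>\<^bsub>T\<^esub> t') \<ominus>\<^bsub>FT\<^esub> (single (s, t) \<oplus>\<^bsub>FT\<^esub> single (s, t')) | s t t'.
   s <: S \<and> t <: T \<and> t' \<in> carrier T} \<union>
  {single (c \<odot>\<^bsub>S\<^esub> s, t) \<ominus>\<^bsub>FT\<^esub> (c \<odot>\<^bsub>FT\<^esub> single (s, t)) | c s t.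
   s <: S \<and> t \<in> carrier T} \<union>
  {single (s, c \<odot>\<^bsub>T\<^esub> t) \<ominus>\<^bsub>FT\<^esub> (c \<odot>\<^bsub>FT\<^esub> single (s, t)) | c s t.
   s <: S \<and> t <: T}"

lemma R_eq: "R = lin_span FT rel_gens" by (simp only: tensor_rels_def tensor_free_def Let_def)

lemma sg: "s <: S ==> t <: T ==> single (s, t) <: FT" by (rule single_carrier) simp

lemma rel_gens_closed: "rel_gens \<subseteq> carrier FT"
 by (intro Un_least subsetI; elim CollectE exE conjE; simp only:; intro FT.minus_closed FT.a_closed FT.vs_sc sg S.a_closed T.a_closed S.vs_sc T.vs_sc)

lemma sub_R: "submodule R CC FT" unfolding R_eq by (rule FT.span_sub[OF rel_gens_closed])

lemma vspace_Q: "vspace Q" by (rule vspace_quot[OF FT.vspace_axioms sub_R])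

lemma pr_linear: "linear_on FT Q pr" by (rule linear_on_proj[OF FT.vspace_axioms sub_R])

lemma rel_in_R: "r \<in> rel_gens ==> r \<in> R" unfolding R_eq by (rule FT.span_in)

lemma pr_bilinear:
 "t <: T ==> linear_on S Q (\<lambda>s. pr (single (s, t)))" "s <: S ==> linear_on T Q (\<lambda>t. pr (single (s, t)))"
proof -
 note q = FT.coset_eq[OF sub_R]
 note l = linear_onD[OF pr_linear]
 assume t: "t <: T"
 show "linear_on S Q (\<lambda>s. pr (single (s, t)))" unfolding linear_on_def
 proof (intro conjI ballI allI)
  fix s assume s: "s <: S"
  show "pr (single (s, t)) <: Q" by (rule l(1)[OF sg[OF s t]])
  show "pr (single (c \<odot>\<^bsub>S\<^esub> s, t)) = c \<odot>\<^bsub>Q\<^esub> pr (single (s, t))" for c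
   unfolding l(3)[OF sg[OF s t], symmetric] q[OF sg[OF S.vs_sc[OF s] t] FT.vs_sc[OF sg[OF s t]]]
   by (rule rel_in_R) (use s t in blast)
  show "pr (single (s \<oplus>\<^bsub>S\<^esub> s', t)) = pr (single (s, t)) \<oplus>\<^bsub>Q\<^esub> pr (single (s', t))" if s': "s' <: S" for s'
   unfolding l(2)[OF sg[OF s t] sg[OF s' t], symmetric] q[OF sg[OF S.a_closed[OF s s'] t] FT.a_closed[OF sg[OF s t] sg[OF s' t]]]
   by (rule rel_in_R) (use s s' t in blast)
 qed
next
 note q = FT.coset_eq[OF sub_R]
 note l = linear_onD[OF pr_linear]
 assume s: "s <: S"
 show "linear_on T Q (\<lambda>t. pr (single (s, t)))" unfolding linear_on_def
 proof (intro conjI ballI allI)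
  fix t assume t: "t <: T"
  show "pr (single (s, t)) <: Q" by (rule l(1)[OF sg[OF s t]])
  show "pr (single (s, c \<odot>\<^bsub>T\<^esub> t)) = c \<odot>\<^bsub>Q\<^esub> pr (single (s, t))" for c
   unfolding l(3)[OF sg[OF s t], symmetric] q[OF sg[OF s T.vs_sc[OF t]] FT.vs_sc[OF sg[OF s t]]]
   by (rule rel_in_R) (use s t in blast)
  show "pr (single (s, t \<oplus>\<^bsub>T\<^esub> t')) = pr (single (s, t)) \<oplus>\<^bsub>Q\<^esub> pr (single (s, t'))" if t': "t' <: T" for t'
   unfolding l(2)[OF sg[OF s t] sg[OF s t'], symmetric] q[OF sg[OF s T.a_closed[OF t t']] FT.a_closed[OF sg[OF s t] sg[OF s t']]]
   by (rule rel_in_R) (use s t t' in blast)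
 qed
qed

lemma th_R: "f \<in> R ==> th f = \<zero>\<^bsub>V\<^esub>"
proof -
 interpret V: vspace V by (rule vspace_Std)
 note m = linear_on_minus[OF FT.vspace_axioms V.vspace_axioms th_linear]
 note l = linear_onD[OF th_linear]
 note f = linear_onD[OF iso_mapD(2)[OF \<phi>]] linear_onD[OF iso_mapD(2)[OF \<psi>]]
 have k: "th (f \<ominus>\<^bsub>FT\<^esub> g) \<in> {\<zero>\<^bsub>V\<^esub>}" if "f <: FT" "g <: FT" "th f = th g" for f g
  using m[OF that(1,2)] V.vs_eq_iff[OF l(1) l(1), of f g] that by simp
 note t = th_single S.a_closed T.a_closed S.vs_sc T.vs_sc sg FT.a_closed FT.vs_sc l(2,3) f(2,3,5,6)
 have "th r \<in> {\<zero>\<^bsub>V\<^esub>}" if r: "r \<in> rel_gens" for r using r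
  by (elim UnE CollectE exE conjE; simp only:; intro k) (simp_all add: t del: Std_simps(1) free_space_simps)
 from linear_on_span_into[OF FT.vspace_axioms V.vspace_axioms th_linear rel_gens_closed V.sub_trivial this]
 show "f \<in> R ==> th f = \<zero>\<^bsub>V\<^esub>" unfolding R_eq by blast
qed

abbreviation "fi \<equiv> inv_into (carrier S) \<phi>"
abbreviation "pi' \<equiv> inv_into (carrier T) \<psi>"

text \<open>A linear section of \<open>th\<close>: each basis vector goes to the elementary tensor
  of the preimages of its positive and its negative part.\<close>

definition sec :: "(nat => complex) => 's \<times> 't => complex" where
 "sec = lc FT (\<lambda>n. single (fi (E (posp (dec n))), pi' (E (negp (dec n)))))"

lemma fi: "iso_map (carrier (osp eps a 0)) S1 S fi" "iso_map (carrier (osp False 0 b)) T1 T pi'"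
 by (rule iso_map_inv[OF S \<phi>], rule iso_map_inv[OF T \<psi>])

lemma fi_inv: "u <: S1 ==> \<phi> (fi u) = u" "w <: T1 ==> \<psi> (pi' w) = w"
 "s <: S ==> fi (\<phi> s) = s" "t <: T ==> pi' (\<psi> t) = t"
 using iso_mapD(1)[OF \<phi>] iso_mapD(1)[OF \<psi>] by (auto simp: bij_betw_def f_inv_into_f inv_into_f_f simp del: Std_simps)

lemma sec_closed: "d \<in> DK (Kt K1 K2) a b lam ==> single (fi (E (posp d)), pi' (E (negp d))) <: FT"
 by (intro sg iso_mapD(5)[OF fi(1)] iso_mapD(5)[OF fi(2)] E_Std) (use DK_split[OF DK_Fin, of d _ a b lam K1 K2] in auto)

lemma sec_linear: "linear_on V FT sec"
 unfolding sec_def linear_on_Std[where par = "\<lambda>_. 0"]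
 by (rule FT.lc_linear) (use sec_closed DK_Fin in \<open>auto simp del: free_space_simps\<close>)

lemma sec_E: "d \<in> DK (Kt K1 K2) a b lam ==> sec (E d) = single (fi (E (posp d)), pi' (E (negp d)))"
 unfolding sec_def using FT.lc_single[of _ "code d"] sec_closed[of d] DK_Fin[of d] by simp

lemma th_sec: "v <: V ==> th (sec v) = v"
proof (rule linear_on_eq_Std[OF vspace_Std linear_on_comp[OF sec_linear th_linear] linear_on_id])
 fix d assume d: "d \<in> DK (Kt K1 K2) a b lam"
 hence s: "posp d \<in> DK K1 a 0 lam" "negp d \<in> DK K2 0 b lam" using DK_split[OF DK_Fin[OF d]] by blast+
 note e = E_Std[OF s(1), of p1] E_Std[OF s(2), of p2]
 show "th (sec (E d)) = E d"
  unfolding sec_E[OF d] th_single[OF iso_mapD(5)[OF fi(1) e(1)] iso_mapD(5)[OF fi(2) e(2)]]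
   fi_inv(1)[OF e(1)] fi_inv(2)[OF e(2)] tau_E[OF DK_DD[OF s(1)] DK_DD[OF s(2)]] by simp
qed

text \<open>Modulo the relations both sides are bilinear in u and w, so they are compared on basis
  vectors, where \<open>tau\<close> gives a basis vector again.\<close>

lemma pr_sec_tau: "u <: S1 ==> w <: T1 ==> pr (sec (tau u w)) = pr (single (fi u, pi' w))"
proof -
 assume u: "u <: S1" and w: "w <: T1"
 note ps = linear_on_comp[OF sec_linear pr_linear]
 show ?thesis
 proof (rule linear_on_eq_Std[OF vspace_Q linear_on_comp[OF tau_linear(1)[OF w] ps] _ _ u])
  show "linear_on S1 Q (\<lambda>u. pr (single (fi u, pi' w)))"
   by (rule linear_on_comp[OF iso_mapD(2)[OF fi(1)] pr_bilinear(1)[OF iso_mapD(5)[OF fi(2) w]]])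
  fix d1 assume d1: "d1 \<in> DK K1 a 0 lam"
  note e1 = E_Std[OF d1, of p1]
  show "pr (sec (tau (E d1) w)) = pr (single (fi (E d1), pi' w))"
  proof (rule linear_on_eq_Std[OF vspace_Q linear_on_comp[OF tau_linear(2)[OF e1] ps] _ _ w])
   show "linear_on T1 Q (\<lambda>w. pr (single (fi (E d1), pi' w)))"
    by (rule linear_on_comp[OF iso_mapD(2)[OF fi(2)] pr_bilinear(2)[OF iso_mapD(5)[OF fi(1) e1]]])
   fix d2 assume d2: "d2 \<in> DK K2 0 b lam"
   note D = DK_DD[OF d1] DK_DD[OF d2]
   have "d1 \<lhd>+ d2 \<in> DK (Kt K1 K2) a b lam"
    using DK_split[of "d1 \<lhd>+ d2"] DD_split_unique[OF D] d1 d2 DK_Fin by simp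
   from sec_E[OF this] show "pr (sec (tau (E d1) (E d2))) = pr (single (fi (E d1), pi' (E d2)))"
    unfolding tau_E[OF D] DD_split_unique[OF D] by simp
  qed
 qed
qed

text \<open>With \<open>th_sec\<close> this makes \<open>th\<close> and \<open>sec\<close> mutually
  inverse modulo the relations. It suffices to check elementary tensors, by
  \<open>pr_sec_tau\<close>.\<close>

lemma pr_sec_th: "f <: FT ==> pr (sec (th f)) = pr f"
proof (rule linear_on_eq_free[OF vspace_Q linear_on_comp[OF linear_on_comp[OF th_linear sec_linear] pr_linear] pr_linear])
 fix k assume "k \<in> carrier S \<times> carrier T"
 then obtain s t where k: "k = (s, t)" "s <: S" "t <: T" by blast
 show "pr (sec (th (single k))) = pr (single k)"
  unfolding k(1) th_single[OF k(2,3)] pr_sec_tau[OF iso_mapD(5)[OF \<phi> k(2)] iso_mapD(5)[OF \<psi> k(3)]]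
  using fi_inv(3)[OF k(2)] fi_inv(4)[OF k(3)] by simp
qed

lemma th_zero_iff: "f <: FT ==> th f = \<zero>\<^bsub>V\<^esub> \<longleftrightarrow> f \<in> R"
proof
 assume f: "f <: FT" and "th f = \<zero>\<^bsub>V\<^esub>"
 hence "pr f = pr \<zero>\<^bsub>FT\<^esub>" using pr_sec_th[OF f] linear_on_zero[OF vspace_Std FT.vspace_axioms sec_linear] by simp
 thus "f \<in> R" using FT.coset_zero[OF sub_R] f FT.zero_closed FT.sub_zero[OF sub_R] by metis
qed (rule th_R)

context
 fixes x y assumes x: "x <: (osp eps a 0)" and y: "y <: (osp False 0 b)"
begin

text \<open>The operator of (x, y) on the free space, before it is known to descend to the
  quotient.\<close>

definition "dact = lc FT (\<lambda>k. single (act S x (fst k), snd k) \<oplus>\<^bsub>FT\<^esub> single (fst k, act T y (snd k)))"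

lemma dact_linear: "linear_on FT FT dact"
 unfolding dact_def
 by (rule FT.lc_linear) (use S T x y in \<open>intro FT.a_closed sg; auto simp: wf_rep_def\<close>)

lemma dact_single: "s <: S ==> t <: T ==> dact (single (s, t)) = single (act S x s, t) \<oplus>\<^bsub>FT\<^esub> single (s, act T y t)"
proof -
 assume s: "s <: S" "t <: T"
 hence "single (act S x s, t) \<oplus>\<^bsub>FT\<^esub> single (s, act T y t) <: FT"
  using S T x y by (intro FT.a_closed sg) (auto simp: wf_rep_def)
 thus ?thesis unfolding dact_def using FT.lc_single[of _ "(s, t)"] by simp
qed

lemma th_dact:
 assumes f: "f <: FT"
 shows "th (dact f) = std_act a b lam (g0_embed a b (x, y)) (th f)"
proof (rule linear_on_eq_free[OF vspace_free_space _ _ _ f])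
 interpret Vs: vspace V by (rule vspace_Std)
 have toVV: "linear_on FT (VV a b lam) g" if "linear_on FT V g" for g
  using that Std_in_VV[of _ "Kt K1 K2" a b lam p] unfolding linear_on_def by (simp del: Std_simps(1) free_space_simps(1))
 have c: "cl_incl a b x <: (Cl a b)" "cl_incl a b y <: (Cl a b)"
  using linear_onD(1)[OF Idx_le.cl_incl_linear[OF Idx_le_0(1)] osp_Cl[OF x]]
   linear_onD(1)[OF Idx_le.cl_incl_linear[OF Idx_le_0(2)] osp_Cl[OF y]] by blast+
 have g: "g0_embed a b (x, y) <: (Cl a b)" using g0_embed_osp[OF x y] osp_Cl by auto
 show "linear_on FT (VV a b lam) (\<lambda>f. th (dact f))" by (rule toVV[OF linear_on_comp[OF dact_linear th_linear]])
 show "linear_on FT (VV a b lam) (\<lambda>f. std_act a b lam (g0_embed a b (x, y)) (th f))"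
  by (rule linear_on_comp[OF toVV[OF th_linear] std_act_linear_right[OF g]])
 fix k assume "k \<in> carrier S \<times> carrier T"
 then obtain s t where k: "k = (s, t)" "s <: S" "t <: T" by blast
 have k': "act S x s <: S" "act T y t <: T" using S T x y k by (auto simp: wf_rep_def)
 have u: "\<phi> s <: (VV a 0 lam)" "\<psi> t <: (VV 0 b lam)"
  using Std_in_VV[OF iso_mapD(5)[OF \<phi> k(2)]] Std_in_VV[OF iso_mapD(5)[OF \<psi> k(3)]] by blast+
 have "th (dact (single k)) = tau (\<phi> (act S x s)) (\<psi> t) \<oplus>\<^bsub>V\<^esub> tau (\<phi> s) (\<psi> (act T y t))"
  unfolding k(1) dact_single[OF k(2,3)] linear_onD(2)[OF th_linear sg[OF k'(1) k(3)] sg[OF k(2) k'(2)]]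
   th_single[OF k'(1) k(3)] th_single[OF k(2) k'(2)] by simp
 also have "\<dots> = std_act a b lam (cl_incl a b x) (tau (\<phi> s) (\<psi> t)) \<oplus>\<^bsub>V\<^esub> std_act a b lam (cl_incl a b y) (tau (\<phi> s) (\<psi> t))"
  unfolding iso_mapD(4)[OF \<phi> x k(2)] iso_mapD(4)[OF \<psi> y k(3)] Std_simps(6)
   std_act_tau_pos[OF osp_Cl[OF x] u] std_act_tau_neg[OF osp_Calg[OF y] u] ..
 also have "\<dots> = std_act a b lam (g0_embed a b (x, y)) (tau (\<phi> s) (\<psi> t))"
  using linear_onD(2)[OF std_act_linear[OF tau_VV[OF u]] c] by (simp add: g0_embed_def)
 finally show "th (dact (single k)) = std_act a b lam (g0_embed a b (x, y)) (th (single k))"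
  unfolding k(1) th_single[OF k(2,3)] .
qed

text \<open>The relations are the kernel of \<open>th\<close>, and \<open>th\<close> intertwines
  \<open>dact\<close> with an honest linear action; hence \<open>dact\<close> preserves the
  relations and the union over representatives is one coset.\<close>

lemma tensor_act: "f <: FT ==> act (tensor S T) (x, y) (pr f) = pr (dact f)"
proof -
 assume f: "f <: FT"
 note d = linear_onD(1)[OF dact_linear]
 have "act (tensor S T) (x, y) (pr f) = (\<Union>g\<in>pr f. pr (dact g))"
  by (simp add: tensor_def tensor_free_def Let_def superspace.extend_def rep.fields_def dact_def lc_def[abs_def])
 also have "\<dots> = pr (dact f)"
 proof (rule FT.coset_lift[OF sub_R f d])
  fix g assume "g \<in> pr f"
  hence g: "g <: FT" "g \<ominus>\<^bsub>FT\<^esub> f \<in> R" using FT.coset_mem[OF sub_R f] by blast+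
  have m: "th (g \<ominus>\<^bsub>FT\<^esub> f) = th g \<ominus>\<^bsub>V\<^esub> th f" if "g <: FT" "f <: FT" for g f
   by (rule linear_on_minus[OF FT.vspace_axioms vspace_Std th_linear that])
  note vi = vspace.vs_eq_iff[OF vspace_Std linear_onD(1)[OF th_linear] linear_onD(1)[OF th_linear]]
  have "th g = th f" using th_R[OF g(2)] m[OF g(1) f] vi[OF g(1) f] by simp
  hence "th (dact g) = th (dact f)" using th_dact g(1) f by simp
  hence "th (dact g \<ominus>\<^bsub>FT\<^esub> dact f) = \<zero>\<^bsub>V\<^esub>" using m[OF d[OF g(1)] d[OF f]] vi[OF d[OF g(1)] d[OF f]] by simp
  thus "dact g \<ominus>\<^bsub>FT\<^esub> dact f \<in> R" using th_zero_iff[OF FT.minus_closed[OF d[OF g(1)] d[OF f]]] by blast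
 qed
 finally show ?thesis .
qed

end

lemma tensor_simps:
 "carrier (tensor S T) = carrier Q" "ring.add (tensor S T) = ring.add Q" "module.smult (tensor S T) = module.smult Q"
 "part (tensor S T) = part Q"
 by (simp_all add: tensor_def tensor_free_def Let_def superspace.extend_def rep.fields_def)

theorem tensor_iso:
 "rep_iso (carrier (osp eps a 0) \<times> carrier (osp False 0 b)) (pullback (g0_embed a b) V) (tensor S T)"
 unfolding rep_iso_iff
proof (rule exI[of _ "\<lambda>v. pr (sec v)"])
 let ?P = "\<lambda>v. pr (sec v)"
 note l = linear_on_comp[OF sec_linear pr_linear]
 note sc = linear_onD(1)[OF sec_linear]
 note V = vspace_Std[of "Kt K1 K2" a b lam p]
 have inj: "inj_on ?P (carrier V)"
 proof (rule inj_onI)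
  fix v v' assume v: "v <: V" "v' <: V" and "?P v = ?P v'"
  hence "th (sec v \<ominus>\<^bsub>FT\<^esub> sec v') = \<zero>\<^bsub>V\<^esub>" using FT.coset_eq[OF sub_R sc sc] th_R by blast
  hence "v \<ominus>\<^bsub>V\<^esub> v' = \<zero>\<^bsub>V\<^esub>" unfolding linear_on_minus[OF FT.vspace_axioms V th_linear sc[OF v(1)] sc[OF v(2)]] using v th_sec by simp
  thus "v = v'" using vspace.vs_eq_iff[OF V v] by blast
 qed
 have im: "?P ` carrier V = carrier Q"
 proof
  show "?P ` carrier V \<subseteq> carrier Q" using linear_onD(1)[OF l] by blast
  show "carrier Q \<subseteq> ?P ` carrier V"
  proof
   fix q assume "q <: Q"
   then obtain f where f: "f <: FT" "q = pr f" by auto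
   show "q \<in> ?P ` carrier V" by (rule image_eqI[of _ _ "th f"]) (use f pr_sec_th linear_onD(1)[OF th_linear] in auto)
  qed
 qed
 have z: "?P \<zero>\<^bsub>V\<^esub> = pr \<zero>\<^bsub>FT\<^esub>" using linear_on_zero[OF V FT.vspace_axioms sec_linear] by simp
 have par: "?P ` part V q = part Q q" for q
 proof -
  have "p + ns d = 0" if "d \<in> DK (Kt K1 K2) a b lam" for d using p[of "ns d"] that by (simp add: DK_def)
  hence e: "{n \<in> code ` DK (Kt K1 K2) a b lam. p + ns (dec n) = q} = (if q = 0 then code ` DK (Kt K1 K2) a b lam else {})"
   by (auto simp: DK_Fin)
  show ?thesis
  proof (cases "q = 0")
   case True
   have "part V q = carrier V" "part FT q = carrier FT" using e True by simp_all
   thus ?thesis using im by simp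
  next
   case False
   have "part V q = {f. finite {i. f i \<noteq> 0} \<and> {i. f i \<noteq> 0} \<subseteq> {}}" by (simp only: Std_simps(5) e False if_False)
   hence "part V q = {\<zero>\<^bsub>V\<^esub>}" by (auto simp: fun_eq_iff)
   moreover have "part FT q = {\<zero>\<^bsub>FT\<^esub>}" using False by (auto simp: fun_eq_iff)
   ultimately show ?thesis using z by (simp del: free_space_simps Std_simps)
  qed
 qed
 have eq: "?P (std_act a b lam (g0_embed a b (x, y)) v) = act (tensor S T) (x, y) (?P v)"
  if x: "x <: (osp eps a 0)" and y: "y <: (osp False 0 b)" and v: "v <: V" for x y v
 proof -
  have "act (tensor S T) (x, y) (?P v) = pr (dact x y (sec v))" by (rule tensor_act[OF x y sc[OF v]])
  also have "\<dots> = pr (sec (th (dact x y (sec v))))" by (rule pr_sec_th[symmetric, OF linear_onD(1)[OF dact_linear[OF x y] sc[OF v]]])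
  also have "\<dots> = ?P (std_act a b lam (g0_embed a b (x, y)) v)" unfolding th_dact[OF x y sc[OF v]] th_sec[OF v] ..
  finally show ?thesis ..
 qed
 have "linear_on (pullback (g0_embed a b) V) (tensor S T) ?P"
  using l unfolding linear_on_def tensor_simps pullback_simps .
 thus "iso_map (carrier (osp eps a 0) \<times> carrier (osp False 0 b)) (pullback (g0_embed a b) V) (tensor S T) ?P"
  unfolding iso_map_def tensor_simps pullback_simps bij_betw_def using inj im par eq by (auto simp del: Std_simps(1,5) quot_simps)
qed

end

section \<open>The decomposition theorem\<close>

lemma rep_iso_id:
 assumes "carrier N = carrier M" "ring.add N = ring.add M" "module.smult N = module.smult M" "part N = part M"
  "\<And>x v. x \<in> G ==> v <: M ==> act N x v = act M x v"
 shows "rep_iso G M N"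
 unfolding rep_iso_def by (rule exI[of _ "\<lambda>v. v"]) (simp add: assms bij_betw_def)

lemma parity_shift_simps [simp]:
 "carrier (parity_shift M) = carrier M" "ring.zero (parity_shift M) = ring.zero M" "ring.add (parity_shift M) = ring.add M"
 "module.smult (parity_shift M) = module.smult M" "part (parity_shift M) = (\<lambda>p. part M (p + 1))" "act (parity_shift M) = act M"
 by (simp_all add: parity_shift_def)

lemma rep_iso_pullback:
 assumes "rep_iso G M N" "f ` H \<subseteq> G"
 shows "rep_iso H (pullback f M) (pullback f N)"
proof -
 obtain \<phi> where "iso_map G M N \<phi>" using assms(1) rep_iso_iff by blast
 hence "iso_map H (pullback f M) (pullback f N) \<phi>" using assms(2) by (auto simp: iso_map_def linear_on_def image_subset_iff)
 thus ?thesis using rep_iso_iff by blast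
qed

lemma rep_iso_parity_shift:
 assumes "rep_iso G M N"
 shows "rep_iso G (parity_shift M) (parity_shift N)"
proof -
 obtain \<phi> where "iso_map G M N \<phi>" using assms(1) rep_iso_iff by blast
 hence "iso_map G (parity_shift M) (parity_shift N) \<phi>" by (simp add: iso_map_def linear_on_def)
 thus ?thesis using rep_iso_iff by blast
qed

lemma subsp_ops [simp]: "ring.add (subsp M W) = ring.add M" "module.smult (subsp M W) = module.smult M"
 by (simp_all add: subsp_def)

lemma rep_iso_subsp_part:
 assumes "rep_iso G M N" "superspace M"
 shows "rep_iso G (subsp M (part M q)) (subsp N (part N q))"
proof -
 obtain \<phi> where \<phi>: "iso_map G M N \<phi>" using assms(1) rep_iso_iff by blast
 have s: "part M p \<subseteq> carrier M" for p using superspaceD(5)[OF assms(2)] by blast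
 note im = iso_mapD(3)[OF \<phi>]
 have inj: "inj_on \<phi> (carrier M)" using iso_mapD(1)[OF \<phi>] by (rule bij_betw_imp_inj_on)
 have "\<phi> ` (part M q \<inter> part M p) = part N q \<inter> part N p" for p
  unfolding inj_on_image_Int[OF inj s s] im ..
 moreover have "bij_betw \<phi> (part M q) (part N q)"
  unfolding bij_betw_def im by (rule conjI[OF inj_on_subset[OF inj s] refl])
 ultimately have "iso_map G (subsp M (part M q)) (subsp N (part N q)) \<phi>"
  using iso_mapD(4)[OF \<phi>] linear_onD[OF iso_mapD(2)[OF \<phi>]] subsetD[OF s[of q]] im[of q]
  by (auto simp: iso_map_def linear_on_def)
 thus ?thesis using rep_iso_iff by blast
qed

lemma superspace_cong:
 assumes M: "superspace M" and e: "carrier N = carrier M" "ring.zero N = ring.zero M" "ring.add N = ring.add M"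
  "module.smult N = module.smult M" and p: "part N = part M \<or> part N = (\<lambda>p. part M (p + 1))"
 shows "superspace N"
proof -
 interpret V: vspace M by (rule superspaceD(1)[OF M])
 have p': "part N 0 = part M 0 \<and> part N 1 = part M 1 \<or> part N 0 = part M 1 \<and> part N 1 = part M 0" using p by auto
 show ?thesis
 proof (rule superspaceI)
  show "vspace N" by (rule vspace_cong[OF V.vspace_axioms e])
  show "submodule (part N q) CC N" for q
   using p superspaceD(2)[OF M] unfolding submodule_cong[OF V.vspace_axioms e] by auto
  show "x = \<zero>\<^bsub>N\<^esub>" if "x \<in> part N 0" "x \<in> part N 1" for x using that p' superspaceD(3)[OF M] e(2) by auto
  show "\<exists>x\<in>part N 0. \<exists>y\<in>part N 1. v = x \<oplus>\<^bsub>N\<^esub> y" if "v <: N" for v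
  proof -
   obtain x y where "x \<in> part M 0" "y \<in> part M 1" "v = x \<oplus>\<^bsub>M\<^esub> y" using superspaceD(4)[OF M, of v] \<open>v <: N\<close> e(1) by auto
   thus ?thesis using p' e(3) V.a_comm[of x y] superspaceD(5)[OF M] by metis
  qed
 qed
qed

lemma superspace_pullback: "superspace M ==> superspace (pullback f M)" by (erule superspace_cong) simp_all
lemma superspace_parity_shift: "superspace M ==> superspace (parity_shift M)" by (erule superspace_cong) simp_all

text \<open>The index set is an initial segment on either side of 0, so a nonempty side contains -1
  or 1.\<close>

lemma Idx_unit: "i \<in> Idx a b ==> i < 0 ==> - 1 \<in> Idx a b" "i \<in> Idx a b ==> 0 < i ==> 1 \<in> Idx a b"
proof -
 assume i: "i \<in> Idx a b"
 have *: "enat (nat 1) \<le> c" if "enat n \<le> c" "nat 1 \<le> n" for n c using that order_trans[OF _ that(1)] by simp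
 show "i < 0 ==> - 1 \<in> Idx a b" using i *[of "nat (- i)" b] by (auto simp: Idx_def)
 show "0 < i ==> 1 \<in> Idx a b" using i *[of "nat i" a] by (auto simp: Idx_def)
qed

text \<open>A nonzero odd generator is a bracket of a positive and a negative letter, or a single
  negative letter if eps holds. The indices obtained are the form in which the nonzero odd part is
  used below.\<close>

lemma odd_part_nonzero:
 assumes "part (osp eps a b) 1 \<noteq> {\<zero>\<^bsub>osp eps a b\<^esub>}"
 shows "- 1 \<in> Idx a b \<and> (eps \<or> 1 \<in> Idx a b)"
proof -
 interpret C: vspace "Cl a b" by (rule vspace_Cl)
 let ?B = "osp_gens eps a b \<inter> part (Cl a b) 1"
 have "\<not> ?B \<subseteq> {\<zero>\<^bsub>Cl a b\<^esub>}"
 proof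
  assume "?B \<subseteq> {\<zero>\<^bsub>Cl a b\<^esub>}"
  hence "lin_span (Cl a b) ?B \<subseteq> {\<zero>\<^bsub>Cl a b\<^esub>}" by (rule C.span_minimal[OF C.sub_trivial])
  hence "x = \<zero>\<^bsub>Cl a b\<^esub>" if "x \<in> part (osp eps a b) 1" for x using osp_part_span[of x eps a b 1] that unfolding osp_ops by blast
  moreover have "\<zero>\<^bsub>Cl a b\<^esub> \<in> part (osp eps a b) 1" using C.sub_zero[OF sub_osp] C.sub_zero[OF Cl_part_sub] by simp
  ultimately show False using assms unfolding osp_ops(3) by blast
 qed
 then obtain y where y: "y \<in> osp_gens eps a b" "y \<in> part (Cl a b) 1" "y \<noteq> \<zero>\<^bsub>Cl a b\<^esub>" by blast
 hence one: "q = 1" if "y \<in> part (Cl a b) q" for q using Cl_part_zero[OF that y(2)] by blast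
 from y(1) consider g h where "y = qq a b g h" "g \<in> letters a b" "h \<in> letters a b"
  | g where "y = wrd a b [g]" "g \<in> letters a b" eps unfolding osp_gens_def by (auto split: if_splits)
 thus ?thesis
 proof cases
  case 1
  have "gen_par g + gen_par h = 1" using one qq_part[OF 1(2,3)] 1(1) by blast
  hence "idx g < 0 \<longleftrightarrow> \<not> idx h < 0" by (auto simp: gen_par_def split: if_splits)
  moreover have i: "idx g \<in> Idx a b" "idx h \<in> Idx a b" using 1 by auto
  moreover have "idx g \<noteq> 0" "idx h \<noteq> 0" using i Idx_nonzero by blast+
  ultimately show ?thesis using Idx_unit[of "idx g" a b] Idx_unit[of "idx h" a b] by linarith
 next
  case 2
  have "gen_par g = 1" using one Wg(2)[OF 2(2)] 2(1) by blast
  thus ?thesis using 2 Idx_unit(1)[of "idx g" a b] by (auto simp: gen_par_def split: if_splits)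
 qed
qed

text \<open>The two letters of an index never vanish together: \<open>Eta i\<close> vanishes only at
  y = 0, where \<open>Xi i\<close> does not.\<close>

lemma DD_flip:
 assumes d: "d \<in> DD a b lam" and i: "i \<in> Idx a b"
 shows "\<exists>g. idx g = i \<and> d \<lhd>+ dl g \<in> DD a b lam"
proof (cases "mag lam (Xi i) d = 0")
 case True
 hence "mag lam (Eta i) d \<noteq> 0" by (auto simp: mag_def split: if_splits)
 from DD_step[OF d _ this] i show ?thesis by (intro exI[of _ "Eta i"]) simp
next
 case False
 from DD_step[OF d _ False] i show ?thesis by (intro exI[of _ "Xi i"]) simp
qed

lemma DD_parities:
 assumes "admissible a b lam" "s = 0 \<or> 1 \<in> Idx a b" "q = 0 \<or> - 1 \<in> Idx a b"
 shows "\<exists>d\<in>DD a b lam. ps d = s \<and> ns d = q"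
proof -
 have "\<exists>d\<in>DD a b lam. ps d = s \<and> ns d = 0"
 proof (cases "s = 0")
  case True thus ?thesis using zero_DD[OF assms(1)] by (intro bexI[of _ "\<lambda>_. 0"]) simp_all
 next
  case False
  then obtain g where "idx g = 1" "(\<lambda>_. 0) \<lhd>+ dl g \<in> DD a b lam" using DD_flip[OF zero_DD[OF assms(1)]] assms(2) by blast
  thus ?thesis using False by (intro bexI[of _ "(\<lambda>_. 0) \<lhd>+ dl g"]) (simp_all add: sm_plus sm_dl)
 qed
 then obtain d where d: "d \<in> DD a b lam" "ps d = s" "ns d = 0" by blast
 show ?thesis
 proof (cases "q = 0")
  case True thus ?thesis using d by blast
 next
  case False
  then obtain g where "idx g = - 1" "d \<lhd>+ dl g \<in> DD a b lam" using DD_flip[OF d(1)] assms(3) by blast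
  thus ?thesis using False d DD_Fin[OF d(1)] by (intro bexI[of _ "d \<lhd>+ dl g"]) (simp_all add: sm_plus sm_dl)
 qed
qed

lemma DK_exists:
 assumes "admissible a b lam" "eps \<or> r = q \<or> 1 \<in> Idx a b" "q = 0 \<or> - 1 \<in> Idx a b"
 shows "\<exists>d\<in>DK (Kc eps r) a b lam. ns d = q"
proof -
 \<comment> \<open>Modulo 2 the choice \<open>ps d\<close> = r + q and \<open>ns d\<close> = q gives
   \<open>ps d + ns d\<close> = r; if eps holds, \<open>ps d\<close> may be taken to be 0.\<close>
 have "(if eps then 0 else r + q) = 0 \<or> 1 \<in> Idx a b" using assms(2) by (cases eps; cases "r = q") auto
 then obtain d where "d \<in> DD a b lam" "ps d = (if eps then 0 else r + q)" "ns d = q"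
  using DD_parities[OF assms(1) _ assms(3)] by blast
 thus ?thesis by (intro bexI[of _ d]) (auto simp: DK_def Kc_def add.assoc)
qed

text \<open>The vector at d becomes the base vector. Its parity p + \<open>ns d\<close> is the new
  parity parameter, and the label r becomes 0 since it is counted from the new base.\<close>

lemma Std_shift:
 assumes d: "d \<in> DK (Kc eps r) a b mu" and lam: "\<And>i. i \<in> Idx a b ==> lam i = mu i + of_int (d i)"
 shows "rep_iso (carrier (Calg eps a b)) (Std (Kc eps r) a b mu p) (Std (Kc eps 0) a b lam (p + ns d))"
proof (rule simple_weight_Std_iso)
 show "simple_weight eps a b (Std (Kc eps r) a b mu p)" using d by (intro simple_weight_Std) blast
 have *: "E d (code e) \<noteq> 0 \<longleftrightarrow> e = d" if "e \<in> DD a b mu" for e using DD_Fin[OF that] DK_Fin[OF d] by (simp add: single_def)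
 show "wvec a b (Std (Kc eps r) a b mu p) lam (E d)" using wvec_Std_iff[OF E_Std[OF d]] * lam by blast
 show "E d \<noteq> \<zero>\<^bsub>Std (Kc eps r) a b mu p\<^esub>" using E_nonzero by simp
 show "E d \<in> part (Std (Kc eps r) a b mu p) (p + ns d)" using Std_part_iff E_Std[OF d] * by blast
qed

lemma DD_admissible: "d \<in> DD a b mu ==> admissible a b (\<lambda>i. mu i + of_int (d i))"
 unfolding admissible_def DD_def okk_def by force

text \<open>The weight vector at hand may be odd. Moving the base weight by a shift d with
  \<open>ns d\<close> equal to its parity q turns the parity parameter q into 0.\<close>

lemma spinor_oscillator_Std:
 assumes "spinor_oscillator_type eps a b M" "- 1 \<in> Idx a b \<and> (eps \<or> 1 \<in> Idx a b)"
 shows "\<exists>lam. admissible a b lam \<and> rep_iso (carrier (osp eps a b)) M (Std (Kc eps 0) a b lam 0)"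
proof -
 obtain N :: "(cl, 'a) rep" where N: "simple_weight eps a b N" "rep_iso (carrier (osp eps a b)) M N"
  using spinor_oscillator_pullback[OF assms(1)] by blast
 obtain mu q m where m: "wvec a b N mu m" "m \<noteq> \<zero>\<^bsub>N\<^esub>" "m \<in> part N q" using simple_weight_vector[OF N(1)] by blast
 obtain d where d: "d \<in> DK (Kc eps 0) a b mu" "ns d = q" using DK_exists[OF wvec_admissible[OF N(1) m(1,2)], of eps 0 q] assms(2) by blast
 let ?lam = "\<lambda>i. mu i + of_int (d i)"
 have "rep_iso (carrier (Calg eps a b)) N (Std (Kc eps 0) a b ?lam 0)"
  using rep_iso_trans[OF simple_weight_Std_iso[OF N(1) m] Std_shift[OF d(1), of ?lam q]] d(2) by simp
 hence "rep_iso (carrier (osp eps a b)) N (Std (Kc eps 0) a b ?lam 0)" by (rule rep_iso_mono) (use osp_Calg in blast)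
 thus ?thesis using rep_iso_trans[OF N(2)] DD_admissible[OF DK_DD[OF d(1)]] by blast
qed

section \<open>Spinor and oscillator modules as standard modules\<close>

definition even_type :: "bool => enat => enat => (cl, 's) rep => bool" where
 "even_type eps a b S \<longleftrightarrow> lie_module (osp eps a b) S \<and> purely_even S \<and>
   (\<exists>N :: (cl, 's) rep. simple_weight eps a b N \<and> rep_iso (carrier (osp eps a b)) S N)"

lemma spinor_even_type: "spinor eps a S \<longleftrightarrow> even_type eps a 0 S"
 unfolding spinor_def even_type_def simple_weight_iff ..

lemma oscillator_even_type: "oscillator b T \<longleftrightarrow> even_type False 0 b T"
 unfolding oscillator_def even_type_def simple_weight_iff by simp

lemma even_type_wf: "even_type eps a b S ==> wf_rep (carrier (osp eps a b)) S"
 unfolding even_type_def lie_module_def using graded_actionD(8) by blast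

text \<open>Since S is purely even, the homogeneous weight vector lies in the even part, which fixes
  the parity parameter as 0.\<close>

lemma even_type_Std_iso:
 fixes S :: "(cl, 's) rep"
 assumes S: "even_type eps a b S"
 shows "\<exists>(N :: (cl, 's) rep) lam. simple_weight eps a b N \<and> rep_iso (carrier (osp eps a b)) S N \<and> admissible a b lam \<and>
  rep_iso (carrier (Calg eps a b)) N (Std (Kc eps 0) a b lam 0)"
proof -
 obtain N :: "(cl, 's) rep" where N: "simple_weight eps a b N" "rep_iso (carrier (osp eps a b)) S N" and e: "part S 1 = {\<zero>\<^bsub>S\<^esub>}"
  using S unfolding even_type_def purely_even_def by blast
 obtain \<phi> where \<phi>: "iso_map (carrier (osp eps a b)) S N \<phi>" using N(2) rep_iso_iff by blast
 have sN: "superspace N" using N(1) unfolding simple_weight_def assoc_module_def graded_action_def by blast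
 have sS: "superspace S" using even_type_wf[OF S] unfolding wf_rep_def by blast
 have e': "part N 1 = {\<zero>\<^bsub>N\<^esub>}"
  using iso_mapD(3)[OF \<phi>, of 1] e linear_on_zero[OF superspaceD(1)[OF sS] superspaceD(1)[OF sN] iso_mapD(2)[OF \<phi>]] by simp
 obtain lam q m where m: "wvec a b N lam m" "m \<noteq> \<zero>\<^bsub>N\<^esub>" "m \<in> part N q" using simple_weight_vector[OF N(1)] by blast
 have "q = 0" using m e' by (cases q) auto
 thus ?thesis using N wvec_admissible[OF N(1) m(1,2)] simple_weight_Std_iso[OF N(1) m] by blast
qed

lemma even_type_Std:
 assumes "DK (Kc eps r) a b lam \<noteq> {}" "\<And>d. d \<in> DK (Kc eps r) a b lam ==> p + ns d = 0"
 shows "even_type eps a b (Std (Kc eps r) a b lam p)"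
proof -
 let ?M = "Std (Kc eps r) a b lam p"
 have "v = \<zero>\<^bsub>?M\<^esub>" if "v \<in> part ?M 1" for v
 proof
  fix n
  have "{i \<in> code ` DK (Kc eps r) a b lam. p + ns (dec i) = 1} = {}" using assms(2) DK_Fin by auto
  hence "{i. v i \<noteq> 0} \<subseteq> {}" using that by (simp only: Std_simps(5) mem_Collect_eq)
  thus "v n = \<zero>\<^bsub>?M\<^esub> n" by auto
 qed
 hence "purely_even ?M" unfolding purely_even_def using vspace.sub_zero[OF vspace_Std superspaceD(2)[OF superspace_Std]] by blast
 thus ?thesis unfolding even_type_def
  using lie_module_assoc[OF assoc_module_Std[OF adm_Kc]] simple_weight_Std[OF assms(1)] rep_iso_refl by blast
qed

lemma DK_ns: "d \<in> DK K a 0 lam ==> ns d = 0" "d \<in> DK K 0 b lam ==> ps d = 0"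
proof -
 assume "d \<in> DK K a 0 lam"
 hence "d i = 0" if "i < 0" for i using that Idx_sgn(1)[of i a] unfolding DK_def DD_def by fastforce
 thus "ns d = 0" by (intro sm_none) blast
next
 assume "d \<in> DK K 0 b lam"
 hence "d i = 0" if "0 < i" for i using that Idx_sgn(2)[of i b] unfolding DK_def DD_def by fastforce
 thus "ps d = 0" by (intro sm_none) blast
qed

text \<open>The weights of the two factors live on disjoint sets of indices and are glued to a
  single \<open>lam\<close>, which is also the base weight for the module over
  \<open>osp eps a b\<close>.\<close>

lemma even_type_pair:
 fixes S :: "(cl, 's) rep" and T :: "(cl, 't) rep"
 assumes S: "even_type eps a 0 S" and T: "even_type False 0 b T"
 shows "\<exists>(N :: (cl, 's) rep) (N' :: (cl, 't) rep) lam. admissible a b lam \<and>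
  simple_weight eps a 0 N \<and> rep_iso (carrier (osp eps a 0)) S N \<and> rep_iso (carrier (Calg eps a 0)) N (Std (Kc eps 0) a 0 lam 0) \<and>
  simple_weight False 0 b N' \<and> rep_iso (carrier (osp False 0 b)) T N' \<and> rep_iso (carrier (Calg False 0 b)) N' (Std (Kc False 0) 0 b lam 0)"
proof -
 obtain N :: "(cl, 's) rep" and l1 where N: "simple_weight eps a 0 N" "rep_iso (carrier (osp eps a 0)) S N" "admissible a 0 l1"
  "rep_iso (carrier (Calg eps a 0)) N (Std (Kc eps 0) a 0 l1 0)" using even_type_Std_iso[OF S] by blast
 obtain N' :: "(cl, 't) rep" and l2 where N': "simple_weight False 0 b N'" "rep_iso (carrier (osp False 0 b)) T N'" "admissible 0 b l2"
  "rep_iso (carrier (Calg False 0 b)) N' (Std (Kc False 0) 0 b l2 0)" using even_type_Std_iso[OF T] by blast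
 define lam where "lam i = (if 0 < i then l1 i else l2 i)" for i
 have z: "(\<lambda>_. 0) \<in> DK (Kc eps' 0) a' b' l" if "admissible a' b' l" for eps' a' b' l using zero_DD[OF that] by (simp add: DK_def Kc_def)
 have "rep_iso (carrier (Calg eps a 0)) (Std (Kc eps 0) a 0 l1 0) (Std (Kc eps 0) a 0 lam 0)"
  using Std_shift[OF z[OF N(3)], of lam] Idx_sgn(1) by (simp add: lam_def)
 moreover have "rep_iso (carrier (Calg False 0 b)) (Std (Kc False 0) 0 b l2 0) (Std (Kc False 0) 0 b lam 0)"
  using Std_shift[OF z[OF N'(3)], of lam] Idx_sgn(2) by (force simp: lam_def)
 moreover have "admissible a b lam" using N(3) Idx_iff(1)[of _ a b] unfolding admissible_def lam_def by auto
 ultimately show ?thesis using N N' rep_iso_trans[OF N(4)] rep_iso_trans[OF N'(4)] by blast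
qed

section \<open>Twins as the two halves of one Clifford-Weyl module\<close>

lemma wf_parity_shift:
 assumes "wf_rep G M"
 shows "wf_rep G (parity_shift M)"
proof (rule wf_repI)
 show "superspace (parity_shift M)" by (rule superspace_parity_shift) (use assms in \<open>simp add: wf_rep_def\<close>)
 show "act (parity_shift M) x v <: (parity_shift M)" if "x \<in> G" "v <: (parity_shift M)" for x v
  using assms that by (simp add: wf_rep_def)
qed

text \<open>Twins ask for a module on the product type of the direct sum. The larger algebra acts on
  F; its action is carried along the isomorphism to the space of D.\<close>

lemma transport_act:
 fixes D :: "('x, 'd) rep"
 assumes D: "wf_rep H D" and F: "wf_rep G F" and H: "H \<subseteq> G" and i: "rep_iso H D F"
 shows "\<exists>N :: ('x, 'd) rep. superspace N \<and> rep_iso G F N \<and> rep_iso H N D"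
proof -
 obtain \<chi> where \<chi>: "iso_map H D F \<chi>" using i rep_iso_iff by blast
 let ?i = "inv_into (carrier D) \<chi>"
 define N where "N = D\<lparr>act := \<lambda>x v. ?i (act F x (\<chi> v))\<rparr>"
 have N: "carrier N = carrier D" "ring.zero N = ring.zero D" "ring.add N = ring.add D" "module.smult N = module.smult D"
  "part N = part D" "act N = (\<lambda>x v. ?i (act F x (\<chi> v)))" by (simp_all add: N_def)
 note j = iso_map_inv[OF D \<chi>]
 have inv: "\<chi> (?i w) = w" if "w <: F" for w
  using iso_mapD(1)[OF \<chi>] that by (simp add: bij_betw_def f_inv_into_f)
 have inv': "?i (\<chi> v) = v" if "v <: D" for v
  using iso_mapD(1)[OF \<chi>] that by (simp add: bij_betw_def inv_into_f_f)
 have "superspace N" by (rule superspace_cong[of D]) (use D N in \<open>simp_all add: wf_rep_def\<close>)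
 moreover have "iso_map G F N ?i"
  using iso_mapD(1,2,3)[OF j] inv F unfolding iso_map_def linear_on_def N by (simp add: wf_rep_def)
 moreover have "rep_iso H N D"
 proof (rule rep_iso_id)
  fix x v assume x: "x \<in> H" and "v <: N"
  hence v: "v <: D" by (simp add: N)
  hence "act D x v <: D" using D x by (simp add: wf_rep_def)
  thus "act D x v = act N x v" unfolding N iso_mapD(4)[OF \<chi> x v, symmetric] using inv' by simp
 qed (simp_all add: N)
 ultimately show ?thesis using rep_iso_iff by blast
qed

text \<open>The projection to the constituent with \<open>ps + ns\<close> = r.\<close>

definition rst :: "bit => (nat => complex) => nat => complex" where
 "rst r v = (\<lambda>n. if ps (dec n) + ns (dec n) = r then v n else 0)"

lemma rst_add: "(\<lambda>n. rst 0 v n + rst 1 v n) = v"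
 by (auto simp: rst_def fun_eq_iff)

lemma rst_Std: "v \<in> part (Std (Kc True 0) a b lam p) q ==> rst r v \<in> part (Std (Kc False r) a b lam p) q"
 unfolding Std_part_iff Std_VV by (auto simp: rst_def Kc_def DD_Fin elim: rev_finite_subset)

lemma Std_Kc_le: "v \<in> part (Std (Kc False r) a b lam p) q ==> v \<in> part (Std (Kc True 0) a b lam p) q"
 unfolding Std_part_iff Std_VV by (auto simp: Kc_def)

lemma Std_disjoint:
 assumes "u <: (Std (Kc False r) a b lam p)"
 shows "rst q u = (if q = r then u else (\<lambda>_. 0))"
proof
 fix n
 have "ps (dec n) + ns (dec n) = r" if "u n \<noteq> 0"
 proof -
  have "n \<in> code ` DK (Kc False r) a b lam" using assms that by auto
  then obtain d where "d \<in> DK (Kc False r) a b lam" "n = code d" by blast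
  thus ?thesis using DK_Fin[of d] by (simp add: DK_def Kc_def)
 qed
 thus "rst q u n = (if q = r then u else (\<lambda>_. 0)) n" by (auto simp: rst_def)
qed

lemma Std_part_decompose:
 "v <: (Std K a b lam p) ==> \<exists>v0\<in>part (Std K a b lam p) 0. \<exists>v1\<in>part (Std K a b lam p) 1. v = (\<lambda>n. v0 n + v1 n)"
 using superspaceD(4)[OF superspace_Std, of v K a b lam p] by simp

lemma rst_Std_carrier:
 assumes "v <: (Std (Kc True 0) a b lam p)"
 shows "rst r v <: (Std (Kc False r) a b lam p)"
proof -
 interpret V: vspace "Std (Kc False r) a b lam p" by (rule vspace_Std)
 obtain v0 v1 where v: "v0 \<in> part (Std (Kc True 0) a b lam p) 0" "v1 \<in> part (Std (Kc True 0) a b lam p) 1" "v = (\<lambda>n. v0 n + v1 n)"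
  using Std_part_decompose[OF assms] by blast
 have "rst r v = rst r v0 \<oplus>\<^bsub>Std (Kc False r) a b lam p\<^esub> rst r v1" by (simp add: v(3) rst_def fun_eq_iff)
 thus ?thesis using V.a_closed superspaceD(5)[OF superspace_Std rst_Std[OF v(1)]] superspaceD(5)[OF superspace_Std rst_Std[OF v(2)]] by metis
qed

text \<open>Over \<open>Cl_ev\<close> the standard module of \<open>Cl\<close> is the sum of its
  pieces with r = 0 and r = 1; the two projections \<open>rst\<close> recover the summands.\<close>

lemma dsum_Std_iso:
 fixes P :: "(cl, 's) rep" and P' :: "(cl, 'r) rep"
 assumes P: "rep_iso (carrier (Calg False a b)) P (Std (Kc False 0) a b lam p)"
  and P': "rep_iso (carrier (Calg False a b)) P' (Std (Kc False 1) a b lam p)"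
 shows "rep_iso (carrier (Calg False a b)) (dsum P P') (Std (Kc True 0) a b lam p)"
proof -
 let ?H = "carrier (Calg False a b)" let ?A = "Std (Kc False 0) a b lam p" let ?B = "Std (Kc False 1) a b lam p" let ?V = "Std (Kc True 0) a b lam p"
 obtain \<phi> where \<phi>: "iso_map ?H P ?A \<phi>" using P rep_iso_iff by blast
 obtain \<psi> where \<psi>: "iso_map ?H P' ?B \<psi>" using P' rep_iso_iff by blast
 let ?f = "\<lambda>st. \<phi> (fst st) \<oplus>\<^bsub>?V\<^esub> \<psi> (snd st)"
 interpret V: vspace ?V by (rule vspace_Std)
 have le: "u <: (Std (Kc False r) a b lam p) ==> u <: ?V" for u r
  unfolding Std_VV by (auto simp: Kc_def)
 have \<phi>c: "\<phi> s <: ?A" if "s <: P" for s by (rule iso_mapD(5)[OF \<phi> that])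
 have \<psi>c: "\<psi> t <: ?B" if "t <: P'" for t by (rule iso_mapD(5)[OF \<psi> that])
 have rf: "rst 0 (?f (s, t)) = \<phi> s" "rst 1 (?f (s, t)) = \<psi> t" if "s <: P" "t <: P'" for s t
 proof -
  have "rst r (?f (s, t)) = (\<lambda>n. rst r (\<phi> s) n + rst r (\<psi> t) n)" for r by (simp add: rst_def fun_eq_iff)
  thus "rst 0 (?f (s, t)) = \<phi> s" "rst 1 (?f (s, t)) = \<psi> t"
   unfolding Std_disjoint[OF \<phi>c[OF that(1)]] Std_disjoint[OF \<psi>c[OF that(2)]] by simp_all
 qed
 have inj: "inj_on ?f (carrier P \<times> carrier P')"
 proof (rule inj_onI, clarify)
  fix s t s' t' assume c: "s <: P" "t <: P'" "s' <: P" "t' <: P'" and e: "?f (s, t) = ?f (s', t')"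
  have "\<phi> s = \<phi> s'" "\<psi> t = \<psi> t'" using rf[OF c(1,2)] rf[OF c(3,4)] unfolding e by metis+
  thus "s = s' \<and> t = t'" using iso_mapD(7)[OF \<phi> c(1,3)] iso_mapD(7)[OF \<psi> c(2,4)] by blast
 qed
 have fc: "?f st <: ?V" if "st \<in> carrier P \<times> carrier P'" for st
 proof -
  have c: "fst st <: P" "snd st <: P'" using that by auto
  show ?thesis by (rule V.a_closed[OF le[OF \<phi>c[OF c(1)]] le[OF \<psi>c[OF c(2)]]])
 qed
 have split: "v = rst 0 v \<oplus>\<^bsub>?V\<^esub> rst 1 v" for v using rst_add[of v] by simp
 have im: "?f ` (carrier P \<times> carrier P') = carrier ?V"
 proof
  show "?f ` (carrier P \<times> carrier P') \<subseteq> carrier ?V" using fc by blast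
  show "carrier ?V \<subseteq> ?f ` (carrier P \<times> carrier P')"
  proof
   fix v assume v: "v <: ?V"
   obtain s where s: "s <: P" "rst 0 v = \<phi> s" using iso_mapD(6)[OF \<phi> rst_Std_carrier[OF v]] by blast
   obtain t where t: "t <: P'" "rst 1 v = \<psi> t" using iso_mapD(6)[OF \<psi> rst_Std_carrier[OF v]] by blast
   have "v = ?f (s, t)" using split[of v] unfolding s(2) t(2) by simp
   thus "v \<in> ?f ` (carrier P \<times> carrier P')" using s t by blast
  qed
 qed
 have par: "?f ` (part P q \<times> part P' q) = part ?V q" for q
 proof
  show "?f ` (part P q \<times> part P' q) \<subseteq> part ?V q"
  proof (rule image_subsetI, clarify)
   fix s t assume "s \<in> part P q" "t \<in> part P' q"
   hence "\<phi> s \<in> part ?A q" "\<psi> t \<in> part ?B q" using iso_mapD(3)[OF \<phi>] iso_mapD(3)[OF \<psi>] by blast+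
   thus "?f (s, t) \<in> part ?V q" using V.sub_add[OF superspaceD(2)[OF superspace_Std] Std_Kc_le Std_Kc_le] by simp
  qed
  show "part ?V q \<subseteq> ?f ` (part P q \<times> part P' q)"
  proof
   fix v assume v: "v \<in> part ?V q"
   obtain s where s: "s \<in> part P q" "rst 0 v = \<phi> s" using rst_Std[OF v] iso_mapD(3)[OF \<phi>] by blast
   obtain t where t: "t \<in> part P' q" "rst 1 v = \<psi> t" using rst_Std[OF v] iso_mapD(3)[OF \<psi>] by blast
   have "v = ?f (s, t)" using split[of v] unfolding s(2) t(2) by simp
   thus "v \<in> ?f ` (part P q \<times> part P' q)" using s t by blast
  qed
 qed
 have lin: "linear_on (dsum P P') ?V ?f"
  unfolding linear_on_def
 proof (intro conjI ballI allI)
  note l1 = linear_onD[OF iso_mapD(2)[OF \<phi>]] note l2 = linear_onD[OF iso_mapD(2)[OF \<psi>]]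
  fix x assume "x <: (dsum P P')"
  then obtain s t where x: "x = (s, t)" "s <: P" "t <: P'" by auto
  show "?f x <: ?V" using fc x by blast
  show "?f (c \<odot>\<^bsub>dsum P P'\<^esub> x) = c \<odot>\<^bsub>?V\<^esub> ?f x" for c
   unfolding x(1) dsum_simps fst_conv snd_conv l1(3)[OF x(2)] l2(3)[OF x(3)] by (simp add: algebra_simps)
  fix y assume "y <: (dsum P P')"
  then obtain s' t' where y: "y = (s', t')" "s' <: P" "t' <: P'" by auto
  show "?f (x \<oplus>\<^bsub>dsum P P'\<^esub> y) = ?f x \<oplus>\<^bsub>?V\<^esub> ?f y"
   unfolding x(1) y(1) dsum_simps fst_conv snd_conv l1(2)[OF x(2) y(2)] l2(2)[OF x(3) y(3)] by (simp add: algebra_simps)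
 qed
 have eq: "?f (act (dsum P P') x st) = act ?V x (?f st)" if x: "x \<in> ?H" and stc: "st \<in> carrier P \<times> carrier P'" for x st
 proof -
  obtain s t where st: "st = (s, t)" "s <: P" "t <: P'" using stc by blast
  have "std_act a b lam x (\<phi> s \<oplus>\<^bsub>VV a b lam\<^esub> \<psi> t) = std_act a b lam x (\<phi> s) \<oplus>\<^bsub>VV a b lam\<^esub> std_act a b lam x (\<psi> t)"
   by (rule linear_onD(2)[OF std_act_linear_right[OF Calg_Cl[OF x]] Std_in_VV[OF \<phi>c[OF st(2)]] Std_in_VV[OF \<psi>c[OF st(3)]]])
  thus ?thesis unfolding st(1) dsum_simps fst_conv snd_conv iso_mapD(4)[OF \<phi> x st(2)] iso_mapD(4)[OF \<psi> x st(3)] by simp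
 qed
 have "iso_map ?H (dsum P P') ?V ?f"
  unfolding iso_map_def bij_betw_def dsum_simps by (intro conjI allI ballI inj im par lin eq)
 thus ?thesis using rep_iso_iff by blast
qed

lemma twin_extension:
 fixes P :: "(cl, 's) rep" and P' :: "(cl, 'r) rep"
 assumes P: "simple_weight False a b P" "rep_iso (carrier (Calg False a b)) P (Std (Kc False 0) a b lam p)"
  and P': "wf_rep (carrier (Calg False a b)) P'" "rep_iso (carrier (Calg False a b)) P' (Std (Kc False 1) a b lam p)"
  and lam: "admissible a b lam"
 shows "\<exists>N :: (cl, 's \<times> 'r) rep. simple_weight_Cl a b N \<and> rep_iso (carrier (Cl_ev a b)) N (dsum P P')"
proof -
 let ?V = "Std (Kc True 0) a b lam p"
 have wP: "wf_rep (carrier (Calg False a b)) P" using P(1) unfolding simple_weight_def assoc_module_def using graded_actionD(8) by blast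
 have "wf_rep (carrier (Calg False a b)) (dsum P P')"
  using superspace_dsum wP P'(1) unfolding wf_rep_def by auto
 moreover have "DK (Kc True 0) a b lam \<noteq> {}" using zero_DD[OF lam] by (auto simp: DK_def Kc_def)
 hence sw: "simple_weight True a b ?V" by (rule simple_weight_Std)
 hence "wf_rep (carrier (Calg True a b)) ?V" unfolding simple_weight_def assoc_module_def using graded_actionD(8) by blast
 moreover have "carrier (Calg False a b) \<subseteq> carrier (Calg True a b)" using Calg_Cl[of _ False a b] by (simp add: Calg_def[of True] subset_iff)
 ultimately obtain N :: "(cl, 's \<times> 'r) rep" where N: "superspace N" "rep_iso (carrier (Calg True a b)) ?V N"
  "rep_iso (carrier (Calg False a b)) N (dsum P P')"
  using transport_act[OF _ _ _ dsum_Std_iso[OF P(2) P'(2)]] by blast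
 have "simple_weight True a b N" by (rule simple_weight_iso[OF sw N(1,2)])
 thus ?thesis using N(3) unfolding simple_weight_iff by (auto simp: Calg_def)
qed

section \<open>The even and the odd part as tensor products\<close>

abbreviation G0 :: "bool => enat => enat => (cl \<times> cl) set" where
 "G0 eps a b \<equiv> carrier (osp eps a 0) \<times> carrier (osp False 0 b)"

abbreviation PB :: "enat => enat => (cl, 'm) rep => bit => (cl \<times> cl, 'm) rep" where
 "PB a b M q \<equiv> pullback (g0_embed a b) (subsp M (part M q))"

text \<open>Spelled out: \<open>ns\<close> = r, and also \<open>ps\<close> = r unless eps
  holds.\<close>

abbreviation "Kp eps r \<equiv> Kt (Kc eps r) (Kc False r)"

lemma g0_embed_image: "g0_embed a b ` G0 eps a b \<subseteq> part (osp eps a b) 0"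
 using g0_embed_osp by blast

lemma tensor_Std:
 assumes "wf_rep (carrier (osp eps a 0)) S" "wf_rep (carrier (osp False 0 b)) T"
  and "rep_iso (carrier (osp eps a 0)) S (Std (Kc eps r) a 0 lam p1)" "rep_iso (carrier (osp False 0 b)) T (Std (Kc False r) 0 b lam p2)"
 shows "rep_iso (G0 eps a b) (pullback (g0_embed a b) (Std (Kp eps r) a b lam r)) (tensor S T)"
proof -
 obtain \<phi> where \<phi>: "iso_map (carrier (osp eps a 0)) S (Std (Kc eps r) a 0 lam p1) \<phi>" using assms(3) rep_iso_iff by blast
 obtain \<psi> where \<psi>: "iso_map (carrier (osp False 0 b)) T (Std (Kc False r) 0 b lam p2) \<psi>" using assms(4) rep_iso_iff by blast
 interpret tensor_std eps a b lam "Kc eps r" "Kc False r" p1 p2 r S T \<phi> \<psi>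
  by (rule tensor_std.intro[OF assms(1,2) \<phi> \<psi>]) (simp add: Kc_def)
 show ?thesis by (rule tensor_iso)
qed

text \<open>For a module with \<open>ps + ns\<close> = 0, the condition \<open>ns\<close> = q on
  parity forces \<open>ps\<close> = q as well; this is the predicate
  \<open>Kp eps q\<close>.\<close>

lemma Std_piece:
 "rep_iso G (subsp (Std (Kc eps 0) a b lam 0) (part (Std (Kc eps 0) a b lam 0) q)) (Std (Kp eps q) a b lam 0)"
proof -
 have k: "Kc eps 0 x n \<and> n = q \<longleftrightarrow> Kp eps q x n" for x n by (cases x; cases n; cases q) (auto simp: Kc_def)
 have c: "v <: (Std (Kp eps q) a b lam 0) \<longleftrightarrow> v \<in> part (Std (Kc eps 0) a b lam 0) q" for v
  unfolding Std_part_iff Std_VV k[symmetric] by auto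
 have "part (Std (Kp eps q) a b lam 0) x = part (Std (Kc eps 0) a b lam 0) q \<inter> part (Std (Kc eps 0) a b lam 0) x" for x
 proof (rule Set.set_eqI)
  fix v show "v \<in> part (Std (Kp eps q) a b lam 0) x \<longleftrightarrow> v \<in> part (Std (Kc eps 0) a b lam 0) q \<inter> part (Std (Kc eps 0) a b lam 0) x"
   unfolding Std_part_iff[of v "Kp eps q"] c Int_iff Std_part_iff[of v "Kc eps 0"] by blast
 qed
 moreover have "carrier (Std (Kp eps q) a b lam 0) = part (Std (Kc eps 0) a b lam 0) q" using c by (rule Set.set_eqI)
 ultimately show ?thesis by (intro rep_iso_id) (simp_all add: fun_eq_iff del: Std_simps(1,5))
qed

lemma PB_Std:
 assumes M: "superspace M" and i: "rep_iso (carrier (osp eps a b)) M (Std (Kc eps 0) a b lam 0)"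
 shows "rep_iso (G0 eps a b) (PB a b M q) (pullback (g0_embed a b) (Std (Kp eps q) a b lam 0))"
proof -
 have "rep_iso (carrier (osp eps a b)) (subsp M (part M q)) (Std (Kp eps q) a b lam 0)"
  by (rule rep_iso_trans[OF rep_iso_subsp_part[OF i M] Std_piece])
 thus ?thesis by (rule rep_iso_pullback) (use g0_embed_image in fastforce)
qed

lemma wf_PB: "lie_module (osp eps a b) M ==> wf_rep (G0 eps a b) (PB a b M q)"
proof (rule wf_repI)
 assume "lie_module (osp eps a b) M"
 hence g: "graded_action (osp eps a b) M" by (simp add: lie_module_def)
 show "superspace (PB a b M q)" by (rule superspace_pullback[OF superspace_subsp_part[OF graded_actionD(1)[OF g]]])
 fix z v assume "z \<in> G0 eps a b" and v: "v <: (PB a b M q)"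
 hence z: "g0_embed a b z \<in> part (osp eps a b) 0" using g0_embed_image by blast
 show "act (PB a b M q) z v <: (PB a b M q)" using graded_actionD(5)[OF g z, of v q] v by simp
qed

text \<open>In the odd part \<open>ns\<close> = 1, and without eps also \<open>ps\<close> = 1, so
  both factors pass to the constituent labelled 1, the twin. T' gets the parity parameter 1 because
  its vectors have \<open>ns\<close> = 1 and T' has to be purely even.\<close>

theorem twin_decomposition_Std:
 fixes S N :: "(cl, 's) rep" and T N' :: "(cl, 't) rep"
 assumes S: "even_type eps a 0 S" "simple_weight eps a 0 N" "rep_iso (carrier (osp eps a 0)) S N" "rep_iso (carrier (Calg eps a 0)) N (Std (Kc eps 0) a 0 lam 0)"
  and T: "even_type False 0 b T" "simple_weight False 0 b N'" "rep_iso (carrier (osp False 0 b)) T N'" "rep_iso (carrier (Calg False 0 b)) N' (Std (Kc False 0) 0 b lam 0)"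
  and lam: "admissible a b lam" and ne: "- 1 \<in> Idx a b \<and> (eps \<or> 1 \<in> Idx a b)"
  and M: "superspace M" "rep_iso (carrier (osp eps a b)) M (Std (Kc eps 0) a b lam 0)"
 shows "twin_decomposition eps a b M S (Std (Kc eps 1) a 0 lam 0) T (Std (Kc False 1) 0 b lam 1)"
proof -
 let ?S' = "Std (Kc eps 1) a 0 lam 0" and ?T' = "Std (Kc False 1) 0 b lam 1"
 have lam0: "admissible a 0 lam" "admissible 0 b lam" using lam Idx_iff(1)[of _ a b] Idx_sgn(2) by (force simp: admissible_def)+
 have "eps \<or> 1 \<in> Idx a 0" "- 1 \<in> Idx 0 b" using ne Idx_iff(1)[of 1 a b] Idx_iff(2)[of "-1" b a] by auto
 hence nonempty: "DK (Kc eps 1) a 0 lam \<noteq> {}" "DK (Kc False 1) 0 b lam \<noteq> {}"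
  using DK_exists[OF lam0(1), of eps 1 0] DK_exists[OF lam0(2), of False 1 1] by auto
 have S': "even_type eps a 0 ?S'" by (rule even_type_Std[OF nonempty(1)]) (use DK_ns(1) in simp)
 have "1 + ns d = 0" if "d \<in> DK (Kc False 1) 0 b lam" for d using that DK_ns(2)[OF that] by (simp add: DK_def Kc_def)
 hence T': "even_type False 0 b ?T'" by (rule even_type_Std[OF nonempty(2)])
 have mono: "carrier (osp eps' a' b') \<subseteq> carrier (Calg eps' a' b')" for eps' a' b' using osp_Calg by blast
 note SS = rep_iso_trans[OF S(3) rep_iso_mono[OF S(4) mono]] and TT = rep_iso_trans[OF T(3) rep_iso_mono[OF T(4) mono]]
 have wfS: "wf_rep (carrier (Calg eps' a' b')) (Std (Kc eps' r) a' b' l p)" for eps' a' b' r l p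
  using graded_actionD(8) assoc_module_Std[OF adm_Kc] unfolding assoc_module_def by blast
 have tS: "twin_spinor eps a S ?S'"
 proof (cases eps)
  case True
  \<comment> \<open>With eps there is no condition on \<open>ps\<close>, so S' is the standard
    module isomorphic to S, as twins of o(2a+1)-modules should be.\<close>
  have "Kc eps 1 = Kc eps 0" using True by (simp add: Kc_def)
  thus ?thesis unfolding twin_spinor_def spinor_even_type using S(1) S' SS True by simp
 next
  case False
  have e: "eps = False" using False by simp
  note S = S[unfolded e]
  from twin_extension[OF S(2,4) wfS rep_iso_refl lam0(1)] False
  show ?thesis unfolding twin_spinor_def spinor_even_type
   using S S' simple_weight_Std[OF nonempty(1)] rep_iso_refl by (simp add: simple_weight_iff) blast
 qed
 \<comment> \<open>The shift turns the parity parameter 1 back into 0, so that the two constituents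
   fit into one standard module over \<open>Cl 0 b\<close>.\<close>
 have "rep_iso (carrier (Calg False 0 b)) (parity_shift ?T') (Std (Kc False 1) 0 b lam 0)"
  by (rule rep_iso_id) (simp_all add: add.commute add.left_commute)
 moreover have "wf_rep (carrier (Calg False 0 b)) (parity_shift ?T')"
  by (rule wf_parity_shift[OF wfS])
 ultimately obtain N2 :: "(cl, 't \<times> (nat => complex)) rep" where
  "simple_weight_Cl 0 b N2" "rep_iso (carrier (Cl_ev 0 b)) N2 (dsum N' (parity_shift ?T'))"
  using twin_extension[OF T(2,4) _ _ lam0(2)] by blast
 moreover have "simple_weight_Cl_ev 0 b N'" "simple_weight_Cl_ev 0 b ?T'"
  using T(2) simple_weight_Std[OF nonempty(2)] by (simp_all add: simple_weight_iff)
 ultimately have tT: "twin_oscillator b T ?T'"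
  unfolding twin_oscillator_def oscillator_even_type using T(1,3) T' rep_iso_refl by blast
 have d0: "rep_iso (G0 eps a b) (PB a b M 0) (tensor S T)"
  by (rule rep_iso_trans[OF PB_Std[OF M] tensor_Std[OF even_type_wf[OF S(1)] even_type_wf[OF T(1)] SS TT]])
 \<comment> \<open>\<open>tensor_Std\<close> has parity parameter 1 here, since it puts the product
   into the even part; the parity shift accounts for the difference.\<close>
 have "rep_iso (G0 eps a b) (pullback (g0_embed a b) (Std (Kp eps 1) a b lam 0)) (parity_shift (pullback (g0_embed a b) (Std (Kp eps 1) a b lam 1)))"
  by (rule rep_iso_id) (simp_all add: add.commute add.left_commute)
 from rep_iso_trans[OF rep_iso_trans[OF PB_Std[OF M] this]
   rep_iso_parity_shift[OF tensor_Std[OF even_type_wf[OF S'] even_type_wf[OF T'] rep_iso_refl rep_iso_refl]]]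
 have d1: "rep_iso (G0 eps a b) (PB a b M 1) (parity_shift (tensor ?S' ?T'))" .
 show ?thesis unfolding twin_decomposition_def tensor_decomposition_def Let_def using tS tT d0 d1 by blast
qed

section \<open>Uniqueness: weights seen by the even part\<close>

lemma std_act_h:
 assumes i: "i \<in> Idx a b" and v: "v <: (VV a b lam)"
 shows "std_act a b lam (h_elt a b i) v = (\<lambda>n. (lam i + of_int (dec n i) + (if 0 < i then - 1 / 2 else 1 / 2)) * v n)"
proof -
 note l = linear_onD[OF std_act_linear[OF v]]
 interpret C: vspace "Cl a b" by (rule vspace_Cl)
 have w: "wrd a b [] <: (Cl a b)" by (rule W_carrier) simp
 have "std_act a b lam (wrd a b []) v = v" using std_act_word[OF _ v, of "[]"] by simp
 thus ?thesis unfolding h_elt_def l(2)[OF cl_u_closed[OF i] C.vs_sc[OF w]] l(3)[OF w] std_act_u[OF i v]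
  by (simp add: fun_eq_iff algebra_simps)
qed

text \<open>The image of the base vector is nonzero and keeps its weight, tested on the elements of
  the even part that map to \<open>h_elt a b i\<close>. Any shift in the support of the image serves
  as d.\<close>

lemma Std_common_weight:
 assumes i: "rep_iso (G0 eps a b) (pullback (g0_embed a b) (Std K a b lam p)) (pullback (g0_embed a b) (Std K' a b mu q))"
  and z: "(\<lambda>_. 0) \<in> DK K a b lam"
 shows "\<exists>d\<in>DK K' a b mu. \<forall>i\<in>Idx a b. lam i = mu i + of_int (d i)"
proof -
 let ?P = "pullback (g0_embed a b) (Std K a b lam p)" let ?Q = "pullback (g0_embed a b) (Std K' a b mu q)"
 obtain \<chi> where \<chi>: "iso_map (G0 eps a b) ?P ?Q \<chi>" using i rep_iso_iff by blast
 let ?e = "E (\<lambda>_. 0)"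
 have e: "?e <: ?P" using E_Std[OF z] by (simp only: pullback_simps)
 have vP: "vspace ?P" and vQ: "vspace ?Q"
  using superspaceD(1)[OF superspace_pullback[OF superspace_Std]] by blast+
 interpret P: vspace ?P by (rule vP)
 have v: "\<chi> ?e <: ?Q" by (rule iso_mapD(5)[OF \<chi> e])
 have "\<chi> ?e \<noteq> \<zero>\<^bsub>?Q\<^esub>"
 proof
  assume "\<chi> ?e = \<zero>\<^bsub>?Q\<^esub>"
  hence "\<chi> ?e = \<chi> \<zero>\<^bsub>?P\<^esub>" using linear_on_zero[OF vP vQ iso_mapD(2)[OF \<chi>]] by simp
  hence "?e = \<zero>\<^bsub>?P\<^esub>" by (rule iso_mapD(7)[OF \<chi> e P.zero_closed])
  thus False using E_nonzero by simp
 qed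
 then obtain n where n: "\<chi> ?e n \<noteq> 0" by (auto simp: fun_eq_iff)
 hence "n \<in> code ` DK K' a b mu" using v by auto
 then obtain d where d: "d \<in> DK K' a b mu" "n = code d" by blast
 have "lam i = mu i + of_int (d i)" if i: "i \<in> Idx a b" for i
 proof -
  let ?c = "if 0 < i then - 1 / 2 else 1 / 2 :: complex"
  obtain z where z: "z \<in> G0 eps a b" "g0_embed a b z = h_elt a b i"
  proof (cases "0 < i")
   case True
   hence j: "i \<in> Idx a 0" using i Idx_iff(1) by blast
   show ?thesis
    by (rule that[of "(h_elt a 0 i, \<zero>\<^bsub>Cl 0 b\<^esub>)"])
     (use h_elt_osp[OF j] g0_embed_h(1)[OF j] vspace.sub_zero[OF vspace_Cl sub_osp] in auto)
  next
   case False
   hence "i < 0" using Idx_nonzero[OF i] by simp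
   hence j: "i \<in> Idx 0 b" using i Idx_iff(2) by blast
   show ?thesis
    by (rule that[of "(\<zero>\<^bsub>Cl a 0\<^esub>, h_elt 0 b i)"])
     (use h_elt_osp[OF j] g0_embed_h(2)[OF j] vspace.sub_zero[OF vspace_Cl sub_osp] in auto)
  qed
  have eV: "?e <: (VV a b lam)" by (rule Std_in_VV) (use e in \<open>simp only: pullback_simps\<close>)
  have vV: "\<chi> ?e <: (VV a b mu)" by (rule Std_in_VV) (use v in \<open>simp only: pullback_simps\<close>)
  have "std_act a b lam (h_elt a b i) ?e = (lam i + ?c) \<odot>\<^bsub>?P\<^esub> ?e"
   unfolding std_act_h[OF i eV] by (auto simp: single_def fun_eq_iff)
  hence "act ?P z ?e = (lam i + ?c) \<odot>\<^bsub>?P\<^esub> ?e" using z(2) by simp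
  hence "act ?Q z (\<chi> ?e) = (lam i + ?c) \<odot>\<^bsub>?Q\<^esub> \<chi> ?e"
   using iso_mapD(4)[OF \<chi> z(1) e] linear_onD(3)[OF iso_mapD(2)[OF \<chi>] e] by simp
  hence "std_act a b mu (h_elt a b i) (\<chi> ?e) n = (lam i + ?c) * \<chi> ?e n" using z(2) by simp
  hence "(mu i + of_int (d i) + ?c) * \<chi> ?e n = (lam i + ?c) * \<chi> ?e n"
   unfolding std_act_h[OF i vV] d(2) using DK_Fin[OF d(1)] by simp
  hence "mu i + of_int (d i) + ?c = lam i + ?c" using n by (simp only: mult_cancel_right) simp
  thus ?thesis by (simp only: add_right_cancel)
 qed
 thus ?thesis using d(1) by blast
qed

lemma zero_Kp: "admissible a b lam ==> (\<lambda>_. 0) \<in> DK (Kp eps 0) a b lam"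
 using zero_DD by (simp add: DK_def Kc_def)

lemma wf_pullback_iso:
 assumes "wf_rep G Y" "rep_iso G Y (pullback f M)" "superspace M"
 shows "wf_rep G (pullback f M)"
proof -
 obtain \<phi> where "iso_map G Y (pullback f M) \<phi>" using assms(2) rep_iso_iff by blast
 from iso_map_wf[OF assms(1) this] show ?thesis using superspace_pullback[OF assms(3)] by (intro wf_repI)
qed

lemma rep_iso_common:
 assumes Y: "wf_rep (G0 eps a b) Y" "rep_iso (G0 eps a b) Y (pullback (g0_embed a b) (Std K a b lam p))"
  "rep_iso (G0 eps a b) Y (pullback (g0_embed a b) (Std K' a b mu q))" and z: "(\<lambda>_. 0) \<in> DK K a b lam"
 shows "\<exists>d\<in>DK K' a b mu. \<forall>i\<in>Idx a b. lam i = mu i + of_int (d i)"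
 by (rule Std_common_weight[OF rep_iso_trans[OF rep_iso_sym[OF Y(1,2)] Y(3)] z])

lemma g0_Std_wf: "wf_rep (G0 eps a b) (pullback (g0_embed a b) (Std (Kp eps q) a b lam 0))"
proof -
 let ?M = "Std (Kc eps 0) a b lam 0"
 have "wf_rep (G0 eps a b) (PB a b ?M q)" by (rule wf_PB[OF lie_module_assoc[OF assoc_module_Std[OF adm_Kc]]])
 thus ?thesis by (rule wf_pullback_iso[OF _ PB_Std[OF superspace_Std rep_iso_refl] superspace_Std])
qed

text \<open>Both tensor products are standard modules, so their base weights differ by a shift d.
  The positive part of d relates the first factors and the negative part the second ones, by
  \<open>Std_shift\<close>.\<close>

lemma tensor_cancel:
 assumes S: "even_type eps a 0 S" and P: "even_type eps a 0 P" and T: "even_type False 0 b T" and Q: "even_type False 0 b Q"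
  and Y: "wf_rep (G0 eps a b) Y" "rep_iso (G0 eps a b) Y (tensor S T)" "rep_iso (G0 eps a b) Y (tensor P Q)"
 shows "rep_iso (carrier (osp eps a 0)) S P \<and> rep_iso (carrier (osp False 0 b)) T Q"
proof -
 have mono: "carrier (osp eps' a' b') \<subseteq> carrier (Calg eps' a' b')" for eps' a' b' using osp_Calg by blast
 have pair: "\<exists>lam. admissible a b lam \<and> rep_iso (carrier (osp eps a 0)) S (Std (Kc eps 0) a 0 lam 0) \<and>
   rep_iso (carrier (osp False 0 b)) T (Std (Kc False 0) 0 b lam 0)"
  if S: "even_type eps a 0 S" and T: "even_type False 0 b T" for S :: "(cl, 'x) rep" and T :: "(cl, 'y) rep"
 proof -
  obtain N :: "(cl, 'x) rep" and N' :: "(cl, 'y) rep" and lam where lam: "admissible a b lam"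
   and N: "rep_iso (carrier (osp eps a 0)) S N" "rep_iso (carrier (Calg eps a 0)) N (Std (Kc eps 0) a 0 lam 0)"
    "rep_iso (carrier (osp False 0 b)) T N'" "rep_iso (carrier (Calg False 0 b)) N' (Std (Kc False 0) 0 b lam 0)"
   using even_type_pair[OF S T] by blast
  from lam rep_iso_trans[OF N(1) rep_iso_mono[OF N(2) mono]] rep_iso_trans[OF N(3) rep_iso_mono[OF N(4) mono]]
  show ?thesis by blast
 qed
 obtain lam where lam: "admissible a b lam" "rep_iso (carrier (osp eps a 0)) S (Std (Kc eps 0) a 0 lam 0)"
  "rep_iso (carrier (osp False 0 b)) T (Std (Kc False 0) 0 b lam 0)" using pair[OF S T] by blast
 obtain mu where mu: "admissible a b mu" "rep_iso (carrier (osp eps a 0)) P (Std (Kc eps 0) a 0 mu 0)"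
  "rep_iso (carrier (osp False 0 b)) Q (Std (Kc False 0) 0 b mu 0)" using pair[OF P Q] by blast
 note YS = rep_iso_trans[OF Y(2) rep_iso_sym[OF g0_Std_wf tensor_Std[OF even_type_wf[OF S] even_type_wf[OF T] lam(2,3)]]]
 note YP = rep_iso_trans[OF Y(3) rep_iso_sym[OF g0_Std_wf tensor_Std[OF even_type_wf[OF P] even_type_wf[OF Q] mu(2,3)]]]
 obtain d where d: "d \<in> DK (Kp eps 0) a b mu" "\<And>i. i \<in> Idx a b ==> lam i = mu i + of_int (d i)"
  using rep_iso_common[OF Y(1) YS YP zero_Kp[OF lam(1)]] by blast
 note dF = DK_Fin[OF d(1)]
 have ds: "posp d \<in> DK (Kc eps 0) a 0 mu" "negp d \<in> DK (Kc False 0) 0 b mu"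
  using d(1) unfolding DK_split[OF dF] by blast+
 have "lam i = mu i + of_int (posp d i)" if "i \<in> Idx a 0" for i
  using d(2)[of i] that Idx_iff(1)[of i a b] by (simp add: posp_def)
 from Std_shift[OF ds(1) this] have 1: "rep_iso (carrier (osp eps a 0)) (Std (Kc eps 0) a 0 mu 0) (Std (Kc eps 0) a 0 lam 0)"
  using DK_ns(1)[OF ds(1)] rep_iso_mono[OF _ mono] by fastforce
 have "lam i = mu i + of_int (negp d i)" if "i \<in> Idx 0 b" for i
  using d(2)[of i] that Idx_iff(2)[of i b a] by (simp add: negp_def)
 moreover have "ns (negp d) = 0" using d(1) dF by (simp add: sm_negp DK_def Kc_def)
 ultimately have 2: "rep_iso (carrier (osp False 0 b)) (Std (Kc False 0) 0 b mu 0) (Std (Kc False 0) 0 b lam 0)"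
  using Std_shift[OF ds(2), of lam 0] rep_iso_mono[OF _ mono] by fastforce
 show ?thesis
  using rep_iso_trans[OF lam(2) rep_iso_sym[OF even_type_wf[OF P] rep_iso_trans[OF mu(2) 1]]]
   rep_iso_trans[OF lam(3) rep_iso_sym[OF even_type_wf[OF Q] rep_iso_trans[OF mu(3) 2]]] by blast
qed

text \<open>The even parts share a weight, so the base weights differ by a shift d with
  \<open>ns d\<close> = 0. \<open>Std_shift\<close> along d then keeps the parity parameter 0 and
  compares the whole modules.\<close>

lemma determined_by_even_part:
 assumes M: "spinor_oscillator_type eps a b M" and N: "spinor_oscillator_type eps a b N"
  and ne: "- 1 \<in> Idx a b \<and> (eps \<or> 1 \<in> Idx a b)"
  and Z: "rep_iso (G0 eps a b) (PB a b M 0) Z" "rep_iso (G0 eps a b) (PB a b N 0) Z"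
 shows "rep_iso (carrier (osp eps a b)) M N"
proof -
 have lM: "lie_module (osp eps a b) M" and lN: "lie_module (osp eps a b) N"
  using M N by (simp_all add: spinor_oscillator_type_def weight_osp_module_def)
 have sM: "superspace M" and sN: "superspace N" and wN: "wf_rep (carrier (osp eps a b)) N"
  using lM lN graded_actionD(1,8) unfolding lie_module_def by blast+
 obtain lam where lam: "admissible a b lam" "rep_iso (carrier (osp eps a b)) M (Std (Kc eps 0) a b lam 0)"
  using spinor_oscillator_Std[OF M ne] by blast
 obtain mu where mu: "admissible a b mu" "rep_iso (carrier (osp eps a b)) N (Std (Kc eps 0) a b mu 0)"
  using spinor_oscillator_Std[OF N ne] by blast
 have "rep_iso (G0 eps a b) (PB a b M 0) (pullback (g0_embed a b) (Std (Kp eps 0) a b mu 0))"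
  by (rule rep_iso_trans[OF rep_iso_trans[OF Z(1) rep_iso_sym[OF wf_PB[OF lN] Z(2)]] PB_Std[OF sN mu(2)]])
 from rep_iso_common[OF wf_PB[OF lM] PB_Std[OF sM lam(2)] this zero_Kp[OF lam(1)]]
 obtain d where d: "d \<in> DK (Kp eps 0) a b mu" "\<And>i. i \<in> Idx a b ==> lam i = mu i + of_int (d i)" by blast
 have "d \<in> DK (Kc eps 0) a b mu" "ns d = 0" using d(1) by (auto simp: DK_def Kc_def)
 hence "rep_iso (carrier (Calg eps a b)) (Std (Kc eps 0) a b mu 0) (Std (Kc eps 0) a b lam 0)"
  using Std_shift[of d eps 0 a b mu lam 0] d(2) by simp
 hence "rep_iso (carrier (osp eps a b)) (Std (Kc eps 0) a b mu 0) (Std (Kc eps 0) a b lam 0)"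
  by (rule rep_iso_mono) (use osp_Calg in blast)
 thus ?thesis by (rule rep_iso_trans[OF lam(2) rep_iso_sym[OF wN rep_iso_trans[OF mu(2)]]])
qed

lemma twin_decomposition_even_types:
 assumes "twin_decomposition eps a b M S S' T T'"
 shows "even_type eps a 0 S" "even_type eps a 0 S'" "even_type False 0 b T" "even_type False 0 b T'"
  "rep_iso (G0 eps a b) (PB a b M 0) (tensor S T)" "rep_iso (G0 eps a b) (PB a b M 1) (parity_shift (tensor S' T'))"
 using assms unfolding twin_decomposition_def twin_spinor_def twin_oscillator_def tensor_decomposition_def Let_def
  spinor_even_type oscillator_even_type by blast+

text \<open>\<open>tensor_cancel\<close> is applied to each part; in the odd part the parity shift
  is first undone by a second one.\<close>

lemma twin_decomposition_unique:
 assumes M: "lie_module (osp eps a b) M" and S: "twin_decomposition eps a b M S S' T T'" and P: "twin_decomposition eps a b M P P' Q Q'"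
 shows "rep_iso (carrier (osp eps a 0)) S P \<and> rep_iso (carrier (osp eps a 0)) S' P' \<and>
  rep_iso (carrier (osp False 0 b)) T Q \<and> rep_iso (carrier (osp False 0 b)) T' Q'"
proof -
 note S = twin_decomposition_even_types[OF S] note P = twin_decomposition_even_types[OF P]
 let ?Y = "parity_shift (PB a b M 1)"
 have pp: "rep_iso (G0 eps a b) (parity_shift (parity_shift Z)) Z" for Z :: "(cl \<times> cl, 'z) rep"
  by (rule rep_iso_id) (simp_all add: add.assoc)
 have "wf_rep (G0 eps a b) ?Y" by (rule wf_parity_shift[OF wf_PB[OF M]])
 from tensor_cancel[OF S(2) P(2) S(4) P(4) this rep_iso_trans[OF rep_iso_parity_shift[OF S(6)] pp] rep_iso_trans[OF rep_iso_parity_shift[OF P(6)] pp]]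
  tensor_cancel[OF S(1) P(1) S(3) P(3) wf_PB[OF M] S(5) P(5)]
 show ?thesis by blast
qed

lemma twin_decomposition_exists:
 assumes M: "spinor_oscillator_type eps a b M" and ne: "- 1 \<in> Idx a b \<and> (eps \<or> 1 \<in> Idx a b)"
 shows "\<exists>(S :: cl_rep) (S' :: cl_rep) (T :: cl_rep) (T' :: cl_rep). twin_decomposition eps a b M S S' T T'"
proof -
 have sM: "superspace M" using M graded_actionD(1) unfolding spinor_oscillator_type_def weight_osp_module_def lie_module_def by blast
 obtain lam where lam: "admissible a b lam" "rep_iso (carrier (osp eps a b)) M (Std (Kc eps 0) a b lam 0)"
  using spinor_oscillator_Std[OF M ne] by blast
 have "admissible a 0 lam" "admissible 0 b lam" using lam(1) Idx_iff(1)[of _ a b] Idx_sgn(2) by (force simp: admissible_def)+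
 hence n: "DK (Kc eps 0) a 0 lam \<noteq> {}" "DK (Kc False 0) 0 b lam \<noteq> {}" using zero_DD by (fastforce simp: DK_def Kc_def)+
 have S: "even_type eps a 0 (Std (Kc eps 0) a 0 lam 0)" by (rule even_type_Std[OF n(1)]) (use DK_ns(1) in simp)
 have "0 + ns d = 0" if "d \<in> DK (Kc False 0) 0 b lam" for d using that DK_ns(2)[OF that] by (simp add: DK_def Kc_def)
 hence T: "even_type False 0 b (Std (Kc False 0) 0 b lam 0)" by (rule even_type_Std[OF n(2)])
 from twin_decomposition_Std[OF S simple_weight_Std[OF n(1)] rep_iso_refl rep_iso_refl T simple_weight_Std[OF n(2)] rep_iso_refl rep_iso_refl lam(1) ne sM lam(2)]
 show ?thesis by blast
qed

lemma simple_parts: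
 assumes M: "spinor_oscillator_type eps a b M" and ne: "- 1 \<in> Idx a b \<and> (eps \<or> 1 \<in> Idx a b)"
 shows "simple_rep (part (osp eps a b) 0) (subsp M (part M q))"
proof -
 let ?G = "part (osp eps a b) 0"
 have g: "graded_action (osp eps a b) M" using M unfolding spinor_oscillator_type_def weight_osp_module_def lie_module_def by blast
 note sM = graded_actionD(1)[OF g]
 obtain lam where lam: "admissible a b lam" "rep_iso (carrier (osp eps a b)) M (Std (Kc eps 0) a b lam 0)"
  using spinor_oscillator_Std[OF M ne] by blast
 let ?V = "Std (Kc eps 0) a b lam 0"
 have wV: "wf_rep (carrier (osp eps a b)) ?V" using graded_actionD(8) lie_module_assoc[OF assoc_module_Std[OF adm_Kc]] unfolding lie_module_def by blast
 have G: "?G \<subseteq> carrier (osp eps a b)" by auto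
 have gV: "graded_action (osp eps a b) ?V" using lie_module_assoc[OF assoc_module_Std[OF adm_Kc]] unfolding lie_module_def by blast
 have "rep_iso ?G (subsp M (part M q)) (subsp ?V (part ?V q))"
  by (rule rep_iso_mono[OF rep_iso_subsp_part[OF lam(2) sM] G])
 moreover have wf: "wf_rep ?G (subsp N (part N q))" if "graded_action (osp eps a b) N" for N :: "(cl, 'x) rep"
  using superspace_subsp_part[OF graded_actionD(1)[OF that]] graded_actionD(5)[OF that, of _ 0 _ q] by (intro wf_repI) (simp_all del: osp_ops)
 ultimately have "rep_iso ?G (subsp ?V (part ?V q)) (subsp M (part M q))" using rep_iso_sym[OF wf[OF g]] by blast
 moreover have "simple_rep ?G (subsp ?V (part ?V q))"
  by (rule simple_Std_part) (use DK_exists[OF lam(1), of eps 0 q] ne in auto)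
 ultimately show ?thesis using simple_rep_iso[OF wf[OF gV] superspace_subsp_part[OF sM]] by blast
qed

lemma spinor_oscillator_exists:
 fixes S :: "(cl, 's) rep" and T :: "(cl, 't) rep"
 assumes S: "spinor eps a S" and T: "oscillator b T" and ne: "- 1 \<in> Idx a b \<and> (eps \<or> 1 \<in> Idx a b)"
 shows "\<exists>M :: cl_rep. bounded_spinor_oscillator eps a b M \<and> (\<exists>(S' :: cl_rep) (T' :: cl_rep). twin_decomposition eps a b M S S' T T')"
proof -
 note S = S[unfolded spinor_even_type] note T = T[unfolded oscillator_even_type]
 obtain N :: "(cl, 's) rep" and N' :: "(cl, 't) rep" and lam where lam: "admissible a b lam"
  and N: "simple_weight eps a 0 N" "rep_iso (carrier (osp eps a 0)) S N" "rep_iso (carrier (Calg eps a 0)) N (Std (Kc eps 0) a 0 lam 0)"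
  and N': "simple_weight False 0 b N'" "rep_iso (carrier (osp False 0 b)) T N'" "rep_iso (carrier (Calg False 0 b)) N' (Std (Kc False 0) 0 b lam 0)"
  using even_type_pair[OF S T] by blast
 have "DK (Kc eps 0) a b lam \<noteq> {}" using zero_DD[OF lam] by (force simp: DK_def Kc_def)
 hence "bounded_spinor_oscillator eps a b (Std (Kc eps 0) a b lam 0)" by (rule Std_bounded_spinor_oscillator)
 thus ?thesis using twin_decomposition_Std[OF S N T N' lam ne superspace_Std rep_iso_refl] by blast
qed

theorem theorem3p7:
  fixes a b :: enat and \<epsilon> :: bool
  assumes "a = \<infinity> \<or> b = \<infinity>"
    and "part (osp \<epsilon> a b) 1 \<noteq> {\<zero>\<^bsub>osp \<epsilon> a b\<^esub>}"
  shows
    "(\<forall>M :: (cl, 'm) rep. bounded_spinor_oscillator \<epsilon> a b M \<longrightarrow>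
        simple_rep (part (osp \<epsilon> a b) 0) (subsp M (part M 0)) \<and>
        simple_rep (part (osp \<epsilon> a b) 0) (subsp M (part M 1)))
     \<and>
     (\<forall>M :: (cl, 'm) rep. bounded_spinor_oscillator \<epsilon> a b M \<longrightarrow>
        (\<exists>(S :: cl_rep) (S' :: cl_rep) (T :: cl_rep) (T' :: cl_rep).
           twin_decomposition \<epsilon> a b M S S' T T') \<and>
        (\<forall>(S :: (cl, 's) rep) (S' :: (cl, 's1) rep) (T :: (cl, 't) rep) (T' :: (cl, 't1) rep)
          (P :: (cl, 'p) rep) (P' :: (cl, 'p1) rep) (Q :: (cl, 'q) rep) (Q' :: (cl, 'q1) rep).
           twin_decomposition \<epsilon> a b M S S' T T' \<and> twin_decomposition \<epsilon> a b M P P' Q Q' \<longrightarrow>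
           rep_iso (carrier (osp \<epsilon> a 0)) S P \<and> rep_iso (carrier (osp \<epsilon> a 0)) S' P' \<and>
           rep_iso (carrier (osp False 0 b)) T Q \<and> rep_iso (carrier (osp False 0 b)) T' Q') \<and>
        (\<forall>(N :: (cl, 'n) rep)
          (S :: (cl, 's) rep) (S' :: (cl, 's1) rep) (T :: (cl, 't) rep) (T' :: (cl, 't1) rep).
           bounded_spinor_oscillator \<epsilon> a b N \<and>
           twin_decomposition \<epsilon> a b M S S' T T' \<and> twin_decomposition \<epsilon> a b N S S' T T' \<longrightarrow>
           rep_iso (carrier (osp \<epsilon> a b)) M N))
     \<and>
     (\<forall>(S :: (cl, 's) rep) (T :: (cl, 't) rep). spinor \<epsilon> a S \<and> oscillator b T \<longrightarrow>
        (\<exists>M :: cl_rep. bounded_spinor_oscillator \<epsilon> a b M \<and>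
           (\<exists>(S' :: cl_rep) (T' :: cl_rep). twin_decomposition \<epsilon> a b M S S' T T')) \<and>
        (\<forall>(M :: (cl, 'm) rep) (N :: (cl, 'n) rep)
          (S' :: (cl, 's1) rep) (T' :: (cl, 't1) rep) (P' :: (cl, 'p1) rep) (Q' :: (cl, 'q1) rep).
           bounded_spinor_oscillator \<epsilon> a b M \<and> bounded_spinor_oscillator \<epsilon> a b N \<and>
           twin_decomposition \<epsilon> a b M S S' T T' \<and> twin_decomposition \<epsilon> a b N S P' T Q' \<longrightarrow>
           rep_iso (carrier (osp \<epsilon> a b)) M N))"
proof -
 have ne: "- 1 \<in> Idx a b \<and> (\<epsilon> \<or> 1 \<in> Idx a b)" by (rule odd_part_nonzero[OF assms(2)])
 have so: "spinor_oscillator_type \<epsilon> a b M" if "bounded_spinor_oscillator \<epsilon> a b M" for M :: "(cl, 'x) rep"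
  using that by (simp add: bounded_spinor_oscillator_def)
 have lie: "lie_module (osp \<epsilon> a b) M" if "bounded_spinor_oscillator \<epsilon> a b M" for M :: "(cl, 'x) rep"
  using so[OF that] by (simp add: spinor_oscillator_type_def weight_osp_module_def)
 \<comment> \<open>Only S and T are shared between the two decompositions, and all types are
   generic, so this covers uniqueness for given S, S', T, T' as well as for a given pair (S,
   T).\<close>
 have det: "rep_iso (carrier (osp \<epsilon> a b)) M N"
  if "bounded_spinor_oscillator \<epsilon> a b M" "bounded_spinor_oscillator \<epsilon> a b N"
   "twin_decomposition \<epsilon> a b M S S' T T'" "twin_decomposition \<epsilon> a b N S P' T Q'"
  for M :: "(cl, 'x1) rep" and N :: "(cl, 'x2) rep" and S :: "(cl, 'x3) rep" and S' :: "(cl, 'x4) rep"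
   and T :: "(cl, 'x5) rep" and T' :: "(cl, 'x6) rep" and P' :: "(cl, 'x7) rep" and Q' :: "(cl, 'x8) rep"
  by (rule determined_by_even_part[OF so[OF that(1)] so[OF that(2)] ne
   twin_decomposition_even_types(5)[OF that(3)] twin_decomposition_even_types(5)[OF that(4)]])
 show ?thesis
 proof (intro conjI allI impI, goal_cases)
  case (1 M) thus ?case by (intro simple_parts[OF so ne])
 next
  case (2 M) thus ?case by (intro simple_parts[OF so ne])
 next
  case (3 M) thus ?case by (intro twin_decomposition_exists[OF so ne])
 next
  case (4 M S S' T T' P P' Q Q') thus ?case using twin_decomposition_unique[OF lie] by blast
 next
  case (5 M S S' T T' P P' Q Q') thus ?case using twin_decomposition_unique[OF lie] by blast
 next
  case (6 M S S' T T' P P' Q Q') thus ?case using twin_decomposition_unique[OF lie] by blast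
 next
  case (7 M S S' T T' P P' Q Q') thus ?case using twin_decomposition_unique[OF lie] by blast
 next
  case (8 M N S S' T T') thus ?case using det by blast
 next
  case (9 S T) thus ?case using spinor_oscillator_exists[OF _ _ ne] by blast
 next
  case (10 S T M N S' T' P' Q') thus ?case using det by blast
 qed
qed

end
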